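(* Let $\Gamma\subset\mathbb{R}^2$ be a smooth ($C^\infty$) closed curve whose curvature vanishes at finitely many points, to order $\kappa-2$ at these points, where $\kappa>2$. Let $f\in C^\infty(\Gamma)$, let the weight profile $\theta$ have regularity order $q$, and let $\alpha\in[0,1]$. There is $\varepsilon_0>0$ such that if the tube width is $\varepsilon=\varepsilon(h)=\Theta(h^\alpha)$ with $\varepsilon\le\varepsilon_0$, then, as $h\to0^+$, $$|\mathcal{I}(f)-\mathcal{I}_h(f)|=\mathcal{O}\left(h^{\frac1\kappa+(q+1)(1-\alpha)}\right).$$
   Context: Setting ($d=2$): $\Gamma$ is the boundary of a bounded simply connected domain $\Omega\subset\mathbb{R}^2$, with outward unit normal $\mathbf{n}$. The curvature vanishes to order $\kappa-2$ at $\mathbf{z}\in\Gamma$ if, after a rigid motion placing $\mathbf{z}$ at the origin, $\Gamma$ is locally the graph $\{(x,g(x)):|x|\le r\}$ for some $r>0$, with $g(x)=|x|^\kappa a(x)$, $a\in C^\infty[-r,r]$, $a(x)\ne0$ for all $x\in[-r,r]$. The tube is $T_\varepsilon=\{\mathbf{x}\in\mathbb{R}^2: \mathrm{dist}(\mathbf{x},\Gamma)\le\varepsilon\}$, with $\varepsilon$ always assumed small enough that every $\mathbf{x}\in T_\varepsilon$ has a unique closest point $P_\Gamma(\mathbf{x})\in\Gamma$. The signed distance is $d_\Gamma(\mathbf{x})=\mathbf{n}(P_\Gamma(\mathbf{x}))\cdot(\mathbf{x}-P_\Gamma(\mathbf{x}))$. $J_\varepsilon(\mathbf{x},\eta)=1-\eta\,k(\mathbf{x})$,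 where $k(\mathbf{x})$ is the signed curvature at $\mathbf{x}$ of the level curve $\{d_\Gamma=\eta\}$ (positive for circles); this is the Jacobian of $P_\Gamma$ restricted to that level curve. Weight profile of regularity order $q\in\{0,1,2,\dots\}$: a fixed function $\theta:\mathbb{R}\to\mathbb{R}$ with $\mathrm{supp}\,\theta=[-1,1]$, $\int_{-1}^1\theta=1$; if $q\ge1$, $\theta\in C^{q-1}(\mathbb{R})$ and $\theta^{(q)}$ is piecewise $C^1$; if $q=0$, $\theta\in L^\infty(\mathbb{R})$ is piecewise $C^1$ (piecewise $C^1$: finitely many pieces, $C^1$ up to the closure on each). $\theta_\varepsilon(s)=\varepsilon^{-1}\theta(s/\varepsilon)$. $\mathcal{I}(f)=\int_\Gamma f\,d\sigma$, where $\sigma$ is arc length measure, and $$\mathcal{I}_h(f)=h^2\sum_{\mathbf{x}\in(h\mathbb{Z})^2\cap T_\varepsilon}f(P_\Gamma(\mathbf{x}))\,\theta_\varepsilon(d_\Gamma(\mathbf{x}))\,J_\varepsilon(\mathbf{x},d_\Gamma(\mathbf{x})).$$ $\varepsilon=\Theta(h^\alpha)$ means $c_1h^\alpha\le\varepsilon\le c_2h^\alpha$ with constants $c_1,c_2>0$; the constants in $\mathcal{O}$ are independent of $h$. *)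

theory Defs
  imports "HOL-Analysis.Analysis" "HOL-Library.Landau_Symbols"
begin

subsection \<open>Smoothness of functions of one real variable\<close>

text \<open>\<open>D j\<close> is the \<open>j\<close>-th derivative; since derivatives are taken within \<open>S\<close>, they are
  one-sided at the end points of a closed interval.\<close>

definition Ck_on :: "nat \<Rightarrow> real set \<Rightarrow> (real \<Rightarrow> 'a::real_normed_vector) \<Rightarrow> bool" where
  "Ck_on k S f \<longleftrightarrow>
     (\<exists>D. (\<forall>x\<in>S. D 0 x = f x) \<and>
          (\<forall>j<k. \<forall>x\<in>S. (D j has_vector_derivative D (Suc j) x) (at x within S)) \<and>
          continuous_on S (D k))"

definition smooth_on :: "real set \<Rightarrow> (real \<Rightarrow> 'a::real_normed_vector) \<Rightarrow> bool" where
  "smooth_on S f \<longleftrightarrow> (\<forall>k. Ck_on k S f)"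

text \<open>\<open>F\<close> is the finite set of break points; on every interval between break points the function
  is \<open>C\<^sup>1\<close> up to the closure. Its values at the break points themselves are arbitrary.\<close>

definition piecewise_C1 :: "(real \<Rightarrow> real) \<Rightarrow> bool" where
  "piecewise_C1 \<psi> \<longleftrightarrow>
     (\<exists>F. finite F \<and>
        (\<forall>a b. a < b \<and> {a<..<b} \<inter> F = {} \<longrightarrow>
           (\<exists>g. g C1_differentiable_on {a..b} \<and> (\<forall>s\<in>{a<..<b}. \<psi> s = g s))))"


subsection \<open>Weight profiles\<close>

text \<open>For \<open>q \<ge> 1\<close> the derivative of order \<open>q\<close> is only required to exist off a finite set \<open>E\<close>.\<close>

definition weight_profile :: "nat \<Rightarrow> (real \<Rightarrow> real) \<Rightarrow> bool" where
  "weight_profile q \<theta> \<longleftrightarrow>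
     closure {s. \<theta> s \<noteq> 0} = {-1..1} \<and>
     (\<theta> has_integral 1) {-1..1} \<and>
     (if q = 0
      then \<theta> \<in> borel_measurable lebesgue \<and> (\<exists>C. AE s in lebesgue. \<bar>\<theta> s\<bar> \<le> C) \<and> piecewise_C1 \<theta>
      else Ck_on (q - 1) UNIV \<theta> \<and>
           (\<exists>\<psi> E. finite E \<and>
              (\<forall>s. s \<notin> E \<longrightarrow> ((deriv ^^ (q - 1)) \<theta> has_real_derivative \<psi> s) (at s)) \<and>
              piecewise_C1 \<psi>))"

definition scaled_weight :: "(real \<Rightarrow> real) \<Rightarrow> real \<Rightarrow> real \<Rightarrow> real" where
  "scaled_weight \<theta> \<epsilon> s = \<theta> (s / \<epsilon>) / \<epsilon>"


subsection \<open>Plane curves\<close>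

text \<open>A regular simple closed \<open>C\<^sup>\<infinity>\<close> parametrisation of period 1.\<close>

definition smooth_closed_curve :: "(real \<Rightarrow> real^2) \<Rightarrow> bool" where
  "smooth_closed_curve \<gamma> \<longleftrightarrow>
     smooth_on UNIV \<gamma> \<and> (\<forall>t. \<gamma> (t + 1) = \<gamma> t) \<and> inj_on \<gamma> {0..<1} \<and>
     (\<forall>t. vector_derivative \<gamma> (at t) \<noteq> 0)"

definition arc_length_integral :: "(real \<Rightarrow> real^2) \<Rightarrow> (real^2 \<Rightarrow> real) \<Rightarrow> real" where
  "arc_length_integral \<gamma> f =
     integral {0..1} (\<lambda>t. f (\<gamma> t) * norm (vector_derivative \<gamma> (at t)))"

text \<open>The unit vector at \<open>z \<in> frontier \<Omega>\<close> that is orthogonal to the velocity of every differentiable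
  curve running through \<open>z\<close> inside \<open>frontier \<Omega>\<close> and that points out of \<open>\<Omega>\<close>.\<close>

definition outward_normal :: "(real^2) set \<Rightarrow> real^2 \<Rightarrow> real^2" where
  "outward_normal \<Omega> z = (THE \<nu>.
     norm \<nu> = 1 \<and>
     (\<forall>c v. range c \<subseteq> frontier \<Omega> \<and> c 0 = z \<and> (c has_vector_derivative v) (at (0::real))
        \<longrightarrow> \<nu> \<bullet> v = 0) \<and>
     (\<exists>\<delta>>0. \<forall>t. 0 < t \<and> t < \<delta> \<longrightarrow> z - t *\<^sub>R \<nu> \<in> \<Omega> \<and> z + t *\<^sub>R \<nu> \<notin> closure \<Omega>))"

text \<open>Signed curvature at \<open>x\<close> of the curve \<open>C\<close> (a set) with unit normal \<open>\<nu>\<close> at \<open>x\<close>: the value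
  \<open>- (c'' \<bullet> \<nu>) / |c'|\<^sup>2\<close> at \<open>x\<close> for any regular local parametrisation \<open>c\<close> of \<open>C\<close>. A circle of radius
  \<open>R\<close> with its outward normal has curvature \<open>1 / R\<close>.\<close>

definition signed_curvature :: "(real^2) set \<Rightarrow> real^2 \<Rightarrow> real^2 \<Rightarrow> real" where
  "signed_curvature C \<nu> x = (THE k.
     \<exists>c c' w r. r > 0 \<and> c 0 = x \<and>
       (\<forall>t. \<bar>t\<bar> < r \<longrightarrow> c t \<in> C \<and> (c has_vector_derivative c' t) (at t)) \<and>
       (c' has_vector_derivative w) (at (0::real)) \<and> c' 0 \<noteq> 0 \<and>
       k = - (w \<bullet> \<nu>) / (norm (c' 0))\<^sup>2)"

text \<open>The matrix \<open>Q\<close> is the rotational part of the rigid motion \<open>y \<mapsto> Q (y - z)\<close> taking \<open>z\<close> to the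
  origin. The graph is a neighbourhood of the origin in the moved curve.\<close>

definition curvature_vanishes_to_order :: "(real^2) set \<Rightarrow> real^2 \<Rightarrow> real \<Rightarrow> bool" where
  "curvature_vanishes_to_order \<Gamma> z m \<longleftrightarrow>
     (\<exists>Q r a. let \<Gamma>' = (\<lambda>y. Q *v (y - z)) ` \<Gamma>;
                 G = {vector [x, \<bar>x\<bar> powr (m + 2) * a x] | x. \<bar>x\<bar> \<le> r}
        in rotation_matrix Q \<and> r > 0 \<and> smooth_on {-r..r} a \<and> (\<forall>x\<in>{-r..r}. a x \<noteq> 0) \<and>
           G \<subseteq> \<Gamma>' \<and> (\<exists>U. open U \<and> 0 \<in> U \<and> \<Gamma>' \<inter> U \<subseteq> G))"


subsection \<open>Tubes and implicit boundary quadrature\<close>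

text \<open>Throughout, the curve is \<open>\<Gamma> = frontier \<Omega>\<close>.\<close>

definition tube :: "(real^2) set \<Rightarrow> real \<Rightarrow> (real^2) set" where
  "tube \<Gamma> \<epsilon> = {x. infdist x \<Gamma> \<le> \<epsilon>}"

definition unique_closest_points :: "(real^2) set \<Rightarrow> real \<Rightarrow> bool" where
  "unique_closest_points \<Gamma> \<epsilon> \<longleftrightarrow>
     (\<forall>x\<in>tube \<Gamma> \<epsilon>. \<exists>!p. p \<in> \<Gamma> \<and> (\<forall>y\<in>\<Gamma>. dist x p \<le> dist x y))"

definition signed_distance :: "(real^2) set \<Rightarrow> real^2 \<Rightarrow> real" where
  "signed_distance \<Omega> x =
     (let p = closest_point (frontier \<Omega>) x in outward_normal \<Omega> p \<bullet> (x - p))"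

text \<open>The normal at \<open>x\<close> of the level curve of the signed distance through \<open>x\<close> is the outward normal
  at the closest point of \<open>x\<close>.\<close>

definition level_curvature :: "(real^2) set \<Rightarrow> real \<Rightarrow> real^2 \<Rightarrow> real" where
  "level_curvature \<Omega> \<eta> x =
     signed_curvature {y. signed_distance \<Omega> y = \<eta>}
       (outward_normal \<Omega> (closest_point (frontier \<Omega>) x)) x"

definition level_jacobian :: "(real^2) set \<Rightarrow> real^2 \<Rightarrow> real \<Rightarrow> real" where
  "level_jacobian \<Omega> x \<eta> = 1 - \<eta> * level_curvature \<Omega> \<eta> x"

definition square_grid :: "real \<Rightarrow> (real^2) set" where
  "square_grid h = {x. \<forall>i. \<exists>m::int. x $ i = h * of_int m}"

definition lattice_quadrature ::
  "(real^2) set \<Rightarrow> (real \<Rightarrow> real) \<Rightarrow> (real^2 \<Rightarrow> real) \<Rightarrow> real \<Rightarrow> real \<Rightarrow> real" where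
  "lattice_quadrature \<Omega> \<theta> f \<epsilon> h =
     h\<^sup>2 * (\<Sum>x\<in>square_grid h \<inter> tube (frontier \<Omega>) \<epsilon>.
        f (closest_point (frontier \<Omega>) x) * scaled_weight \<theta> \<epsilon> (signed_distance \<Omega> x) *
        level_jacobian \<Omega> x (signed_distance \<Omega> x))"

end

theory Submission
  imports Defs
begin

text \<open>By the coarea formula, the quadrature is a trapezoidal sum on \<open>h \<int>\<^sup>2\<close> of a function whose integral is the
  integral of \<open>f\<close> along the curve. Poisson summation bounds the error by the sum over the integer vectors
  \<open>k \<noteq> 0\<close> of the integrals of \<open>scaled_weight \<theta> \<epsilon> \<eta> * A \<eta>\<close> over \<open>\<eta>\<close>, where \<open>A \<eta>\<close> is an oscillatory integral along the
  curve with the restriction of a plane wave of frequency \<open>\<bar>k\<bar> / h\<close> to the offset curve at distance \<open>\<eta>\<close>.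
  By van der Corput's estimates, \<open>A\<close> is of the order of the frequency to the power \<open>- 1 / \<kappa>\<close>, uniformly in the
  direction. The frequency is a combination of its normal and its tangential component, so that \<open>A\<close> is, up to a
  factor of one over the frequency, an \<open>\<eta>\<close>-derivative of an integral of the same kind plus another such integral.
  Hence \<open>q + 1\<close> integrations by parts in \<open>\<eta>\<close> bound each term by \<open>(h / (\<epsilon> \<bar>k\<bar>)) ^ (q + 1) * (h / \<bar>k\<bar>) powr (1 / \<kappa>)\<close>,
  which is summable if \<open>q \<ge> 1\<close>.

  If \<open>q = 0\<close>, then \<open>\<theta>\<close> is first averaged over the length \<open>h powr (1 + 1 / \<kappa>)\<close>, and the decay of \<open>A\<close> with the exponent
  \<open>- 1 / 2\<close> away from the normal directions at the flat points compensates for the slowly decaying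
  tail; this suffices because \<open>\<kappa> \<ge> 4\<close> by the smoothness of the curve. The error of the averaging is bounded by
  quadratures of averaged indicators, to which the same estimate applies.\<close>

text \<open>The Jacobian factor of the quadrature is \<open>speed / stretch\<close> and cancels the
  area element \<open>stretch\<close> of the tube. So the zero frequency reproduces the arc length
  integral exactly, and only nonzero frequencies remain. The obstacle is \<open>q = 0\<close>: the
  terms then decay like \<open>\<bar>k\<bar> powr - (1 + 1 / \<kappa>)\<close> only. Averaging over
  the length \<open>\<delta>\<close> gains a second factor
  \<open>h / (\<delta> * \<bar>k\<bar>)\<close>. The choice
  \<open>\<delta> = h powr (1 + 1 / \<kappa>)\<close> is forced by the cost
  \<open>\<delta> / \<epsilon>\<close> of changing the weight, which has to be of the claimed order.
  The second factor is thus \<open>K / \<bar>k\<bar>\<close> with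
  \<open>K = h powr - (1 / \<kappa>)\<close>, and with isotropic decay a positive power of
  \<open>K\<close> would be lost. Therefore each square shell of radius \<open>R\<close> is split:
  for every flat direction, one lattice point on each side gets the isotropic decay and contributes
  a summable power of \<open>R\<close>, while the others decay like the inverse square root of their
  distance to the normal line. Their total is of order \<open>K * sqrt h\<close>, and this is at
  most \<open>h powr (1 / \<kappa>)\<close> precisely for \<open>\<kappa> >= 4\<close>.\<close>

abbreviation pairing :: "real \<Rightarrow> (real \<Rightarrow> real) \<Rightarrow> (real \<Rightarrow> 'a::real_normed_vector) \<Rightarrow> 'a" where
 "pairing c \<psi> X \<equiv> integral {-c..c} (\<lambda>t. \<psi> t *\<^sub>R X t)"


section \<open>Weights of bounded variation\<close>

text \<open>\<open>V\<close> dominates both the total mass and the total variation of \<open>\<psi>\<close> on \<open>{a..b}\<close>, the latter by duality.\<close>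

definition dual_bv :: "(real => real) => real => real => real => bool" where
 "dual_bv \<psi> a b V \<longleftrightarrow> 0 <= V \<and>
   (\<forall>(X :: real => complex) s. continuous_on {a..b} X --> (\<forall>t\<in>{a..b}. norm (X t) <= s) -->
    (\<lambda>t. \<psi> t *\<^sub>R X t) integrable_on {a..b} \<and> norm (integral {a..b} (\<lambda>t. \<psi> t *\<^sub>R X t)) <= V * s) \<and>
   (\<forall>(X :: real => complex) X' s. (\<forall>t\<in>{a..b}. (X has_vector_derivative X' t) (at t within {a..b})) -->
    continuous_on {a..b} X' --> (\<forall>t\<in>{a..b}. norm (X t) <= s) -->
    norm (integral {a..b} (\<lambda>t. \<psi> t *\<^sub>R X' t)) <= V * s)"

lemma dual_bvD:
 fixes X :: "real => complex"
 assumes "dual_bv \<psi> a b V" "continuous_on {a..b} X" "\<And>t. t \<in> {a..b} ==> norm (X t) <= s"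
 shows "norm (integral {a..b} (\<lambda>t. \<psi> t *\<^sub>R X t)) <= V * s"
 using assms unfolding dual_bv_def by blast

lemma dual_bvD_deriv:
 fixes X :: "real => complex"
 assumes "dual_bv \<psi> a b V" "\<And>t. t \<in> {a..b} ==> (X has_vector_derivative X' t) (at t within {a..b})"
  "continuous_on {a..b} X'" "\<And>t. t \<in> {a..b} ==> norm (X t) <= s"
 shows "norm (integral {a..b} (\<lambda>t. \<psi> t *\<^sub>R X' t)) <= V * s"
 using assms unfolding dual_bv_def by blast

lemma dual_bv_nonneg: "dual_bv \<psi> a b V ==> 0 <= V"
 by (simp add: dual_bv_def)

lemma dual_bv_integrable:
 fixes X :: "real => complex"
 assumes "dual_bv \<psi> a b V" "continuous_on {a..b} X"
 shows "(\<lambda>t. \<psi> t *\<^sub>R X t) integrable_on {a..b}"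
proof -
 have "bounded (X ` {a..b})" using assms by (intro compact_imp_bounded compact_continuous_image) auto
 then obtain s where "\<forall>t\<in>{a..b}. norm (X t) <= s" by (auto simp: bounded_iff)
 then show ?thesis using assms unfolding dual_bv_def by blast
qed

lemma dual_bv_mono:
 assumes d: "dual_bv \<psi> a b V" and le: "V <= W" and ab: "a <= b"
 shows "dual_bv \<psi> a b W"
proof -
 have V: "0 <= V" using d by (simp add: dual_bv_def)
 \<comment> \<open>The bound at the single point \<open>a\<close> makes \<open>s\<close>
   nonnegative, so a larger constant does weaken the estimate; over an empty interval
   \<open>s\<close> could be negative.\<close>
 have *: "n <= W * s" if "n <= V * s" "\<forall>t\<in>{a..b}. norm (X t :: complex) <= s" for n s X
 proof -
  have "0 <= s" using order_trans[OF norm_ge_zero bspec[OF that(2), of a]] ab by simp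
  then show ?thesis using mult_right_mono[OF le, of s] that(1) by linarith
 qed
 show ?thesis
  unfolding dual_bv_def
 proof (intro conjI allI impI)
  show "0 <= W" using V le by simp
 next
  fix X :: "real => complex" and s
  assume X: "continuous_on {a..b} X" "\<forall>t\<in>{a..b}. norm (X t) <= s"
  show "(\<lambda>t. \<psi> t *\<^sub>R X t) integrable_on {a..b}" by (rule dual_bv_integrable[OF d X(1)])
  show "norm (integral {a..b} (\<lambda>t. \<psi> t *\<^sub>R X t)) <= W * s"
   by (rule *[OF dual_bvD[OF d X(1)] X(2)]) (use X in blast)
 next
  fix X X' :: "real => complex" and s
  assume X: "\<forall>t\<in>{a..b}. (X has_vector_derivative X' t) (at t within {a..b})" "continuous_on {a..b} X'"
   "\<forall>t\<in>{a..b}. norm (X t) <= s"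
  show "norm (integral {a..b} (\<lambda>t. \<psi> t *\<^sub>R X' t)) <= W * s"
   by (rule *[OF dual_bvD_deriv[OF d _ X(2)] X(3)]) (use X in blast)+
 qed
qed

text \<open>A test function restricts to both halves with the same bound \<open>s\<close>. As
  \<open>X\<close> need not vanish at the ends, the constants also pay for the boundary values of
  \<open>\<psi>\<close>, and so a jump at \<open>m\<close> is already covered.\<close>

lemma dual_bv_combine:
 assumes 1: "dual_bv \<psi> a m V" and 2: "dual_bv \<psi> m b W" and m: "a <= m" "m <= b"
 shows "dual_bv \<psi> a b (V + W)"
proof -
 have sub: "{a..m} \<subseteq> {a..b}" "{m..b} \<subseteq> {a..b}" using m by auto
 have cont: "(\<lambda>t. \<psi> t *\<^sub>R X t) integrable_on {a..b} \<and>
   integral {a..b} (\<lambda>t. \<psi> t *\<^sub>R X t) = integral {a..m} (\<lambda>t. \<psi> t *\<^sub>R X t) + integral {m..b} (\<lambda>t. \<psi> t *\<^sub>R X t)"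
  if "continuous_on {a..b} X" for X :: "real => complex"
 proof -
  have i: "(\<lambda>t. \<psi> t *\<^sub>R X t) integrable_on {a..m}" "(\<lambda>t. \<psi> t *\<^sub>R X t) integrable_on {m..b}"
   using m by (auto intro!: dual_bv_integrable[OF 1] dual_bv_integrable[OF 2] continuous_on_subset[OF that])
  then have "(\<lambda>t. \<psi> t *\<^sub>R X t) integrable_on {a..b}"
   using m by (intro Henstock_Kurzweil_Integration.integrable_combine[of a m b])
  then show ?thesis using m by (simp add: Henstock_Kurzweil_Integration.integral_combine)
 qed
 show ?thesis
  unfolding dual_bv_def
 proof (intro conjI allI impI)
  show "0 <= V + W" using 1 2 by (simp add: dual_bv_def)
 next
  fix X :: "real => complex" and s assume X: "continuous_on {a..b} X" "\<forall>t\<in>{a..b}. norm (X t) <= s"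
  show "(\<lambda>t. \<psi> t *\<^sub>R X t) integrable_on {a..b}" using cont X by blast
  have "norm (integral {a..m} (\<lambda>t. \<psi> t *\<^sub>R X t)) <= V * s"
   by (rule dual_bvD[OF 1 continuous_on_subset[OF X(1) sub(1)]]) (use X sub in blast)
  moreover have "norm (integral {m..b} (\<lambda>t. \<psi> t *\<^sub>R X t)) <= W * s"
   by (rule dual_bvD[OF 2 continuous_on_subset[OF X(1) sub(2)]]) (use X sub in blast)
  ultimately show "norm (integral {a..b} (\<lambda>t. \<psi> t *\<^sub>R X t)) <= (V + W) * s"
   using cont[OF X(1)] by (simp add: distrib_right norm_triangle_le add_mono)
 next
  fix X X' :: "real => complex" and s
  assume d: "\<forall>t\<in>{a..b}. (X has_vector_derivative X' t) (at t within {a..b})"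
   and X: "continuous_on {a..b} X'" "\<forall>t\<in>{a..b}. norm (X t) <= s"
  have "norm (integral {a..m} (\<lambda>t. \<psi> t *\<^sub>R X' t)) <= V * s"
   by (rule dual_bvD_deriv[OF 1 has_vector_derivative_within_subset[OF _ sub(1)] continuous_on_subset[OF X(1) sub(1)]])
    (use d X sub in blast)+
  moreover have "norm (integral {m..b} (\<lambda>t. \<psi> t *\<^sub>R X' t)) <= W * s"
   by (rule dual_bvD_deriv[OF 2 has_vector_derivative_within_subset[OF _ sub(2)] continuous_on_subset[OF X(1) sub(2)]])
    (use d X sub in blast)+
  ultimately show "norm (integral {a..b} (\<lambda>t. \<psi> t *\<^sub>R X' t)) <= (V + W) * s"
   using cont[OF X(1)] by (simp add: distrib_right norm_triangle_le add_mono)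
 qed
qed

lemma dual_bv_point: "dual_bv \<psi> a a 0"
 unfolding dual_bv_def using integrable_on_refl[of _ a] by auto

text \<open>Integration by parts against \<open>g\<close> gives two boundary terms and the integral
  of the derivative, hence the constant \<open>2 * G + G * (b - a)\<close>. The end points, where
  \<open>\<psi>\<close> may differ from \<open>g\<close>, are negligible.\<close>

lemma dual_bv_C1:
 assumes ab: "a <= b" and g: "g C1_differentiable_on {a..b}" and eq: "\<And>t. t \<in> {a<..<b} ==> \<psi> t = g t"
 shows "\<exists>V. dual_bv \<psi> a b V"
proof -
 obtain D where D: "\<And>t. t \<in> {a..b} ==> (g has_vector_derivative D t) (at t)" and cD: "continuous_on {a..b} D"
  using g unfolding C1_differentiable_on_def by blast
 have cg: "continuous_on {a..b} g"
  using g by (rule C1_differentiable_imp_continuous_on)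
 have "bounded (g ` {a..b})" "bounded (D ` {a..b})"
  by (intro compact_imp_bounded compact_continuous_image cg cD compact_Icc)+
 then obtain G0 G1 where G01: "\<forall>t\<in>{a..b}. \<bar>g t\<bar> <= G0" "\<forall>t\<in>{a..b}. \<bar>D t\<bar> <= G1"
  by (auto simp: bounded_iff)
 define G where "G = max G0 G1"
 have G: "\<bar>g t\<bar> <= G" "\<bar>D t\<bar> <= G" if "t \<in> {a..b}" for t
  using bspec[OF G01(1) that] bspec[OF G01(2) that] by (auto simp: G_def)
 have G0: "0 <= G" using G(1)[of a] ab by (auto intro: order_trans[OF abs_ge_zero])
 have int: "(\<lambda>t. \<psi> t *\<^sub>R X t) integrable_on {a..b} \<and>
   integral {a..b} (\<lambda>t. \<psi> t *\<^sub>R X t) = integral {a..b} (\<lambda>t. g t *\<^sub>R X t)"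
  if "continuous_on {a..b} X" for X :: "real => complex"
 proof -
  have "(\<lambda>t. g t *\<^sub>R X t) integrable_on {a..b}"
   by (intro integrable_continuous_real continuous_intros cg that)
  then have "((\<lambda>t. g t *\<^sub>R X t) has_integral integral {a..b} (\<lambda>t. g t *\<^sub>R X t)) {a..b}" by blast
  then have "((\<lambda>t. \<psi> t *\<^sub>R X t) has_integral integral {a..b} (\<lambda>t. g t *\<^sub>R X t)) {a..b}"
   by (rule has_integral_spike_finite[rotated 2, where S = "{a, b}"]) (auto simp: eq)
  then show ?thesis by (auto simp: integral_unique)
 qed
 have bd: "norm (integral {a..b} (\<lambda>t. h t *\<^sub>R X t)) <= G * (b - a) * s"
  if "continuous_on {a..b} X" "continuous_on {a..b} h" "\<And>t. t \<in> {a..b} ==> \<bar>h t\<bar> <= G"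
   "\<And>t. t \<in> {a..b} ==> norm (X t) <= s" for X :: "real => complex" and h s
 proof -
  have "norm (integral {a..b} (\<lambda>t. h t *\<^sub>R X t)) <= (G * s) * (b - a)"
   using that G0 by (intro integral_bound ab continuous_intros) (auto intro!: mult_mono)
  then show ?thesis by (simp add: mult_ac)
 qed
 have "dual_bv \<psi> a b (2 * G + G * (b - a))"
  unfolding dual_bv_def
 proof (intro conjI allI impI)
  show "0 <= 2 * G + G * (b - a)" using G0 ab by simp
 next
  fix X :: "real => complex" and s assume X: "continuous_on {a..b} X" "\<forall>t\<in>{a..b}. norm (X t) <= s"
  have s: "0 <= s" using X(2)[rule_format, of a] ab by (auto intro: order_trans[OF norm_ge_zero])
  show "(\<lambda>t. \<psi> t *\<^sub>R X t) integrable_on {a..b}" using int X by blast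
  have "norm (integral {a..b} (\<lambda>t. \<psi> t *\<^sub>R X t)) <= G * (b - a) * s"
   using int[OF X(1)] bd[OF X(1) cg G(1)] X(2) by simp
  also have "\<dots> <= (2 * G + G * (b - a)) * s" using G0 s by (intro mult_right_mono) auto
  finally show "norm (integral {a..b} (\<lambda>t. \<psi> t *\<^sub>R X t)) <= (2 * G + G * (b - a)) * s" .
 next
  fix X X' :: "real => complex" and s
  assume d: "\<forall>t\<in>{a..b}. (X has_vector_derivative X' t) (at t within {a..b})"
   and X: "continuous_on {a..b} X'" "\<forall>t\<in>{a..b}. norm (X t) <= s"
  have cX: "continuous_on {a..b} X" unfolding continuous_on_eq_continuous_within using d has_vector_derivative_continuous by blast
  have "((\<lambda>t. g t *\<^sub>R X t) has_vector_derivative (g t *\<^sub>R X' t + D t *\<^sub>R X t)) (at t within {a..b})"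
   if t: "t \<in> {a..b}" for t
   using has_vector_derivative_scaleR[OF _ d[rule_format, OF t], of g "D t"] has_vector_derivative_at_within[OF D[OF t]]
   by (simp add: has_real_derivative_iff_has_vector_derivative)
  then have "((\<lambda>t. g t *\<^sub>R X' t + D t *\<^sub>R X t) has_integral (g b *\<^sub>R X b - g a *\<^sub>R X a)) {a..b}"
   by (intro fundamental_theorem_of_calculus ab)
  moreover have "(\<lambda>t. g t *\<^sub>R X' t) integrable_on {a..b}" "(\<lambda>t. D t *\<^sub>R X t) integrable_on {a..b}"
   by (intro integrable_continuous_real continuous_intros cg cD cX X)+
  ultimately have "integral {a..b} (\<lambda>t. g t *\<^sub>R X' t) + integral {a..b} (\<lambda>t. D t *\<^sub>R X t) = g b *\<^sub>R X b - g a *\<^sub>R X a"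
   using integral_add integral_unique by metis
  then have "integral {a..b} (\<lambda>t. \<psi> t *\<^sub>R X' t) = g b *\<^sub>R X b - g a *\<^sub>R X a - integral {a..b} (\<lambda>t. D t *\<^sub>R X t)"
   using int[OF X(1)] by (simp add: algebra_simps)
  also have "norm \<dots> <= norm (g b *\<^sub>R X b) + norm (g a *\<^sub>R X a) + norm (integral {a..b} (\<lambda>t. D t *\<^sub>R X t))"
   by (intro norm_triangle_le_diff add_mono norm_triangle_ineq4 order_refl)
  also have "\<dots> <= G * s + G * s + G * (b - a) * s"
   using G[of a] G[of b] X ab bd[OF cX cD G(2)] G0 by (intro add_mono) (auto intro!: mult_mono)
  also have "\<dots> = (2 * G + G * (b - a)) * s" by (simp add: algebra_simps)
  finally show "norm (integral {a..b} (\<lambda>t. \<psi> t *\<^sub>R X' t)) <= (2 * G + G * (b - a)) * s" .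
 qed
 then show ?thesis by blast
qed

section \<open>Piecewise C1 functions\<close>

lemma finite_gap:
 fixes F :: "real set"
 assumes "finite F"
 obtains d where "0 < d" "\<And>y. y \<in> F ==> \<bar>y - x\<bar> < d ==> y = x"
proof -
 obtain d where "0 < d" "\<forall>y\<in>F. y \<noteq> x --> d <= dist x y"
  using finite_set_avoid[OF assms, of x] by blast
 then show ?thesis using that[of d] by (force simp: dist_real_def)
qed

text \<open>Bisection replaces an enumeration of the break points: a short interval around
  \<open>x\<close> contains no break point except possibly \<open>x\<close> itself, so it consists
  of two C1 pieces that meet at \<open>x\<close>.\<close>

lemma piecewise_C1_dual_bv:
 assumes "piecewise_C1 \<psi>" and ab: "a <= b"
 shows "\<exists>V. dual_bv \<psi> a b V"
proof -
 obtain F where F: "finite F" and C: "\<And>a b. a < b ==> {a<..<b} \<inter> F = {} ==>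
   \<exists>g. g C1_differentiable_on {a..b} \<and> (\<forall>s\<in>{a<..<b}. \<psi> s = g s)"
  using assms unfolding piecewise_C1_def by blast
 have C': "\<exists>V. dual_bv \<psi> a b V" if gap: "a <= b" "{a<..<b} \<inter> F = {}" for a b
 proof (cases "a = b")
  case True then show ?thesis using dual_bv_point by blast
 next
  case False
  then obtain g where "g C1_differentiable_on {a..b}" "\<forall>s\<in>{a<..<b}. \<psi> s = g s" using C[of a b] gap by auto
  then show ?thesis using dual_bv_C1[OF gap(1)] by blast
 qed
 show ?thesis using ab
 proof (induction rule: Bolzano)
  case (trans a b c)
  then show ?case using dual_bv_combine by blast
 next
  case (local x)
  obtain d where d: "0 < d" "\<And>y. y \<in> F ==> \<bar>y - x\<bar> < d ==> y = x" using finite_gap[OF F] by metis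
  show ?case
  proof (rule exI[of _ d], intro conjI allI impI)
   fix u v assume uv: "u <= x \<and> x <= v \<and> v - u < d"
   have "{u<..<x} \<inter> F = {}" "{x<..<v} \<inter> F = {}" using uv d(2) by force+
   then obtain V W where "dual_bv \<psi> u x V" "dual_bv \<psi> x v W" using C' uv by meson
   then show "\<exists>V. dual_bv \<psi> u v V" using dual_bv_combine uv by blast
  qed (use d in auto)
 qed
qed

lemma piecewise_C1_bounded:
 assumes "piecewise_C1 \<psi>" and ab: "a <= b"
 shows "\<exists>C. \<forall>t\<in>{a..b}. \<bar>\<psi> t\<bar> <= C"
proof -
 obtain F where F: "finite F" and C: "\<And>a b. a < b ==> {a<..<b} \<inter> F = {} ==>
   \<exists>g. g C1_differentiable_on {a..b} \<and> (\<forall>s\<in>{a<..<b}. \<psi> s = g s)"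
  using assms unfolding piecewise_C1_def by blast
 have C': "\<exists>C. \<forall>t\<in>{a..b}. \<bar>\<psi> t\<bar> <= C" if gap: "a <= b" "{a<..<b} \<inter> F = {}" for a b
 proof (cases "a = b")
  case True then show ?thesis by auto
 next
  case False
  then obtain g where g: "g C1_differentiable_on {a..b}" "\<forall>s\<in>{a<..<b}. \<psi> s = g s" using C[of a b] gap by auto
  have "continuous_on {a..b} g" using g(1) by (rule C1_differentiable_imp_continuous_on)
  then have "bounded (g ` {a..b})" by (intro compact_imp_bounded compact_continuous_image) auto
  then obtain G where G: "\<forall>t\<in>{a..b}. \<bar>g t\<bar> <= G" by (auto simp: bounded_iff)
  \<comment> \<open>The C1 piece describes \<open>\<psi>\<close> in the open interval only; the
    values at its ends are arbitrary and enter the bound separately.\<close>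
  then have "\<bar>\<psi> t\<bar> <= max G (max \<bar>\<psi> a\<bar> \<bar>\<psi> b\<bar>)" if "t \<in> {a..b}" for t
   using g(2) that bspec[OF G that] by (cases "t = a \<or> t = b") (auto simp: le_max_iff_disj)
  then show ?thesis by blast
 qed
 show ?thesis using ab
 proof (induction rule: Bolzano)
  case (trans a b c)
  then obtain A B where "\<forall>t\<in>{a..b}. \<bar>\<psi> t\<bar> <= A" "\<forall>t\<in>{b..c}. \<bar>\<psi> t\<bar> <= B" by blast
  then have "\<forall>t\<in>{a..c}. \<bar>\<psi> t\<bar> <= max A B" by (force simp: le_max_iff_disj)
  then show ?case by blast
 next
  case (local x)
  obtain d where d: "0 < d" "\<And>y. y \<in> F ==> \<bar>y - x\<bar> < d ==> y = x" using finite_gap[OF F] by metis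
  show ?case
  proof (rule exI[of _ d], intro conjI allI impI)
   fix u v assume uv: "u <= x \<and> x <= v \<and> v - u < d"
   have "{u<..<x} \<inter> F = {}" "{x<..<v} \<inter> F = {}" using uv d(2) by force+
   then obtain A B where "\<forall>t\<in>{u..x}. \<bar>\<psi> t\<bar> <= A" "\<forall>t\<in>{x..v}. \<bar>\<psi> t\<bar> <= B" using C' uv by meson
   then have "\<forall>t\<in>{u..v}. \<bar>\<psi> t\<bar> <= max A B" by (force simp: le_max_iff_disj)
   then show "\<exists>C. \<forall>t\<in>{u..v}. \<bar>\<psi> t\<bar> <= C" by blast
  qed (use d in auto)
 qed
qed

lemma C1_Lipschitz:
 assumes g: "g C1_differentiable_on {a..b}"
 shows "\<exists>M\<ge>0. \<forall>x y. a <= x --> x <= y --> y <= b --> \<bar>g y - g x :: real\<bar> <= M * (y - x)"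
proof -
 obtain D where D: "\<And>t. t \<in> {a..b} ==> (g has_vector_derivative D t) (at t)" and cD: "continuous_on {a..b} D"
  using g unfolding C1_differentiable_on_def by blast
 have "bounded (D ` {a..b})"
  by (intro compact_imp_bounded compact_continuous_image cD compact_Icc)
 then obtain M where M: "0 < M" "\<And>t. t \<in> {a..b} ==> \<bar>D t\<bar> <= M"
  by (auto simp: bounded_pos)
 have "\<bar>g y - g x\<bar> <= M * (y - x)" if "a <= x" "x <= y" "y <= b" for x y
 proof -
  have "norm (g y - g x) <= M * norm (y - x)"
  proof (rule field_differentiable_bound[of "{a..b}" g D])
   fix z assume "z \<in> {a..b}"
   then show "(g has_field_derivative D z) (at z within {a..b})"
    using D by (simp add: has_real_derivative_iff_has_vector_derivative has_vector_derivative_at_within)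
  qed (use M that in auto)
  then show ?thesis using that by simp
 qed
 then show ?thesis using M(1) by (intro exI[of _ M]) auto
qed

text \<open>A single constant has to serve all intervals free of break points, because the averaging
  error away from the jumps is to be uniform. Bisection assembles it from the constants of the
  pieces.\<close>

lemma piecewise_C1_Lipschitz:
 assumes "piecewise_C1 \<psi>" and ab: "a <= b"
 obtains F where "finite F" "\<And>u v. u < v ==> {u<..<v} \<inter> F = {} ==> (\<forall>s\<in>{u<..<v}. isCont \<psi> s)"
  "\<exists>M\<ge>0. \<forall>x y. a <= x --> x <= y --> y <= b --> {x..y} \<inter> F = {} --> \<bar>\<psi> y - \<psi> x\<bar> <= M * (y - x)"
proof -
 obtain F where F: "finite F" and C: "\<And>a b. a < b ==> {a<..<b} \<inter> F = {} ==>
   \<exists>g. g C1_differentiable_on {a..b} \<and> (\<forall>s\<in>{a<..<b}. \<psi> s = g s)"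
  using assms unfolding piecewise_C1_def by blast
 have C': "\<exists>M\<ge>0. \<forall>x y. a < x --> x <= y --> y < b --> \<bar>\<psi> y - \<psi> x\<bar> <= M * (y - x)" if gap: "a < b" "{a<..<b} \<inter> F = {}" for a b
 proof -
  obtain g where g: "g C1_differentiable_on {a..b}" "\<forall>s\<in>{a<..<b}. \<psi> s = g s" using C[OF gap] by blast
  then obtain M where "0 <= M" "\<forall>x y. a <= x --> x <= y --> y <= b --> \<bar>g y - g x\<bar> <= M * (y - x)"
   using C1_Lipschitz by blast
  then show ?thesis using g(2) by (intro exI[of _ M]) auto
 qed
 show ?thesis
 proof (rule that[OF F])
  fix u v :: real assume uv: "u < v" "{u<..<v} \<inter> F = {}"
  then obtain g where g: "g C1_differentiable_on {u..v}" "\<forall>s\<in>{u<..<v}. \<psi> s = g s" using C[of u v] by auto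
  show "\<forall>s\<in>{u<..<v}. isCont \<psi> s"
  proof
   fix s assume s: "s \<in> {u<..<v}"
   have "isCont g s" using g(1) s unfolding C1_differentiable_on_def
    by (meson atLeastAtMost_iff greaterThanLessThan_iff has_vector_derivative_continuous less_imp_le)
   moreover have "\<forall>\<^sub>F x in nhds s. \<psi> x = g x"
    using s g(2) by (auto simp: eventually_nhds intro!: exI[of _ "{u<..<v}"])
   ultimately show "isCont \<psi> s" using isCont_cong by blast
  qed
 next
  let ?P = "\<lambda>a b. \<exists>M\<ge>0. \<forall>x y. a <= x --> x <= y --> y <= b --> {x..y} \<inter> F = {} --> \<bar>\<psi> y - \<psi> x\<bar> <= M * (y - x)"
  show "?P a b" using ab
  proof (induction rule: Bolzano)
   case (trans a b c)
   obtain A where A: "0 <= A" "\<And>x y. a <= x ==> x <= y ==> y <= b ==> {x..y} \<inter> F = {} ==> \<bar>\<psi> y - \<psi> x\<bar> <= A * (y - x)"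
    using trans(1) by meson
   obtain B where B: "0 <= B" "\<And>x y. b <= x ==> x <= y ==> y <= c ==> {x..y} \<inter> F = {} ==> \<bar>\<psi> y - \<psi> x\<bar> <= B * (y - x)"
    using trans(2) by meson
   have "\<bar>\<psi> y - \<psi> x\<bar> <= max A B * (y - x)" if xy: "a <= x" "x <= y" "y <= c" "{x..y} \<inter> F = {}" for x y
   proof -
    have m: "A * r <= max A B * r" "B * r <= max A B * r" if "0 <= r" for r
     using that by (auto intro: mult_right_mono)
    consider "y <= b" | "b <= x" | "x < b" "b < y" by linarith
    then show ?thesis
    proof cases
     case 1 then show ?thesis using A(2)[of x y] m(1)[of "y - x"] xy by auto
    next
     case 2 then show ?thesis using B(2)[of x y] m(2)[of "y - x"] xy by auto
    next
     case 3
     have "{x..b} \<inter> F = {}" using 3 xy(4) by force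
     moreover have "{b..y} \<subseteq> {x..y}" using 3 by auto
     then have "{b..y} \<inter> F = {}" using xy(4) by blast
     ultimately have "\<bar>\<psi> b - \<psi> x\<bar> <= A * (b - x)" "\<bar>\<psi> y - \<psi> b\<bar> <= B * (y - b)"
      using A(2)[of x b] B(2)[of b y] xy 3 by auto
     then have "\<bar>\<psi> y - \<psi> x\<bar> <= max A B * (b - x) + max A B * (y - b)"
      using m(1)[of "b - x"] m(2)[of "y - b"] 3 by linarith
     then show ?thesis by (simp add: algebra_simps)
    qed
   qed
   then show ?case using A(1) by (intro exI[of _ "max A B"]) auto
  next
   case (local x)
   obtain d where d: "0 < d" "\<And>y. y \<in> F ==> \<bar>y - x\<bar> < d ==> y = x" using finite_gap[OF F] by metis
   have "\<exists>M\<ge>0. \<forall>u v. x - d < u --> u <= v --> v < x + d --> {u..v} \<inter> F = {} --> \<bar>\<psi> v - \<psi> u\<bar> <= M * (v - u)"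
   proof (cases "x \<in> F")
    case True
    have "{x - d<..<x} \<inter> F = {}" "{x<..<x + d} \<inter> F = {}" using d(2) by force+
    then obtain A B where A: "A \<ge> 0" "\<And>u v. x - d < u ==> u <= v ==> v < x ==> \<bar>\<psi> v - \<psi> u\<bar> <= A * (v - u)"
     and B: "B \<ge> 0" "\<And>u v. x < u ==> u <= v ==> v < x + d ==> \<bar>\<psi> v - \<psi> u\<bar> <= B * (v - u)"
     using C'[of "x - d" x] C'[of x "x + d"] d(1) by auto
    have "\<bar>\<psi> v - \<psi> u\<bar> <= max A B * (v - u)" if "x - d < u" "u <= v" "v < x + d" "{u..v} \<inter> F = {}" for u v
    proof -
     have "x \<notin> {u..v}" using that(4) True by blast
     then have "v < x \<or> x < u" by auto
     then show ?thesis
     proof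
      assume "v < x"
      then show ?thesis using A(2)[of u v] that mult_right_mono[of A "max A B" "v - u"] by auto
     next
      assume "x < u"
      then show ?thesis using B(2)[of u v] that mult_right_mono[of B "max A B" "v - u"] by auto
     qed
    qed
    then show ?thesis using A(1) by (intro exI[of _ "max A B"]) auto
   next
    case False
    then have "{x - d<..<x + d} \<inter> F = {}" using d(2) by (force simp: abs_less_iff)
    then show ?thesis using C'[of "x - d" "x + d"] d(1) by force
   qed
   then obtain M where M: "0 <= M" "\<And>u v. x - d < u ==> u <= v ==> v < x + d ==> {u..v} \<inter> F = {} ==> \<bar>\<psi> v - \<psi> u\<bar> <= M * (v - u)"
    by meson
   show ?case
   proof (rule exI[of _ d], intro conjI allI impI)
    fix u v assume uv: "u <= x \<and> x <= v \<and> v - u < d"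
    then show "?P u v" using M by (intro exI[of _ M]) auto
   qed (use d in auto)
  qed
 qed
qed

section \<open>Poisson summation as an inequality\<close>

text \<open>This is the de la Vallee Poussin kernel of period one; the central binomial coefficient
  makes its mean over a period equal to one.\<close>

definition cos_kernel :: "nat => real => real" where
 "cos_kernel M x = 4 ^ M / real ((2 * M) choose M) * cos (pi * x) ^ (2 * M)"

text \<open>The Fourier coefficient of \<open>cos_kernel M\<close> at the frequency
  \<open>i - M\<close>; the shift keeps the index natural, and \<open>i = M\<close> is the zeroth
  coefficient.\<close>

definition kernel_coeff :: "nat => nat => real" where
 "kernel_coeff M i = real ((2 * M) choose i) / real ((2 * M) choose M)"

lemma kernel_coeff_bounds: "0 <= kernel_coeff M i" "kernel_coeff M i <= 1"
 using binomial_maximum'[of M i] by (auto simp: kernel_coeff_def divide_simps)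

lemma kernel_coeff_mid: "kernel_coeff M M = 1"
 by (simp add: kernel_coeff_def)

lemma cos_kernel_nonneg: "0 <= cos_kernel M x"
 by (simp add: cos_kernel_def)

text \<open>Binomial expansion of the power \<open>2 * M\<close> of
  \<open>cis (pi * x) + cis (- (pi * x))\<close>. The even exponent leaves only integer multiples of
  \<open>2 * pi * x\<close>.\<close>

lemma cos_kernel_cis:
 "complex_of_real (cos_kernel M x) =
   (\<Sum>i\<le>2*M. of_real (kernel_coeff M i) * cis (2 * pi * (real i - real M) * x))"
proof -
 have "complex_of_real (2 * cos (pi * x)) = cis (pi * x) + cis (- (pi * x))"
  by (simp add: complex_eq_iff)
 then have "complex_of_real (2 * cos (pi * x)) ^ (2*M) =
   (\<Sum>i\<le>2*M. of_nat ((2*M) choose i) * cis (pi * x) ^ i * cis (- (pi * x)) ^ (2*M - i))"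
  by (simp add: binomial_ring)
 also have "\<dots> = (\<Sum>i\<le>2*M. of_nat ((2*M) choose i) * cis (2 * pi * (real i - real M) * x))"
 proof (rule sum.cong)
  fix i assume "i \<in> {..2*M}"
  then have "real i * (pi * x) + real (2*M - i) * (- (pi * x)) = 2 * pi * (real i - real M) * x"
   by (simp add: of_nat_diff algebra_simps)
  then show "of_nat ((2*M) choose i) * cis (pi * x) ^ i * cis (- (pi * x)) ^ (2*M - i) =
    of_nat ((2*M) choose i) * cis (2 * pi * (real i - real M) * x)"
   by (simp only: Complex.DeMoivre mult.assoc cis_mult)
 qed simp
 finally have *: "complex_of_real (4 ^ M * cos (pi * x) ^ (2*M)) =
   (\<Sum>i\<le>2*M. of_nat ((2*M) choose i) * cis (2 * pi * (real i - real M) * x))"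
  by (simp add: power_mult power_mult_distrib)
 have "complex_of_real (cos_kernel M x) =
   complex_of_real (4 ^ M * cos (pi * x) ^ (2*M)) / of_nat ((2*M) choose M)"
  by (simp add: cos_kernel_def)
 then show ?thesis
  by (simp only: * kernel_coeff_def sum_divide_distrib) (simp add: field_simps)
qed

lemma cos_kernel_cos:
 "cos_kernel M x = (\<Sum>i\<le>2*M. kernel_coeff M i * cos (2 * pi * (real i - real M) * x))"
 using arg_cong[OF cos_kernel_cis[of M x], of Re] by (simp add: Re_sum)

lemma cos_kernel_prod:
 "cos_kernel M x * cos_kernel M y =
   (\<Sum>i\<le>2*M. \<Sum>j\<le>2*M. kernel_coeff M i * kernel_coeff M j *
    cos (2 * pi * ((real i - real M) * x + (real j - real M) * y)))"
proof -
 have "complex_of_real (cos_kernel M x * cos_kernel M y) =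
   (\<Sum>i\<le>2*M. \<Sum>j\<le>2*M. of_real (kernel_coeff M i * kernel_coeff M j) *
    cis (2 * pi * ((real i - real M) * x + (real j - real M) * y)))"
  unfolding of_real_mult cos_kernel_cis sum_product
  by (intro sum.cong refl) (simp add: cis_mult distrib_left mult_ac)
 from arg_cong[OF this, of Re] show ?thesis by (simp add: Re_sum)
qed

lemma continuous_cos_kernel [continuous_intros]:
 fixes f :: "'a::t2_space => real"
 shows "continuous_on S f ==> continuous_on S (\<lambda>x. cos_kernel M (f x))"
 unfolding cos_kernel_def by (intro continuous_intros)

lemma integral_cos_period:
 fixes j :: int and c :: real
 assumes "j \<noteq> 0"
 shows "((\<lambda>x. cos (2 * pi * real_of_int j * x)) has_integral 0) {c - 1/2..c + 1/2}"
proof -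
 let ?w = "2 * pi * real_of_int j"
 have "((\<lambda>x. cos (?w * x)) has_integral
   (sin (?w * (c + 1/2)) / ?w - sin (?w * (c - 1/2)) / ?w)) {c - 1/2..c + 1/2}"
  by (rule fundamental_theorem_of_calculus)
   (use assms in \<open>auto intro!: derivative_eq_intros simp: has_real_derivative_iff_has_vector_derivative[symmetric]\<close>)
 moreover have "sin (?w * (c + 1/2)) = sin (?w * (c - 1/2) + 2 * pi * real_of_int j)"
  by (simp add: algebra_simps)
 then have "sin (?w * (c + 1/2)) = sin (?w * (c - 1/2))"
  by (simp add: sin_add sin_integer_2pi cos_integer_2pi)
 ultimately show ?thesis by simp
qed

text \<open>Nonzero frequencies integrate to zero over a period; what remains is the coefficient at
  \<open>i = M\<close>, which is one.\<close>

lemma cos_kernel_integral_cell: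
 "((cos_kernel M) has_integral 1) {c - 1/2..c + 1/2}"
proof -
 have "((\<lambda>x. \<Sum>i\<le>2*M. kernel_coeff M i * cos (2 * pi * (real i - real M) * x)) has_integral
   (\<Sum>i\<le>2*M. kernel_coeff M i * (if i = M then 1 else 0))) {c - 1/2..c + 1/2}"
 proof (intro has_integral_sum has_integral_mult_right)
  fix i
  show "((\<lambda>x. cos (2 * pi * (real i - real M) * x)) has_integral (if i = M then 1 else 0)) {c - 1/2..c + 1/2}"
  proof (cases "i = M")
   case True
   have "((\<lambda>x. 1::real) has_integral (c + 1/2 - (c - 1/2))) {c - 1/2..c + 1/2}"
    using has_integral_const_real[of "1::real" "c - 1/2" "c + 1/2"] by simp
   then show ?thesis using True by simp
  next
   case False
   then show ?thesis using integral_cos_period[of "int i - int M" c] by simp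
  qed
 qed simp
 moreover have "(\<Sum>i\<le>2*M. kernel_coeff M i * (if i = M then 1 else 0)) = 1"
  by (subst sum.remove[of _ M]) (auto simp: kernel_coeff_mid intro!: sum.neutral)
 ultimately show ?thesis
  unfolding cos_kernel_cos[abs_def] by simp
qed

definition kernel_tail :: "real => nat => real" where
 "kernel_tail \<delta> M = 4 ^ M / real ((2 * M) choose M) * cos (pi * \<delta>) ^ (2 * M)"

lemma kernel_tail_nonneg: "0 <= kernel_tail \<delta> M"
 by (simp add: kernel_tail_def)

text \<open>The central binomial coefficient is at least \<open>4 ^ M / (2 * M)\<close>, so the
  normalising factor grows at most linearly in \<open>M\<close>, while the power of the cosine
  decays geometrically.\<close>

lemma kernel_tail_tendsto:
 assumes "0 < \<delta>" "\<delta> < 1/2"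
 shows "(\<lambda>M. kernel_tail \<delta> M) \<longlonglongrightarrow> 0"
proof -
 define c where "c = cos (pi * \<delta>) ^ 2"
 have "0 <= pi * \<delta>" using assms by simp
 then have "0 < cos (pi * \<delta>)" using assms by (intro cos_gt_zero) (auto simp: field_simps)
 moreover have "cos (pi * \<delta>) < cos 0"
  using assms by (intro cos_monotone_0_pi) (auto simp: field_simps)
 ultimately have c: "0 <= c" "c < 1"
  by (auto simp: c_def power_less_one_iff)
 have "(\<lambda>M. real M * c ^ M) \<longlonglongrightarrow> 0"
  using powser_times_n_limit_0[of c] c by simp
 then have lim: "(\<lambda>M. 2 * (real M * c ^ M)) \<longlonglongrightarrow> 0"
  using tendsto_mult_right_zero by blast
 show ?thesis
 proof (rule tendsto_sandwich[OF _ _ tendsto_const lim])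
  show "\<forall>\<^sub>F M in sequentially. 0 <= kernel_tail \<delta> M" by (simp add: kernel_tail_nonneg)
  show "\<forall>\<^sub>F M in sequentially. kernel_tail \<delta> M <= 2 * (real M * c ^ M)"
  proof (rule eventually_sequentiallyI[of 1])
   fix M :: nat assume M: "1 <= M"
   then have "4 ^ M / (2 * real M) <= real ((2 * M) choose M)"
    using central_binomial_lower_bound[of M] by simp
   then have "4 ^ M / real ((2 * M) choose M) <= 2 * real M"
    using M by (simp add: field_simps)
   then have "4 ^ M / real ((2 * M) choose M) * c ^ M <= 2 * real M * c ^ M"
    using c by (intro mult_right_mono) auto
   then show "kernel_tail \<delta> M <= 2 * (real M * c ^ M)"
    by (simp add: kernel_tail_def c_def power_mult)
  qed
 qed
qed

lemma cos_kernel_le_tail: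
 assumes "0 < \<delta>" "\<delta> <= \<bar>x - of_int n\<bar>" "\<bar>x - of_int n\<bar> <= 1/2"
 shows "cos_kernel M x <= kernel_tail \<delta> M"
proof -
 define y where "y = x - of_int n"
 have "cos (pi * x) = cos (pi * y + of_int n * pi)" by (simp add: y_def algebra_simps)
 also have "\<dots> = cos (pi * y) * (cos (of_int n * pi))"
  using sin_npi_int[of n] by (simp add: cos_add mult.commute)
 finally have "\<bar>cos (pi * x)\<bar> = \<bar>cos (pi * y)\<bar>" 
  by (simp add: abs_mult cos_int_times_real mult.commute)
 also have "\<dots> = \<bar>cos (pi * \<bar>y\<bar>)\<bar>"
  by (simp add: abs_if)
 also have "\<dots> = cos (pi * \<bar>y\<bar>)"
  using assms by (intro abs_of_nonneg cos_ge_zero) (auto simp: y_def field_simps intro: order_trans[of _ 0])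
 also have "\<dots> <= cos (pi * \<delta>)"
  using assms by (intro cos_monotone_0_pi_le) (auto simp: y_def field_simps)
 finally have "\<bar>cos (pi * x)\<bar> ^ (2*M) <= cos (pi * \<delta>) ^ (2*M)"
  by (rule power_mono) simp
 then have "cos (pi * x) ^ (2*M) <= cos (pi * \<delta>) ^ (2*M)"
  by (simp add: power_even_abs)
 then show ?thesis
  unfolding cos_kernel_def kernel_tail_def by (intro mult_left_mono) auto
qed

text \<open>The kernel is an approximate identity on one cell: within \<open>\<delta>\<close> of the
  centre the oscillation \<open>\<eta>\<close> meets total mass one, and farther away
  \<open>2 * B\<close> meets a kernel below \<open>kernel_tail \<delta> M\<close> on a cell of
  length one.\<close>

lemma cos_kernel_cell_approx:
 fixes e :: "real => real" and n :: int
 assumes c: "continuous_on {of_int n - 1/2..of_int n + 1/2} e"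
  and B: "\<And>x. x \<in> {of_int n - 1/2..of_int n + 1/2} ==> \<bar>e x\<bar> <= B"
  and d: "0 < \<delta>"
  and \<eta>: "0 <= \<eta>" "\<And>x. x \<in> {of_int n - 1/2..of_int n + 1/2} ==> \<bar>x - of_int n\<bar> <= \<delta> ==> \<bar>e x - e (of_int n)\<bar> <= \<eta>"
 shows "\<bar>integral {of_int n - 1/2..of_int n + 1/2} (\<lambda>x. e x * cos_kernel M x) - e (of_int n)\<bar>
   <= \<eta> + 2 * B * kernel_tail \<delta> M"
proof -
 let ?I = "{real_of_int n - 1/2..of_int n + 1/2}"
 have K: "(cos_kernel M has_integral 1) ?I" by (rule cos_kernel_integral_cell)
 have i1: "(\<lambda>x. e x * cos_kernel M x) integrable_on ?I"
  by (intro integrable_continuous_real continuous_intros c)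
 have B0: "0 <= B" using B[of "of_int n"] by (auto intro: order_trans[OF abs_ge_zero])
 have "integral ?I (\<lambda>x. e x * cos_kernel M x) - e (of_int n) =
   integral ?I (\<lambda>x. e x * cos_kernel M x) - integral ?I (\<lambda>x. e (of_int n) * cos_kernel M x)"
  using K by (simp add: integral_unique)
 also have "\<dots> = integral ?I (\<lambda>x. e x * cos_kernel M x - e (of_int n) * cos_kernel M x)"
  using i1 K by (intro integral_diff[symmetric]) (auto intro!: integrable_on_mult_right simp: has_integral_integrable)
 finally have eq: "integral ?I (\<lambda>x. e x * cos_kernel M x) - e (of_int n) =
   integral ?I (\<lambda>x. (e x - e (of_int n)) * cos_kernel M x)" by (simp add: algebra_simps)
 have "norm (integral ?I (\<lambda>x. (e x - e (of_int n)) * cos_kernel M x))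
   <= integral ?I (\<lambda>x. \<eta> * cos_kernel M x + 2 * B * kernel_tail \<delta> M)"
 proof (rule integral_norm_bound_integral)
  show "(\<lambda>x. (e x - e (of_int n)) * cos_kernel M x) integrable_on ?I"
   by (intro integrable_continuous_real continuous_intros c)
  show "(\<lambda>x. \<eta> * cos_kernel M x + 2 * B * kernel_tail \<delta> M) integrable_on ?I"
   by (intro integrable_continuous_real continuous_intros)
  fix x assume x: "x \<in> ?I"
  show "norm ((e x - e (of_int n)) * cos_kernel M x) <= \<eta> * cos_kernel M x + 2 * B * kernel_tail \<delta> M"
  proof (cases "\<bar>x - of_int n\<bar> <= \<delta>")
   case True
   have "\<bar>e x - e (of_int n)\<bar> * cos_kernel M x <= \<eta> * cos_kernel M x"
    using \<eta>(2)[OF x True] cos_kernel_nonneg by (intro mult_right_mono) auto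
   moreover have "0 <= 2 * B * kernel_tail \<delta> M"
    using B0 kernel_tail_nonneg[of \<delta> M] by simp
   ultimately show ?thesis using cos_kernel_nonneg[of M x] by (simp add: abs_mult)
  next
   case False
   have "cos_kernel M x <= kernel_tail \<delta> M"
    using x False d by (intro cos_kernel_le_tail[where n = n]) (auto simp: abs_le_iff)
   moreover have "\<bar>e x - e (of_int n)\<bar> <= 2 * B"
    using B[OF x] B[of "of_int n"] by auto
   ultimately have "\<bar>e x - e (of_int n)\<bar> * cos_kernel M x <= 2 * B * kernel_tail \<delta> M"
    using cos_kernel_nonneg[of M x] B0 by (intro mult_mono) auto
   moreover have "0 <= \<eta> * cos_kernel M x" using \<eta>(1) cos_kernel_nonneg by simp
   ultimately show ?thesis using cos_kernel_nonneg[of M x] by (simp add: abs_mult)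
  qed
 qed
 also have "\<dots> = \<eta> + 2 * B * kernel_tail \<delta> M"
 proof (rule integral_unique)
  have "((\<lambda>x. 2 * B * kernel_tail \<delta> M) has_integral 2 * B * kernel_tail \<delta> M) ?I"
   using has_integral_const_real[of "2 * B * kernel_tail \<delta> M" "real_of_int n - 1/2" "of_int n + 1/2"] by simp
  then show "((\<lambda>x. \<eta> * cos_kernel M x + 2 * B * kernel_tail \<delta> M) has_integral \<eta> + 2 * B * kernel_tail \<delta> M) ?I"
   using has_integral_add[OF has_integral_mult_right[OF K, of \<eta>]] by simp
 qed
 finally show ?thesis using eq by simp
qed

text \<open>The edges are half-integers, so that the box is a union of unit cells centred at lattice
  points and no lattice point lies on its boundary.\<close>

definition cell_box :: "nat => real set" where
 "cell_box L = {- real L - 1/2..real L + 1/2}"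

lemma integral_cell_box:
 fixes e :: "real => real"
 assumes "continuous_on (cell_box L) e"
 shows "integral (cell_box L) e =
  (\<Sum>n\<in>{- int L..int L}. integral {of_int n - 1/2..of_int n + 1/2} e)"
 using assms
proof (induction L)
 case 0
 show ?case by (simp add: cell_box_def)
next
 case (Suc L)
 have int: "e integrable_on cell_box (Suc L)"
  using Suc.prems by (simp add: cell_box_def integrable_continuous_real)
 have sub: "cell_box L \<subseteq> cell_box (Suc L)" by (auto simp: cell_box_def)
 have "integral (cell_box (Suc L)) e =
   integral {- real (Suc L) - 1/2..real L + 1/2} e + integral {real L + 1/2..real (Suc L) + 1/2} e"
  unfolding cell_box_def
  by (rule Henstock_Kurzweil_Integration.integral_combine[symmetric]) (use int in \<open>auto simp: cell_box_def\<close>)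
 also have "integral {- real (Suc L) - 1/2..real L + 1/2} e =
   integral {- real (Suc L) - 1/2..- real L - 1/2} e + integral (cell_box L) e"
  unfolding cell_box_def
  by (rule Henstock_Kurzweil_Integration.integral_combine[symmetric])
   (auto intro!: integrable_continuous_real continuous_on_subset[OF Suc.prems] simp: cell_box_def)
 also have "integral (cell_box L) e =
   (\<Sum>n\<in>{- int L..int L}. integral {of_int n - 1/2..of_int n + 1/2} e)"
  using Suc.IH continuous_on_subset[OF Suc.prems sub] by blast
 finally have step: "integral (cell_box (Suc L)) e =
   integral {- real (Suc L) - 1/2..- real L - 1/2} e + (\<Sum>n\<in>{- int L..int L}. integral {of_int n - 1/2..of_int n + 1/2} e) +
   integral {real L + 1/2..real (Suc L) + 1/2} e" .
 have J: "{- int (Suc L)..int (Suc L)} = insert (- int (Suc L)) (insert (int (Suc L)) {- int L..int L})"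
  by auto
 have ins: "(\<Sum>n\<in>insert (- int (Suc L)) (insert (int (Suc L)) {- int L..int L}). G n) =
   G (- int (Suc L)) + (G (int (Suc L)) + (\<Sum>n\<in>{- int L..int L}. G n))" for G :: "int => real"
  by (subst sum.insert, simp, simp, subst sum.insert, auto)
 have e: "real_of_int (- int (Suc L)) + 1/2 = - real L - 1/2" "real_of_int (- int (Suc L)) - 1/2 = - real (Suc L) - 1/2"
  "real_of_int (int (Suc L)) - 1/2 = real L + 1/2" "real_of_int (int (Suc L)) + 1/2 = real (Suc L) + 1/2"
  by auto
 show ?case unfolding J ins e step by simp
qed

lemma integrable_cell_box:
 fixes e :: "real => real"
 shows "continuous_on (cell_box L) e ==> e integrable_on cell_box L"
 unfolding cell_box_def by (rule integrable_continuous_real)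

lemma cos_kernel_box_approx:
 fixes e :: "real => real"
 assumes c: "continuous_on (cell_box L) e"
  and B: "\<And>x. x \<in> cell_box L ==> \<bar>e x\<bar> <= B"
  and d: "0 < \<delta>"
  and \<eta>: "0 <= \<eta>" "\<And>x y. x \<in> cell_box L ==> y \<in> cell_box L ==> \<bar>x - y\<bar> <= \<delta> ==> \<bar>e x - e y\<bar> <= \<eta>"
 shows "\<bar>integral (cell_box L) (\<lambda>x. e x * cos_kernel M x) - (\<Sum>n\<in>{- int L..int L}. e (of_int n))\<bar>
   <= (2 * real L + 1) * (\<eta> + 2 * B * kernel_tail \<delta> M)"
proof -
 have sub: "{real_of_int n - 1/2..of_int n + 1/2} \<subseteq> cell_box L" if "n \<in> {- int L..int L}" for n
  using that by (auto simp: cell_box_def)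
 have "integral (cell_box L) (\<lambda>x. e x * cos_kernel M x) - (\<Sum>n\<in>{- int L..int L}. e (of_int n)) =
   (\<Sum>n\<in>{- int L..int L}. integral {of_int n - 1/2..of_int n + 1/2} (\<lambda>x. e x * cos_kernel M x) - e (of_int n))"
  by (subst integral_cell_box) (auto intro!: continuous_intros c simp: sum_subtractf)
 also have "\<bar>\<dots>\<bar> <= (\<Sum>n\<in>{- int L..int L}. \<eta> + 2 * B * kernel_tail \<delta> M)"
 proof (rule order_trans[OF sum_abs sum_mono])
  fix n assume n: "n \<in> {- int L..int L}"
  have "real_of_int n \<in> cell_box L" using sub[OF n] by auto
  then show "\<bar>integral {of_int n - 1/2..of_int n + 1/2} (\<lambda>x. e x * cos_kernel M x) - e (of_int n)\<bar>
    <= \<eta> + 2 * B * kernel_tail \<delta> M"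
   using sub[OF n] B \<eta> by (intro cos_kernel_cell_approx d continuous_on_subset[OF c]) auto
 qed
 also have "\<dots> = (2 * real L + 1) * (\<eta> + 2 * B * kernel_tail \<delta> M)" by simp
 finally show ?thesis .
qed

text \<open>The one-dimensional estimate is used in \<open>y\<close> for each \<open>x\<close>, then
  in \<open>x\<close> for each lattice value of \<open>y\<close>. Both times the error
  \<open>l * r\<close> is multiplied by \<open>l = 2 * L + 1\<close>: first as the mass of the
  kernel over the box, then as the number of lattice values.\<close>

lemma cos_kernel_box2_approx:
 fixes E :: "real => real => real"
 assumes c: "continuous_on (cell_box L \<times> cell_box L) (\<lambda>(x, y). E x y)"
  and B: "\<And>x y. x \<in> cell_box L ==> y \<in> cell_box L ==> \<bar>E x y\<bar> <= B"
  and d: "0 < \<delta>" and \<eta>0: "0 <= \<eta>"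
  and \<eta>: "\<And>x y x' y'. [|x \<in> cell_box L; y \<in> cell_box L; x' \<in> cell_box L; y' \<in> cell_box L;
    \<bar>x - x'\<bar> <= \<delta>; \<bar>y - y'\<bar> <= \<delta>|] ==> \<bar>E x y - E x' y'\<bar> <= \<eta>"
 shows "\<bar>integral (cell_box L) (\<lambda>x. integral (cell_box L) (\<lambda>y. E x y * (cos_kernel M x * cos_kernel M y))) -
   (\<Sum>m\<in>{- int L..int L}. \<Sum>n\<in>{- int L..int L}. E (of_int m) (of_int n))\<bar>
   <= 2 * (2 * real L + 1)\<^sup>2 * (\<eta> + 2 * B * kernel_tail \<delta> M)"
proof -
 let ?Q = "cell_box L" and ?J = "{- int L..int L}"
 define r where "r = \<eta> + 2 * B * kernel_tail \<delta> M"
 define l where "l = 2 * real L + 1"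
 have z: "(0::real) \<in> ?Q" and memJ: "real_of_int n \<in> ?Q" if "n \<in> ?J" for n
  using that by (auto simp: cell_box_def)
 have cx: "continuous_on ?Q (\<lambda>x. E x y)" if "y \<in> ?Q" for y
  using that by (intro continuous_on_compose2[OF c, of _ "\<lambda>x. (x, y)", simplified]) (auto intro!: continuous_intros)
 have cy: "continuous_on ?Q (\<lambda>y. E x y)" if "x \<in> ?Q" for x
  using that by (intro continuous_on_compose2[OF c, of _ "\<lambda>y. (x, y)", simplified]) (auto intro!: continuous_intros)
 define i where "i x = integral ?Q (\<lambda>y. E x y * cos_kernel M y)" for x
 have ci: "continuous_on ?Q i"
 proof -
  have "continuous_on (?Q \<times> cbox (- real L - 1/2) (real L + 1/2)) (\<lambda>(x, y). E x y * cos_kernel M y)"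
   using c unfolding cell_box_def cbox_interval split_def by (intro continuous_intros) auto
  from integral_continuous_on_param[OF this] show ?thesis
   by (simp add: i_def[abs_def] cell_box_def)
 qed
 have K: "(cos_kernel M) integrable_on ?Q" unfolding cell_box_def by (intro integrable_continuous_real continuous_intros)
 have lK: "integral ?Q (cos_kernel M) = l"
  by (subst integral_cell_box) (auto intro!: continuous_intros simp: l_def integral_unique[OF cos_kernel_integral_cell])
 have inner: "\<bar>i x - (\<Sum>n\<in>?J. E x (of_int n))\<bar> <= l * r" if "x \<in> ?Q" for x
  unfolding i_def l_def r_def
  by (rule cos_kernel_box_approx[OF cy]) (use that B d \<eta>0 \<eta> in auto)
 have outer: "\<bar>integral ?Q (\<lambda>x. E x (of_int n) * cos_kernel M x) - (\<Sum>m\<in>?J. E (of_int m) (of_int n))\<bar> <= l * r"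
  if "n \<in> ?J" for n
  unfolding l_def r_def
  by (rule cos_kernel_box_approx[OF cx]) (use memJ[OF that] B d \<eta>0 \<eta> in auto)
 have "integral ?Q (\<lambda>x. integral ?Q (\<lambda>y. E x y * (cos_kernel M x * cos_kernel M y))) =
   integral ?Q (\<lambda>x. i x * cos_kernel M x)"
  unfolding i_def by (intro arg_cong[where f="integral ?Q"] ext) (simp flip: integral_mult_right add: mult_ac)
 moreover have "\<bar>integral ?Q (\<lambda>x. i x * cos_kernel M x) - integral ?Q (\<lambda>x. (\<Sum>n\<in>?J. E x (of_int n)) * cos_kernel M x)\<bar>
   <= l * (l * r)"
 proof -
  have s: "continuous_on ?Q (\<lambda>x. \<Sum>n\<in>?J. E x (of_int n))"
   by (intro continuous_on_sum cx memJ)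
  have "integral ?Q (\<lambda>x. i x * cos_kernel M x) - integral ?Q (\<lambda>x. (\<Sum>n\<in>?J. E x (of_int n)) * cos_kernel M x)
   = integral ?Q (\<lambda>x. i x * cos_kernel M x - (\<Sum>n\<in>?J. E x (of_int n)) * cos_kernel M x)"
   by (intro integral_diff[symmetric] integrable_cell_box continuous_on_mult ci s continuous_intros)
  also have "norm \<dots> <= integral ?Q (\<lambda>x. (l * r) * cos_kernel M x)"
  proof (rule integral_norm_bound_integral)
   show "(\<lambda>x. i x * cos_kernel M x - (\<Sum>n\<in>?J. E x (of_int n)) * cos_kernel M x) integrable_on ?Q"
    by (intro integrable_cell_box continuous_on_diff continuous_on_mult ci s continuous_intros)
   show "(\<lambda>x. l * r * cos_kernel M x) integrable_on ?Q" using K by (rule integrable_on_mult_right)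
   fix x assume "x \<in> ?Q"
   then show "norm (i x * cos_kernel M x - (\<Sum>n\<in>?J. E x (of_int n)) * cos_kernel M x) <= l * r * cos_kernel M x"
    using mult_right_mono[OF inner cos_kernel_nonneg[of M x]] cos_kernel_nonneg[of M x]
    by (simp add: left_diff_distrib[symmetric] abs_mult)
  qed
  also have "\<dots> = l * (l * r)" using lK by simp
  finally show ?thesis by simp
 qed
 moreover have "integral ?Q (\<lambda>x. (\<Sum>n\<in>?J. E x (of_int n)) * cos_kernel M x) =
   (\<Sum>n\<in>?J. integral ?Q (\<lambda>x. E x (of_int n) * cos_kernel M x))"
  unfolding sum_distrib_right
  by (intro integral_sum integrable_cell_box continuous_on_mult cx memJ continuous_intros) auto
 moreover have "\<bar>(\<Sum>n\<in>?J. integral ?Q (\<lambda>x. E x (of_int n) * cos_kernel M x)) -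
    (\<Sum>n\<in>?J. \<Sum>m\<in>?J. E (of_int m) (of_int n))\<bar> <= l * (l * r)"
 proof -
  have "\<bar>(\<Sum>n\<in>?J. integral ?Q (\<lambda>x. E x (of_int n) * cos_kernel M x)) -
    (\<Sum>n\<in>?J. \<Sum>m\<in>?J. E (of_int m) (of_int n))\<bar> <= (\<Sum>n\<in>?J. l * r)"
   unfolding sum_subtractf[symmetric] by (rule order_trans[OF sum_abs sum_mono]) (rule outer)
  also have "\<dots> = l * (l * r)" by (simp add: l_def)
  finally show ?thesis .
 qed
 moreover have "(\<Sum>n\<in>?J. \<Sum>m\<in>?J. E (of_int m) (of_int n)) = (\<Sum>m\<in>?J. \<Sum>n\<in>?J. E (of_int m) (of_int n))"
  by (rule sum.swap)
 ultimately have "\<bar>integral ?Q (\<lambda>x. integral ?Q (\<lambda>y. E x y * (cos_kernel M x * cos_kernel M y))) -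
   (\<Sum>m\<in>?J. \<Sum>n\<in>?J. E (of_int m) (of_int n))\<bar> <= l * (l * r) + l * (l * r)"
  by linarith
 then show ?thesis by (simp add: l_def r_def power2_eq_square algebra_simps)
qed

text \<open>Only the positivity of the Fourier coefficients of the kernel, their bound by the zeroth one, and
 the concentration of the kernel at the integers enter, so that no convergence of the Fourier
 series is needed.\<close>

theorem poisson_inequality:
 fixes E :: "real => real => real"
 assumes c: "continuous_on (cell_box L \<times> cell_box L) (\<lambda>(x, y). E x y)"
  and bd: "\<And>S :: (int \<times> int) set. finite S ==> (0, 0) \<notin> S ==>
    (\<Sum>(k, l)\<in>S. \<bar>integral (cell_box L) (\<lambda>x. integral (cell_box L)
     (\<lambda>y. E x y * cos (2 * pi * (of_int k * x + of_int l * y))))\<bar>) <= D"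
 shows "\<bar>(\<Sum>m\<in>{- int L..int L}. \<Sum>n\<in>{- int L..int L}. E (of_int m) (of_int n)) -
   integral (cell_box L) (\<lambda>x. integral (cell_box L) (\<lambda>y. E x y))\<bar> <= D"
proof -
 let ?Q = "cell_box L" and ?J = "{- int L..int L}"
 define F where "F k l = integral ?Q (\<lambda>x. integral ?Q
     (\<lambda>y. E x y * cos (2 * pi * (of_int k * x + of_int l * y))))" for k l :: int
 define S0 where "S0 = (\<Sum>m\<in>?J. \<Sum>n\<in>?J. E (of_int m) (of_int n))"
 have cy: "continuous_on ?Q (\<lambda>y. E x y)" if "x \<in> ?Q" for x
  using that by (intro continuous_on_compose2[OF c, of _ "\<lambda>y. (x, y)", simplified]) (auto intro!: continuous_intros)
 have ii: "(\<lambda>x. integral ?Q (\<lambda>y. E x y * g x y)) integrable_on ?Q"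
  if "continuous_on (?Q \<times> ?Q) (\<lambda>(x, y). g x y)" for g :: "real => real => real"
 proof -
  have "continuous_on (?Q \<times> cbox (- real L - 1/2) (real L + 1/2)) (\<lambda>(x, y). E x y * g x y)"
   using c that unfolding cell_box_def cbox_interval split_def by (intro continuous_intros)
  from integral_continuous_on_param[OF this] show ?thesis
   by (auto simp: cell_box_def intro: integrable_continuous_real)
 qed
 have expand: "integral ?Q (\<lambda>x. integral ?Q (\<lambda>y. E x y * (cos_kernel M x * cos_kernel M y))) =
   (\<Sum>i\<le>2*M. \<Sum>j\<le>2*M. kernel_coeff M i * kernel_coeff M j * F (int i - int M) (int j - int M))" for M
 proof -
  have "integral ?Q (\<lambda>y. E x y * (cos_kernel M x * cos_kernel M y)) =
    (\<Sum>i\<le>2*M. \<Sum>j\<le>2*M. kernel_coeff M i * kernel_coeff M j *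
     integral ?Q (\<lambda>y. E x y * cos (2 * pi * (of_int (int i - int M) * x + of_int (int j - int M) * y))))"
   if x: "x \<in> ?Q" for x
  proof -
   have 1: "(\<lambda>y. kernel_coeff M i * kernel_coeff M j *
      (E x y * cos (2 * pi * (of_int (int i - int M) * x + of_int (int j - int M) * y)))) integrable_on ?Q" for i j
    using cy[OF x] unfolding cell_box_def by (intro integrable_continuous_real continuous_intros)
   have "integral ?Q (\<lambda>y. E x y * (cos_kernel M x * cos_kernel M y)) =
    integral ?Q (\<lambda>y. \<Sum>i\<le>2*M. \<Sum>j\<le>2*M. kernel_coeff M i * kernel_coeff M j *
      (E x y * cos (2 * pi * (of_int (int i - int M) * x + of_int (int j - int M) * y))))"
    unfolding cos_kernel_prod by (simp add: sum_distrib_left mult_ac)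
   also have "\<dots> = (\<Sum>i\<le>2*M. \<Sum>j\<le>2*M. integral ?Q (\<lambda>y. kernel_coeff M i * kernel_coeff M j *
      (E x y * cos (2 * pi * (of_int (int i - int M) * x + of_int (int j - int M) * y)))))"
    by (subst integral_sum; (intro finite_atMost integrable_sum 1)?)
     (intro sum.cong refl integral_sum finite_atMost 1)
   finally show ?thesis by simp
  qed
  then have "integral ?Q (\<lambda>x. integral ?Q (\<lambda>y. E x y * (cos_kernel M x * cos_kernel M y))) =
   integral ?Q (\<lambda>x. \<Sum>i\<le>2*M. \<Sum>j\<le>2*M. kernel_coeff M i * kernel_coeff M j *
     integral ?Q (\<lambda>y. E x y * cos (2 * pi * (of_int (int i - int M) * x + of_int (int j - int M) * y))))"
   by (rule integral_cong)
  also have "\<dots> = (\<Sum>i\<le>2*M. \<Sum>j\<le>2*M. kernel_coeff M i * kernel_coeff M j * F (int i - int M) (int j - int M))"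
  proof -
   have 1: "(\<lambda>x. kernel_coeff M i * kernel_coeff M j *
     integral ?Q (\<lambda>y. E x y * cos (2 * pi * (of_int (int i - int M) * x + of_int (int j - int M) * y)))) integrable_on ?Q" for i j
    by (intro integrable_on_mult_right ii) (auto simp: split_def intro!: continuous_intros)
   show ?thesis
    by (subst integral_sum; (intro finite_atMost integrable_sum 1)?)
     (subst integral_sum; (intro finite_atMost 1)?; simp add: F_def)
  qed
  finally show ?thesis .
 qed
 have F00: "F 0 0 = integral ?Q (\<lambda>x. integral ?Q (\<lambda>y. E x y))" by (simp add: F_def)
 \<comment> \<open>The pair \<open>(M, M)\<close> has coefficient one and frequency zero. All other
   coefficients lie between zero and one, so their contribution is at most \<open>D\<close>,
   uniformly in \<open>M\<close>.\<close>
 have near: "\<bar>integral ?Q (\<lambda>x. integral ?Q (\<lambda>y. E x y * (cos_kernel M x * cos_kernel M y))) - F 0 0\<bar> <= D" for M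
 proof -
  define h where "h = (\<lambda>(i, j). (int i - int M, int j - int M))"
  define P where "P = {..2*M} \<times> {..2*M} - {(M, M)}"
  have "(\<Sum>i\<le>2*M. \<Sum>j\<le>2*M. kernel_coeff M i * kernel_coeff M j * F (int i - int M) (int j - int M)) =
   (\<Sum>(i, j)\<in>{..2*M} \<times> {..2*M}. kernel_coeff M i * kernel_coeff M j * F (int i - int M) (int j - int M))"
   by (simp add: sum.cartesian_product)
  also have "\<dots> = F 0 0 + (\<Sum>(i, j)\<in>P. kernel_coeff M i * kernel_coeff M j * F (int i - int M) (int j - int M))"
   unfolding P_def by (subst sum.remove[of _ "(M, M)"]) (auto simp: kernel_coeff_mid)
  finally have "integral ?Q (\<lambda>x. integral ?Q (\<lambda>y. E x y * (cos_kernel M x * cos_kernel M y))) - F 0 0 =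
    (\<Sum>(i, j)\<in>P. kernel_coeff M i * kernel_coeff M j * F (int i - int M) (int j - int M))"
   using expand by simp
  also have "\<bar>\<dots>\<bar> <= (\<Sum>(i, j)\<in>P. \<bar>F (int i - int M) (int j - int M)\<bar>)"
  proof (rule order_trans[OF sum_abs sum_mono], clarify)
   fix i j
   have "\<bar>kernel_coeff M i * kernel_coeff M j\<bar> <= 1"
    using kernel_coeff_bounds by (simp add: abs_mult mult_le_one)
   then show "\<bar>kernel_coeff M i * kernel_coeff M j * F (int i - int M) (int j - int M)\<bar> <= \<bar>F (int i - int M) (int j - int M)\<bar>"
    using mult_right_mono[of "\<bar>kernel_coeff M i * kernel_coeff M j\<bar>" 1] by (simp add: abs_mult)
  qed
  also have "\<dots> = (\<Sum>(k, l)\<in>h ` P. \<bar>F k l\<bar>)"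
   by (subst sum.reindex) (auto simp: inj_on_def h_def intro!: sum.cong)
  also have "\<dots> <= D"
   unfolding F_def by (rule bd) (auto simp: P_def h_def)
  finally show ?thesis .
 qed
 have "\<bar>S0 - F 0 0\<bar> <= D + eps" if eps: "0 < eps" for eps :: real
 proof -
  define a where "a = 2 * (2 * real L + 1)\<^sup>2"
  have a: "0 < a" by (simp add: a_def zero_less_power2)
  define \<eta> where "\<eta> = eps / (2 * a)"
  have \<eta>: "0 < \<eta>" using a eps by (simp add: \<eta>_def)
  have cpt: "compact (?Q \<times> ?Q)" unfolding cell_box_def by (intro compact_Times) auto
  have "bounded ((\<lambda>(x, y). E x y) ` (?Q \<times> ?Q))"
   by (intro compact_imp_bounded compact_continuous_image c cpt)
  then obtain B where B: "\<And>x y. x \<in> ?Q ==> y \<in> ?Q ==> \<bar>E x y\<bar> <= B"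
   unfolding bounded_iff by fastforce
  have B0: "0 <= B" using B[of 0 0] by (auto simp: cell_box_def intro: order_trans[OF abs_ge_zero])
  have "uniformly_continuous_on (?Q \<times> ?Q) (\<lambda>(x, y). E x y)"
   by (rule compact_uniformly_continuous[OF c cpt])
  then obtain d where d: "0 < d" and du: "\<And>p p'. p \<in> ?Q \<times> ?Q ==> p' \<in> ?Q \<times> ?Q ==> dist p' p < d ==>
    dist (case p' of (x, y) => E x y) (case p of (x, y) => E x y) < \<eta>"
   unfolding uniformly_continuous_on_def using \<eta> by meson
  \<comment> \<open>\<open>d / 3\<close> keeps the sum of two coordinate differences below
    \<open>d\<close>, and \<open>1 / 4\<close> keeps \<open>\<delta>\<close> below half a cell, as
    the convergence of \<open>kernel_tail\<close> requires.\<close>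
  define \<delta> where "\<delta> = min (d / 3) (1 / 4)"
  have \<delta>: "0 < \<delta>" "\<delta> < 1/2" using d by (auto simp: \<delta>_def)
  have osc: "\<bar>E x y - E x' y'\<bar> <= \<eta>"
   if "x \<in> ?Q" "y \<in> ?Q" "x' \<in> ?Q" "y' \<in> ?Q" "\<bar>x - x'\<bar> <= \<delta>" "\<bar>y - y'\<bar> <= \<delta>" for x y x' y'
  proof -
   have "dist (x, y) (x', y') <= \<bar>x - x'\<bar> + \<bar>y - y'\<bar>"
    using sqrt_sum_squares_le_sum_abs[of "x - x'" "y - y'"] by (simp add: dist_Pair_Pair dist_real_def)
   also have "\<dots> < d" using that d by (auto simp: \<delta>_def)
   finally show ?thesis using du[of "(x', y')" "(x, y)"] that by (simp add: dist_real_def)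
  qed
  have "(\<lambda>M. a * (\<eta> + 2 * B * kernel_tail \<delta> M)) \<longlonglongrightarrow> a * (\<eta> + 2 * B * 0)"
   by (intro tendsto_intros kernel_tail_tendsto \<delta>)
  moreover have "a * (\<eta> + 2 * B * 0) < eps" using a eps by (simp add: \<eta>_def)
  ultimately have "\<forall>\<^sub>F M in sequentially. a * (\<eta> + 2 * B * kernel_tail \<delta> M) < eps"
   by (rule order_tendstoD)
  then obtain M where M: "a * (\<eta> + 2 * B * kernel_tail \<delta> M) < eps"
   using eventually_happens'[OF sequentially_bot] by blast
  have "\<bar>integral ?Q (\<lambda>x. integral ?Q (\<lambda>y. E x y * (cos_kernel M x * cos_kernel M y))) - S0\<bar>
    <= a * (\<eta> + 2 * B * kernel_tail \<delta> M)"
   unfolding S0_def a_def by (rule cos_kernel_box2_approx[OF c B \<delta>(1) _ osc]) (use \<eta> in auto)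
  with near[of M] M show ?thesis by linarith
 qed
 then show ?thesis using field_le_epsilon F00 unfolding S0_def by metis
qed

section \<open>Van der Corput estimates\<close>

lemma cis_has_vector_derivative:
 assumes "(F has_real_derivative F') (at t within S)"
 shows "((\<lambda>t. cis (F t)) has_vector_derivative (\<i> * of_real F' * cis (F t))) (at t within S)"
 using has_derivative_cis[OF assms[unfolded has_field_derivative_def]]
 by (simp add: has_vector_derivative_def scaleR_conv_of_real mult_ac)

lemma real_mvt_within:
 fixes f f' :: "real => real"
 assumes "a <= x" "x <= y" "y <= b"
  and d: "\<And>t. t \<in> {a..b} ==> (f has_real_derivative f' t) (at t within {a..b})"
 obtains z where "z \<in> {x..y}" "f y - f x = (y - x) * f' z"
proof (cases "x = y")
 case True
 then show ?thesis using that[of x] by simp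
next
 case False
 then have "x < y" using assms by simp
 moreover have "(f has_derivative (\<lambda>h. h * f' t)) (at t within {x..y})" if "x <= t" "t <= y" for t
  using has_field_derivative_subset[OF d[of t], of "{x..y}"] that assms(1-3)
  by (auto simp: has_field_derivative_def mult_commute_abs)
 ultimately obtain z where "z \<in> {x<..<y}" "f y - f x = (y - x) * f' z"
  using mvt_simple[of x y f "\<lambda>t h. h * f' t"] by auto
 then show ?thesis using that[of z] by auto
qed

text \<open>The integrand is \<open>B / (\<i> * \<Lambda> * p)\<close> times the derivative of
  \<open>cis F\<close>: the factor \<open>G\<close>, common to the amplitude and the phase
  derivative, cancels, and only \<open>B\<close> and \<open>p\<close> are differentiated.\<close>

lemma oscillatory_integral_by_parts:
 fixes B B' G p p' F :: "real => real"
 assumes lam: "0 < \<Lambda>" and \<delta>: "0 < \<delta>" and ab: "a <= b"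
  and F: "\<And>t. t \<in> {a..b} ==> (F has_real_derivative \<Lambda> * p t * G t) (at t within {a..b})"
  and B: "\<And>t. t \<in> {a..b} ==> (B has_real_derivative B' t) (at t within {a..b})"
  and p: "\<And>t. t \<in> {a..b} ==> (p has_real_derivative p' t) (at t within {a..b})"
  and cont: "continuous_on {a..b} G" "continuous_on {a..b} B'" "continuous_on {a..b} p'"
  and K: "\<And>t. t \<in> {a..b} ==> \<bar>B t\<bar> <= K" "\<And>t. t \<in> {a..b} ==> \<bar>B' t\<bar> <= K"
  and pd: "\<And>t. t \<in> {a..b} ==> \<delta> <= \<bar>p t\<bar>"
  and V: "integral {a..b} (\<lambda>t. \<bar>p' t\<bar> / (p t)\<^sup>2) <= V"
 shows "norm (integral {a..b} (\<lambda>t. of_real (B t * G t) * cis (F t))) <= (2 * K / \<delta> + K * (b - a) / \<delta> + K * V) / \<Lambda>"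
proof -
 have p0: "p t \<noteq> 0" if "t \<in> {a..b}" for t using pd[OF that] \<delta> by auto
 have cF: "continuous_on {a..b} F" and cB: "continuous_on {a..b} B" and cp: "continuous_on {a..b} p"
  by (rule DERIV_continuous_on[OF F] DERIV_continuous_on[OF B] DERIV_continuous_on[OF p], assumption)+
 have K0: "0 <= K" using K(1)[of a] ab by (auto intro: order_trans[OF abs_ge_zero])
 have ccis: "continuous_on {a..b} (\<lambda>t. cis (F t))"
  by (intro continuous_on_cis cF)
 define H where "H t = of_real (B t / (\<Lambda> * p t)) * (- \<i>) * cis (F t)" for t
 define R where "R t = of_real ((B' t * p t - B t * p' t) / (\<Lambda> * (p t)\<^sup>2)) * (- \<i>) * cis (F t)" for t
 have dH: "(H has_vector_derivative (R t + of_real (B t * G t) * cis (F t))) (at t within {a..b})" if t: "t \<in> {a..b}" for t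
 proof -
  have "((\<lambda>t. B t / (\<Lambda> * p t)) has_real_derivative (B' t * p t - B t * p' t) / (\<Lambda> * (p t)\<^sup>2)) (at t within {a..b})"
   using p0[OF t] lam
   by (auto intro!: derivative_eq_intros B[OF t] p[OF t] simp: field_simps power2_eq_square)
  then have "((\<lambda>t. complex_of_real (B t / (\<Lambda> * p t))) has_vector_derivative
    of_real ((B' t * p t - B t * p' t) / (\<Lambda> * (p t)\<^sup>2))) (at t within {a..b})"
   by (intro has_vector_derivative_of_real) (simp add: has_real_derivative_iff_has_vector_derivative)
  from has_vector_derivative_mult[OF has_vector_derivative_mult[OF this has_vector_derivative_const[of "- \<i>"]]
    cis_has_vector_derivative[OF F[OF t]]]
  show ?thesis unfolding H_def[abs_def] R_def
   using p0[OF t] lam by (simp add: field_simps)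
 qed
 have "((\<lambda>t. R t + of_real (B t * G t) * cis (F t)) has_integral (H b - H a)) {a..b}"
  by (rule fundamental_theorem_of_calculus[OF ab dH])
 moreover have cR: "continuous_on {a..b} R"
  unfolding R_def using p0 lam by (intro continuous_intros cont ccis cB cp) auto
 then have iR: "R integrable_on {a..b}" by (rule integrable_continuous_real)
 ultimately have "((\<lambda>t. (R t + of_real (B t * G t) * cis (F t)) - R t) has_integral (H b - H a - integral {a..b} R)) {a..b}"
  by (intro has_integral_diff) auto
 then have eq: "integral {a..b} (\<lambda>t. of_real (B t * G t) * cis (F t)) = H b - H a - integral {a..b} R"
  by (simp add: integral_unique)
 have nH: "norm (H t) <= K / \<delta> / \<Lambda>" if t: "t \<in> {a..b}" for t
 proof -
  have "norm (H t) = \<bar>B t\<bar> / \<bar>p t\<bar> / \<Lambda>" using lam by (simp add: H_def norm_mult norm_divide abs_mult)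
  also have "\<dots> <= K / \<delta> / \<Lambda>"
   using K(1)[OF t] pd[OF t] \<delta> lam K0 by (intro divide_right_mono frac_le) auto
  finally show ?thesis .
 qed
 have cq: "continuous_on {a..b} (\<lambda>t. \<bar>p' t\<bar> / (p t)\<^sup>2)"
  using p0 by (intro continuous_intros cont cp) auto
 have "norm (integral {a..b} R) <= integral {a..b} (\<lambda>t. K / \<delta> / \<Lambda> + K / \<Lambda> * (\<bar>p' t\<bar> / (p t)\<^sup>2))"
 proof (rule integral_norm_bound_integral[OF iR])
  show "(\<lambda>t. K / \<delta> / \<Lambda> + K / \<Lambda> * (\<bar>p' t\<bar> / (p t)\<^sup>2)) integrable_on {a..b}"
   by (intro integrable_continuous_real continuous_intros cq)
  fix t assume t: "t \<in> {a..b}"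
  have q: "0 < \<Lambda> * (p t)\<^sup>2" using lam p0[OF t] by simp
  have "norm (R t) = \<bar>(B' t * p t - B t * p' t) / (\<Lambda> * (p t)\<^sup>2)\<bar>"
   by (simp only: R_def norm_mult norm_of_real norm_minus_cancel norm_ii norm_cis mult_1_right)
  also have "\<dots> = \<bar>B' t * p t - B t * p' t\<bar> / (\<Lambda> * (p t)\<^sup>2)"
   using q by (simp only: abs_divide abs_of_pos)
  also have "\<dots> <= (\<bar>B' t\<bar> * \<bar>p t\<bar> + \<bar>B t\<bar> * \<bar>p' t\<bar>) / (\<Lambda> * (p t)\<^sup>2)"
   using lam by (intro divide_right_mono) (auto simp flip: abs_mult)
  also have "\<dots> = \<bar>B' t\<bar> / \<bar>p t\<bar> / \<Lambda> + \<bar>B t\<bar> / \<Lambda> * (\<bar>p' t\<bar> / (p t)\<^sup>2)"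
  proof -
   have "(A * r + C * P) / (\<Lambda> * r\<^sup>2) = A / r / \<Lambda> + C / \<Lambda> * (P / r\<^sup>2)" if "0 < r" for A C P r :: real
    using that lam by (simp add: add_divide_distrib power2_eq_square)
   from this[of "\<bar>p t\<bar>"] show ?thesis using p0[OF t] by simp
  qed
  also have "\<dots> <= K / \<delta> / \<Lambda> + K / \<Lambda> * (\<bar>p' t\<bar> / (p t)\<^sup>2)"
   using K(1)[OF t] K(2)[OF t] pd[OF t] \<delta> lam K0
   by (intro add_mono divide_right_mono frac_le mult_right_mono) auto
  finally show "norm (R t) <= K / \<delta> / \<Lambda> + K / \<Lambda> * (\<bar>p' t\<bar> / (p t)\<^sup>2)" .
 qed
 also have "\<dots> = K / \<delta> / \<Lambda> * (b - a) + K / \<Lambda> * integral {a..b} (\<lambda>t. \<bar>p' t\<bar> / (p t)\<^sup>2)"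
  using ab by (subst integral_add[OF integrable_const_ivl integrable_on_mult_right[OF integrable_continuous_real[OF cq]]])
   (simp only: integral_mult_right integral_const_real content_real real_scaleR_def mult.commute)
 also have "\<dots> <= K / \<delta> / \<Lambda> * (b - a) + K / \<Lambda> * V"
  using V K0 lam by (intro add_left_mono mult_left_mono) auto
 finally have nR: "norm (integral {a..b} R) <= K / \<delta> / \<Lambda> * (b - a) + K / \<Lambda> * V" .
 have "norm (H b - H a - integral {a..b} R) <= norm (H b) + norm (H a) + norm (integral {a..b} R)"
  by (meson add_mono norm_triangle_ineq4 order_refl order_trans)
 also have "\<dots> <= K / \<delta> / \<Lambda> + K / \<delta> / \<Lambda> + (K / \<delta> / \<Lambda> * (b - a) + K / \<Lambda> * V)"
  using nH[of a] nH[of b] nR ab by (intro add_mono) auto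
 also have "\<dots> = (2 * K / \<delta> + K * (b - a) / \<delta> + K * V) / \<Lambda>"
  by (simp add: add_divide_distrib)
 finally show ?thesis using eq by simp
qed

text \<open>By monotonicity \<open>\<bar>p'\<bar> / p\<^sup>2\<close> is the derivative of
  \<open>- (s / p)\<close>, so the integral is a difference of two boundary values of size at most
  \<open>1 / \<delta>\<close>.\<close>

lemma mono_phase_total_variation:
 fixes p p' :: "real => real"
 assumes \<delta>: "0 < \<delta>" and ab: "a <= b"
  and p: "\<And>t. t \<in> {a..b} ==> (p has_real_derivative p' t) (at t within {a..b})"
  and s: "\<bar>s\<bar> = 1" "\<And>t. t \<in> {a..b} ==> 0 <= s * p' t"
  and pd: "\<And>t. t \<in> {a..b} ==> \<delta> <= \<bar>p t\<bar>"
 shows "integral {a..b} (\<lambda>t. \<bar>p' t\<bar> / (p t)\<^sup>2) <= 2 / \<delta>"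
proof -
 have p0: "p t \<noteq> 0" if "t \<in> {a..b}" for t using pd[OF that] \<delta> by auto
 have "((\<lambda>t. - (s / p t)) has_real_derivative \<bar>p' t\<bar> / (p t)\<^sup>2) (at t within {a..b})" if t: "t \<in> {a..b}" for t
 proof -
  have "\<bar>p' t\<bar> = s * p' t" using s(1) s(2)[OF t] by (metis abs_mult abs_of_nonneg mult_1)
  then show ?thesis
   using p0[OF t] by (auto intro!: derivative_eq_intros p[OF t] simp: power2_eq_square)
 qed
 then have "((\<lambda>t. \<bar>p' t\<bar> / (p t)\<^sup>2) has_integral (- (s / p b) - - (s / p a))) {a..b}"
  by (intro fundamental_theorem_of_calculus[OF ab]) (simp add: has_real_derivative_iff_has_vector_derivative)
 then have "integral {a..b} (\<lambda>t. \<bar>p' t\<bar> / (p t)\<^sup>2) = s / p a - s / p b"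
  by (simp add: integral_unique)
 also have "\<dots> <= \<bar>s / p a\<bar> + \<bar>s / p b\<bar>" by linarith
 also have "\<dots> <= 1 / \<delta> + 1 / \<delta>"
  using pd[of a] pd[of b] ab \<delta> s(1) by (intro add_mono) (auto simp: abs_divide intro!: divide_left_mono)
 finally show ?thesis by simp
qed

text \<open>For monotone \<open>p\<close> the set where \<open>\<bar>p\<bar> <= \<delta>\<close> is
  an interval, found by two uses of the intermediate value theorem. The disjunctions allow each of
  the three pieces to degenerate to a point.\<close>

lemma mono_phase_split_inc:
 fixes p :: "real => real"
 assumes ab: "a <= b" and c: "continuous_on {a..b} p" and m: "mono_on {a..b} p" and \<delta>: "0 < \<delta>"
 obtains a1 b1 where "a <= a1" "a1 <= b1" "b1 <= b"
  "a1 = a \<or> (\<forall>t\<in>{a..a1}. \<delta> <= \<bar>p t\<bar>)" "b1 = b \<or> (\<forall>t\<in>{b1..b}. \<delta> <= \<bar>p t\<bar>)"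
  "a1 = b1 \<or> (\<forall>t\<in>{a1..b1}. \<bar>p t\<bar> <= \<delta>)"
proof -
 have M: "p x <= p y" if "a <= x" "x <= y" "y <= b" for x y
  using mono_onD[OF m] that by auto
 obtain a1 where a1: "a <= a1" "a1 <= b" "a1 = a \<or> p a1 <= - \<delta>" "a1 = b \<or> - \<delta> <= p a1"
 proof (cases "- \<delta> <= p a \<or> p b <= - \<delta>")
  case True
  then show ?thesis using that[of a] that[of b] ab by auto
 next
  case False
  then obtain x where "a <= x" "x <= b" "p x = - \<delta>"
   using IVT'[of p a "- \<delta>" b] ab c by auto
  then show ?thesis using that[of x] by auto
 qed
 obtain b1 where b1: "a1 <= b1" "b1 <= b" "b1 = b \<or> \<delta> <= p b1" "b1 = a1 \<or> p b1 <= \<delta>"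
 proof (cases "p b <= \<delta> \<or> \<delta> <= p a1")
  case True
  then show ?thesis using that[of a1] that[of b] a1 by auto
 next
  case False
  have "continuous_on {a1..b} p" using c a1 by (auto intro: continuous_on_subset)
  then obtain x where "a1 <= x" "x <= b" "p x = \<delta>"
   using IVT'[of p a1 \<delta> b] a1 False by auto
  then show ?thesis using that[of x] by auto
 qed
 show ?thesis
 proof (rule that[OF a1(1) b1(1,2)])
  show "a1 = a \<or> (\<forall>t\<in>{a..a1}. \<delta> <= \<bar>p t\<bar>)"
  proof (cases "a1 = a")
   case False
   then have "p t <= - \<delta>" if "t \<in> {a..a1}" for t using M[of t a1] a1 that by auto
   then show ?thesis by (force simp: abs_if)
  qed simp
  show "b1 = b \<or> (\<forall>t\<in>{b1..b}. \<delta> <= \<bar>p t\<bar>)"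
  proof (cases "b1 = b")
   case False
   then have "\<delta> <= p t" if "t \<in> {b1..b}" for t using M[of b1 t] a1 b1 that by auto
   then show ?thesis by (force simp: abs_if)
  qed simp
  show "a1 = b1 \<or> (\<forall>t\<in>{a1..b1}. \<bar>p t\<bar> <= \<delta>)"
  proof (cases "a1 = b1")
   case False
   then have "- \<delta> <= p a1" "p b1 <= \<delta>" using a1 b1 by auto
   then have "p t <= \<delta> \<and> - \<delta> <= p t" if "t \<in> {a1..b1}" for t
    using M[of t b1] M[of a1 t] a1 b1 that by auto
   then show ?thesis by (force simp: abs_le_iff)
  qed simp
 qed
qed

lemma mono_phase_split:
 fixes p p' :: "real => real"
 assumes ab: "a <= b" and \<delta>: "0 < \<delta>"
  and p: "\<And>t. t \<in> {a..b} ==> (p has_real_derivative p' t) (at t within {a..b})"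
  and s: "\<bar>s\<bar> = 1" "\<And>t. t \<in> {a..b} ==> 0 <= s * p' t"
 obtains a1 b1 where "a <= a1" "a1 <= b1" "b1 <= b"
  "a1 = a \<or> (\<forall>t\<in>{a..a1}. \<delta> <= \<bar>p t\<bar>)" "b1 = b \<or> (\<forall>t\<in>{b1..b}. \<delta> <= \<bar>p t\<bar>)"
  "a1 = b1 \<or> (\<forall>t\<in>{a1..b1}. \<bar>p t\<bar> <= \<delta>)"
proof -
 have c: "continuous_on {a..b} p" by (rule DERIV_continuous_on[OF p])
 have "s * p x <= s * p y" if "x \<in> {a..b}" "y \<in> {a..b}" "x <= y" for x y
 proof -
  have xy: "a <= x" "x <= y" "y <= b" using that by auto
  obtain z where z: "z \<in> {x..y}" "p y - p x = (y - x) * p' z"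
   using real_mvt_within[OF xy p] by blast
  have "s * p y - s * p x = s * (p y - p x)" by (rule right_diff_distrib[symmetric])
  then have "s * p y - s * p x = (y - x) * (s * p' z)" by (simp add: z(2))
  moreover have "0 <= (y - x) * (s * p' z)" using s(2)[of z] z that by auto
  ultimately show ?thesis by simp
 qed
 then have "mono_on {a..b} (\<lambda>t. s * p t)" by (intro mono_onI) auto
 moreover have "continuous_on {a..b} (\<lambda>t. s * p t)" by (intro continuous_intros c)
 ultimately obtain a1 b1 where "a <= a1" "a1 <= b1" "b1 <= b"
  "a1 = a \<or> (\<forall>t\<in>{a..a1}. \<delta> <= \<bar>s * p t\<bar>)" "b1 = b \<or> (\<forall>t\<in>{b1..b}. \<delta> <= \<bar>s * p t\<bar>)"
  "a1 = b1 \<or> (\<forall>t\<in>{a1..b1}. \<bar>s * p t\<bar> <= \<delta>)"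
  using mono_phase_split_inc[OF ab _ _ \<delta>] by metis
 then show ?thesis using that[of a1 b1] s(1) by (simp add: abs_mult)
qed

text \<open>The data of an oscillatory integral over \<open>{a..b}\<close> with phase derivative \<open>\<Lambda> * p * G\<close> and
 amplitude \<open>B * G\<close>, where \<open>p\<close> is monotone.\<close>

locale monotone_phase =
 fixes a b \<Lambda> K K' s :: real and B B' G p p' F :: "real => real"
 assumes ab: "a <= b" "b - a <= 1" and lam: "0 < \<Lambda>"
  and F: "\<And>t. t \<in> {a..b} ==> (F has_real_derivative \<Lambda> * p t * G t) (at t within {a..b})"
  and B: "\<And>t. t \<in> {a..b} ==> (B has_real_derivative B' t) (at t within {a..b})"
  and p: "\<And>t. t \<in> {a..b} ==> (p has_real_derivative p' t) (at t within {a..b})"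
  and cont: "continuous_on {a..b} G" "continuous_on {a..b} B'" "continuous_on {a..b} p'"
  and K: "\<And>t. t \<in> {a..b} ==> \<bar>B t\<bar> <= K" "\<And>t. t \<in> {a..b} ==> \<bar>B' t\<bar> <= K"
  and K': "\<And>t. t \<in> {a..b} ==> \<bar>B t * G t\<bar> <= K'"
  and s: "\<bar>s\<bar> = 1" "\<And>t. t \<in> {a..b} ==> 0 <= s * p' t"
begin

abbreviation "integrand \<equiv> (\<lambda>t. complex_of_real (B t * G t) * cis (F t))"

lemma K_nonneg: "0 <= K" "0 <= K'"
 using K(1)[of a] K'[of a] ab by (auto intro: order_trans[OF abs_ge_zero])

lemma cont_integrand: "continuous_on {a..b} integrand"
proof -
 have "continuous_on {a..b} F" "continuous_on {a..b} B" by (rule DERIV_continuous_on[OF F] DERIV_continuous_on[OF B], assumption)+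
 then show ?thesis by (intro continuous_intros continuous_on_cis cont)
qed

lemma trivial_bound:
 assumes "a <= x" "x <= y" "y <= b"
 shows "norm (integral {x..y} integrand) <= K' * (y - x)"
proof (rule integral_bound[OF assms(2)])
 show "continuous_on {x..y} integrand" using assms by (intro continuous_on_subset[OF cont_integrand]) auto
 fix t assume "t \<in> {x..y}"
 then show "norm (integrand t) <= K'" using K'[of t] assms by (simp add: norm_mult flip: abs_mult)
qed

text \<open>The factor five consists of two boundary terms, one term for \<open>B'\<close> on an
  interval of length at most one, and two for the variation of \<open>1 / p\<close>.\<close>

lemma nonstationary_bound:
 assumes xy: "a <= x" "x <= y" "y <= b" and \<delta>: "0 < \<delta>" and pd: "\<And>t. t \<in> {x..y} ==> \<delta> <= \<bar>p t\<bar>"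
 shows "norm (integral {x..y} integrand) <= 5 * K / (\<Lambda> * \<delta>)"
proof -
 have sub: "{x..y} \<subseteq> {a..b}" using xy by auto
 have d: "(f has_real_derivative f') (at t within {x..y})"
  if "(f has_real_derivative f') (at t within {a..b})" for f f' t
  using has_field_derivative_subset[OF that sub] .
 have V: "integral {x..y} (\<lambda>t. \<bar>p' t\<bar> / (p t)\<^sup>2) <= 2 / \<delta>"
  by (rule mono_phase_total_variation[OF \<delta> xy(2) _ s(1) _ pd]) (use sub d p s in blast)+
 have "norm (integral {x..y} integrand) <= (2 * K / \<delta> + K * (y - x) / \<delta> + K * (2 / \<delta>)) / \<Lambda>"
 proof (rule oscillatory_integral_by_parts[where p = p and p' = p' and B' = B', OF lam \<delta> xy(2) _ _ _ _ _ _ _ _ pd V])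
  fix t assume "t \<in> {x..y}"
  then have t: "t \<in> {a..b}" using sub by blast
  show "(F has_real_derivative \<Lambda> * p t * G t) (at t within {x..y})"
   "(B has_real_derivative B' t) (at t within {x..y})" "(p has_real_derivative p' t) (at t within {x..y})"
   using d F[OF t] B[OF t] p[OF t] by blast+
  show "\<bar>B t\<bar> <= K" "\<bar>B' t\<bar> <= K" using K t by blast+
 qed (rule continuous_on_subset[OF _ sub], rule cont)+
 also have "\<dots> <= (2 * K / \<delta> + K * 1 / \<delta> + K * (2 / \<delta>)) / \<Lambda>"
  using ab xy lam \<delta> K_nonneg by (intro divide_right_mono add_mono mult_left_mono) auto
 also have "\<dots> = 5 * K / (\<Lambda> * \<delta>)" using lam \<delta> by (simp add: field_simps)
 finally show ?thesis .
qed

text \<open>Van der Corput's argument: the trivial bound on the middle interval, of length at most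
  \<open>l\<close>, and integration by parts on the two outer ones. The level
  \<open>\<delta>\<close> stays free, to balance the two contributions.\<close>

lemma split_bound:
 assumes \<delta>: "0 < \<delta>" and l0: "0 <= l"
  and l: "\<And>x y. a <= x ==> x <= y ==> y <= b ==> (\<And>t. t \<in> {x..y} ==> \<bar>p t\<bar> <= \<delta>) ==> y - x <= l"
 shows "norm (integral {a..b} integrand) <= K' * l + 10 * K / (\<Lambda> * \<delta>)"
proof -
 obtain x y where xy: "a <= x" "x <= y" "y <= b"
  and 1: "x = a \<or> (\<forall>t\<in>{a..x}. \<delta> <= \<bar>p t\<bar>)" and 2: "y = b \<or> (\<forall>t\<in>{y..b}. \<delta> <= \<bar>p t\<bar>)"
  and 3: "x = y \<or> (\<forall>t\<in>{x..y}. \<bar>p t\<bar> <= \<delta>)"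
  using mono_phase_split[OF ab(1) \<delta> p s] by blast
 have int: "integrand integrable_on {u..v}" if "a <= u" "v <= b" for u v
  by (intro integrable_continuous_real continuous_on_subset[OF cont_integrand]) (use that in auto)
 have "integral {a..b} integrand = integral {a..x} integrand + integral {x..b} integrand"
  by (rule Henstock_Kurzweil_Integration.integral_combine[symmetric]) (use xy int in auto)
 also have "integral {x..b} integrand = integral {x..y} integrand + integral {y..b} integrand"
  by (rule Henstock_Kurzweil_Integration.integral_combine[symmetric]) (use xy int in auto)
 finally have eq: "integral {a..b} integrand = integral {a..x} integrand + (integral {x..y} integrand + integral {y..b} integrand)" .
 have "norm (integral {a..b} integrand) <=
   norm (integral {a..x} integrand) + (norm (integral {x..y} integrand) + norm (integral {y..b} integrand))"
  unfolding eq by (intro norm_triangle_le add_left_mono norm_triangle_ineq)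
 moreover have pos: "0 <= 5 * K / (\<Lambda> * \<delta>)" using K_nonneg lam \<delta> by simp
 have "norm (integral {a..x} integrand) <= 5 * K / (\<Lambda> * \<delta>)"
 proof (cases "x = a")
  case True then show ?thesis using pos by simp
 next
  case False then show ?thesis using 1 xy by (intro nonstationary_bound \<delta>) auto
 qed
 moreover have "norm (integral {y..b} integrand) <= 5 * K / (\<Lambda> * \<delta>)"
 proof (cases "y = b")
  case True then show ?thesis using pos by simp
 next
  case False then show ?thesis using 2 xy by (intro nonstationary_bound \<delta>) auto
 qed
 moreover have "norm (integral {x..y} integrand) <= K' * l"
 proof (cases "x = y")
  case True then show ?thesis using l0 K_nonneg by simp
 next
  case False
  then have "y - x <= l" using l xy 3 by blast
  then show ?thesis using trivial_bound[OF xy] K_nonneg by (meson mult_left_mono order_trans)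
 qed
 ultimately show ?thesis by simp
qed

lemma mvt_bound:
 assumes xy: "a <= x" "x <= y" "y <= b" and d: "\<And>t. t \<in> {x..y} ==> d <= \<bar>p' t\<bar>"
 shows "d * (y - x) <= \<bar>p y - p x\<bar>"
proof -
 obtain z where z: "z \<in> {x..y}" "p y - p x = (y - x) * p' z"
  using real_mvt_within[OF xy p] by blast
 then have "\<bar>p y - p x\<bar> = \<bar>p' z\<bar> * (y - x)" using xy by (simp add: abs_mult)
 then show ?thesis using mult_right_mono[OF d[OF z(1)], of "y - x"] xy by simp
qed

text \<open>If \<open>\<bar>p\<bar> <= \<delta>\<close> on an interval of length
  \<open>4 * r\<close>, a quarter of it keeps the distance \<open>r\<close> from \<open>t0\<close>.
  The mean value theorem there gives \<open>m * r powr (\<beta> + 1) <= 2 * \<delta>\<close>,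
  wherever \<open>t0\<close> lies.\<close>

lemma power_type_bound:
 assumes m: "0 < m" and \<beta>: "0 <= \<beta>"
  and low: "\<And>t. t \<in> {a..b} ==> m * \<bar>t - t0\<bar> powr \<beta> <= \<bar>p' t\<bar>"
 shows "norm (integral {a..b} integrand) <= (4 * K' * (2 / m) powr (1 / (\<beta> + 1)) + 10 * K) * \<Lambda> powr - (1 / (\<beta> + 2))"
proof -
 \<comment> \<open>At this level the length of the middle interval, of order
   \<open>\<delta> powr (1 / (\<beta> + 1))\<close>, and \<open>1 / (\<Lambda> * \<delta>)\<close>
   are both of order \<open>\<Lambda> powr - (1 / (\<beta> + 2))\<close>.\<close>
 define \<delta> where "\<delta> = \<Lambda> powr - ((\<beta> + 1) / (\<beta> + 2))"
 have \<delta>: "0 < \<delta>" using lam by (simp add: \<delta>_def)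
 define l where "l = 4 * (2 / m) powr (1 / (\<beta> + 1)) * \<Lambda> powr - (1 / (\<beta> + 2))"
 have "norm (integral {a..b} integrand) <= K' * l + 10 * K / (\<Lambda> * \<delta>)"
 proof (rule split_bound[OF \<delta>])
  show "0 <= l" by (simp add: l_def)
  fix x y assume xy: "a <= x" "x <= y" "y <= b" and small: "\<And>t. t \<in> {x..y} ==> \<bar>p t\<bar> <= \<delta>"
  define r where "r = (y - x) / 4"
  have r0: "0 <= r" using xy by (simp add: r_def)
  have y: "y = x + 4 * r" unfolding r_def by (simp add: field_simps)
  obtain u where u: "x <= u" "u + r <= y" and far: "\<And>t. t \<in> {u..u + r} ==> r <= \<bar>t - t0\<bar>"
  proof (cases "t0 <= x + 2 * r")
   case True
   then show ?thesis using y r0 by (intro that[of "x + 3 * r"]) auto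
  next
   case False
   then show ?thesis using y r0 by (intro that[of x]) auto
  qed
  have "m * r powr \<beta> * (u + r - u) <= \<bar>p (u + r) - p u\<bar>"
  proof (rule mvt_bound)
   fix t assume t: "t \<in> {u..u + r}"
   have "m * r powr \<beta> <= m * \<bar>t - t0\<bar> powr \<beta>"
    using m \<beta> r0 far[OF t] by (intro mult_left_mono powr_mono2) auto
   also have "\<dots> <= \<bar>p' t\<bar>" using t u xy by (intro low) auto
   finally show "m * r powr \<beta> <= \<bar>p' t\<bar>" .
  qed (use u xy r0 in auto)
  also have "\<dots> <= 2 * \<delta>" using small[of "u + r"] small[of u] u r0 by auto
  finally have *: "m * (r powr \<beta> * r) <= 2 * \<delta>" by simp
  have "r <= (2 / m * \<delta>) powr (1 / (\<beta> + 1))"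
  proof (cases "r = 0")
   case False
   then have "r powr (\<beta> + 1) <= 2 / m * \<delta>"
    using * m r0 by (simp add: powr_add field_simps)
   then have "(r powr (\<beta> + 1)) powr (1 / (\<beta> + 1)) <= (2 / m * \<delta>) powr (1 / (\<beta> + 1))"
    using \<beta> by (intro powr_mono2) auto
   then show ?thesis using r0 \<beta> by (simp add: powr_powr)
  qed simp
  also have "\<dots> = (2 / m) powr (1 / (\<beta> + 1)) * \<Lambda> powr - (1 / (\<beta> + 2))"
   using m lam \<beta> by (subst powr_mult) (auto simp: \<delta>_def powr_powr)
  finally show "y - x <= l" by (simp add: r_def l_def)
 qed
 also have "10 * K / (\<Lambda> * \<delta>) = 10 * K * \<Lambda> powr - (1 / (\<beta> + 2))"
 proof -
  have "\<Lambda> * \<delta> = \<Lambda> powr (1 + - ((\<beta> + 1) / (\<beta> + 2)))" using lam by (simp only: \<delta>_def powr_add powr_one)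
  also have "1 + - ((\<beta> + 1) / (\<beta> + 2)) = 1 / (\<beta> + 2)" using \<beta> by (simp add: field_simps)
  finally show ?thesis by (simp add: powr_minus divide_inverse)
 qed
 finally show ?thesis by (simp add: l_def algebra_simps)
qed

text \<open>Where \<open>p\<close> is small compared with \<open>q\<close>, the point
  \<open>t\<close> cannot be close to \<open>t0\<close>, and so \<open>\<bar>p'\<bar>\<close> is at
  least of order \<open>\<phi>\<close>. This is the second derivative test with parameter
  \<open>\<Lambda> * \<phi>\<close>, whose exponent is \<open>1 / 2\<close> for every
  \<open>\<beta>\<close>.\<close>

lemma directional_bound:
 assumes m: "0 < m" and M: "0 < M" and \<beta>: "0 <= \<beta>"
  and low: "\<And>t. t \<in> {a..b} ==> m * \<bar>t - t0\<bar> powr \<beta> <= \<bar>p' t\<bar>"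
  and up: "\<And>t. t \<in> {a..b} ==> \<bar>p t - q\<bar> <= M * \<bar>t - t0\<bar> powr \<beta>"
  and \<phi>: "0 <= \<phi>" "\<phi> <= \<bar>q\<bar>"
 shows "norm (integral {a..b} integrand) * sqrt (\<Lambda> * \<phi>) <= 4 * K' * M / m + 10 * K + 2 * K'"
proof (cases "\<Lambda> * \<phi> <= 4")
 case True
 then have "sqrt (\<Lambda> * \<phi>) <= 2" using real_sqrt_le_mono[OF True] by simp
 moreover have "norm (integral {a..b} integrand) <= K'"
  using trivial_bound[of a b] ab K_nonneg mult_left_mono[of "b - a" 1 K'] by auto
 ultimately have "norm (integral {a..b} integrand) * sqrt (\<Lambda> * \<phi>) <= K' * 2"
  using K_nonneg lam \<phi> by (intro mult_mono) auto
 moreover have "0 <= 4 * K' * M / m + 10 * K" using K_nonneg m M by simp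
 ultimately show ?thesis by simp
next
 case False
 then have \<phi>0: "0 < \<phi>" using \<phi> lam by (cases "\<phi> = 0") auto
 define r where "r = sqrt (\<Lambda> * \<phi>)"
 have r: "2 < r" using False real_sqrt_less_mono[of 4 "\<Lambda> * \<phi>"] by (simp add: r_def)
 have r2: "r * r = \<Lambda> * \<phi>" using lam \<phi> by (simp add: r_def)
 \<comment> \<open>This is \<open>sqrt (\<phi> / \<Lambda>)\<close>, which balances the length
   \<open>\<delta> / \<phi>\<close> with \<open>1 / (\<Lambda> * \<delta>)\<close>. As
   \<open>r > 2\<close>, it is at most \<open>\<phi> / 2\<close>, so that
   \<open>\<bar>p t\<bar> <= \<delta>\<close> keeps \<open>p t\<close> away from
   \<open>q\<close>.\<close>
 define \<delta> where "\<delta> = \<phi> / r"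
 have \<delta>: "0 < \<delta>" using \<phi>0 r by (simp add: \<delta>_def)
 have \<delta>2: "\<delta> <= \<phi> / 2" using \<phi>0 r unfolding \<delta>_def by (intro divide_left_mono) auto
 have "norm (integral {a..b} integrand) <= K' * (4 * M / m / r) + 10 * K / (\<Lambda> * \<delta>)"
 proof (rule split_bound[OF \<delta>])
  show "0 <= 4 * M / m / r" using m M r by simp
  fix x y assume xy: "a <= x" "x <= y" "y <= b" and small: "\<And>t. t \<in> {x..y} ==> \<bar>p t\<bar> <= \<delta>"
  have "m * \<phi> / (2 * M) * (y - x) <= \<bar>p y - p x\<bar>"
  proof (rule mvt_bound[OF xy])
   fix t assume t: "t \<in> {x..y}"
   then have t': "t \<in> {a..b}" using xy by auto
   have "\<phi> / 2 <= \<bar>q\<bar> - \<bar>p t\<bar>" using small[OF t] \<phi> \<delta>2 by simp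
   also have "\<dots> <= M * \<bar>t - t0\<bar> powr \<beta>" using up[OF t'] by linarith
   finally have "m / M * (\<phi> / 2) <= m / M * (M * \<bar>t - t0\<bar> powr \<beta>)"
    using m M by (intro mult_left_mono) auto
   also have "\<dots> <= \<bar>p' t\<bar>" using low[OF t'] M by simp
   finally show "m * \<phi> / (2 * M) <= \<bar>p' t\<bar>" by (simp add: field_simps)
  qed
  also have "\<dots> <= 2 * \<delta>" using small[of y] small[of x] xy by auto
  finally have "y - x <= 2 * \<delta> * (2 * M) / (m * \<phi>)" using m M \<phi>0 by (simp add: field_simps)
  also have "\<dots> = 4 * M / m / r" using \<phi>0 r m by (simp add: \<delta>_def field_simps)
  finally show "y - x <= 4 * M / m / r" .
 qed
 also have "\<Lambda> * \<delta> = r" using r2 r by (simp add: \<delta>_def field_simps)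
 finally have "norm (integral {a..b} integrand) <= (4 * K' * M / m + 10 * K) / r"
  by (simp add: add_divide_distrib mult_ac)
 then have "norm (integral {a..b} integrand) * r <= 4 * K' * M / m + 10 * K"
  using r by (simp add: pos_le_divide_eq)
 then show ?thesis using K_nonneg by (simp add: r_def)
qed

end

section \<open>Averaged weights and families of oscillatory integrals\<close>

text \<open>The forward Steklov mean of step \<open>\<delta>\<close>. Its adjoint is the backward
  mean, which acts on the test functions below.\<close>

definition steklov :: "real => (real => real) => real => real" where
 "steklov \<delta> \<theta> \<eta> = integral {\<eta>..\<eta> + \<delta>} \<theta> / \<delta>"

lemma scaleR_quotient: "a *\<^sub>R ((x + y) / k) = (a *\<^sub>R x + a *\<^sub>R y) * (1 / k)" for k :: complex
 by (simp add: scaleR_conv_of_real distrib_left add_divide_distrib)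

text \<open>The mean of \<open>\<theta>\<close> lives on
  \<open>{-\<rho> - \<delta>..\<rho>}\<close>, and the backward mean evaluates test functions on
  \<open>{\<eta> - \<delta>..\<eta>}\<close>; the margin \<open>\<rho> + \<delta> <= r\<close> keeps
  both in \<open>{-r..r}\<close>. The constant \<open>V\<close> belongs to \<open>\<theta>\<close>
  itself and not to its mean.\<close>

locale steklov_profile =
 fixes \<theta> :: "real => real" and \<rho> \<delta> r V :: real and E :: "real set"
 assumes E: "finite E" "\<And>t. t \<notin> E ==> isCont \<theta> t"
  and int: "\<And>a b. \<theta> integrable_on {a..b}"
  and supp: "\<And>t. \<rho> < \<bar>t\<bar> ==> \<theta> t = 0"
  and \<delta>: "0 < \<delta>" "\<delta> <= 1" and \<rho>: "0 <= \<rho>" "\<rho> + \<delta> <= r"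
  and bv: "dual_bv \<theta> (-\<rho>) \<rho> V"
begin

lemma steklov_eq:
 assumes "-r <= \<eta>"
 shows "steklov \<delta> \<theta> \<eta> = (integral {-r..\<eta> + \<delta>} \<theta> - integral {-r..\<eta>} \<theta>) / \<delta>"
proof -
 have "integral {-r..\<eta>} \<theta> + integral {\<eta>..\<eta> + \<delta>} \<theta> = integral {-r..\<eta> + \<delta>} \<theta>"
  using assms \<delta> by (intro Henstock_Kurzweil_Integration.integral_combine int) auto
 then show ?thesis by (simp add: steklov_def)
qed

lemma continuous_steklov: "continuous_on {-r..r} (steklov \<delta> \<theta>)"
proof -
 have I: "continuous_on {-r..r + \<delta>} (\<lambda>x. integral {-r..x} \<theta>)"
  by (rule indefinite_integral_continuous_1[OF int])
 have "continuous_on {-r..r} (\<lambda>\<eta>. (integral {-r..\<eta> + \<delta>} \<theta> - integral {-r..\<eta>} \<theta>) / \<delta>)"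
  using \<delta> by (intro continuous_intros continuous_on_compose2[OF I]) auto
 then show ?thesis
  by (rule continuous_on_eq) (simp add: steklov_eq)
qed

lemma steklov_support: "\<eta> \<notin> {-\<rho> - \<delta>..\<rho>} ==> steklov \<delta> \<theta> \<eta> = 0"
proof -
 assume "\<eta> \<notin> {-\<rho> - \<delta>..\<rho>}"
 then have "\<theta> t = 0" if "t \<in> {\<eta>..\<eta> + \<delta>}" for t using that by (intro supp) auto
 then have "integral {\<eta>..\<eta> + \<delta>} \<theta> = integral {\<eta>..\<eta> + \<delta>} (\<lambda>_. 0)" by (rule integral_cong)
 then show ?thesis by (simp add: steklov_def)
qed

text \<open>The product \<open>U\<close> of the increment of a primitive of \<open>\<theta>\<close>
  with the primitive \<open>B\<close> of \<open>X\<close> vanishes at both ends: at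
  \<open>-r\<close> because \<open>B\<close> starts there, at \<open>r\<close> because
  \<open>\<theta>\<close> is zero beyond \<open>\<rho>\<close>. Its derivative contains the
  difference of two shifts of \<open>\<theta>\<close>, and a translation of the variable moves the
  shift to \<open>B\<close>.\<close>

lemma steklov_pairing:
 fixes X :: "real => complex"
 assumes X: "continuous_on {-r..r} X"
 shows "pairing r (steklov \<delta> \<theta>) X =
  pairing \<rho> \<theta> (\<lambda>\<eta>. (integral {-r..\<eta>} X - integral {-r..\<eta> - \<delta>} X) /\<^sub>R \<delta>)"
proof -
 define I where "I x = integral {-r..x} \<theta>" for x
 define B where "B x = integral {-r..x} X" for x
 have r0: "0 < r" using \<delta> \<rho> by simp
 have cI: "continuous_on {-r..r + \<delta>} I"
  unfolding I_def by (rule indefinite_integral_continuous_1[OF int])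
 have dB: "(B has_vector_derivative X t) (at t within {-r..r})" if "t \<in> {-r..r}" for t
  unfolding B_def by (rule integral_has_vector_derivative[OF X that])
 have cB: "continuous_on {-r..r} B"
  unfolding continuous_on_eq_continuous_within using dB has_vector_derivative_continuous by blast
 have dI: "(I has_vector_derivative \<theta> t) (at t)" if "-r < t" "t < r + \<delta>" "t \<notin> E" for t
 proof -
  have "(I has_vector_derivative \<theta> t) (at t within ({-r..r + \<delta>} - {}))"
   unfolding I_def using that E(2)[OF that(3)]
   by (intro integral_has_vector_derivative_continuous_at int) (auto intro: continuous_at_imp_continuous_at_within)
  moreover have "at t within ({-r..r + \<delta>} - {}) = at t"
   unfolding Diff_empty by (rule at_within_interior) (use that in simp)
  ultimately show ?thesis by simp
 qed
 define U where "U \<eta> = (I (\<eta> + \<delta>) - I \<eta>) *\<^sub>R B \<eta>" for \<eta>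
 define G where "G \<eta> = (\<theta> (\<eta> + \<delta>) - \<theta> \<eta>) *\<^sub>R B \<eta>" for \<eta>
 define H where "H \<eta> = (I (\<eta> + \<delta>) - I \<eta>) *\<^sub>R X \<eta>" for \<eta>
 have cID: "continuous_on {-r..r} (\<lambda>\<eta>. I (\<eta> + \<delta>) - I \<eta>)"
  using \<delta> by (intro continuous_intros continuous_on_compose2[OF cI]) auto
 have "((\<lambda>\<eta>. H \<eta> + G \<eta>) has_integral (U r - U (-r))) {-r..r}"
 proof (rule fundamental_theorem_of_calculus_interior_strong)
  \<comment> \<open>The increment may fail to be differentiable at the break points of
    \<open>\<theta>\<close> and at these points moved back by \<open>\<delta>\<close>.\<close>
  show "finite (E \<union> (\<lambda>e. e - \<delta>) ` E)" using E(1) by simp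
  show "continuous_on {-r..r} U" unfolding U_def by (intro continuous_intros cID cB)
  fix t assume t: "t \<in> {-r<..<r} - (E \<union> (\<lambda>e. e - \<delta>) ` E)"
  then have tE: "t \<notin> E" "t + \<delta> \<notin> E" by (auto simp: image_iff)
  have "(I has_vector_derivative \<theta> (t + \<delta>)) (at (t + \<delta>))" "(I has_vector_derivative \<theta> t) (at t)"
   using dI tE t \<delta> by auto
  then have "((\<lambda>\<eta>. I (\<eta> + \<delta>) - I \<eta>) has_real_derivative (\<theta> (t + \<delta>) - \<theta> t)) (at t)"
   by (auto intro!: derivative_intros simp: DERIV_shift has_real_derivative_iff_has_vector_derivative[symmetric])
  moreover have "(B has_vector_derivative X t) (at t)"
   using dB[of t] t at_within_interior[of t "{-r..r}"] by (simp only: interior_atLeastAtMost_real) auto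
  ultimately show "(U has_vector_derivative (H t + G t)) (at t)"
   unfolding U_def H_def G_def by (rule has_vector_derivative_scaleR)
 qed (use r0 in auto)
 moreover have "U r = 0"
 proof -
  have "I r + integral {r..r + \<delta>} \<theta> = I (r + \<delta>)"
   unfolding I_def using r0 \<delta> by (intro Henstock_Kurzweil_Integration.integral_combine int) auto
  moreover have "integral {r..r + \<delta>} \<theta> = integral {r..r + \<delta>} (\<lambda>_. 0)"
   using \<rho> \<delta> by (intro integral_cong supp) auto
  ultimately show ?thesis by (simp add: U_def)
 qed
 moreover have "U (-r) = 0" by (simp add: U_def B_def)
 ultimately have HG: "((\<lambda>\<eta>. H \<eta> + G \<eta>) has_integral 0) {-r..r}" by simp
 have cBs: "continuous_on {-\<rho>..\<rho>} B" "continuous_on {-\<rho>..\<rho>} (\<lambda>\<eta>. B (\<eta> - \<delta>))"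
  using \<rho> \<delta> by (auto intro!: continuous_on_compose2[OF cB] continuous_intros)
 have i1: "(\<lambda>\<eta>. \<theta> \<eta> *\<^sub>R B \<eta>) integrable_on {-\<rho>..\<rho>}" and i2: "(\<lambda>\<eta>. \<theta> \<eta> *\<^sub>R B (\<eta> - \<delta>)) integrable_on {-\<rho>..\<rho>}"
  by (rule dual_bv_integrable[OF bv] cBs)+
 define J1 where "J1 = pairing \<rho> \<theta> B"
 define J2 where "J2 = pairing \<rho> \<theta> (\<lambda>\<eta>. B (\<eta> - \<delta>))"
 have "((\<lambda>\<eta>. \<theta> \<eta> *\<^sub>R B \<eta>) has_integral J1) {-r..r}"
  unfolding J1_def
  by (rule has_integral_on_superset[OF integrable_integral[OF i1]]) (use \<rho> \<delta> in \<open>auto simp: supp abs_if\<close>)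
 moreover have "((\<lambda>\<eta>. \<theta> (\<eta> + \<delta>) *\<^sub>R B \<eta>) has_integral J2) {-r..r}"
 proof -
  have "(((\<lambda>\<eta>. \<theta> \<eta> *\<^sub>R B (\<eta> - \<delta>)) \<circ> (+) \<delta>) has_integral J2) {-\<rho> - \<delta>..\<rho> - \<delta>}"
   unfolding has_integral_shift_Icc_real J2_def using integrable_integral[OF i2] by simp
  then have "((\<lambda>\<eta>. \<theta> (\<eta> + \<delta>) *\<^sub>R B \<eta>) has_integral J2) {-\<rho> - \<delta>..\<rho> - \<delta>}"
   by (simp add: o_def add.commute)
  then show ?thesis
  proof (rule has_integral_on_superset)
   fix x assume "x \<notin> {-\<rho> - \<delta>..\<rho> - \<delta>}"
   then have "\<theta> (x + \<delta>) = 0" using \<delta> by (intro supp) (auto simp: abs_if)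
   then show "\<theta> (x + \<delta>) *\<^sub>R B x = 0" by simp
  qed (use \<rho> \<delta> in auto)
 qed
 ultimately have "(G has_integral (J2 - J1)) {-r..r}"
  unfolding G_def scaleR_left_diff_distrib by (intro has_integral_diff)
 from has_integral_diff[OF HG this] have "(H has_integral (J1 - J2)) {-r..r}" by simp
 then have "((\<lambda>\<eta>. inverse \<delta> *\<^sub>R H \<eta>) has_integral (inverse \<delta> *\<^sub>R (J1 - J2))) {-r..r}"
  by (rule has_integral_cmul)
 then have "((\<lambda>\<eta>. steklov \<delta> \<theta> \<eta> *\<^sub>R X \<eta>) has_integral (inverse \<delta> *\<^sub>R (J1 - J2))) {-r..r}"
  by (rule has_integral_eq[rotated]) (simp add: steklov_eq H_def I_def divide_inverse mult_ac)
 moreover have "pairing \<rho> \<theta> (\<lambda>\<eta>. (B \<eta> - B (\<eta> - \<delta>)) /\<^sub>R \<delta>) = inverse \<delta> *\<^sub>R (J1 - J2)"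
 proof -
  have "(\<lambda>\<eta>. \<theta> \<eta> *\<^sub>R ((B \<eta> - B (\<eta> - \<delta>)) /\<^sub>R \<delta>)) = (\<lambda>\<eta>. inverse \<delta> *\<^sub>R (\<theta> \<eta> *\<^sub>R B \<eta> - \<theta> \<eta> *\<^sub>R B (\<eta> - \<delta>)))"
   by (auto simp: scaleR_right_diff_distrib mult_ac)
  then show ?thesis using integral_diff[OF i1 i2] by (simp add: J1_def J2_def)
 qed
 ultimately show ?thesis by (simp add: integral_unique B_def)
qed

lemma average_bound:
 fixes X :: "real => complex"
 assumes X: "continuous_on {-r..r} X" and s: "\<And>t. t \<in> {-r..r} ==> norm (X t) <= s" and \<eta>: "\<eta> \<in> {-\<rho>..\<rho>}"
 shows "norm ((integral {-r..\<eta>} X - integral {-r..\<eta> - \<delta>} X) /\<^sub>R \<delta>) <= s"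
proof -
 have "integral {-r..\<eta> - \<delta>} X + integral {\<eta> - \<delta>..\<eta>} X = integral {-r..\<eta>} X"
  using \<eta> \<rho> \<delta> by (intro Henstock_Kurzweil_Integration.integral_combine integrable_continuous_real continuous_on_subset[OF X]) auto
 then have "integral {-r..\<eta>} X - integral {-r..\<eta> - \<delta>} X = integral {\<eta> - \<delta>..\<eta>} X" by (simp add: algebra_simps)
 moreover have "norm (integral {\<eta> - \<delta>..\<eta>} X) <= s * (\<eta> - (\<eta> - \<delta>))"
  using \<eta> \<rho> \<delta> by (intro integral_bound continuous_on_subset[OF X] s) auto
 ultimately show ?thesis using \<delta> by (simp add: divide_inverse_commute[symmetric] field_simps)
qed

lemma steklov_pairing_bound:
 fixes X :: "real => complex"
 assumes X: "continuous_on {-r..r} X" and s: "\<And>t. t \<in> {-r..r} ==> norm (X t) <= s"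
 shows "norm (pairing r (steklov \<delta> \<theta>) X) <= V * s"
 unfolding steklov_pairing[OF X]
proof (rule dual_bvD[OF bv _ average_bound[OF X s]])
 have cB: "continuous_on {-r..r} (\<lambda>x. integral {-r..x} X)"
  by (intro indefinite_integral_continuous_1 integrable_continuous_real X)
 show "continuous_on {-\<rho>..\<rho>} (\<lambda>\<eta>. (integral {-r..\<eta>} X - integral {-r..\<eta> - \<delta>} X) /\<^sub>R \<delta>)"
  using \<rho> \<delta> by (intro continuous_intros continuous_on_compose2[OF cB]) auto
qed

text \<open>The backward mean of a derivative is a difference quotient. This trades the derivative
  for a factor \<open>1 / \<delta>\<close> and is the source of the second bound in
  \<open>steklov_bound\<close>.\<close>

lemma steklov_pairing_deriv:
 fixes X :: "real => complex"
 assumes X: "\<And>t. t \<in> {-r..r} ==> (X has_vector_derivative X' t) (at t within {-r..r})"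
  and cX': "continuous_on {-r..r} X'"
 shows "pairing r (steklov \<delta> \<theta>) X' =
  pairing \<rho> \<theta> (\<lambda>\<eta>. (X \<eta> - X (\<eta> - \<delta>)) /\<^sub>R \<delta>)"
proof -
 have *: "integral {-r..u} X' = X u - X (-r)" if "u \<in> {-r..r}" for u
 proof (rule integral_unique, rule fundamental_theorem_of_calculus)
  fix x assume "x \<in> {-r..u}"
  then show "(X has_vector_derivative X' x) (at x within {-r..u})"
   using that by (intro has_vector_derivative_within_subset[OF X]) auto
 qed (use that in auto)
 show ?thesis
  unfolding steklov_pairing[OF cX'] by (intro integral_cong) (use \<rho> \<delta> * in auto)
qed

text \<open>The backward mean of \<open>X\<close> obeys the same bound as \<open>X\<close> and has
  the difference quotient as its derivative, so the variation bound of \<open>\<theta>\<close>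
  applies without a loss in \<open>\<delta>\<close>.\<close>

lemma steklov_pairing_deriv_bound:
 fixes X :: "real => complex"
 assumes X: "\<And>t. t \<in> {-r..r} ==> (X has_vector_derivative X' t) (at t within {-r..r})"
  and cX': "continuous_on {-r..r} X'" and s: "\<And>t. t \<in> {-r..r} ==> norm (X t) <= s"
 shows "norm (pairing r (steklov \<delta> \<theta>) X') <= V * s"
proof -
 have cX: "continuous_on {-r..r} X"
  unfolding continuous_on_eq_continuous_within using X has_vector_derivative_continuous by blast
 define Y where "Y \<eta> = (integral {-r..\<eta>} X - integral {-r..\<eta> - \<delta>} X) /\<^sub>R \<delta>" for \<eta>
 have dB: "((\<lambda>x. integral {-r..x} X) has_vector_derivative X t) (at t within {-r..r})" if "t \<in> {-r..r}" for t
  by (rule integral_has_vector_derivative[OF cX that])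
 have dY: "(Y has_vector_derivative ((X t - X (t - \<delta>)) /\<^sub>R \<delta>)) (at t within {-\<rho>..\<rho>})" if t: "t \<in> {-\<rho>..\<rho>}" for t
 proof -
  have 1: "((\<lambda>x. integral {-r..x} X) has_vector_derivative X t) (at t within {-\<rho>..\<rho>})"
   using t \<rho> \<delta> by (intro has_vector_derivative_within_subset[OF dB]) auto
  have "((\<lambda>x. integral {-r..x} X) \<circ> (\<lambda>x. x - \<delta>) has_vector_derivative (1 *\<^sub>R X (t - \<delta>))) (at t within {-\<rho>..\<rho>})"
  proof (rule vector_diff_chain_within)
   show "((\<lambda>x. x - \<delta>) has_vector_derivative 1) (at t within {-\<rho>..\<rho>})"
    by (auto intro!: derivative_eq_intros)
   show "((\<lambda>x. integral {-r..x} X) has_vector_derivative X (t - \<delta>)) (at (t - \<delta>) within (\<lambda>x. x - \<delta>) ` {-\<rho>..\<rho>})"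
    using t \<rho> \<delta> by (intro has_vector_derivative_within_subset[OF dB]) auto
  qed
  then have 2: "((\<lambda>x. integral {-r..x - \<delta>} X) has_vector_derivative X (t - \<delta>)) (at t within {-\<rho>..\<rho>})"
   by (simp add: o_def)
  show ?thesis
   using has_vector_derivative_scaleR[OF DERIV_const has_vector_derivative_diff[OF 1 2], of "inverse \<delta>"]
   by (simp add: Y_def[abs_def])
 qed
 have eq: "pairing r (steklov \<delta> \<theta>) X' =
  pairing \<rho> \<theta> (\<lambda>\<eta>. (X \<eta> - X (\<eta> - \<delta>)) /\<^sub>R \<delta>)"
  by (rule steklov_pairing_deriv[OF X cX'])
 show ?thesis
  unfolding eq
 proof (rule dual_bvD_deriv[OF bv dY])
  show "continuous_on {-\<rho>..\<rho>} (\<lambda>t. (X t - X (t - \<delta>)) /\<^sub>R \<delta>)"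
   using \<rho> \<delta> by (intro continuous_intros continuous_on_compose2[OF cX]) auto
  show "norm (Y t) <= s" if "t \<in> {-\<rho>..\<rho>}" for t
   unfolding Y_def by (rule average_bound[OF cX s that])
 qed
qed

end

section \<open>Families of oscillatory integrals that reproduce themselves under integration by
  parts\<close>

definition splits :: "real => real => (real => complex) => (real => complex) => (real => complex) => (real => complex) => bool" where
 "splits r l X X1 X2 D \<longleftrightarrow> continuous_on {-r..r} D \<and>
   (\<forall>\<eta>\<in>{-r..r}. (X2 has_vector_derivative D \<eta>) (at \<eta> within {-r..r}) \<and> X \<eta> = (D \<eta> + X1 \<eta>) / (\<i> * of_real l))"

lemma splitsD:
 assumes "splits r l X X1 X2 D"
 shows "continuous_on {-r..r} D" "\<eta> \<in> {-r..r} ==> (X2 has_vector_derivative D \<eta>) (at \<eta> within {-r..r})"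
  "\<eta> \<in> {-r..r} ==> X \<eta> = (D \<eta> + X1 \<eta>) / (\<i> * of_real l)"
 using assms by (auto simp: splits_def)

text \<open>A family of oscillatory integrals \<open>A b w \<eta>\<close> with frequency \<open>L w\<close>, where each amplitude
 \<open>b\<close> splits into an exact \<open>\<eta>\<close>-derivative and a remainder, both smaller by the factor \<open>1 / L w\<close>.\<close>

locale osc_family =
 fixes A :: "'b => 'w => real => complex" and \<A> :: "'b set" and L S :: "'w => real"
  and W :: "'w set" and r :: real
 assumes L: "\<And>w. w \<in> W ==> 0 < L w" and S: "\<And>w. w \<in> W ==> 0 <= S w"
  and bound: "\<And>b. b \<in> \<A> ==> \<exists>C\<ge>0. \<forall>w\<in>W. \<forall>\<eta>\<in>{-r..r}. norm (A b w \<eta>) <= C * S w"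
  and reduce: "\<And>b. b \<in> \<A> ==> \<exists>b1\<in>\<A>. \<exists>b2\<in>\<A>. \<exists>D. \<forall>w\<in>W. splits r (L w) (A b w) (A b1 w) (A b2 w) (D w)"
  and cont: "\<And>b w. b \<in> \<A> ==> w \<in> W ==> continuous_on {-r..r} (A b w)"
begin

lemma norm_div_L: "w \<in> W ==> norm (z / (\<i> * of_real (L w))) = norm z / L w"
 using L[of w] by (simp add: norm_divide norm_mult)

lemma shifted_pairing_bound:
 assumes b: "b \<in> \<A>"
 shows "\<exists>C\<ge>0. \<forall>w\<in>W. \<forall>\<theta> \<rho> V y. dual_bv \<theta> (-\<rho>) \<rho> V --> 0 <= \<rho> --> \<rho> + \<bar>y\<bar> <= r -->
   norm (pairing \<rho> \<theta> (\<lambda>\<eta>. A b w (\<eta> - y))) <= C * V * S w / L w"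
proof -
 obtain b1 b2 D where b12: "b1 \<in> \<A>" "b2 \<in> \<A>"
  and sp: "\<And>w. w \<in> W ==> splits r (L w) (A b w) (A b1 w) (A b2 w) (D w)"
  using reduce[OF b] by blast
 note D = splitsD(1)[OF sp] and dA = splitsD(2)[OF sp] and eq = splitsD(3)[OF sp]
 obtain C1 where C1: "0 <= C1" "\<And>w \<eta>. w \<in> W ==> \<eta> \<in> {-r..r} ==> norm (A b1 w \<eta>) <= C1 * S w"
  using bound[OF b12(1)] by meson
 obtain C2 where C2: "0 <= C2" "\<And>w \<eta>. w \<in> W ==> \<eta> \<in> {-r..r} ==> norm (A b2 w \<eta>) <= C2 * S w"
  using bound[OF b12(2)] by meson
 show ?thesis
 proof (intro exI[of _ "C1 + C2"] conjI ballI allI impI)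
  fix w \<theta> \<rho> V y assume w: "w \<in> W" and bv: "dual_bv \<theta> (-\<rho>) \<rho> V" and \<rho>: "0 <= \<rho>" "\<rho> + \<bar>y\<bar> <= r"
  have in_r: "\<eta> - y \<in> {-r..r}" if "\<eta> \<in> {-\<rho>..\<rho>}" for \<eta> using that \<rho> by auto
  have c1: "continuous_on {-\<rho>..\<rho>} (\<lambda>\<eta>. A b1 w (\<eta> - y))"
   by (intro continuous_on_compose2[OF cont[OF b12(1) w]] continuous_intros) (use in_r in auto)
  have cD: "continuous_on {-\<rho>..\<rho>} (\<lambda>\<eta>. D w (\<eta> - y))"
   by (intro continuous_on_compose2[OF D[OF w]] continuous_intros) (use in_r in auto)
  have d: "((\<lambda>\<eta>. A b2 w (\<eta> - y)) has_vector_derivative D w (t - y)) (at t within {-\<rho>..\<rho>})"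
   if t: "t \<in> {-\<rho>..\<rho>}" for t
  proof -
   have "(A b2 w \<circ> (\<lambda>\<eta>. \<eta> - y) has_vector_derivative (1 *\<^sub>R D w (t - y))) (at t within {-\<rho>..\<rho>})"
   proof (rule vector_diff_chain_within)
    show "((\<lambda>x. x - y) has_vector_derivative 1) (at t within {-\<rho>..\<rho>})"
     by (auto intro!: derivative_eq_intros)
    show "(A b2 w has_vector_derivative D w (t - y)) (at (t - y) within (\<lambda>x. x - y) ` {-\<rho>..\<rho>})"
     by (rule has_vector_derivative_within_subset[OF dA[OF w in_r[OF t]]]) (use in_r in auto)
   qed
   then show ?thesis by (simp add: o_def)
  qed
  have "pairing \<rho> \<theta> (\<lambda>\<eta>. A b w (\<eta> - y)) =
   integral {-\<rho>..\<rho>} (\<lambda>\<eta>. (\<theta> \<eta> *\<^sub>R D w (\<eta> - y) + \<theta> \<eta> *\<^sub>R A b1 w (\<eta> - y)) * (1 / (\<i> * of_real (L w))))"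
   by (intro integral_cong) (simp only: eq[OF w in_r] scaleR_quotient)
  also have "\<dots> = (pairing \<rho> \<theta> (\<lambda>\<eta>. D w (\<eta> - y)) + pairing \<rho> \<theta> (\<lambda>\<eta>. A b1 w (\<eta> - y))) / (\<i> * of_real (L w))"
   by (simp add: integral_mult_left integral_add dual_bv_integrable[OF bv cD] dual_bv_integrable[OF bv c1])
  also have "norm \<dots> <= (V * (C2 * S w) + V * (C1 * S w)) / L w"
   unfolding norm_div_L[OF w] using L[OF w]
   by (intro divide_right_mono norm_triangle_le add_mono dual_bvD_deriv[OF bv d cD] dual_bvD[OF bv c1] C1 C2 w in_r) auto
  also have "\<dots> = (C1 + C2) * V * S w / L w" by (simp add: algebra_simps)
  finally show "norm (pairing \<rho> \<theta> (\<lambda>\<eta>. A b w (\<eta> - y))) <= (C1 + C2) * V * S w / L w" .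
 qed (use C1 C2 in auto)
qed

lemma steklov_step:
 assumes sp: "steklov_profile \<theta> \<rho> \<delta> r V E" and w: "w \<in> W" and b1: "b1 \<in> \<A>"
  and D: "continuous_on {-r..r} (D w)"
  and eq: "\<And>\<eta>. \<eta> \<in> {-r..r} ==> A b w \<eta> = (D w \<eta> + A b1 w \<eta>) / (\<i> * of_real (L w))"
 shows "norm (pairing r (steklov \<delta> \<theta>) (A b w)) <=
    (norm (pairing r (steklov \<delta> \<theta>) (D w)) + norm (pairing r (steklov \<delta> \<theta>) (A b1 w))) / L w"
proof -
 interpret steklov_profile \<theta> \<rho> \<delta> r V E by (rule sp)
 have i: "(\<lambda>\<eta>. steklov \<delta> \<theta> \<eta> *\<^sub>R D w \<eta>) integrable_on {-r..r}" "(\<lambda>\<eta>. steklov \<delta> \<theta> \<eta> *\<^sub>R A b1 w \<eta>) integrable_on {-r..r}"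
  by (intro integrable_continuous_real continuous_intros continuous_steklov D cont b1 w)+
 have "pairing r (steklov \<delta> \<theta>) (A b w) =
  integral {-r..r} (\<lambda>\<eta>. (steklov \<delta> \<theta> \<eta> *\<^sub>R D w \<eta> + steklov \<delta> \<theta> \<eta> *\<^sub>R A b1 w \<eta>) * (1 / (\<i> * of_real (L w))))"
  by (intro integral_cong) (simp only: eq scaleR_quotient)
 also have "\<dots> = (pairing r (steklov \<delta> \<theta>) (D w) + pairing r (steklov \<delta> \<theta>) (A b1 w)) / (\<i> * of_real (L w))"
  by (simp add: integral_mult_left integral_add i)
 finally show ?thesis
  using L[OF w] by (simp add: norm_div_L[OF w] divide_right_mono norm_triangle_ineq)
qed

text \<open>The first bound uses the bounded variation of \<open>\<theta>\<close> only. For the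
  second one the derivative part becomes a difference quotient, both values of which gain a further
  \<open>1 / L w\<close>, at the price of \<open>1 / \<delta>\<close>. Up to constants the bounds
  meet at \<open>L w = 1 / \<delta>\<close>.\<close>

lemma steklov_bound:
 assumes b: "b \<in> \<A>"
 shows "\<exists>C\<ge>0. \<forall>w\<in>W. \<forall>\<theta> \<rho> \<delta> V E. steklov_profile \<theta> \<rho> \<delta> r V E -->
   norm (pairing r (steklov \<delta> \<theta>) (A b w)) <= C * V * S w / L w"
  "\<exists>C\<ge>0. \<forall>w\<in>W. \<forall>\<theta> \<rho> \<delta> V E. steklov_profile \<theta> \<rho> \<delta> r V E -->
   norm (pairing r (steklov \<delta> \<theta>) (A b w)) <= C * V * S w / (\<delta> * (L w)\<^sup>2)"
proof -
 have first: "\<exists>C\<ge>0. \<forall>w\<in>W. \<forall>\<theta> \<rho> \<delta> V E. steklov_profile \<theta> \<rho> \<delta> r V E -->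
   norm (pairing r (steklov \<delta> \<theta>) (A b w)) <= C * V * S w / L w" if b: "b \<in> \<A>" for b
 proof -
  obtain b1 b2 D where b12: "b1 \<in> \<A>" "b2 \<in> \<A>"
   and sp: "\<And>w. w \<in> W ==> splits r (L w) (A b w) (A b1 w) (A b2 w) (D w)"
   using reduce[OF b] by blast
  note D = splitsD(1)[OF sp] and dA = splitsD(2)[OF sp] and eq = splitsD(3)[OF sp]
  obtain C1 where C1: "0 <= C1" "\<And>w \<eta>. w \<in> W ==> \<eta> \<in> {-r..r} ==> norm (A b1 w \<eta>) <= C1 * S w"
   using bound[OF b12(1)] by meson
  obtain C2 where C2: "0 <= C2" "\<And>w \<eta>. w \<in> W ==> \<eta> \<in> {-r..r} ==> norm (A b2 w \<eta>) <= C2 * S w"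
   using bound[OF b12(2)] by meson
  show ?thesis
  proof (intro exI[of _ "C1 + C2"] conjI ballI allI impI)
   fix w \<theta> \<rho> \<delta> V E assume w: "w \<in> W" and sp: "steklov_profile \<theta> \<rho> \<delta> r V E"
   then interpret steklov_profile \<theta> \<rho> \<delta> r V E by simp
   have 1: "norm (pairing r (steklov \<delta> \<theta>) (D w)) <= V * (C2 * S w)"
    using w by (intro steklov_pairing_deriv_bound[OF dA D C2(2)]) auto
   have 2: "norm (pairing r (steklov \<delta> \<theta>) (A b1 w)) <= V * (C1 * S w)"
    using w by (intro steklov_pairing_bound cont b12 C1(2))
   have "norm (pairing r (steklov \<delta> \<theta>) (A b w)) <= (V * (C2 * S w) + V * (C1 * S w)) / L w"
    by (rule order_trans[OF steklov_step[where D = D, OF sp w b12(1) D[OF w] eq[OF w]] divide_right_mono[OF add_mono[OF 1 2]]]) (use L[OF w] in auto)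
   then show "norm (pairing r (steklov \<delta> \<theta>) (A b w)) <= (C1 + C2) * V * S w / L w"
    by (simp add: algebra_simps)
  qed (use C1 C2 in auto)
 qed
 show "\<exists>C\<ge>0. \<forall>w\<in>W. \<forall>\<theta> \<rho> \<delta> V E. steklov_profile \<theta> \<rho> \<delta> r V E -->
   norm (pairing r (steklov \<delta> \<theta>) (A b w)) <= C * V * S w / L w"
  by (rule first[OF b])
 show "\<exists>C\<ge>0. \<forall>w\<in>W. \<forall>\<theta> \<rho> \<delta> V E. steklov_profile \<theta> \<rho> \<delta> r V E -->
   norm (pairing r (steklov \<delta> \<theta>) (A b w)) <= C * V * S w / (\<delta> * (L w)\<^sup>2)"
 proof -
  obtain b1 b2 D where b12: "b1 \<in> \<A>" "b2 \<in> \<A>"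
   and sp: "\<And>w. w \<in> W ==> splits r (L w) (A b w) (A b1 w) (A b2 w) (D w)"
   using reduce[OF b] by blast
  note D = splitsD(1)[OF sp] and dA = splitsD(2)[OF sp] and eq = splitsD(3)[OF sp]
  obtain C1 where C1: "0 <= C1" "\<And>w \<theta> \<rho> \<delta> V E. w \<in> W ==> steklov_profile \<theta> \<rho> \<delta> r V E ==>
    norm (pairing r (steklov \<delta> \<theta>) (A b1 w)) <= C1 * V * S w / L w"
   using first[OF b12(1)] by meson
  obtain C2 where C2: "0 <= C2" "\<And>w \<theta> \<rho> V y. w \<in> W ==> dual_bv \<theta> (-\<rho>) \<rho> V ==> 0 <= \<rho> ==> \<rho> + \<bar>y\<bar> <= r ==>
    norm (pairing \<rho> \<theta> (\<lambda>\<eta>. A b2 w (\<eta> - y))) <= C2 * V * S w / L w"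
   using shifted_pairing_bound[OF b12(2)] by meson
  show ?thesis
  proof (intro exI[of _ "C1 + 2 * C2"] conjI ballI allI impI)
   fix w \<theta> \<rho> \<delta> V E assume w: "w \<in> W" and sp: "steklov_profile \<theta> \<rho> \<delta> r V E"
   then interpret steklov_profile \<theta> \<rho> \<delta> r V E by simp
   define Q where "Q = V * S w / L w"
   have Q: "0 <= Q" using dual_bv_nonneg[OF bv] S[OF w] L[OF w] by (simp add: Q_def)
   have in_r: "\<eta> \<in> {-r..r}" "\<eta> - \<delta> \<in> {-r..r}" if "\<eta> \<in> {-\<rho>..\<rho>}" for \<eta> using that \<rho> \<delta> by auto
   have c2: "continuous_on {-\<rho>..\<rho>} (\<lambda>\<eta>. A b2 w \<eta>)" "continuous_on {-\<rho>..\<rho>} (\<lambda>\<eta>. A b2 w (\<eta> - \<delta>))"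
    by (intro continuous_on_compose2[OF cont[OF b12(2) w]] continuous_intros; use in_r in auto)+
   have "pairing r (steklov \<delta> \<theta>) (D w) =
     pairing \<rho> (\<lambda>_. inverse \<delta>) (\<lambda>\<eta>. \<theta> \<eta> *\<^sub>R A b2 w \<eta> - \<theta> \<eta> *\<^sub>R A b2 w (\<eta> - \<delta>))"
    using steklov_pairing_deriv[of "A b2 w" "D w", OF dA[OF w] D[OF w]] by (simp add: scaleR_right_diff_distrib mult_ac)
   also have "\<dots> = inverse \<delta> *\<^sub>R (pairing \<rho> \<theta> (A b2 w) - pairing \<rho> \<theta> (\<lambda>\<eta>. A b2 w (\<eta> - \<delta>)))"
    by (simp add: integral_diff dual_bv_integrable[OF bv c2(1)] dual_bv_integrable[OF bv c2(2)])
   also have "norm \<dots> <= inverse \<delta> * (C2 * V * S w / L w + C2 * V * S w / L w)"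
    unfolding norm_scaleR using C2(2)[OF w bv \<rho>(1), of 0] C2(2)[OF w bv \<rho>(1), of \<delta>] \<rho> \<delta>
    by (intro mult_mono order_trans[OF norm_triangle_ineq4 add_mono]) auto
   also have "\<dots> = 2 * C2 * Q / \<delta>" by (simp add: Q_def divide_inverse)
   finally have 1: "norm (pairing r (steklov \<delta> \<theta>) (D w)) <= 2 * C2 * Q / \<delta>" .
   \<comment> \<open>The remainder has its extra factor \<open>1 / L w\<close> already; as
     \<open>\<delta> \<le> 1\<close>, it fits under the weaker bound with
     \<open>1 / \<delta>\<close>.\<close>
   have "C1 * Q * \<delta> <= C1 * Q * 1" using \<delta> C1 Q by (intro mult_left_mono) auto
   then have "C1 * Q <= C1 * Q / \<delta>" using \<delta> by (simp add: pos_le_divide_eq)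
   then have 2: "norm (pairing r (steklov \<delta> \<theta>) (A b1 w)) <= C1 * Q / \<delta>"
    using C1(2)[OF w sp] by (simp add: Q_def)
   have "norm (pairing r (steklov \<delta> \<theta>) (A b w)) <= (2 * C2 * Q / \<delta> + C1 * Q / \<delta>) / L w"
    by (rule order_trans[OF steklov_step[where D = D, OF sp w b12(1) D[OF w] eq[OF w]] divide_right_mono[OF add_mono[OF 1 2]]]) (use L[OF w] in auto)
   also have "\<dots> = (C1 + 2 * C2) * V * S w / (\<delta> * (L w)\<^sup>2)"
    using L[OF w] \<delta> by (simp add: Q_def power2_eq_square field_simps)
   finally show "norm (pairing r (steklov \<delta> \<theta>) (A b w)) <= (C1 + 2 * C2) * V * S w / (\<delta> * (L w)\<^sup>2)" .
  qed (use C1 C2 in auto)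
 qed
qed

text \<open>The profile \<open>\<theta> i\<close> is the \<open>i\<close>-th derivative of \<open>\<theta> 0\<close>; only the weak form of this is needed.\<close>

lemma profile_bound:
 fixes \<theta> :: "nat => real => real" and c V :: real
 assumes parts: "\<And>i (X :: real => complex) X'. i < q ==>
    (\<And>t. t \<in> {-c..c} ==> (X has_vector_derivative X' t) (at t within {-c..c})) ==> continuous_on {-c..c} X' ==>
    pairing c (\<theta> i) X' = - pairing c (\<theta> (Suc i)) X"
  and bv: "\<And>i. i <= q ==> dual_bv (\<theta> i) (-c) c V" and c: "0 < c"
 shows "b \<in> \<A> ==> i <= q ==> i + n <= q + 1 ==>
  \<exists>C\<ge>0. \<forall>w\<in>W. \<forall>eps. 0 < eps --> eps <= 1 --> c * eps <= r -->
   norm (pairing c (\<theta> i) (\<lambda>s. A b w (eps * s))) <= C * S w / (eps * L w) ^ n"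
proof (induction n arbitrary: b i)
 case 0
 obtain C where C: "0 <= C" "\<And>w \<eta>. w \<in> W ==> \<eta> \<in> {-r..r} ==> norm (A b w \<eta>) <= C * S w"
  using bound[OF 0(1)] by meson
 have V: "0 <= V" using bv[OF 0(2)] by (rule dual_bv_nonneg)
 show ?case
 proof (intro exI[of _ "V * C"] conjI ballI allI impI)
  fix w eps assume w: "w \<in> W" and eps: "0 < eps" "eps <= 1" "c * eps <= r"
  have in_r: "eps * s \<in> {-r..r}" if "s \<in> {-c..c}" for s
  proof -
   have "\<bar>eps * s\<bar> <= eps * c" using that eps by (auto simp: abs_mult intro!: mult_left_mono)
   then have "\<bar>eps * s\<bar> <= r" using eps by (simp add: mult.commute)
   then show ?thesis by (simp add: abs_le_iff)
  qed
  have "norm (pairing c (\<theta> i) (\<lambda>s. A b w (eps * s))) <= V * (C * S w)"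
   by (intro dual_bvD[OF bv[OF 0(2)]] continuous_on_compose2[OF cont[OF 0(1) w]] continuous_intros C w)
    (use in_r in auto)
  then show "norm (pairing c (\<theta> i) (\<lambda>s. A b w (eps * s))) <= V * C * S w / (eps * L w) ^ 0" by simp
 qed (use C V in auto)
next
 case (Suc n)
 obtain b1 b2 D where b12: "b1 \<in> \<A>" "b2 \<in> \<A>"
  and sp: "\<And>w. w \<in> W ==> splits r (L w) (A b w) (A b1 w) (A b2 w) (D w)"
  using reduce[OF Suc.prems(1)] by blast
 note D = splitsD(1)[OF sp] and dA = splitsD(2)[OF sp] and eq = splitsD(3)[OF sp]
 obtain C1 where C1: "0 <= C1" "\<And>w eps. w \<in> W ==> 0 < eps ==> eps <= 1 ==> c * eps <= r ==>
   norm (pairing c (\<theta> i) (\<lambda>s. A b1 w (eps * s))) <= C1 * S w / (eps * L w) ^ n"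
  using Suc.IH[OF b12(1) Suc.prems(2)] Suc.prems(3) by auto
 have in_r: "eps * s \<in> {-r..r}" if "s \<in> {-c..c}" "0 < eps" "eps <= 1" "c * eps <= r" for s eps
 proof -
  have "\<bar>eps * s\<bar> <= eps * c" using that by (auto simp: abs_mult intro!: mult_left_mono)
  then have "\<bar>eps * s\<bar> <= r" using that by (simp add: mult.commute)
  then show ?thesis by (simp add: abs_le_iff)
 qed
 have d: "((\<lambda>s. A b2 w (eps * s)) has_vector_derivative (eps *\<^sub>R D w (eps * t))) (at t within {-c..c})"
  if w: "w \<in> W" and t: "t \<in> {-c..c}" and eps: "0 < eps" "eps <= 1" "c * eps <= r" for w eps t
 proof -
  have "(A b2 w \<circ> (\<lambda>s. eps * s) has_vector_derivative (eps *\<^sub>R D w (eps * t))) (at t within {-c..c})"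
  proof (rule vector_diff_chain_within)
   show "((\<lambda>s. eps * s) has_vector_derivative eps) (at t within {-c..c})"
    by (auto intro!: derivative_eq_intros)
   show "(A b2 w has_vector_derivative D w (eps * t)) (at (eps * t) within (\<lambda>s. eps * s) ` {-c..c})"
    by (rule has_vector_derivative_within_subset[OF dA[OF w in_r[OF t eps]]]) (use in_r eps in blast)
  qed
  then show ?thesis by (simp add: o_def)
 qed
 have cs: "continuous_on {-c..c} (\<lambda>s. D w (eps * s))" "continuous_on {-c..c} (\<lambda>s. A b1 w (eps * s))"
  if w: "w \<in> W" and eps: "0 < eps" "eps <= 1" "c * eps <= r" for w eps
  using in_r[OF _ eps] by (auto intro!: continuous_on_compose2[OF D[OF w]] continuous_on_compose2[OF cont[OF b12(1) w]] continuous_intros simp del: atLeastAtMost_iff)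
 have cD: "continuous_on {-c..c} (\<lambda>s. eps *\<^sub>R D w (eps * s))"
  if w: "w \<in> W" and eps: "0 < eps" "eps <= 1" "c * eps <= r" for w eps
  by (intro continuous_intros cs that)
 have "\<exists>C\<ge>0. \<forall>w\<in>W. \<forall>eps. 0 < eps --> eps <= 1 --> c * eps <= r -->
   norm (pairing c (\<theta> i) (\<lambda>s. eps *\<^sub>R D w (eps * s))) <= C * S w / (eps * L w) ^ n"
 \<comment> \<open>While \<open>i < q\<close>, the derivative moves to the profile. At
   \<open>i = q\<close> only \<open>n = 0\<close> is left, and the variation part of
   \<open>dual_bv\<close> absorbs the derivative; this last use raises the power from
   \<open>q\<close> to \<open>q + 1\<close>.\<close>
 proof (cases "i < q")
  case True
  obtain C where C: "0 <= C" "\<And>w eps. w \<in> W ==> 0 < eps ==> eps <= 1 ==> c * eps <= r ==>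
    norm (pairing c (\<theta> (Suc i)) (\<lambda>s. A b2 w (eps * s))) <= C * S w / (eps * L w) ^ n"
   using Suc.IH[OF b12(2), of "Suc i"] True Suc.prems(3) by auto
  show ?thesis
  proof (intro exI[of _ C] conjI ballI allI impI C)
   fix w eps assume w: "w \<in> W" and eps: "0 < eps" "eps <= 1" "c * eps <= r"
   have "pairing c (\<theta> i) (\<lambda>s. eps *\<^sub>R D w (eps * s)) = - pairing c (\<theta> (Suc i)) (\<lambda>t. A b2 w (eps * t))"
    by (rule parts[OF True d[OF w _ eps] cD[OF w eps]])
   then show "norm (pairing c (\<theta> i) (\<lambda>s. eps *\<^sub>R D w (eps * s))) <= C * S w / (eps * L w) ^ n"
    using C(2)[OF w eps] by simp
  qed
 next
  case False
  then have n: "n = 0" using Suc.prems by simp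
  obtain C where C: "0 <= C" "\<And>w \<eta>. w \<in> W ==> \<eta> \<in> {-r..r} ==> norm (A b2 w \<eta>) <= C * S w"
   using bound[OF b12(2)] by meson
  have V: "0 <= V" using bv[OF Suc.prems(2)] by (rule dual_bv_nonneg)
  show ?thesis
  proof (intro exI[of _ "V * C"] conjI ballI allI impI)
   fix w eps assume w: "w \<in> W" and eps: "0 < eps" "eps <= 1" "c * eps <= r"
   have "norm (pairing c (\<theta> i) (\<lambda>s. eps *\<^sub>R D w (eps * s))) <= V * (C * S w)"
    by (intro dual_bvD_deriv[OF bv[OF Suc.prems(2)] d[OF w _ eps] cD[OF w eps]] C(2) w in_r eps)
   then show "norm (pairing c (\<theta> i) (\<lambda>s. eps *\<^sub>R D w (eps * s))) <= V * C * S w / (eps * L w) ^ n"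
    by (simp add: n)
  qed (use C V in auto)
 qed
 then obtain C2 where C2: "0 <= C2" "\<And>w eps. w \<in> W ==> 0 < eps ==> eps <= 1 ==> c * eps <= r ==>
   norm (pairing c (\<theta> i) (\<lambda>s. eps *\<^sub>R D w (eps * s))) <= C2 * S w / (eps * L w) ^ n" by meson
 show ?case
 proof (intro exI[of _ "C1 + C2"] conjI ballI allI impI)
  fix w eps assume w: "w \<in> W" and eps: "0 < eps" "eps <= 1" "c * eps <= r"
  define Q where "Q = S w / (eps * L w) ^ n"
  have Q: "0 <= Q" using S[OF w] L[OF w] eps by (simp add: Q_def)
  define P1 where "P1 = pairing c (\<theta> i) (\<lambda>s. A b1 w (eps * s))"
  define P2 where "P2 = pairing c (\<theta> i) (\<lambda>s. eps *\<^sub>R D w (eps * s))"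
  have "pairing c (\<theta> i) (\<lambda>s. A b w (eps * s)) =
   integral {-c..c} (\<lambda>s. (inverse eps *\<^sub>R (\<theta> i s *\<^sub>R (eps *\<^sub>R D w (eps * s))) + \<theta> i s *\<^sub>R A b1 w (eps * s)) * (1 / (\<i> * of_real (L w))))"
   using eps(1) by (intro integral_cong) (simp only: eq[OF w in_r[OF _ eps]] scaleR_quotient, simp)
  also have "\<dots> = (inverse eps *\<^sub>R P2 + P1) / (\<i> * of_real (L w))"
   unfolding integral_mult_left P1_def P2_def
   by (subst integral_add) (auto intro!: integrable_cmul dual_bv_integrable[OF bv[OF Suc.prems(2)]] cD[OF w eps] cs[OF w eps] simp del: scaleR_scaleR)
  also have "norm \<dots> <= (inverse eps * norm P2 + norm P1) / L w"
   unfolding norm_div_L[OF w] using L[OF w] eps by (intro divide_right_mono norm_triangle_le add_mono) auto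
  also have "\<dots> <= (inverse eps * (C2 * Q) + inverse eps * (C1 * Q)) / L w"
  proof -
   have "norm P1 <= 1 * (C1 * Q)" using C1(2)[OF w eps] by (simp add: P1_def Q_def)
   \<comment> \<open>Since \<open>eps \<le> 1\<close>, the remainder can carry the same factor
     \<open>1 / eps\<close> that scaling gives to the derivative part.\<close>
   also have "\<dots> <= inverse eps * (C1 * Q)" using eps C1 Q by (intro mult_right_mono) (auto simp: one_le_inverse)
   finally show ?thesis
    using C2(2)[OF w eps] L[OF w] eps by (intro divide_right_mono add_mono mult_left_mono) (auto simp: P2_def Q_def)
  qed
  also have "\<dots> = (C1 + C2) * S w / (eps * L w) ^ Suc n"
   using eps L[OF w] by (simp add: Q_def field_simps)
  finally show "norm (pairing c (\<theta> i) (\<lambda>s. A b w (eps * s))) <= (C1 + C2) * S w / (eps * L w) ^ Suc n" .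
 qed (use C1 C2 in auto)
qed

end

section \<open>Sums over the integer lattice\<close>

definition sup_norm :: "int \<times> int => real" where
 "sup_norm k = real_of_int (max \<bar>fst k\<bar> \<bar>snd k\<bar>)"

text \<open>The four sides of the square of radius \<open>R\<close>, parametrised by
  \<open>j\<close>. The corners belong to two sides, which only enlarges sums of nonnegative
  terms.\<close>

definition square_side :: "nat => int => int => int \<times> int" where
 "square_side e R j = (if e = 0 then (R, j) else if e = 1 then (- R, j) else if e = 2 then (j, R) else (j, - R))"

lemma sup_norm_square_side: "j \<in> {-R..R} ==> sup_norm (square_side e R j) = real_of_int R"
 by (auto simp: sup_norm_def square_side_def)

lemma lattice_sum_le_sides:
 fixes g :: "int \<times> int => real"
 assumes S: "finite S" "(0, 0) \<notin> S" and g: "\<And>k. 0 <= g k"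
 shows "\<exists>M. sum g S <= (\<Sum>R\<in>{1..M::nat}. \<Sum>e<4. \<Sum>j\<in>{- int R..int R}. g (square_side e (int R) j))"
proof -
 define N where "N k = nat (max \<bar>fst k\<bar> \<bar>snd k\<bar>)" for k :: "int \<times> int"
 define M where "M = Max (insert 0 (N ` S))"
 define I where "I = Sigma {1..M} (\<lambda>R. {..<4::nat} \<times> {- int R..int R})"
 define h where "h = (\<lambda>(R, e, j). square_side e (int R) j)"
 have fI: "finite I" by (simp add: I_def)
 have "S \<subseteq> h ` I"
 proof
  fix k assume k: "k \<in> S"
  obtain a b where ab: "k = (a, b)" by (cases k)
  have nz: "a \<noteq> 0 \<or> b \<noteq> 0" using k S(2) ab by auto
  have "N k <= M" unfolding M_def using k S(1) by (intro Max_ge) auto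
  moreover have "1 <= N k" using nz by (auto simp: N_def ab)
  ultimately have R: "N k \<in> {1..M}" by simp
  have "\<exists>e<4. \<exists>j\<in>{- int (N k)..int (N k)}. k = square_side e (int (N k)) j"
  proof -
   consider "\<bar>b\<bar> <= \<bar>a\<bar>" "0 <= a" | "\<bar>b\<bar> <= \<bar>a\<bar>" "a < 0" | "\<bar>a\<bar> < \<bar>b\<bar>" "0 <= b" | "\<bar>a\<bar> < \<bar>b\<bar>" "b < 0"
    by linarith
   then show ?thesis
   proof cases
    case 1 then show ?thesis by (intro exI[of _ 0] conjI bexI[of _ b]) (auto simp: N_def ab square_side_def)
   next
    case 2 then show ?thesis by (intro exI[of _ 1] conjI bexI[of _ b]) (auto simp: N_def ab square_side_def)
   next
    case 3 then show ?thesis by (intro exI[of _ 2] conjI bexI[of _ a]) (auto simp: N_def ab square_side_def)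
   next
    case 4 then show ?thesis by (intro exI[of _ 3] conjI bexI[of _ a]) (auto simp: N_def ab square_side_def)
   qed
  qed
  then obtain e j where "e < 4" "j \<in> {- int (N k)..int (N k)}" "k = square_side e (int (N k)) j" by blast
  then show "k \<in> h ` I"
   using R by (intro image_eqI[of _ _ "(N k, e, j)"]) (auto simp: h_def I_def)
 qed
 then have "sum g S <= sum g (h ` I)" using g fI by (intro sum_mono2) auto
 also have "\<dots> <= sum (g \<circ> h) I" using g fI by (intro sum_image_le) auto
 also have "\<dots> = (\<Sum>R\<in>{1..M}. \<Sum>e<4. \<Sum>j\<in>{- int R..int R}. g (square_side e (int R) j))"
 proof -
  have "sum (g \<circ> h) I = (\<Sum>(R, x)\<in>I. g (square_side (fst x) (int R) (snd x)))"
   by (simp add: h_def o_def split_def)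
  also have "\<dots> = (\<Sum>R\<in>{1..M}. \<Sum>x\<in>{..<4} \<times> {- int R..int R}. g (square_side (fst x) (int R) (snd x)))"
   unfolding I_def by (rule sum.Sigma[symmetric]) auto
  finally show ?thesis by (simp add: sum.cartesian_product split_def)
 qed
 finally show ?thesis by blast
qed

lemma sum_powr_bounded:
 assumes "s < -1"
 shows "\<exists>C\<ge>0. \<forall>M. (\<Sum>R\<in>{1..M::nat}. real R powr s) <= C"
proof -
 have s: "summable (\<lambda>n. real n powr s)" using assms by (simp add: summable_real_powr_iff)
 show ?thesis
  by (intro exI[of _ "\<Sum>n. real n powr s"] conjI allI sum_le_suminf suminf_nonneg s) auto
qed

text \<open>The square of radius \<open>R\<close> carries at most
  \<open>4 * (2 * R + 1) \<le> 12 * R\<close> lattice points, so a sum over the plane costs one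
  power of \<open>R\<close> more than a sum over the radii.\<close>

lemma lattice_sum_radial:
 assumes "0 < a"
 shows "\<exists>C\<ge>0. \<forall>S. finite S --> (0, 0) \<notin> S --> (\<Sum>k\<in>S. sup_norm k powr - (2 + a)) <= C"
proof -
 obtain C where C: "0 <= C" "\<And>M::nat. (\<Sum>R\<in>{1..M}. real R powr - (1 + a)) <= C"
  using sum_powr_bounded[of "- (1 + a)"] assms by auto
 show ?thesis
 proof (intro exI[of _ "12 * C"] conjI allI impI)
  fix S :: "(int \<times> int) set" assume "finite S" "(0, 0) \<notin> S"
  then obtain M where "(\<Sum>k\<in>S. sup_norm k powr - (2 + a)) <=
    (\<Sum>R\<in>{1..M::nat}. \<Sum>e<4. \<Sum>j\<in>{- int R..int R}. sup_norm (square_side e (int R) j) powr - (2 + a))"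
   using lattice_sum_le_sides[of S "\<lambda>k. sup_norm k powr - (2 + a)"] by auto
  also have "\<dots> = (\<Sum>R\<in>{1..M}. \<Sum>e<4::nat. \<Sum>j\<in>{- int R..int R}. real R powr - (2 + a))"
   by (intro sum.cong refl) (simp add: sup_norm_square_side)
  also have "\<dots> <= (\<Sum>R\<in>{1..M}. 12 * real R powr - (1 + a))"
  proof (intro sum_mono)
   fix R assume R: "R \<in> {1..M}"
   have "(\<Sum>e<4::nat. \<Sum>j\<in>{- int R..int R}. real R powr - (2 + a)) = 4 * ((2 * real R + 1) * real R powr - (2 + a))"
    by simp
   also have "\<dots> <= 4 * ((3 * real R) * real R powr - (2 + a))"
    using R by (intro mult_left_mono mult_right_mono) auto
   also have "real R * real R powr - (2 + a) = real R powr (1 + - (2 + a))"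
    using R by (subst powr_add) auto
   then have "4 * ((3 * real R) * real R powr - (2 + a)) = 12 * real R powr - (1 + a)"
    by (simp add: mult.assoc)
   finally show "(\<Sum>e<4::nat. \<Sum>j\<in>{- int R..int R}. real R powr - (2 + a)) <= 12 * real R powr - (1 + a)" .
  qed
  also have "\<dots> <= 12 * C" using C(2)[of M] by (simp flip: sum_distrib_left)
  finally show "(\<Sum>k\<in>S. sup_norm k powr - (2 + a)) <= 12 * C" .
 qed (use C in auto)
qed

text \<open>Along a side the form is affine in \<open>j\<close> with slope \<open>b\<close>. If
  \<open>\<bar>b\<bar> >= 1 / 2\<close>, its values spread out, and \<open>j0\<close> is the integer
  nearest to its zero, clipped to the side. Otherwise \<open>\<bar>a\<bar> > 3 / 4\<close>, the form
  is at least \<open>R / 4\<close> on the whole side, and \<open>j0 = 0\<close> serves.\<close>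

lemma linear_form_spacing:
 fixes a b :: real and R :: int
 assumes ab: "a\<^sup>2 + b\<^sup>2 = 1" and R: "0 <= R"
 shows "\<exists>j0\<in>{-R..R}. \<forall>j\<in>{-R..R}. j \<noteq> j0 --> \<bar>real_of_int (j - j0)\<bar> / 4 <= \<bar>a * of_int R + b * of_int j\<bar>"
proof (cases "\<bar>b\<bar> < 1/2")
 case True
 then have "b\<^sup>2 < (1/2)\<^sup>2" by (metis abs_ge_zero power2_abs power_strict_mono zero_less_numeral)
 then have "(3/4)\<^sup>2 < a\<^sup>2" using ab by (simp add: power2_eq_square)
 then have a: "3/4 < \<bar>a\<bar>" by (metis abs_ge_zero power2_abs power_less_imp_less_base)
 show ?thesis
 proof (rule bexI[of _ 0], intro ballI impI)
  fix j assume j: "j \<in> {-R..R}"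
  then have jR: "\<bar>real_of_int j\<bar> <= of_int R" by auto
  have "\<bar>b * of_int j\<bar> <= 1/2 * of_int R" unfolding abs_mult using True jR by (intro mult_mono) auto
  moreover have "3/4 * of_int R <= \<bar>a * of_int R\<bar>" unfolding abs_mult using a R by (intro mult_mono) auto
  ultimately have "\<bar>real_of_int j\<bar> / 4 <= \<bar>a * of_int R + b * of_int j\<bar>" using jR by linarith
  then show "\<bar>real_of_int (j - 0)\<bar> / 4 <= \<bar>a * of_int R + b * of_int j\<bar>" by simp
 qed (use R in auto)
next
 case False
 define x where "x = - (a * of_int R / b)"
 have b0: "b \<noteq> 0" using False by auto
 have eq: "\<bar>a * of_int R + b * of_int j\<bar> = \<bar>b\<bar> * \<bar>of_int j - x\<bar>" for j
  using b0 by (simp add: x_def flip: abs_mult) (simp add: algebra_simps)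
 define j0 where "j0 = max (-R) (min R (round x))"
 have rx: "\<bar>of_int (round x) - x\<bar> <= 1/2" by (rule of_int_round_abs_le)
 show ?thesis
 proof (rule bexI[of _ j0], intro ballI impI)
  fix j assume j: "j \<in> {-R..R}" "j \<noteq> j0"
  \<comment> \<open>Rounding moves \<open>x\<close> by at most \<open>1 / 2\<close> while
    \<open>j\<close> and \<open>j0\<close> differ by at least one, which costs half of the distance.
    If rounding leaves the side, then \<open>x\<close> lies beyond its end
    \<open>j0\<close>.\<close>
  have "\<bar>real_of_int (j - j0)\<bar> / 2 <= \<bar>of_int j - x\<bar>"
  proof -
   consider "round x < -R" | "R < round x" | "round x \<in> {-R..R}"
    by fastforce
   then show ?thesis
   proof cases
    case 1
    then have j0: "j0 = - R" using R by (auto simp: j0_def)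
    have e: "\<bar>real_of_int (j - j0)\<bar> = real_of_int j + of_int R" using j j0 by auto
    have 1: "0 <= real_of_int j + of_int R" using j by auto
    have "real_of_int (round x) <= real_of_int (- R - 1)" using \<open>round x < - R\<close> by (subst of_int_le_iff) simp
    then have "of_int (round x) <= - real_of_int R - 1" by simp
    moreover have "x <= of_int (round x) + 1/2" using rx unfolding abs_le_iff by linarith
    ultimately have "x <= - real_of_int R - 1/2" by linarith
    then have "(real_of_int j + of_int R) / 2 <= of_int j - x" using 1 by (simp add: field_simps)
    then show ?thesis unfolding e by (rule order_trans[OF _ abs_ge_self])
   next
    case 2
    then have j0: "j0 = R" using R by (auto simp: j0_def)
    have e: "\<bar>real_of_int (j - j0)\<bar> = of_int R - real_of_int j" using j j0 by auto
    have 1: "0 <= of_int R - real_of_int j" using j by auto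
    have "real_of_int (R + 1) <= real_of_int (round x)" using \<open>R < round x\<close> by (subst of_int_le_iff) simp
    then have "real_of_int R + 1 <= of_int (round x)" by simp
    moreover have "of_int (round x) - 1/2 <= x" using rx unfolding abs_le_iff by linarith
    ultimately have "real_of_int R + 1/2 <= x" by linarith
    then have "(of_int R - real_of_int j) / 2 <= - (of_int j - x)" using 1 by (simp add: field_simps)
    then show ?thesis unfolding e by (rule order_trans[OF _ abs_ge_minus_self])
   next
    case 3
    then have "j0 = round x" by (auto simp: j0_def)
    have "1 <= \<bar>j - j0\<bar>" using j by simp
    then have "1 <= \<bar>real_of_int (j - j0)\<bar>" by linarith
    then show ?thesis using rx \<open>j0 = round x\<close> by (auto simp: abs_if split: if_splits)
   qed
  qed
  then have "1/2 * (\<bar>real_of_int (j - j0)\<bar> / 2) <= \<bar>b\<bar> * \<bar>of_int j - x\<bar>"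
   using False by (intro mult_mono) auto
  then show "\<bar>real_of_int (j - j0)\<bar> / 4 <= \<bar>a * of_int R + b * of_int j\<bar>" by (simp add: eq)
 qed (use R in \<open>auto simp: j0_def\<close>)
qed

text \<open>Each term is at most the increment of \<open>2 * sqrt\<close> over the preceding unit
  step, by \<open>2 * x * y <= x * x + y * y\<close> for the two roots.\<close>

lemma sum_inverse_sqrt: "(\<Sum>i\<in>{1..n::nat}. 1 / sqrt (real i)) <= 2 * sqrt (real n)"
proof (induction n)
 case (Suc n)
 define x where "x = sqrt (real n)"
 define y where "y = sqrt (real (Suc n))"
 have xy: "0 <= x" "0 < y" "x <= y" "y * y = x * x + 1" by (auto simp: x_def y_def)
 have "2 * x * y <= x * x + y * y" using sum_squares_bound[of x y] by (simp add: power2_eq_square)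
 then have "(2 * x + 1 / y) * y <= 2 * y * y" using xy by (simp add: distrib_right)
 then have "2 * x + 1 / y <= 2 * y" using xy(2) mult_le_cancel_right_pos by blast
 then show ?case using Suc.IH by (simp add: x_def y_def)
qed simp

lemma sum_inverse_sqrt_shift:
 assumes "j0 \<in> {-R..R}"
 shows "(\<Sum>j\<in>{-R..R} - {j0}. 1 / sqrt \<bar>real_of_int (j - j0)\<bar>) <= 4 * sqrt (2 * real_of_int R)"
proof -
 have R: "0 <= R" using assms by auto
 have "(\<Sum>j\<in>{-R..R} - {j0}. 1 / sqrt \<bar>real_of_int (j - j0)\<bar>) <=
   (\<Sum>j\<in>(\<lambda>i. j0 + int i) ` {1..nat (2 * R)} \<union> (\<lambda>i. j0 - int i) ` {1..nat (2 * R)}. 1 / sqrt \<bar>real_of_int (j - j0)\<bar>)"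
 proof (rule sum_mono2)
  show "{-R..R} - {j0} \<subseteq> (\<lambda>i. j0 + int i) ` {1..nat (2 * R)} \<union> (\<lambda>i. j0 - int i) ` {1..nat (2 * R)}"
  proof
   fix j assume j: "j \<in> {-R..R} - {j0}"
   show "j \<in> (\<lambda>i. j0 + int i) ` {1..nat (2 * R)} \<union> (\<lambda>i. j0 - int i) ` {1..nat (2 * R)}"
   proof (cases "j0 < j")
    case True
    then show ?thesis using j assms by (intro UnI1 image_eqI[of _ _ "nat (j - j0)"]) auto
   next
    case False
    then show ?thesis using j assms by (intro UnI2 image_eqI[of _ _ "nat (j0 - j)"]) auto
   qed
  qed
 qed auto
 also have "\<dots> <= (\<Sum>j\<in>(\<lambda>i. j0 + int i) ` {1..nat (2 * R)}. 1 / sqrt \<bar>real_of_int (j - j0)\<bar>) +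
   (\<Sum>j\<in>(\<lambda>i. j0 - int i) ` {1..nat (2 * R)}. 1 / sqrt \<bar>real_of_int (j - j0)\<bar>)"
  by (subst sum_Un) (auto intro!: sum_nonneg)
 also have "\<dots> = (\<Sum>i\<in>{1..nat (2 * R)}. 1 / sqrt (real i)) + (\<Sum>i\<in>{1..nat (2 * R)}. 1 / sqrt (real i))"
  by (subst (1 2) sum.reindex) (auto simp: inj_on_def)
 also have "\<dots> <= 4 * sqrt (real (nat (2 * R)))" using sum_inverse_sqrt[of "nat (2 * R)"] by simp
 finally show ?thesis using R by simp
qed

text \<open>On each side of the square of radius \<open>R\<close> one point \<open>j0\<close> may
  nearly annihilate the form; there the isotropic bound and the weight \<open>1 / R\<close> give
  \<open>h powr p * R powr - (1 + p)\<close>. At the other points the directional bound leads to a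
  sum of inverse square roots, of order \<open>sqrt R\<close>, and the weight
  \<open>K / R\<^sup>2\<close> makes it \<open>K * sqrt h * R powr - (3/2)\<close>. Both are
  summable over \<open>R\<close>.\<close>

lemma directional_lattice_sum:
 assumes p: "0 < p"
 shows "\<exists>C\<ge>0. \<forall>a b h K m w S. a\<^sup>2 + b\<^sup>2 = 1 --> 0 < h --> 0 <= K --> finite S --> (0, 0) \<notin> S -->
  (\<forall>k\<in>S. 0 <= m k \<and> m k <= (h / sup_norm k) powr p \<and> m k * sqrt \<bar>a * of_int (fst k) + b * of_int (snd k)\<bar> <= sqrt h) -->
  (\<forall>k\<in>S. 0 <= w k \<and> w k <= 1 / sup_norm k \<and> w k <= K / (sup_norm k)\<^sup>2) -->
  (\<Sum>k\<in>S. m k * w k) <= C * (h powr p + K * sqrt h)"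
proof -
 obtain C1 where C1: "0 <= C1" "\<And>M::nat. (\<Sum>R\<in>{1..M}. real R powr - (1 + p)) <= C1"
  using sum_powr_bounded[of "- (1 + p)"] p by auto
 obtain C2 where C2: "0 <= C2" "\<And>M::nat. (\<Sum>R\<in>{1..M}. real R powr - (3/2)) <= C2"
  using sum_powr_bounded[of "- (3/2)"] by auto
 show ?thesis
 proof (intro exI[of _ "4 * C1 + 64 * C2"] conjI allI impI)
  fix a b h K :: real and m w S
  assume ab: "a\<^sup>2 + b\<^sup>2 = 1" and h: "0 < h" and K: "0 <= K" and S: "finite S" "(0, 0) \<notin> S"
   and m: "\<forall>k\<in>S. 0 <= m k \<and> m k <= (h / sup_norm k) powr p \<and> m k * sqrt \<bar>a * of_int (fst k) + b * of_int (snd k)\<bar> <= sqrt h"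
   and w: "\<forall>k\<in>S. 0 <= w k \<and> w k <= 1 / sup_norm k \<and> w k <= K / (sup_norm k)\<^sup>2"
  define g where "g k = (if k \<in> S then m k * w k else 0)" for k
  have g0: "0 <= g k" for k using m w by (auto simp: g_def)
  have side: "(\<Sum>j\<in>{-int R..int R}. g (square_side e (int R) j)) <=
    h powr p * real R powr - (1 + p) + 16 * K * sqrt h * real R powr - (3/2)"
   if R: "1 <= R" for R e
  proof -
   define a' where "a' = (if e = 0 then a else if e = 1 then - a else if e = 2 then b else - b)"
   define b' where "b' = (if e = 0 \<or> e = 1 then b else a)"
   have ab': "a'\<^sup>2 + b'\<^sup>2 = 1" using ab by (auto simp: a'_def b'_def)
   have form: "a * of_int (fst (square_side e (int R) j)) + b * of_int (snd (square_side e (int R) j)) =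
     a' * of_int (int R) + b' * of_int j" for j
    by (auto simp: a'_def b'_def square_side_def)
   obtain j0 where j0: "j0 \<in> {-int R..int R}"
    and sp: "\<And>j. j \<in> {-int R..int R} ==> j \<noteq> j0 ==> \<bar>real_of_int (j - j0)\<bar> / 4 <= \<bar>a' * of_int (int R) + b' * of_int j\<bar>"
    using linear_form_spacing[OF ab', of "int R"] by auto
   have "(\<Sum>j\<in>{-int R..int R}. g (square_side e (int R) j)) =
     g (square_side e (int R) j0) + (\<Sum>j\<in>{-int R..int R} - {j0}. g (square_side e (int R) j))"
    using j0 by (intro sum.remove) auto
   also have "g (square_side e (int R) j0) <= h powr p * real R powr - (1 + p)"
   proof (cases "square_side e (int R) j0 \<in> S")
    case True
    have "m (square_side e (int R) j0) * w (square_side e (int R) j0) <= (h / real R) powr p * (1 / real R)"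
     using m w True sup_norm_square_side[OF j0, of e] by (intro mult_mono) fastforce+
    also have "\<dots> = h powr p * (real R powr - p * real R powr - 1)"
    proof -
     have "(h / real R) powr p = h powr p / real R powr p" using R h by (simp add: powr_divide)
     then show ?thesis using R by (simp add: powr_minus divide_inverse)
    qed
    also have "\<dots> = h powr p * real R powr - (1 + p)"
     by (simp only: powr_add[symmetric]) (simp add: algebra_simps)
    finally show ?thesis using True by (simp add: g_def)
   qed (use h in \<open>simp add: g_def\<close>)
   also have "(\<Sum>j\<in>{-int R..int R} - {j0}. g (square_side e (int R) j)) <=
     (\<Sum>j\<in>{-int R..int R} - {j0}. K / (real R)\<^sup>2 * (2 * sqrt h) * (1 / sqrt \<bar>real_of_int (j - j0)\<bar>))"
   proof (rule sum_mono)
    fix j assume j: "j \<in> {-int R..int R} - {j0}"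
    let ?k = "square_side e (int R) j"
    show "g ?k <= K / (real R)\<^sup>2 * (2 * sqrt h) * (1 / sqrt \<bar>real_of_int (j - j0)\<bar>)"
    proof (cases "?k \<in> S")
     case True
     define u where "u = \<bar>real_of_int (j - j0)\<bar>"
     have u: "0 < u" using j by (auto simp: u_def)
     have "m ?k * sqrt (u / 4) <= m ?k * sqrt \<bar>a * of_int (fst ?k) + b * of_int (snd ?k)\<bar>"
      unfolding form using sp[of j] j m True by (intro mult_left_mono) (auto simp: u_def)
     also have "\<dots> <= sqrt h" using m True by blast
     finally have "m ?k * (sqrt u / 2) <= sqrt h" by (simp add: real_sqrt_divide)
     then have "m ?k <= 2 * sqrt h * (1 / sqrt u)" using u by (simp add: field_simps)
     moreover have "w ?k <= K / (real R)\<^sup>2" using w True sup_norm_square_side[of j "int R" e] j by force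
     ultimately have "m ?k * w ?k <= (2 * sqrt h * (1 / sqrt u)) * (K / (real R)\<^sup>2)"
      using m w True h u by (intro mult_mono) auto
     then show ?thesis using True by (simp add: g_def u_def mult_ac)
    qed (use K h in \<open>simp add: g_def\<close>)
   qed
   also have "\<dots> <= K / (real R)\<^sup>2 * (2 * sqrt h) * (4 * sqrt (2 * real_of_int (int R)))"
    unfolding sum_distrib_left[symmetric] using K h
    by (intro mult_left_mono sum_inverse_sqrt_shift j0) auto
   also have "\<dots> <= K / (real R)\<^sup>2 * (2 * sqrt h) * (8 * sqrt (real R))"
   proof -
    have "sqrt (2::real) <= 2" using real_sqrt_le_mono[of 2 4] by simp
    then have "4 * sqrt (2 * real R) <= 8 * sqrt (real R)"
     unfolding real_sqrt_mult using mult_right_mono[of "sqrt 2" 2 "sqrt (real R)"] by (simp add: mult.commute)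
    then show ?thesis using K h by (intro mult_left_mono) auto
   qed
   also have "\<dots> = 16 * K * sqrt h * (real R powr - 2 * real R powr (1/2))"
   proof -
    have "real R powr - 2 = 1 / (real R)\<^sup>2" using R by (simp add: powr_minus_divide)
    moreover have "real R powr (1/2) = sqrt (real R)" by (simp add: powr_half_sqrt)
    ultimately show ?thesis by (simp only:) simp
   qed
   also have "\<dots> = 16 * K * sqrt h * real R powr - (3/2)" by (simp only: powr_add[symmetric]) simp
   finally show ?thesis by simp
  qed
  obtain M where "sum g S <= (\<Sum>R\<in>{1..M::nat}. \<Sum>e<4. \<Sum>j\<in>{- int R..int R}. g (square_side e (int R) j))"
   using lattice_sum_le_sides[of S g, OF S g0] by blast
  also have "\<dots> <= (\<Sum>R\<in>{1..M::nat}. \<Sum>e<4::nat. h powr p * real R powr - (1 + p) + 16 * K * sqrt h * real R powr - (3/2))"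
   by (intro sum_mono side) auto
  also have "\<dots> = 4 * (h powr p * (\<Sum>R\<in>{1..M}. real R powr - (1 + p))) + 64 * K * sqrt h * (\<Sum>R\<in>{1..M}. real R powr - (3/2))"
   by (simp add: sum.distrib sum_distrib_left algebra_simps)
  also have "\<dots> <= 4 * (h powr p * C1) + 64 * K * sqrt h * C2"
   using C1(2)[of M] C2(2)[of M] K h by (intro add_mono mult_left_mono) auto
  also have "\<dots> <= (4 * C1 + 64 * C2) * (h powr p + K * sqrt h)"
  proof -
   have "0 <= C1 * (K * sqrt h)" "0 <= C2 * h powr p" using C1 C2 K h by auto
   then show ?thesis by (simp add: algebra_simps)
  qed
  finally show "(\<Sum>k\<in>S. m k * w k) <= (4 * C1 + 64 * C2) * (h powr p + K * sqrt h)"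
   by (simp add: g_def cong: sum.cong)
 qed (use C1 C2 in auto)
qed

section \<open>Weight profiles\<close>

lemma piecewise_C1_Lipschitz_ex:
 assumes "piecewise_C1 \<psi>" "a <= b"
 shows "\<exists>F M. finite F \<and> 0 <= M \<and>
  (\<forall>x y. a <= x --> x <= y --> y <= b --> {x..y} \<inter> F = {} --> \<bar>\<psi> y - \<psi> x\<bar> <= M * (y - x))"
 by (rule piecewise_C1_Lipschitz[OF assms]) blast

lemma piecewise_C1_isCont_ex:
 assumes "piecewise_C1 \<psi>"
 shows "\<exists>F. finite F \<and> (\<forall>u v. u < v --> {u<..<v} \<inter> F = {} --> (\<forall>s\<in>{u<..<v}. isCont \<psi> s))"
proof (rule piecewise_C1_Lipschitz[OF assms order_refl[of 0]])
 fix F assume "finite F" "\<And>u v. u < v ==> {u<..<v} \<inter> F = {} ==> \<forall>s\<in>{u<..<v}. isCont \<psi> s"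
 then show ?thesis by (intro exI[of _ F]) simp
qed

lemma weight_profile_support:
 assumes "weight_profile q \<theta>" "1 < \<bar>s\<bar>"
 shows "\<theta> s = 0"
proof (rule ccontr)
 assume "\<theta> s \<noteq> 0"
 then have "s \<in> closure {s. \<theta> s \<noteq> 0}" by (intro subsetD[OF closure_subset]) simp
 then show False using assms by (auto simp: weight_profile_def)
qed

lemma integral_parts_vanishing_ends:
 fixes u v :: "real => real" and X X' :: "real => complex"
 assumes E: "finite E" and ab: "a <= b" and du: "\<And>s. s \<notin> E ==> (u has_real_derivative v s) (at s)"
  and cu: "continuous_on UNIV u" and u0: "u a = 0" "u b = 0"
  and X: "\<And>t. t \<in> {a..b} ==> (X has_vector_derivative X' t) (at t within {a..b})"
  and cX': "continuous_on {a..b} X'"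
 shows "integral {a..b} (\<lambda>t. u t *\<^sub>R X' t) = - integral {a..b} (\<lambda>t. v t *\<^sub>R X t)"
proof -
 have cX: "continuous_on {a..b} X"
  unfolding continuous_on_eq_continuous_within using X has_vector_derivative_continuous by blast
 have cu': "continuous_on {a..b} u" using cu by (rule continuous_on_subset) simp
 have "((\<lambda>t. u t *\<^sub>R X' t + v t *\<^sub>R X t) has_integral (u b *\<^sub>R X b - u a *\<^sub>R X a)) {a..b}"
 proof (rule fundamental_theorem_of_calculus_interior_strong[OF E ab])
  fix t assume t: "t \<in> {a<..<b} - E"
  have "(X has_vector_derivative X' t) (at t)"
   using X[of t] t at_within_interior[of t "{a..b}"] by (simp only: interior_atLeastAtMost_real) auto
  then show "((\<lambda>t. u t *\<^sub>R X t) has_vector_derivative (u t *\<^sub>R X' t + v t *\<^sub>R X t)) (at t)"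
   using du t by (intro has_vector_derivative_scaleR) auto
 qed (intro continuous_intros cu' cX)
 then have "((\<lambda>t. u t *\<^sub>R X' t + v t *\<^sub>R X t) has_integral 0) {a..b}" using u0 by simp
 moreover have i: "(\<lambda>t. u t *\<^sub>R X' t) integrable_on {a..b}"
  by (intro integrable_continuous_real continuous_intros cu' cX')
 ultimately have "((\<lambda>t. (u t *\<^sub>R X' t + v t *\<^sub>R X t) - u t *\<^sub>R X' t) has_integral (0 - integral {a..b} (\<lambda>t. u t *\<^sub>R X' t))) {a..b}"
  by (intro has_integral_diff integrable_integral)
 then show ?thesis by (simp add: integral_unique)
qed

text \<open>On \<open>{-2..2}\<close> the derivatives of order below \<open>q\<close> vanish at the
  ends, so that integration by parts has no boundary terms, and jumps at \<open>1\<close> and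
  \<open>-1\<close> lie in the interior. For \<open>q >= 1\<close> the chain ends with the piecewise
  C1 function \<open>\<psi>\<close>.\<close>

lemma weight_profile_chain:
 assumes wp: "weight_profile q \<theta>"
 obtains T V where "T 0 = \<theta>" "\<And>i. i <= q ==> dual_bv (T i) (-2) 2 V"
  "\<And>i (X :: real => complex) X'. i < q ==>
    (\<And>t. t \<in> {-2..2} ==> (X has_vector_derivative X' t) (at t within {-2..2})) ==> continuous_on {-2..2} X' ==>
    pairing 2 (T i) X' = - pairing 2 (T (Suc i)) X"
  "1 <= q ==> continuous_on UNIV \<theta>"
proof (cases "q = 0")
 case True
 then have "piecewise_C1 \<theta>" using wp by (simp add: weight_profile_def)
 then obtain V where "dual_bv \<theta> (-2) 2 V" using piecewise_C1_dual_bv[of \<theta> "-2" 2] by auto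
 then show ?thesis using True by (intro that[of "\<lambda>_. \<theta>" V]) auto
next
 case False
 obtain n where q: "q = Suc n" using False by (cases q) auto
 have "Ck_on n UNIV \<theta>" using wp by (simp add: weight_profile_def q)
 then obtain D where D0: "\<And>x. D 0 x = \<theta> x" and D: "\<And>j x. j < n ==> (D j has_vector_derivative D (Suc j) x) (at x)"
  and cDn: "continuous_on UNIV (D n)"
  unfolding Ck_on_def by (metis UNIV_I)
 obtain \<psi> E where E: "finite E" and \<psi>: "\<And>s. s \<notin> E ==> ((deriv ^^ n) \<theta> has_real_derivative \<psi> s) (at s)"
  and pC1: "piecewise_C1 \<psi>"
  using wp unfolding weight_profile_def by (auto simp: q)
 have D0': "D 0 = \<theta>" using D0 by auto
 have dn: "(deriv ^^ j) \<theta> = D j" if "j <= n" for j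
  using that
 proof (induction j)
  case (Suc j)
  then have "(deriv ^^ Suc j) \<theta> = deriv (D j)" by simp
  also have "\<dots> = D (Suc j)"
   using D[of j] Suc.prems by (auto intro!: DERIV_imp_deriv simp: has_real_derivative_iff_has_vector_derivative)
  finally show ?case .
 qed (simp add: D0')
 have zero: "D j s = 0" if "j <= n" "1 < \<bar>s\<bar>" for j s
  using that
 proof (induction j arbitrary: s)
  case 0 then show ?case using weight_profile_support[OF wp] D0 by simp
 next
  case (Suc j)
  have "open {s :: real. 1 < \<bar>s\<bar>}" by (intro open_Collect_less continuous_intros)
  moreover have "D j t = 0" if "t \<in> {s. 1 < \<bar>s\<bar>}" for t using Suc.IH[of t] Suc.prems that by simp
  ultimately have "(D j has_vector_derivative 0) (at s)"
   using Suc.prems has_vector_derivative_transform_within_open[OF has_vector_derivative_const[of 0 "at s"], of "{s. 1 < \<bar>s\<bar>}" "D j"]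
   by simp
  moreover have "(D j has_vector_derivative D (Suc j) s) (at s)" using D Suc.prems by simp
  ultimately show ?case by (rule vector_derivative_unique_at[symmetric])
 qed
 have cont: "continuous_on UNIV (D j)" if "j <= n" for j
 proof (cases "j = n")
  case False
  then have "j < n" using that by simp
  then show ?thesis
   by (intro continuous_at_imp_continuous_on ballI has_vector_derivative_continuous[OF D])
 qed (use cDn in simp)
 define T where "T i = (if i = q then \<psi> else D i)" for i
 have dT: "\<exists>E. finite E \<and> (\<forall>s. s \<notin> E --> (T i has_real_derivative T (Suc i) s) (at s))" if "i < q" for i
 proof (cases "i = n")
  case True
  then show ?thesis using E \<psi> dn[of n] by (intro exI[of _ E]) (simp add: T_def q)
 next
  case False
  then show ?thesis using D[of i] that
   by (intro exI[of _ "{}"]) (simp add: T_def q has_real_derivative_iff_has_vector_derivative)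
 qed
 have parts: "pairing 2 (T i) X' = - pairing 2 (T (Suc i)) X"
  if i: "i < q" and "\<And>t. t \<in> {-2..2} ==> (X has_vector_derivative X' t) (at t within {-2..2})"
   "continuous_on {-2..2} X'" for i and X X' :: "real => complex"
 proof -
  obtain F where "finite F" "\<And>s. s \<notin> F ==> (T i has_real_derivative T (Suc i) s) (at s)" using dT[OF i] by blast
  then show ?thesis
   using that cont[of i] zero[of i] by (intro integral_parts_vanishing_ends[of F]) (auto simp: T_def q)
 qed
 \<comment> \<open>Downward induction in \<open>i\<close>: integration by parts turns the variation
   of \<open>T i\<close> into the mass of \<open>T (Suc i)\<close>, and the last member
   \<open>\<psi>\<close> is piecewise C1.\<close>
 have bv: "\<exists>V. dual_bv (T i) (-2) 2 V" if "i <= q" for i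
  using that
 proof (induction "q - i" arbitrary: i)
  case 0
  then have "T i = \<psi>" by (simp add: T_def)
  then show ?case using piecewise_C1_dual_bv[OF pC1, of "-2" 2] by simp
 next
  case (Suc k)
  then have i: "i < q" by simp
  have "k = q - Suc i" using Suc.hyps(2) by simp
  then obtain V where V: "dual_bv (T (Suc i)) (-2) 2 V" using Suc.hyps(1)[of "Suc i"] i by auto
  have cT: "continuous_on {-2..2} (T i)"
   using cont[of i] i by (auto simp: T_def q intro: continuous_on_subset)
  then have "bounded (T i ` {-2..2})" by (intro compact_imp_bounded compact_continuous_image) auto
  then obtain C where C: "0 < C" "\<forall>t\<in>{-2..2}. \<bar>T i t\<bar> <= C" by (auto simp: bounded_pos)
  \<comment> \<open>\<open>4 * C\<close> bounds the mass over an interval of length four, and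
    \<open>V\<close> the variation.\<close>
  have "dual_bv (T i) (-2) 2 (4 * C + V)"
   unfolding dual_bv_def
  proof (intro conjI allI impI)
   show "0 <= 4 * C + V" using C dual_bv_nonneg[OF V] by simp
  next
   fix X :: "real => complex" and s assume X: "continuous_on {-2..2} X" "\<forall>t\<in>{-2..2}. norm (X t) <= s"
   have s: "0 <= s" using order_trans[OF norm_ge_zero bspec[OF X(2), of 0]] by simp
   show "(\<lambda>t. T i t *\<^sub>R X t) integrable_on {-2..2}"
    by (intro integrable_continuous_real continuous_intros cT X)
   have "norm (pairing 2 (T i) X) <= C * s * (2 - - 2)"
    using C X by (intro integral_bound continuous_intros cT) (auto intro!: mult_mono)
   then show "norm (pairing 2 (T i) X) <= (4 * C + V) * s"
    using mult_nonneg_nonneg[OF dual_bv_nonneg[OF V] s] by (simp add: algebra_simps)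
  next
   fix X X' :: "real => complex" and s
   assume d: "\<forall>t\<in>{-2..2}. (X has_vector_derivative X' t) (at t within {-2..2})"
    and X: "continuous_on {-2..2} X'" "\<forall>t\<in>{-2..2}. norm (X t) <= s"
   have s: "0 <= s" using order_trans[OF norm_ge_zero bspec[OF X(2), of 0]] by simp
   have cX: "continuous_on {-2..2} X"
    unfolding continuous_on_eq_continuous_within using d has_vector_derivative_continuous by blast
   have "norm (pairing 2 (T (Suc i)) X) <= V * s"
    by (rule dual_bvD[OF V cX]) (use X in auto)
   moreover have "pairing 2 (T i) X' = - pairing 2 (T (Suc i)) X"
    using d X by (intro parts i) auto
   ultimately show "norm (pairing 2 (T i) X') <= (4 * C + V) * s"
    using C s by (simp add: distrib_right) (smt (verit) mult_nonneg_nonneg)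
  qed
  then show ?case by blast
 qed
 then obtain Vf where Vf: "\<And>i. i <= q ==> dual_bv (T i) (-2) 2 (Vf i)" by metis
 have "dual_bv (T i) (-2) 2 (\<Sum>i\<le>q. Vf i)" if "i <= q" for i
  by (rule dual_bv_mono[OF Vf[OF that]]) (auto intro!: member_le_sum dual_bv_nonneg[OF Vf] simp: that)
 moreover have "T 0 = \<theta>" using D0' by (simp add: T_def q)
 moreover have "continuous_on UNIV \<theta>" using cont[of 0] D0' by simp
 ultimately show ?thesis using parts that[of T "\<Sum>i\<le>q. Vf i"] by blast
qed

lemma dual_bv_real_integrable:
 assumes "dual_bv \<psi> a b V"
 shows "\<psi> integrable_on {a..b}"
proof -
 have "(\<lambda>t. \<psi> t *\<^sub>R (1::complex)) integrable_on {a..b}" by (rule dual_bv_integrable[OF assms]) simp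
 from integrable_linear[OF this bounded_linear_Re] show ?thesis by (simp add: o_def)
qed

lemma scaled_weight_integral:
 fixes X :: "real => 'a::banach"
 assumes "0 < eps" "(\<lambda>s. \<theta> s *\<^sub>R X (eps * s)) integrable_on {a..b}"
 shows "((\<lambda>\<eta>. scaled_weight \<theta> eps \<eta> *\<^sub>R X \<eta>) has_integral integral {a..b} (\<lambda>s. \<theta> s *\<^sub>R X (eps * s))) {a * eps..b * eps}"
proof -
 let ?i = "integral {a..b} (\<lambda>s. \<theta> s *\<^sub>R X (eps * s))"
 have "((\<lambda>\<eta>. \<theta> (1 / eps * \<eta>) *\<^sub>R X (eps * (1 / eps * \<eta>))) has_integral (1 / \<bar>1 / eps\<bar>) *\<^sub>R ?i) ((\<lambda>x. x / (1 / eps)) ` {a..b})"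
  using assms by (intro has_integral_stretch_real integrable_integral) auto
 moreover have "(\<lambda>x. x / (1 / eps)) ` {a..b} = {a * eps..b * eps}"
 proof (intro set_eqI iffI)
  fix y assume "y \<in> {a * eps..b * eps}"
  then show "y \<in> (\<lambda>x. x / (1 / eps)) ` {a..b}"
   using assms(1) by (intro image_eqI[of _ _ "y / eps"]) (auto simp: field_simps)
 qed (use assms(1) in auto)
 ultimately have "((\<lambda>\<eta>. \<theta> (\<eta> / eps) *\<^sub>R X \<eta>) has_integral eps *\<^sub>R ?i) {a * eps..b * eps}"
  using assms(1) by simp
 from has_integral_cmul[OF this, of "inverse eps"] show ?thesis
  using assms(1) by (simp add: scaled_weight_def divide_inverse mult_ac)
qed

lemma integral_scaled_weight:
 assumes wp: "weight_profile q \<theta>" and eps: "0 < eps" "2 * eps <= c"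
 shows "integral {-c..c} (scaled_weight \<theta> eps) = 1"
proof -
 have "(\<theta> has_integral 1) {-1..1}" using wp by (simp add: weight_profile_def)
 then have "(\<theta> has_integral 1) {-2..2}"
  by (rule has_integral_on_superset) (use weight_profile_support[OF wp] in auto)
 then have i2: "integral {-2..2} \<theta> = 1" "\<theta> integrable_on {-2..2}" by auto
 have "(scaled_weight \<theta> eps has_integral 1) {-2 * eps..2 * eps}"
  using scaled_weight_integral[where X = "\<lambda>_. 1 :: real" and \<theta> = \<theta> and a = "-2" and b = 2, OF eps(1)] i2 by simp
 then have "(scaled_weight \<theta> eps has_integral 1) {-c..c}"
 proof (rule has_integral_on_superset)
  show "scaled_weight \<theta> eps x = 0" if "x \<notin> {-2 * eps..2 * eps}" for x
   using that weight_profile_support[OF wp, of "x / eps"] eps by (auto simp: scaled_weight_def abs_divide less_divide_eq)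
 qed (use eps in auto)
 then show ?thesis by (rule integral_unique)
qed

text \<open>Scaling preserves the mass, whereas undoing the chain rule in the variation costs
  \<open>1 / eps\<close>. The single constant \<open>V / eps\<close> covers both because
  \<open>eps \<le> 1\<close>.\<close>

lemma dual_bv_scaled_weight:
 assumes bv: "dual_bv \<theta> (-c) c V" and c: "0 < c" and eps: "0 < eps" "eps <= 1"
 shows "dual_bv (scaled_weight \<theta> eps) (- (c * eps)) (c * eps) (V / eps)"
proof -
 have V: "0 <= V" using bv by (rule dual_bv_nonneg)
 have in_r: "eps * s \<in> {- (c * eps)..c * eps}" if "s \<in> {-c..c}" for s
 proof -
  have "\<bar>eps * s\<bar> <= eps * c" using that eps by (auto simp: abs_mult intro!: mult_left_mono)
  then have "\<bar>eps * s\<bar> <= c * eps" by (simp add: mult.commute)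
  then show ?thesis by (simp add: abs_le_iff)
 qed
 have cc: "continuous_on {-c..c} (\<lambda>s. X (eps * s))" if "continuous_on {- (c * eps)..c * eps} X" for X :: "real => complex"
  by (intro continuous_on_compose2[OF that] continuous_intros) (use in_r in auto)
 have hi: "((\<lambda>\<eta>. scaled_weight \<theta> eps \<eta> *\<^sub>R X \<eta>) has_integral pairing c \<theta> (\<lambda>s. X (eps * s))) {- (c * eps)..c * eps}"
  if "continuous_on {- (c * eps)..c * eps} X" for X :: "real => complex"
  using scaled_weight_integral[OF eps(1) dual_bv_integrable[OF bv cc[OF that]]] by simp
 show ?thesis
  unfolding dual_bv_def
 proof (intro conjI allI impI)
  show "0 <= V / eps" using V eps by simp
 next
  fix X :: "real => complex" and s
  assume X: "continuous_on {- (c * eps)..c * eps} X" "\<forall>t\<in>{- (c * eps)..c * eps}. norm (X t) <= s"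
  show "(\<lambda>t. scaled_weight \<theta> eps t *\<^sub>R X t) integrable_on {- (c * eps)..c * eps}" using hi[OF X(1)] by blast
  have s: "0 <= s" using order_trans[OF norm_ge_zero bspec[OF X(2), of 0]] c eps by simp
  have "norm (pairing c \<theta> (\<lambda>s. X (eps * s))) <= V * s"
   by (rule dual_bvD[OF bv cc[OF X(1)]]) (use X in_r in auto)
  also have "\<dots> <= V / eps * s" using V s eps by (intro mult_right_mono) (auto simp: pos_le_divide_eq mult_left_le)
  finally show "norm (pairing (c * eps) (scaled_weight \<theta> eps) X) <= V / eps * s"
   using hi[OF X(1)] by (simp add: integral_unique)
 next
  fix X X' :: "real => complex" and s
  assume d: "\<forall>t\<in>{- (c * eps)..c * eps}. (X has_vector_derivative X' t) (at t within {- (c * eps)..c * eps})"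
   and X: "continuous_on {- (c * eps)..c * eps} X'" "\<forall>t\<in>{- (c * eps)..c * eps}. norm (X t) <= s"
  have d': "((\<lambda>s. X (eps * s)) has_vector_derivative (eps *\<^sub>R X' (eps * t))) (at t within {-c..c})" if t: "t \<in> {-c..c}" for t
  proof -
   have "(X \<circ> (\<lambda>s. eps * s) has_vector_derivative (eps *\<^sub>R X' (eps * t))) (at t within {-c..c})"
   proof (rule vector_diff_chain_within)
    show "((\<lambda>s. eps * s) has_vector_derivative eps) (at t within {-c..c})"
     by (auto intro!: derivative_eq_intros)
    show "(X has_vector_derivative X' (eps * t)) (at (eps * t) within (\<lambda>s. eps * s) ` {-c..c})"
     by (rule has_vector_derivative_within_subset[OF bspec[OF d in_r[OF t]]]) (use in_r in blast)
   qed
   then show ?thesis by (simp add: o_def)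
  qed
  have "norm (pairing c \<theta> (\<lambda>s. eps *\<^sub>R X' (eps * s))) <= V * s"
   by (rule dual_bvD_deriv[OF bv d']) (use X in_r cc[OF X(1)] in \<open>auto intro!: continuous_intros\<close>)
  moreover have "pairing c \<theta> (\<lambda>s. eps *\<^sub>R X' (eps * s)) = eps *\<^sub>R pairing c \<theta> (\<lambda>s. X' (eps * s))"
   unfolding integral_cmul[symmetric] by (simp add: mult.commute)
  ultimately have "norm (pairing c \<theta> (\<lambda>s. X' (eps * s))) <= V / eps * s"
   using eps by (simp add: field_simps)
  then show "norm (pairing (c * eps) (scaled_weight \<theta> eps) X') <= V / eps * s"
   using hi[OF X(1)] by (simp add: integral_unique)
 qed
qed

section \<open>Averaged indicators and averaged weights\<close>

lemma indicator_integral: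
 fixes X :: "real => 'a::banach"
 assumes "-\<rho> <= a" "b <= \<rho>"
 shows "((\<lambda>t. indicator {a..b} t *\<^sub>R X t) has_integral i) {-\<rho>..\<rho>} \<longleftrightarrow> (X has_integral i) {a..b}"
proof -
 have "(\<lambda>t. indicator {a..b} t *\<^sub>R X t) = (\<lambda>t. if t \<in> {a..b} then X t else 0)" by (auto simp: indicator_def)
 then show ?thesis using has_integral_restrict[of "{a..b}" "{-\<rho>..\<rho>}" X i] assms by simp
qed

text \<open>The \<open>2\<close> pays for the two jumps and \<open>2 * \<rho>\<close> for the
  mass.\<close>

lemma dual_bv_indicator:
 assumes ab: "-\<rho> <= a" "a <= b" "b <= \<rho>"
 shows "dual_bv (indicator {a..b}) (-\<rho>) \<rho> (2 + 2 * \<rho>)"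
proof -
 have sub: "{a..b} \<subseteq> {-\<rho>..\<rho>}" using ab by auto
 have hi: "((\<lambda>t. indicator {a..b} t *\<^sub>R X t) has_integral (integral {a..b} X)) {-\<rho>..\<rho>}"
  if "continuous_on {-\<rho>..\<rho>} X" for X :: "real => complex"
  unfolding indicator_integral[OF ab(1,3)]
  by (intro integrable_integral integrable_continuous_real continuous_on_subset[OF that sub])
 show ?thesis
  unfolding dual_bv_def
 proof (intro conjI allI impI)
  show "0 <= 2 + 2 * \<rho>" using ab by simp
 next
  fix X :: "real => complex" and s assume X: "continuous_on {-\<rho>..\<rho>} X" "\<forall>t\<in>{-\<rho>..\<rho>}. norm (X t) <= s"
  have s: "0 <= s" using order_trans[OF norm_ge_zero bspec[OF X(2), of \<rho>]] ab by simp
  show "(\<lambda>t. indicator {a..b} t *\<^sub>R X t) integrable_on {-\<rho>..\<rho>}" using hi[OF X(1)] by blast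
  have "norm (integral {a..b} X) <= s * (b - a)"
   using ab X by (intro integral_bound continuous_on_subset[OF X(1) sub]) auto
  also have "\<dots> <= s * (2 + 2 * \<rho>)" using ab s by (intro mult_left_mono) auto
  finally show "norm (pairing \<rho> (indicator {a..b}) X) <= (2 + 2 * \<rho>) * s"
   using hi[OF X(1)] by (simp add: integral_unique mult.commute)
 next
  fix X X' :: "real => complex" and s
  assume d: "\<forall>t\<in>{-\<rho>..\<rho>}. (X has_vector_derivative X' t) (at t within {-\<rho>..\<rho>})"
   and X: "continuous_on {-\<rho>..\<rho>} X'" "\<forall>t\<in>{-\<rho>..\<rho>}. norm (X t) <= s"
  have s: "0 <= s" using order_trans[OF norm_ge_zero bspec[OF X(2), of \<rho>]] ab by simp
  have "(X' has_integral (X b - X a)) {a..b}"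
   using sub by (intro fundamental_theorem_of_calculus ab has_vector_derivative_within_subset[OF bspec[OF d] sub]) auto
  then have "norm (pairing \<rho> (indicator {a..b}) X') = norm (X b - X a)"
   using hi[OF X(1)] by (simp add: integral_unique)
  also have "\<dots> <= s + s"
   using X(2) ab by (intro order_trans[OF norm_triangle_ineq4 add_mono]) auto
  also have "\<dots> <= (2 + 2 * \<rho>) * s" using ab s by (simp add: distrib_right)
  finally show "norm (pairing \<rho> (indicator {a..b}) X') <= (2 + 2 * \<rho>) * s" .
 qed
qed

lemma indicator_Icc_integrable: "(indicator {a..b} :: real => real) integrable_on {c..d}"
proof -
 have "(\<lambda>x. if x \<in> {a..b} then 1 else 0 :: real) integrable_on {c..d}"
  unfolding integrable_restrict_Int[of _ "\<lambda>_. 1"] by (simp add: integrable_on_const)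
 then show ?thesis by (simp add: indicator_def[abs_def] of_bool_def)
qed

lemma steklov_profile_indicator:
 assumes "0 < \<delta>" "\<delta> <= 1" "-\<rho> <= a" "a <= b" "b <= \<rho>" "\<rho> + \<delta> <= r"
 shows "steklov_profile (indicator {a..b}) \<rho> \<delta> r (2 + 2 * \<rho>) {a, b}"
proof
 fix t :: real assume "t \<notin> {a, b}"
 then have "t \<notin> frontier {a..b}" by (auto simp: frontier_def)
 then show "isCont (indicator {a..b} :: real => real) t"
  by (simp add: isCont_indicator)
qed (use assms dual_bv_indicator in \<open>auto simp: indicator_Icc_integrable indicator_def\<close>)

lemma steklov_indicator_nonneg: "0 < \<delta> ==> 0 <= steklov \<delta> (indicator {a..b}) \<eta>"
 unfolding steklov_def by (intro divide_nonneg_pos integral_nonneg indicator_Icc_integrable) auto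

lemma steklov_indicator_one:
 assumes "0 < \<delta>" "a <= \<eta>" "\<eta> + \<delta> <= b"
 shows "steklov \<delta> (indicator {a..b}) \<eta> = 1"
proof -
 have "integral {\<eta>..\<eta> + \<delta>} (indicator {a..b} :: real => real) = integral {\<eta>..\<eta> + \<delta>} (\<lambda>_. 1)"
  using assms by (intro integral_cong) auto
 then show ?thesis using assms by (simp add: steklov_def)
qed

lemma integral_indicator_Icc:
 assumes "-\<rho> <= a" "a <= b" "b <= \<rho>"
 shows "integral {-\<rho>..\<rho>} (indicator {a..b} :: real => real) = b - a"
proof -
 have "((\<lambda>t. indicator {a..b} t *\<^sub>R (1::real)) has_integral (b - a)) {-\<rho>..\<rho>}"
  unfolding indicator_integral[OF assms(1,3)] using has_integral_const_real[of "1::real" a b] assms by simp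
 then show ?thesis by (simp add: integral_unique)
qed

lemma steklov_scaled_weight:
 assumes eps: "0 < eps" and \<delta>: "0 < \<delta>" and int: "\<And>a b. \<theta> integrable_on {a..b}"
 shows "steklov \<delta> (scaled_weight \<theta> eps) \<eta> = steklov (\<delta> / eps) \<theta> (\<eta> / eps) / eps"
  "scaled_weight \<theta> eps integrable_on {a..b}"
proof -
 have *: "(scaled_weight \<theta> eps has_integral integral {a..b} \<theta>) {a * eps..b * eps}" for a b
  using scaled_weight_integral[OF eps, of \<theta> "\<lambda>_. 1::real" a b] int by simp
 show "steklov \<delta> (scaled_weight \<theta> eps) \<eta> = steklov (\<delta> / eps) \<theta> (\<eta> / eps) / eps"
  using integral_unique[OF *[of "\<eta> / eps" "\<eta> / eps + \<delta> / eps"]] eps \<delta> by (simp add: steklov_def distrib_right)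
 show "scaled_weight \<theta> eps integrable_on {a..b}"
  using *[of "a / eps" "b / eps"] eps by auto
qed

lemma weight_profile_0_integrable:
 assumes "weight_profile 0 \<theta>"
 shows "\<theta> integrable_on {a..b}"
proof (cases "a <= b")
 case True
 have "piecewise_C1 \<theta>" using assms by (simp add: weight_profile_def)
 then show ?thesis using piecewise_C1_dual_bv[OF _ True] dual_bv_real_integrable by blast
qed (simp add: integrable_on_empty)

text \<open>\<open>V\<close> is fixed before the width and the step, since the error bound has to be
  uniform in both; only the break points depend on \<open>eps\<close>.\<close>

lemma steklov_profile_scaled_weight:
 assumes wp: "weight_profile 0 \<theta>"
 obtains V where "0 <= V" "\<And>eps \<delta> r. 0 < eps ==> eps <= 1 ==> 0 < \<delta> ==> \<delta> <= 1 ==> 2 * eps + \<delta> <= r ==>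
  \<exists>E. steklov_profile (scaled_weight \<theta> eps) (2 * eps) \<delta> r (V / eps) E"
proof -
 have pc: "piecewise_C1 \<theta>" using wp by (simp add: weight_profile_def)
 obtain V where V: "dual_bv \<theta> (-2) 2 V" using piecewise_C1_dual_bv[OF pc, of "-2" 2] by auto
 obtain F where F: "finite F" "\<And>u v. u < v ==> {u<..<v} \<inter> F = {} ==> \<forall>s\<in>{u<..<v}. isCont \<theta> s"
  using piecewise_C1_isCont_ex[OF pc] by auto
 have cont: "isCont \<theta> s" if "s \<notin> F" for s
 proof -
  obtain d where d: "0 < d" "\<And>y. y \<in> F ==> \<bar>y - s\<bar> < d ==> y = s" using finite_gap[OF F(1)] by metis
  have "{s - d<..<s + d} \<inter> F = {}" using d that by (force simp: abs_less_iff)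
  then show ?thesis using F(2)[of "s - d" "s + d"] d(1) by auto
 qed
 show ?thesis
 proof (rule that[OF dual_bv_nonneg[OF V]])
  fix eps \<delta> r :: real assume a: "0 < eps" "eps <= 1" "0 < \<delta>" "\<delta> <= 1" "2 * eps + \<delta> <= r"
  have "steklov_profile (scaled_weight \<theta> eps) (2 * eps) \<delta> r (V / eps) ((\<lambda>f. f * eps) ` F)"
  proof
   fix t assume "t \<notin> (\<lambda>f. f * eps) ` F"
   then have "t / eps \<notin> F" using a(1) by (auto simp: image_iff)
   then have "isCont \<theta> (t / eps)" by (rule cont)
   then have "isCont (\<lambda>t. \<theta> (t / eps)) t"
    using a(1) by (intro isCont_o2[of t "\<lambda>t. t / eps" \<theta>] continuous_intros) auto
   then show "isCont (scaled_weight \<theta> eps) t"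
    unfolding scaled_weight_def[abs_def] using a(1) by (intro continuous_intros) auto
  next
   fix t assume "2 * eps < \<bar>t\<bar>"
   then have "1 < \<bar>t / eps\<bar>" using a(1) by (simp add: abs_divide)
   then show "scaled_weight \<theta> eps t = 0" using weight_profile_support[OF wp] by (simp add: scaled_weight_def)
  next
   show "dual_bv (scaled_weight \<theta> eps) (- (2 * eps)) (2 * eps) (V / eps)"
    by (rule dual_bv_scaled_weight) (use V a in auto)
  qed (use a F(1) steklov_scaled_weight(2)[OF a(1,3)] weight_profile_0_integrable[OF wp] in auto)
  then show "\<exists>E. steklov_profile (scaled_weight \<theta> eps) (2 * eps) \<delta> r (V / eps) E" by blast
 qed
qed

text \<open>Averaging moves \<open>\<theta>\<close> by a bounded amount near a break point and by \<open>O(\<delta>)\<close> elsewhere; the indicators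
 are themselves averaged so that the bound is again a smoothed profile.\<close>

lemma steklov_error:
 assumes wp: "weight_profile 0 \<theta>"
 obtains F C where "finite F" "F \<subseteq> {-2..2}" "0 <= C" "\<And>\<delta> s. 0 < \<delta> ==> \<delta> <= 1 ==>
  \<bar>\<theta> s - steklov \<delta> \<theta> s\<bar> <= C * ((\<Sum>f\<in>F. steklov \<delta> (indicator {f - \<delta>..f + \<delta>}) s) + \<delta> * steklov \<delta> (indicator {-2..2}) s)"
proof -
 have pc: "piecewise_C1 \<theta>" using wp by (simp add: weight_profile_def)
 obtain B where "\<forall>t\<in>{-2..2}. \<bar>\<theta> t\<bar> <= B"
  using piecewise_C1_bounded[OF pc, of "-2" 2] by auto
 then have B: "\<bar>\<theta> t\<bar> <= B" if "t \<in> {-2..2}" for t using that by blast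
 obtain G M where G: "finite G" and M: "0 <= M"
  "\<And>x y. -2 <= x ==> x <= y ==> y <= 2 ==> {x..y} \<inter> G = {} ==> \<bar>\<theta> y - \<theta> x\<bar> <= M * (y - x)"
  using piecewise_C1_Lipschitz_ex[OF pc, of "-2" 2] by auto
 have B0: "0 <= B" using B[of 0] by simp
 have int: "\<theta> integrable_on {a..b}" for a b using weight_profile_0_integrable[OF wp] .
 define F where "F = G \<inter> {-2..2}"
 show ?thesis
 proof (rule that[of F "2 * B + M"])
  fix \<delta> s :: real assume \<delta>: "0 < \<delta>" "\<delta> <= 1"
  let ?R = "(\<Sum>f\<in>F. steklov \<delta> (indicator {f - \<delta>..f + \<delta>}) s) + \<delta> * steklov \<delta> (indicator {-2..2}) s"
  have nn: "0 <= (\<Sum>f\<in>F. steklov \<delta> (indicator {f - \<delta>..f + \<delta>}) s)" "0 <= \<delta> * steklov \<delta> (indicator {-2..2}) s"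
   using \<delta> by (auto intro!: sum_nonneg mult_nonneg_nonneg steklov_indicator_nonneg)
  have avg: "\<bar>\<theta> s - steklov \<delta> \<theta> s\<bar> <= D" if "\<And>t. t \<in> {s..s + \<delta>} ==> \<bar>\<theta> s - \<theta> t\<bar> <= D" for D
  proof -
   have "\<theta> s - steklov \<delta> \<theta> s = integral {s..s + \<delta>} (\<lambda>t. \<theta> s - \<theta> t) / \<delta>"
    using int \<delta> by (subst integral_diff) (auto simp: steklov_def field_simps)
   moreover have "norm (integral {s..s + \<delta>} (\<lambda>t. \<theta> s - \<theta> t)) <= integral {s..s + \<delta>} (\<lambda>t. D)"
    using that int by (intro integral_norm_bound_integral integrable_diff) auto
   ultimately show ?thesis using \<delta> by (simp add: abs_divide pos_divide_le_eq mult.commute)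
  qed
  show "\<bar>\<theta> s - steklov \<delta> \<theta> s\<bar> <= (2 * B + M) * ?R"
  \<comment> \<open>For other \<open>s\<close> the window \<open>{s..s + \<delta>}\<close>, of
    length at most one, misses the support of \<open>\<theta>\<close>.\<close>
  proof (cases "s \<in> {-2..1}")
   case False
   have z: "\<theta> t = 0" if "t \<in> {s..s + \<delta>}" for t
    using False that \<delta> by (intro weight_profile_support[OF wp]) auto
   then have "\<bar>\<theta> s - steklov \<delta> \<theta> s\<bar> <= 0" using z[of s] \<delta> by (intro avg) auto
   also have "0 <= (2 * B + M) * ?R" using nn B0 M by simp
   finally show ?thesis .
  next
   case True
   show ?thesis
   proof (cases "{s..s + \<delta>} \<inter> G = {}")
    case no: True
    have "\<bar>\<theta> s - steklov \<delta> \<theta> s\<bar> <= M * \<delta>"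
    proof (rule avg)
     fix t assume t: "t \<in> {s..s + \<delta>}"
     then have "{s..t} \<subseteq> {s..s + \<delta>}" by auto
     then have "{s..t} \<inter> G = {}" using no by blast
     then have "\<bar>\<theta> t - \<theta> s\<bar> <= M * (t - s)" using t True \<delta> by (intro M) auto
     also have "\<dots> <= M * \<delta>" using t M by (intro mult_left_mono) auto
     finally show "\<bar>\<theta> s - \<theta> t\<bar> <= M * \<delta>" by (simp add: abs_minus_commute)
    qed
    also have "M * \<delta> = M * (\<delta> * steklov \<delta> (indicator {-2..2}) s)"
     using steklov_indicator_one[of \<delta> "-2" s 2] True \<delta> by simp
    also have "\<dots> <= (2 * B + M) * ?R" using nn B0 M by (intro mult_mono) auto
    finally show ?thesis .
   next
    case False
    then obtain f where f: "f \<in> {s..s + \<delta>}" "f \<in> G" by blast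
    then have fF: "f \<in> F" using True \<delta> by (auto simp: F_def)
    have "\<bar>\<theta> s - steklov \<delta> \<theta> s\<bar> <= 2 * B"
    proof (rule avg)
     fix t assume t: "t \<in> {s..s + \<delta>}"
     show "\<bar>\<theta> s - \<theta> t\<bar> <= 2 * B" using B[of s] B[of t] t True \<delta> by auto
    qed
    \<comment> \<open>A break point \<open>f\<close> in the window means
      \<open>f - \<delta> <= s\<close> and \<open>s <= f\<close>. Then the whole window lies in
      \<open>{f - \<delta>..f + \<delta>}\<close>, and the averaged indicator is one at
      \<open>s\<close>.\<close>
    also have "2 * B = 2 * B * steklov \<delta> (indicator {f - \<delta>..f + \<delta>}) s"
     using steklov_indicator_one[of \<delta> "f - \<delta>" s "f + \<delta>"] f \<delta> by simp
    also have "\<dots> <= (2 * B + M) * ?R"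
    proof (rule mult_mono)
     have "steklov \<delta> (indicator {f - \<delta>..f + \<delta>}) s <= (\<Sum>f\<in>F. steklov \<delta> (indicator {f - \<delta>..f + \<delta>}) s)"
      using fF G \<delta> steklov_indicator_nonneg by (intro member_le_sum) (auto simp: F_def)
     then show "steklov \<delta> (indicator {f - \<delta>..f + \<delta>}) s <= ?R" using nn by simp
    qed (use B0 M \<delta> steklov_indicator_nonneg in auto)
    finally show ?thesis .
   qed
  qed
 qed (use G B0 M in \<open>auto simp: F_def\<close>)
qed

lemma steklov_indicator_scaled:
 assumes "0 < eps" "0 < \<delta>"
 shows "steklov (\<delta> / eps) (indicator {a..b}) (\<eta> / eps) = steklov \<delta> (indicator {a * eps..b * eps}) \<eta>"
proof -
 have "scaled_weight (indicator {a..b}) eps = (\<lambda>t. inverse eps * indicator {a * eps..b * eps} t)"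
  using assms by (intro ext) (auto simp: scaled_weight_def indicator_def field_simps)
 then have "steklov \<delta> (scaled_weight (indicator {a..b}) eps) \<eta> = inverse eps * steklov \<delta> (indicator {a * eps..b * eps}) \<eta>"
  unfolding steklov_def by (simp only: integral_mult_right times_divide_eq_right)
 then show ?thesis
  using steklov_scaled_weight(1)[OF assms, of "indicator {a..b}" \<eta>] assms
  by (simp add: indicator_Icc_integrable field_simps)
qed

lemma steklov_error_scaled:
 assumes wp: "weight_profile 0 \<theta>"
 obtains F C where "finite F" "F \<subseteq> {-2..2}" "0 <= C" "\<And>eps \<delta> \<eta>. 0 < eps ==> 0 < \<delta> ==> \<delta> <= eps ==>
  \<bar>scaled_weight \<theta> eps \<eta> - steklov \<delta> (scaled_weight \<theta> eps) \<eta>\<bar> <=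
   C / eps * ((\<Sum>f\<in>F. steklov \<delta> (indicator {f * eps - \<delta>..f * eps + \<delta>}) \<eta>) + \<delta> / eps * steklov \<delta> (indicator {- 2 * eps..2 * eps}) \<eta>)"
proof -
 show ?thesis
 proof (rule steklov_error[OF wp])
  fix F C
  assume F: "finite F" "F \<subseteq> {-2..2}" "0 <= C" and err: "\<And>\<delta> s. 0 < \<delta> ==> \<delta> <= 1 ==>
   \<bar>\<theta> s - steklov \<delta> \<theta> s\<bar> <= C * ((\<Sum>f\<in>F. steklov \<delta> (indicator {f - \<delta>..f + \<delta>}) s) + \<delta> * steklov \<delta> (indicator {-2..2}) s)"
  show ?thesis
 proof (rule that[OF F])
  fix eps \<delta> \<eta> :: real assume a: "0 < eps" "0 < \<delta>" "\<delta> <= eps"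
  have "scaled_weight \<theta> eps \<eta> - steklov \<delta> (scaled_weight \<theta> eps) \<eta> = (\<theta> (\<eta> / eps) - steklov (\<delta> / eps) \<theta> (\<eta> / eps)) / eps"
   using steklov_scaled_weight(1)[OF a(1,2)] weight_profile_0_integrable[OF wp]
   by (simp add: scaled_weight_def diff_divide_distrib)
  then have "\<bar>scaled_weight \<theta> eps \<eta> - steklov \<delta> (scaled_weight \<theta> eps) \<eta>\<bar> = \<bar>\<theta> (\<eta> / eps) - steklov (\<delta> / eps) \<theta> (\<eta> / eps)\<bar> / eps"
   using a by (simp add: abs_divide)
  also have "\<dots> <= C * ((\<Sum>f\<in>F. steklov (\<delta> / eps) (indicator {f - \<delta> / eps..f + \<delta> / eps}) (\<eta> / eps)) +
    \<delta> / eps * steklov (\<delta> / eps) (indicator {-2..2}) (\<eta> / eps)) / eps"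
   using a by (intro divide_right_mono err) auto
  also have "\<dots> = C / eps * ((\<Sum>f\<in>F. steklov \<delta> (indicator {f * eps - \<delta>..f * eps + \<delta>}) \<eta>) + \<delta> / eps * steklov \<delta> (indicator {- 2 * eps..2 * eps}) \<eta>)"
   using a unfolding steklov_indicator_scaled[OF a(1,2)] by (simp add: left_diff_distrib distrib_right)
  finally show "\<bar>scaled_weight \<theta> eps \<eta> - steklov \<delta> (scaled_weight \<theta> eps) \<eta>\<bar> <=
   C / eps * ((\<Sum>f\<in>F. steklov \<delta> (indicator {f * eps - \<delta>..f * eps + \<delta>}) \<eta>) + \<delta> / eps * steklov \<delta> (indicator {- 2 * eps..2 * eps}) \<eta>)" .
 qed
qed
qed

section \<open>Plane curves and their offsets\<close>

lemma has_vector_derivative_2: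
 fixes f :: "real => real^2"
 assumes that: "F = at t within S"
 shows "(f has_vector_derivative D) F \<longleftrightarrow>
  ((\<lambda>t. f t $ 1) has_real_derivative D $ 1) F \<and> ((\<lambda>t. f t $ 2) has_real_derivative D $ 2) F"
proof
 assume "(f has_vector_derivative D) F"
 then show "((\<lambda>t. f t $ 1) has_real_derivative D $ 1) F \<and> ((\<lambda>t. f t $ 2) has_real_derivative D $ 2) F"
  by (auto simp: has_real_derivative_iff_has_vector_derivative intro: bounded_linear.has_vector_derivative[OF bounded_linear_vec_nth])
next
 assume *: "((\<lambda>t. f t $ 1) has_real_derivative D $ 1) F \<and> ((\<lambda>t. f t $ 2) has_real_derivative D $ 2) F"
 have eq: "v = v $ 1 *\<^sub>R axis 1 1 + v $ 2 *\<^sub>R axis 2 1" for v :: "real^2"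
  by (simp add: vec_eq_iff forall_2 axis_def)
 have "((\<lambda>t. f t $ 1 *\<^sub>R axis 1 1 + f t $ 2 *\<^sub>R axis 2 1) has_vector_derivative
   (D $ 1 *\<^sub>R axis 1 1 + D $ 2 *\<^sub>R (axis 2 1 :: real^2))) (at t within S)"
  using * that by (auto intro!: derivative_eq_intros)
 then show "(f has_vector_derivative D) F" using that by (simp flip: eq)
qed

lemma inner_2: "x \<bullet> y = x $ 1 * y $ 1 + x $ 2 * y $ 2" for x y :: "real^2"
 by (simp add: inner_vec_def sum_2)

lemma norm_2: "norm x = sqrt ((x $ 1)\<^sup>2 + (x $ 2)\<^sup>2)" for x :: "real^2"
 by (simp add: norm_eq_sqrt_inner inner_2 power2_eq_square)

lemma vector_derivative_bound:
 fixes f :: "real => 'a::real_normed_vector"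
 assumes d: "\<And>u. u \<in> {a..b} ==> (f has_vector_derivative f' u) (at u within {a..b})"
  and B: "\<And>u. u \<in> {a..b} ==> norm (f' u) <= B" and xy: "x \<in> {a..b}" "y \<in> {a..b}"
 shows "norm (f x - f y) <= B * \<bar>x - y\<bar>"
proof -
 have "norm (f x - f y) <= B * norm (x - y)"
 proof (rule differentiable_bound[of "{a..b}" f "\<lambda>u h. h *\<^sub>R f' u"])
  fix u assume u: "u \<in> {a..b}"
  show "(f has_derivative (\<lambda>h. h *\<^sub>R f' u)) (at u within {a..b})"
   using d[OF u] by (simp add: has_vector_derivative_def)
  show "onorm (\<lambda>h. h *\<^sub>R f' u) <= B"
   using B[OF u] by (intro onorm_le) (simp add: mult_left_mono mult.commute[of B])
 qed (use xy in auto)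
 then show ?thesis by simp
qed

lemma periodic_int:
 fixes f :: "real => 'a"
 assumes "\<And>t. f (t + 1) = f t"
 shows "f (t + of_int n) = f t"
proof (induction n rule: int_induct[of _ 0])
 case (step1 i)
 then show ?case using assms[of "t + of_int i"] by (simp add: add.assoc)
next
 case (step2 i)
 then show ?case using assms[of "t + of_int i - 1"] by (simp add: algebra_simps)
qed simp

lemma periodic_frac:
 fixes f :: "real => 'a"
 assumes "\<And>t. f (t + 1) = f t"
 shows "f (frac t) = f t"
 using periodic_int[of f "frac t" "\<lfloor>t\<rfloor>", OF assms] by (simp add: frac_def)

lemma periodic_bounded:
 fixes f :: "real => 'a::real_normed_vector"
 assumes per: "\<And>t. f (t + 1) = f t" and c: "continuous_on UNIV f"
 obtains B where "0 < B" "\<And>t. norm (f t) <= B"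
proof -
 have "bounded (f ` {0..1})"
  by (intro compact_imp_bounded compact_continuous_image continuous_on_subset[OF c]) auto
 then obtain B where B: "0 < B" "\<And>t. t \<in> {0..1} ==> norm (f t) <= B"
  unfolding bounded_pos by auto
 have "norm (f t) <= B" for t
  using B(2)[of "frac t"] periodic_frac[of f t, OF per] frac_ge_0[of t] frac_lt_1[of t] by simp
 then show ?thesis using that B(1) by blast
qed

text \<open>\<open>\<Gamma> j\<close> is the derivative of order \<open>j\<close>. The sign
  \<open>sg\<close> is left open because the side on which the domain lies is known only later; it
  decides to which side \<open>nrml\<close> points.\<close>

locale plane_curve =
 fixes \<Gamma> :: "nat => real => real^2" and sg :: real
 assumes d\<Gamma>: "\<And>j t. (\<Gamma> j has_vector_derivative \<Gamma> (Suc j) t) (at t)"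
  and per0: "\<And>t. \<Gamma> 0 (t + 1) = \<Gamma> 0 t"
  and reg: "\<And>t. \<Gamma> 1 t \<noteq> 0"
  and inj: "inj_on (\<Gamma> 0) {0..<1}"
  and sg: "sg = 1 \<or> sg = -1"
begin

abbreviation curve :: "(real^2) set" where "curve \<equiv> range (\<Gamma> 0)"

lemma cont\<Gamma>: "continuous_on S (\<Gamma> j)"
 by (intro continuous_at_imp_continuous_on ballI has_vector_derivative_continuous[OF d\<Gamma>])

lemma per\<Gamma>: "\<Gamma> j (t + 1) = \<Gamma> j t"
proof (induction j arbitrary: t)
 case (Suc j)
 have "(\<Gamma> j \<circ> (\<lambda>t. t + 1) has_vector_derivative (1 *\<^sub>R \<Gamma> (Suc j) (t + 1))) (at t)"
  by (intro vector_diff_chain_at d\<Gamma>) (auto intro!: derivative_eq_intros)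
 moreover have "\<Gamma> j \<circ> (\<lambda>t. t + 1) = \<Gamma> j" using Suc by auto
 ultimately show ?case using vector_derivative_unique_at[OF _ d\<Gamma>[of j t]] by simp
qed (rule per0)

lemma dcomp: "((\<lambda>t. \<Gamma> j t $ i) has_real_derivative \<Gamma> (Suc j) t $ i) (at t within S)"
 using has_vector_derivative_at_within[OF d\<Gamma>[of j t], of S]
 by (simp add: has_real_derivative_iff_has_vector_derivative bounded_linear.has_vector_derivative[OF bounded_linear_vec_nth])

definition speed :: "real => real" where "speed t = norm (\<Gamma> 1 t)"
definition ispeed :: "real => real" where "ispeed t = inverse (norm (\<Gamma> 1 t))"
definition tang :: "real => real^2" where "tang t = ispeed t *\<^sub>R \<Gamma> 1 t"
definition nrml :: "real => real^2" where "nrml t = vector [sg * tang t $ 2, - (sg * tang t $ 1)]"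

text \<open>Speed times signed curvature.\<close>

definition turn :: "real => real" where
 "turn t = sg * (ispeed t)\<^sup>2 * (\<Gamma> 1 t $ 1 * \<Gamma> 2 t $ 2 - \<Gamma> 1 t $ 2 * \<Gamma> 2 t $ 1)"

definition offset :: "real => real => real^2" where "offset t \<eta> = \<Gamma> 0 t + \<eta> *\<^sub>R nrml t"
definition stretch :: "real => real => real" where "stretch t \<eta> = speed t + \<eta> * turn t"

lemma sg2: "sg * sg = 1" "sg\<^sup>2 = 1" using sg by (auto simp: power2_eq_square)

lemma speed_pos: "0 < speed t" and ispeed_pos: "0 < ispeed t"
 using reg[of t] by (auto simp: speed_def ispeed_def)

lemma speed_ispeed: "speed t * ispeed t = 1" "ispeed t * speed t = 1"
 using reg[of t] by (auto simp: speed_def ispeed_def)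

lemma speed2: "(\<Gamma> 1 t $ 1)\<^sup>2 + (\<Gamma> 1 t $ 2)\<^sup>2 = (speed t)\<^sup>2"
 by (simp add: speed_def norm_2)

lemma ispeed2: "(ispeed t)\<^sup>2 * ((\<Gamma> 1 t $ 1)\<^sup>2 + (\<Gamma> 1 t $ 2)\<^sup>2) = 1"
 unfolding speed2 by (simp add: speed_ispeed flip: power_mult_distrib)

lemma \<Gamma>1_eq: "\<Gamma> 1 t = speed t *\<^sub>R tang t"
 by (simp add: tang_def speed_ispeed)

lemma tang_nth: "tang t $ i = ispeed t * \<Gamma> 1 t $ i" by (simp add: tang_def)

lemma nrml_nth: "nrml t $ 1 = sg * tang t $ 2" "nrml t $ 2 = - (sg * tang t $ 1)"
 by (simp_all add: nrml_def)

lemma tang_sq: "(tang t $ 1)\<^sup>2 + (tang t $ 2)\<^sup>2 = 1"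
 using ispeed2[of t] by (simp add: tang_nth power_mult_distrib distrib_left)

lemma norm_tang: "norm (tang t) = 1" using tang_sq by (simp add: norm_2)

lemma nrml_sq: "(nrml t $ 1)\<^sup>2 + (nrml t $ 2)\<^sup>2 = 1"
 using tang_sq[of t] by (simp add: nrml_nth power_mult_distrib sg2)

lemma norm_nrml: "norm (nrml t) = 1" using nrml_sq by (simp add: norm_2)

lemma inner_tang_nrml: "tang t \<bullet> nrml t = 0" "nrml t \<bullet> tang t = 0"
 by (simp_all add: inner_2 nrml_nth)

lemma inner_self: "tang t \<bullet> tang t = 1" "nrml t \<bullet> nrml t = 1"
 using norm_tang norm_nrml by (simp_all add: norm_eq_1)

lemma frame_decomp: "v = (v \<bullet> tang t) *\<^sub>R tang t + (v \<bullet> nrml t) *\<^sub>R nrml t"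
proof -
 define a b where "a = tang t $ 1" and "b = tang t $ 2"
 have ab: "a * a + b * b = 1" using tang_sq[of t] by (simp add: a_def b_def power2_eq_square)
 have 1: "(x * a + y * b) * a + (x * (sg * b) + y * - (sg * a)) * (sg * b) = x" for x y
 proof -
  have "(x * a + y * b) * a + (x * (sg * b) + y * - (sg * a)) * (sg * b) = (x * a + y * b) * a + (sg * sg) * (x * b - y * a) * b"
   by (simp add: algebra_simps)
  also have "\<dots> = x * (a * a + b * b)" by (simp add: sg2 algebra_simps)
  finally show ?thesis using ab by simp
 qed
 have 2: "(x * a + y * b) * b + (x * (sg * b) + y * - (sg * a)) * - (sg * a) = y" for x y
 proof -
  have "(x * a + y * b) * b + (x * (sg * b) + y * - (sg * a)) * - (sg * a) = (x * a + y * b) * b - (sg * sg) * (x * b - y * a) * a"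
   by (simp add: algebra_simps)
  also have "\<dots> = y * (a * a + b * b)" by (simp add: sg2 algebra_simps)
  finally show ?thesis using ab by simp
 qed
 show ?thesis
  using 1[of "v $ 1" "v $ 2"] 2[of "v $ 1" "v $ 2"]
  by (simp add: vec_eq_iff forall_2 inner_2 nrml_nth a_def b_def)
qed

lemma frame_pythagoras: "(v \<bullet> tang t)\<^sup>2 + (v \<bullet> nrml t)\<^sup>2 = (norm v)\<^sup>2"
proof -
 have "v \<bullet> v = v \<bullet> ((v \<bullet> tang t) *\<^sub>R tang t + (v \<bullet> nrml t) *\<^sub>R nrml t)" using frame_decomp[of v t] by simp
 then show ?thesis unfolding power2_norm_eq_inner by (simp only: inner_add_right power2_eq_square inner_scaleR_right)
qed

lemma dispeed:
 "(ispeed has_real_derivative - ((\<Gamma> 1 t $ 1 * \<Gamma> 2 t $ 1 + \<Gamma> 1 t $ 2 * \<Gamma> 2 t $ 2) * ispeed t ^ 3)) (at t within S)"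
proof -
 have pos: "0 < (\<Gamma> 1 t $ 1)\<^sup>2 + (\<Gamma> 1 t $ 2)\<^sup>2" using speed2[of t] speed_pos[of t] by simp
 have eq: "ispeed = (\<lambda>t. inverse (sqrt ((\<Gamma> 1 t $ 1)\<^sup>2 + (\<Gamma> 1 t $ 2)\<^sup>2)))" by (auto simp: ispeed_def norm_2)
 define q where "q = sqrt ((\<Gamma> 1 t $ 1)\<^sup>2 + (\<Gamma> 1 t $ 2)\<^sup>2)"
 have q: "0 < q" using pos by (simp add: q_def)
 have d: "((\<lambda>t. (\<Gamma> 1 t $ 1)\<^sup>2 + (\<Gamma> 1 t $ 2)\<^sup>2) has_real_derivative
   2 * (\<Gamma> 1 t $ 1 * \<Gamma> 2 t $ 1 + \<Gamma> 1 t $ 2 * \<Gamma> 2 t $ 2)) (at t within S)"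
  using dcomp[of 1 1 t S] dcomp[of 1 2 t S]
  by (auto intro!: derivative_eq_intros simp: algebra_simps numeral_2_eq_2)
 have "((\<lambda>t. inverse (sqrt ((\<Gamma> 1 t $ 1)\<^sup>2 + (\<Gamma> 1 t $ 2)\<^sup>2))) has_real_derivative
   - (inverse q * (inverse q / 2 * (2 * (\<Gamma> 1 t $ 1 * \<Gamma> 2 t $ 1 + \<Gamma> 1 t $ 2 * \<Gamma> 2 t $ 2))) * inverse q)) (at t within S)"
  using DERIV_inverse'[OF DERIV_chain2[OF DERIV_real_sqrt[OF pos] d]] q
  unfolding q_def[symmetric] by simp
 moreover have "ispeed t = inverse q" by (simp add: eq q_def)
 moreover have "inverse q * (inverse q / 2 * (2 * c)) * inverse q = c * inverse q ^ 3" for c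
  by (simp add: power3_eq_cube)
 ultimately show ?thesis unfolding eq by (simp only:)
qed

lemma dspeed: "(speed has_real_derivative (\<Gamma> 1 t $ 1 * \<Gamma> 2 t $ 1 + \<Gamma> 1 t $ 2 * \<Gamma> 2 t $ 2) * ispeed t) (at t within S)"
proof -
 have "speed = (\<lambda>t. inverse (ispeed t))" by (auto simp: speed_def ispeed_def)
 moreover have "((\<lambda>t. inverse (ispeed t)) has_real_derivative
   - (inverse (ispeed t) * (- ((\<Gamma> 1 t $ 1 * \<Gamma> 2 t $ 1 + \<Gamma> 1 t $ 2 * \<Gamma> 2 t $ 2) * ispeed t ^ 3)) * inverse (ispeed t))) (at t within S)"
  by (rule DERIV_inverse'[OF dispeed]) (use ispeed_pos[of t] in simp)
 moreover have "- (inverse (ispeed t) * (- (c * ispeed t ^ 3)) * inverse (ispeed t)) = c * ispeed t" for c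
  using ispeed_pos[of t] by (simp add: power3_eq_cube field_simps)
 ultimately show ?thesis by (simp only:)
qed

text \<open>Together with \<open>dnrml\<close> these are the Frenet formulas for a parametrisation
  of arbitrary speed. As \<open>turn\<close> contains the sign \<open>sg\<close>, they hold for both
  orientations.\<close>

lemma dtang: "(tang has_vector_derivative (- turn t) *\<^sub>R nrml t) (at t within S)"
proof -
 define a1 a2 b1 b2 p where "a1 = \<Gamma> 1 t $ 1" and "a2 = \<Gamma> 2 t $ 1" and "b1 = \<Gamma> 1 t $ 2" and "b2 = \<Gamma> 2 t $ 2" and "p = ispeed t"
 have p: "p\<^sup>2 * (a1\<^sup>2 + b1\<^sup>2) = 1" using ispeed2[of t] by (simp add: p_def a1_def b1_def)
 have c1: "((\<lambda>t. tang t $ 1) has_real_derivative (- ((a1 * a2 + b1 * b2) * p ^ 3)) * a1 + a2 * p) (at t within S)"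
  unfolding tang_nth using DERIV_mult[OF dispeed dcomp[of 1 1 t S]]
  by (simp add: a1_def a2_def b1_def b2_def p_def numeral_2_eq_2 mult.commute)
 have c2: "((\<lambda>t. tang t $ 2) has_real_derivative (- ((a1 * a2 + b1 * b2) * p ^ 3)) * b1 + b2 * p) (at t within S)"
  unfolding tang_nth using DERIV_mult[OF dispeed dcomp[of 1 2 t S]]
  by (simp add: a1_def a2_def b1_def b2_def p_def numeral_2_eq_2 mult.commute)
 have e1: "(- ((a1 * a2 + b1 * b2) * p ^ 3)) * a1 + a2 * p = ((- turn t) *\<^sub>R nrml t) $ 1"
 proof -
  have "a2 * p = a2 * p * (p\<^sup>2 * (a1\<^sup>2 + b1\<^sup>2))" by (simp add: p)
  also have "\<dots> = a2 * p ^ 3 * (a1\<^sup>2 + b1\<^sup>2)" by (simp add: power2_eq_square power3_eq_cube mult_ac)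
  finally have e: "a2 * p = a2 * p ^ 3 * (a1\<^sup>2 + b1\<^sup>2)" .
  have "(- ((a1 * a2 + b1 * b2) * p ^ 3)) * a1 + a2 * p = - (p ^ 3 * b1 * (a1 * b2 - b1 * a2))"
   unfolding e by (simp add: algebra_simps power2_eq_square power3_eq_cube)
  also have "\<dots> = - ((sg * sg) * (p ^ 3 * b1 * (a1 * b2 - b1 * a2)))" by (simp add: sg2)
  finally show ?thesis
   by (simp add: turn_def nrml_nth tang_nth a1_def a2_def b1_def b2_def p_def power2_eq_square power3_eq_cube mult_ac)
 qed
 have e2: "(- ((a1 * a2 + b1 * b2) * p ^ 3)) * b1 + b2 * p = ((- turn t) *\<^sub>R nrml t) $ 2"
 proof -
  have "b2 * p = b2 * p * (p\<^sup>2 * (a1\<^sup>2 + b1\<^sup>2))" by (simp add: p)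
  also have "\<dots> = b2 * p ^ 3 * (a1\<^sup>2 + b1\<^sup>2)" by (simp add: power2_eq_square power3_eq_cube mult_ac)
  finally have e: "b2 * p = b2 * p ^ 3 * (a1\<^sup>2 + b1\<^sup>2)" .
  have "(- ((a1 * a2 + b1 * b2) * p ^ 3)) * b1 + b2 * p = p ^ 3 * a1 * (a1 * b2 - b1 * a2)"
   unfolding e by (simp add: algebra_simps power2_eq_square power3_eq_cube)
  also have "\<dots> = (sg * sg) * (p ^ 3 * a1 * (a1 * b2 - b1 * a2))" by (simp add: sg2)
  finally show ?thesis
   by (simp add: turn_def nrml_nth tang_nth a1_def a2_def b1_def b2_def p_def power2_eq_square power3_eq_cube mult_ac)
 qed
 show ?thesis
  unfolding has_vector_derivative_2[OF refl] using c1 c2 unfolding e1 e2 by simp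
qed

lemma dnrml: "(nrml has_vector_derivative turn t *\<^sub>R tang t) (at t within S)"
proof -
 have *: "((\<lambda>t. tang t $ 1) has_real_derivative ((- turn t) *\<^sub>R nrml t) $ 1) (at t within S)"
  "((\<lambda>t. tang t $ 2) has_real_derivative ((- turn t) *\<^sub>R nrml t) $ 2) (at t within S)"
  using dtang unfolding has_vector_derivative_2[OF refl] by blast+
 have e: "sg * ((- turn t) * (- (sg * x))) = turn t * x" "- (sg * ((- turn t) * (sg * x))) = turn t * x" for x
  using sg by auto
 show ?thesis
  unfolding has_vector_derivative_2[OF refl] nrml_nth
  using DERIV_cmult[OF *(2), of sg] DERIV_minus[OF DERIV_cmult[OF *(1), of sg]]
  by (simp only: vector_scaleR_component real_scaleR_def nrml_nth e simp_thms)
qed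

lemma cont_frame: "continuous_on S tang" "continuous_on S nrml" "continuous_on S ispeed" "continuous_on S speed" "continuous_on S turn"
proof -
 show "continuous_on S tang" "continuous_on S nrml"
  by (intro continuous_at_imp_continuous_on ballI has_vector_derivative_continuous[OF dtang] has_vector_derivative_continuous[OF dnrml])+
 show i: "continuous_on S ispeed" "continuous_on S speed"
  by (rule DERIV_continuous_on[OF dispeed], rule DERIV_continuous_on[OF dspeed])
 show "continuous_on S turn" unfolding turn_def by (intro continuous_intros i cont\<Gamma>)
qed

lemma per_frame: "speed (t + 1) = speed t" "ispeed (t + 1) = ispeed t" "tang (t + 1) = tang t" "nrml (t + 1) = nrml t" "turn (t + 1) = turn t"
 by (simp_all add: speed_def ispeed_def tang_def nrml_def turn_def per\<Gamma>)

lemma doffset_t: "((\<lambda>t. offset t \<eta>) has_vector_derivative stretch t \<eta> *\<^sub>R tang t) (at t within S)"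
 unfolding offset_def stretch_def
 using has_vector_derivative_add[OF has_vector_derivative_at_within[OF d\<Gamma>[of 0 t]]
   has_vector_derivative_scaleR[OF DERIV_const[of \<eta>] dnrml[of t S]]]
 by (simp add: \<Gamma>1_eq scaleR_add_left flip: One_nat_def)

lemma doffset_\<eta>: "((\<lambda>\<eta>. offset t \<eta>) has_vector_derivative nrml t) (at \<eta> within S)"
 unfolding offset_def by (auto intro!: derivative_eq_intros)

section \<open>Embeddedness of the curve and its tubular neighbourhood\<close>

lemma eq_imp_int:
 assumes "\<Gamma> 0 s = \<Gamma> 0 t"
 shows "\<exists>n :: int. s = t + of_int n"
proof -
 have "\<Gamma> 0 (frac s) = \<Gamma> 0 (frac t)" using assms by (simp add: periodic_frac per0)
 then have "frac s = frac t" using inj by (auto dest!: inj_onD simp: frac_lt_1)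
 then show ?thesis by (intro exI[of _ "\<lfloor>s\<rfloor> - \<lfloor>t\<rfloor>"]) (simp add: frac_def)
qed

lemma taylor_bound:
 obtains C where "0 < C" "\<And>s t. norm (\<Gamma> 0 s - \<Gamma> 0 t - (s - t) *\<^sub>R \<Gamma> 1 t) <= C * (s - t)\<^sup>2"
proof -
 obtain C where C: "0 < C" "\<And>t. norm (\<Gamma> 2 t) <= C"
  using periodic_bounded[of "\<Gamma> 2"] per\<Gamma> cont\<Gamma> by metis
 have 1: "norm (\<Gamma> 1 u - \<Gamma> 1 t) <= C * \<bar>u - t\<bar>" for u t
  by (rule vector_derivative_bound[of "min u t" "max u t" "\<Gamma> 1" "\<Gamma> 2"])
   (use C has_vector_derivative_at_within[OF d\<Gamma>[of 1]] in \<open>auto simp: numeral_2_eq_2\<close>)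
 have "norm (\<Gamma> 0 s - \<Gamma> 0 t - (s - t) *\<^sub>R \<Gamma> 1 t) <= C * (s - t)\<^sup>2" for s t
 proof -
  have "norm ((\<Gamma> 0 s - s *\<^sub>R \<Gamma> 1 t) - (\<Gamma> 0 t - t *\<^sub>R \<Gamma> 1 t)) <= (C * \<bar>s - t\<bar>) * \<bar>s - t\<bar>"
  proof (rule vector_derivative_bound[of "min s t" "max s t" _ "\<lambda>u. \<Gamma> 1 u - \<Gamma> 1 t"])
   fix u assume u: "u \<in> {min s t..max s t}"
   show "((\<lambda>u. \<Gamma> 0 u - u *\<^sub>R \<Gamma> 1 t) has_vector_derivative \<Gamma> 1 u - \<Gamma> 1 t) (at u within {min s t..max s t})"
    using has_vector_derivative_at_within[OF d\<Gamma>[of 0 u]]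
    by (auto intro!: derivative_eq_intros)
   have "C * \<bar>u - t\<bar> <= C * \<bar>s - t\<bar>" using u C by (intro mult_left_mono) (auto simp: abs_if min_def max_def split: if_splits)
   then show "norm (\<Gamma> 1 u - \<Gamma> 1 t) <= C * \<bar>s - t\<bar>" using 1[of u t] by linarith
  qed auto
  then show ?thesis by (simp add: algebra_simps power2_eq_square flip: abs_mult)
 qed
 then show ?thesis using that C(1) by blast
qed

lemma speed_lower: obtains m where "0 < m" "\<And>t. m <= speed t"
proof -
 obtain B where B: "0 < B" "\<And>t. norm (ispeed t) <= B"
  using periodic_bounded[of ispeed] per_frame cont_frame by metis
 have "inverse B <= speed t" for t
 proof -
  have "inverse B <= inverse (ispeed t)" using B(2)[of t] ispeed_pos[of t] by (intro le_imp_inverse_le) auto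
  then show ?thesis by (simp add: ispeed_def speed_def)
 qed
 then show ?thesis using that[of "inverse B"] B(1) by simp
qed

text \<open>Near the diagonal this is Taylor's formula, away from it compactness and injectivity.
  Differences up to \<open>1 / 2\<close> exclude coincidences by periodicity, and integer shifts
  bring any two points into this range.\<close>

lemma chord_arc: obtains c where "0 < c" "\<And>s t. \<bar>s - t\<bar> <= 1/2 ==> c * \<bar>s - t\<bar> <= norm (\<Gamma> 0 s - \<Gamma> 0 t)"
proof -
 obtain C where C: "0 < C" "\<And>s t. norm (\<Gamma> 0 s - \<Gamma> 0 t - (s - t) *\<^sub>R \<Gamma> 1 t) <= C * (s - t)\<^sup>2"
  using taylor_bound by blast
 obtain m where m: "0 < m" "\<And>t. m <= speed t" using speed_lower by blast
 define d where "d = m / (2 * C)"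
 have d: "0 < d" using m C by (simp add: d_def)
 have near: "m / 2 * \<bar>s - t\<bar> <= norm (\<Gamma> 0 s - \<Gamma> 0 t)" if "\<bar>s - t\<bar> <= d" for s t
 proof -
  have "C * (s - t)\<^sup>2 = C * \<bar>s - t\<bar> * \<bar>s - t\<bar>" by (simp add: power2_eq_square flip: abs_mult)
  also have "\<dots> <= C * d * \<bar>s - t\<bar>" using that C by (intro mult_right_mono mult_left_mono) auto
  also have "\<dots> = m / 2 * \<bar>s - t\<bar>" using C by (simp add: d_def)
  finally have 1: "C * (s - t)\<^sup>2 <= m / 2 * \<bar>s - t\<bar>" .
  have "m * \<bar>s - t\<bar> <= norm ((s - t) *\<^sub>R \<Gamma> 1 t)"
   using mult_right_mono[OF m(2)[of t], of "\<bar>s - t\<bar>"] by (simp add: speed_def mult.commute)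
  also have "\<dots> <= norm (\<Gamma> 0 s - \<Gamma> 0 t) + norm (\<Gamma> 0 s - \<Gamma> 0 t - (s - t) *\<^sub>R \<Gamma> 1 t)"
   by (metis norm_minus_commute norm_triangle_sub)
  finally show ?thesis using C(2)[of s t] 1 by linarith
 qed
 define K where "K = {0..1::real} \<times> {d..1/2}"
 define f where "f p = norm (\<Gamma> 0 (fst p + snd p) - \<Gamma> 0 (fst p))" for p :: "real \<times> real"
 have cf: "continuous_on K f"
  unfolding f_def by (intro continuous_intros continuous_on_compose2[OF cont\<Gamma>[of UNIV 0]]) auto
 have fpos: "0 < f p" if "p \<in> K" for p
 proof (rule ccontr)
  assume "\<not> 0 < f p"
  then have "\<Gamma> 0 (fst p + snd p) = \<Gamma> 0 (fst p)" by (simp add: f_def)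
  then obtain n :: int where n: "fst p + snd p = fst p + of_int n" using eq_imp_int by blast
  then have "0 < real_of_int n" "real_of_int n < 1" using that d by (auto simp: K_def)
  then have "0 < n" "n < 1" by simp_all
  then show False by simp
 qed
 obtain e where e: "0 < e" "\<And>p. p \<in> K ==> e <= f p"
 proof (cases "K = {}")
  case False
  have "compact K" unfolding K_def by (intro compact_Times) auto
  then obtain p0 where "p0 \<in> K" "\<forall>p\<in>K. f p0 <= f p" using continuous_attains_inf[OF _ False cf] by blast
  then show ?thesis using that[of "f p0"] fpos by blast
 qed (use that[of 1] in auto)
 have far: "e <= norm (\<Gamma> 0 (t + u) - \<Gamma> 0 t)" if "d <= u" "u <= 1/2" for t u
 proof -
  have "(frac t, u) \<in> K" using that frac_lt_1[of t] by (auto simp: K_def less_imp_le)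
  from e(2)[OF this] have "e <= norm (\<Gamma> 0 (frac t + u) - \<Gamma> 0 (frac t))" by (simp add: f_def)
  moreover have "\<Gamma> 0 (frac t + u) = \<Gamma> 0 (t + u)"
   using periodic_int[of "\<Gamma> 0" "frac t + u" "\<lfloor>t\<rfloor>"] per0 by (simp add: frac_def algebra_simps)
  ultimately show ?thesis by (simp add: periodic_frac per0)
 qed
 show ?thesis
 proof (rule that[of "min (m / 2) (2 * e)"])
  fix s t :: real assume st: "\<bar>s - t\<bar> <= 1/2"
  show "min (m / 2) (2 * e) * \<bar>s - t\<bar> <= norm (\<Gamma> 0 s - \<Gamma> 0 t)"
  proof (cases "\<bar>s - t\<bar> <= d")
   case True
   have "min (m / 2) (2 * e) * \<bar>s - t\<bar> <= m / 2 * \<bar>s - t\<bar>" by (intro mult_right_mono) auto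
   then show ?thesis using near[OF True] by linarith
  next
   case False
   have "min (m / 2) (2 * e) * \<bar>s - t\<bar> <= 2 * e * (1/2)" using st e by (intro mult_mono) auto
   moreover have "e <= norm (\<Gamma> 0 s - \<Gamma> 0 t)"
   proof (cases "t <= s")
    case True
    then show ?thesis using far[of "s - t" t] st False by simp
   next
    case False
    then show ?thesis using far[of "t - s" s] st \<open>\<not> \<bar>s - t\<bar> <= d\<close> by (simp add: norm_minus_commute)
   qed
   ultimately show ?thesis by simp
  qed
 qed (use m e in auto)
qed

lemma near_rep:
 fixes s t :: real
 obtains s' where "\<bar>s' - t\<bar> <= 1/2" "\<Gamma> 0 s' = \<Gamma> 0 s"
proof -
 define s' where "s' = s + of_int (- round (s - t))"
 have "\<bar>of_int (round (s - t)) - (s - t)\<bar> <= 1/2" by (rule of_int_round_abs_le)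
 moreover have "s' - t = - (of_int (round (s - t)) - (s - t))" by (simp add: s'_def)
 ultimately have "\<bar>s' - t\<bar> <= 1/2" by (simp only: abs_minus_cancel)
 moreover have "\<Gamma> 0 s' = \<Gamma> 0 s" unfolding s'_def by (rule periodic_int[of "\<Gamma> 0", OF per0])
 ultimately show ?thesis using that by blast
qed

text \<open>The chord leaves the tangent only to second order in the parameter, and
  \<open>chord_arc\<close> turns this into the length of the chord. Geometrically, discs of a fixed
  radius touching the curve from either side have no point of the curve in their interior.\<close>

lemma normal_deviation:
 obtains K where "0 < K" "\<And>s t. \<bar>nrml t \<bullet> (\<Gamma> 0 s - \<Gamma> 0 t)\<bar> <= K * (norm (\<Gamma> 0 s - \<Gamma> 0 t))\<^sup>2"
proof -
 obtain C where C: "0 < C" "\<And>s t. norm (\<Gamma> 0 s - \<Gamma> 0 t - (s - t) *\<^sub>R \<Gamma> 1 t) <= C * (s - t)\<^sup>2"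
  using taylor_bound by blast
 obtain c where c: "0 < c" "\<And>s t. \<bar>s - t\<bar> <= 1/2 ==> c * \<bar>s - t\<bar> <= norm (\<Gamma> 0 s - \<Gamma> 0 t)" using chord_arc by blast
 have "\<bar>nrml t \<bullet> (\<Gamma> 0 s - \<Gamma> 0 t)\<bar> <= C / c\<^sup>2 * (norm (\<Gamma> 0 s - \<Gamma> 0 t))\<^sup>2" for s t
 proof -
  obtain s' where s': "\<bar>s' - t\<bar> <= 1/2" "\<Gamma> 0 s' = \<Gamma> 0 s" using near_rep by blast
  have "nrml t \<bullet> (\<Gamma> 0 s - \<Gamma> 0 t) = nrml t \<bullet> (\<Gamma> 0 s' - \<Gamma> 0 t - (s' - t) *\<^sub>R \<Gamma> 1 t)"
  proof -
   have "nrml t \<bullet> \<Gamma> 1 t = 0" by (subst \<Gamma>1_eq) (simp add: inner_tang_nrml)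
   then show ?thesis by (simp add: s' inner_diff_right)
  qed
  also have "\<bar>\<dots>\<bar> <= norm (\<Gamma> 0 s' - \<Gamma> 0 t - (s' - t) *\<^sub>R \<Gamma> 1 t)"
   using Cauchy_Schwarz_ineq2[of "nrml t"] by (metis mult_1 norm_nrml)
  also have "\<dots> <= C * (s' - t)\<^sup>2" by (rule C)
  also have "\<dots> = C / c\<^sup>2 * (c * \<bar>s' - t\<bar>)\<^sup>2" using c by (simp add: power_mult_distrib)
  also have "\<dots> <= C / c\<^sup>2 * (norm (\<Gamma> 0 s' - \<Gamma> 0 t))\<^sup>2"
   by (intro mult_left_mono power_mono c(2)[OF s'(1)]) (use c(1) C(1) in auto)
  finally show ?thesis by (simp add: s')
 qed
 then show ?thesis using that[of "C / c\<^sup>2"] C c by simp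
qed

text \<open>The curvature bound keeps the offset map an immersion, with \<open>stretch\<close> at
  least half the speed; the last condition makes \<open>\<Gamma> 0 t\<close> the unique closest
  point of \<open>offset t \<eta>\<close>.\<close>

definition reach :: "real => bool" where
 "reach r \<longleftrightarrow> 0 < r \<and> r <= 1 \<and> (\<forall>t. r * (\<bar>turn t\<bar> * ispeed t) <= 1/2) \<and>
   (\<forall>s t \<eta>. \<bar>\<eta>\<bar> <= r --> \<Gamma> 0 s \<noteq> \<Gamma> 0 t --> \<bar>\<eta>\<bar> < norm (offset t \<eta> - \<Gamma> 0 s))"

text \<open>For the chord \<open>v\<close>, the squared distance from \<open>offset t \<eta>\<close>
  to \<open>\<Gamma> 0 s\<close> exceeds \<open>\<eta>\<^sup>2\<close> by
  \<open>(norm v)\<^sup>2 - 2 * \<eta> * (nrml t \<bullet> v)\<close>, and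
  \<open>normal_deviation\<close> bounds the second term by half of the first once
  \<open>4 * K * r <= 1\<close>.\<close>

lemma reach_exists: "\<exists>r. reach r"
proof -
 obtain K where K: "0 < K" "\<And>s t. \<bar>nrml t \<bullet> (\<Gamma> 0 s - \<Gamma> 0 t)\<bar> <= K * (norm (\<Gamma> 0 s - \<Gamma> 0 t))\<^sup>2"
  using normal_deviation by blast
 obtain B where B: "0 < B" "\<And>t. norm (turn t * ispeed t) <= B"
  using periodic_bounded[of "\<lambda>t. turn t * ispeed t"] per_frame cont_frame by (metis continuous_on_mult)
 define r where "r = min 1 (min (1 / (4 * K)) (1 / (2 * B)))"
 have r: "0 < r" "r <= 1" "r * (4 * K) <= 1" "r * (2 * B) <= 1"
 proof -
  show "0 < r" "r <= 1" using K B by (auto simp: r_def)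
  have "r <= 1 / (4 * K)" "r <= 1 / (2 * B)" by (auto simp: r_def)
  then show "r * (4 * K) <= 1" "r * (2 * B) <= 1" using K B by (auto simp: pos_le_divide_eq)
 qed
 have "\<bar>\<eta>\<bar> < norm (offset t \<eta> - \<Gamma> 0 s)" if \<eta>: "\<bar>\<eta>\<bar> <= r" and ne: "\<Gamma> 0 s \<noteq> \<Gamma> 0 t" for s t \<eta>
 proof -
  define v where "v = \<Gamma> 0 s - \<Gamma> 0 t"
  have v: "0 < (norm v)\<^sup>2" using ne by (simp add: v_def)
  have "\<bar>2 * \<eta> * (nrml t \<bullet> v)\<bar> = 2 * \<bar>\<eta>\<bar> * \<bar>nrml t \<bullet> v\<bar>" by (simp add: abs_mult)
  also have "\<dots> <= 2 * r * (K * (norm v)\<^sup>2)"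
   using \<eta> K(2)[of t s] r K(1) by (intro mult_mono) (auto simp: v_def)
  also have "\<dots> = (r * (4 * K)) * ((norm v)\<^sup>2 / 2)" by simp
  also have "\<dots> <= 1 * ((norm v)\<^sup>2 / 2)" using r by (intro mult_right_mono) auto
  finally have "2 * \<eta> * (nrml t \<bullet> v) <= (norm v)\<^sup>2 / 2" by (simp add: abs_le_iff)
  then have "\<eta>\<^sup>2 < \<eta>\<^sup>2 - 2 * \<eta> * (nrml t \<bullet> v) + (norm v)\<^sup>2" using v by linarith
  also have "\<dots> = (norm (offset t \<eta> - \<Gamma> 0 s))\<^sup>2"
  proof -
   have e: "offset t \<eta> - \<Gamma> 0 s = \<eta> *\<^sub>R nrml t - v" by (simp add: offset_def v_def)
   show ?thesis
    unfolding e power2_norm_eq_inner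
    by (simp add: inner_diff_left inner_diff_right inner_self inner_commute power2_eq_square algebra_simps)
  qed
  finally show ?thesis using power_less_imp_less_base[of "\<bar>\<eta>\<bar>" 2] by simp
 qed
 moreover have "r * (\<bar>turn t\<bar> * ispeed t) <= 1/2" for t
 proof -
  have "r * (\<bar>turn t\<bar> * ispeed t) <= r * B"
   using B(2)[of t] ispeed_pos[of t] r by (intro mult_left_mono) (auto simp: abs_mult)
  moreover have "r * B <= 1/2" using r(4) by simp
  ultimately show ?thesis by linarith
 qed
 ultimately show ?thesis using r unfolding reach_def by blast
qed

lemma stretch_pos:
 assumes "reach r" "\<bar>\<eta>\<bar> <= r"
 shows "1/2 * speed t <= stretch t \<eta>" "0 < stretch t \<eta>" "\<bar>\<eta> * (turn t * ispeed t)\<bar> <= 1/2"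
proof -
 have "\<bar>\<eta>\<bar> * (\<bar>turn t\<bar> * ispeed t) <= r * (\<bar>turn t\<bar> * ispeed t)"
  using assms ispeed_pos[of t] by (intro mult_right_mono) auto
 also have "\<dots> <= 1/2" using assms by (simp add: reach_def)
 finally show 1: "\<bar>\<eta> * (turn t * ispeed t)\<bar> <= 1/2" using ispeed_pos[of t] by (simp add: abs_mult)
 have "speed t * (1 + \<eta> * (turn t * ispeed t)) = speed t + \<eta> * turn t * (ispeed t * speed t)"
  by (simp add: algebra_simps)
 then have "stretch t \<eta> = speed t * (1 + \<eta> * (turn t * ispeed t))" by (simp add: stretch_def speed_ispeed)
 moreover have "speed t * (1/2) <= speed t * (1 + \<eta> * (turn t * ispeed t))"
  using 1 speed_pos[of t] by (intro mult_left_mono) (auto simp: abs_le_iff)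
 ultimately show "1/2 * speed t <= stretch t \<eta>" by simp
 then show "0 < stretch t \<eta>" using speed_pos[of t] by linarith
qed

lemma norm_offset: "norm (offset t \<eta> - \<Gamma> 0 t) = \<bar>\<eta>\<bar>" by (simp add: offset_def norm_nrml)

lemma range_\<Gamma>: "curve = \<Gamma> 0 ` {0..1}" "curve = \<Gamma> 0 ` {0..<1}"
proof -
 have "\<Gamma> 0 t \<in> \<Gamma> 0 ` {0..<1}" for t
  by (rule image_eqI[of _ _ "frac t"]) (simp_all add: periodic_frac per0 frac_lt_1)
 then show "curve = \<Gamma> 0 ` {0..<1}" "curve = \<Gamma> 0 ` {0..1}"
  by (auto simp: image_iff) (meson atLeastAtMost_iff atLeastLessThan_iff image_iff less_imp_le)+
qed

lemma compact_range: "compact curve"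
 unfolding range_\<Gamma> by (intro compact_continuous_image cont\<Gamma>) auto

lemma offset_closest:
 assumes r: "reach r" and \<eta>: "\<bar>\<eta>\<bar> <= r"
 shows "closest_point curve (offset t \<eta>) = \<Gamma> 0 t" "infdist (offset t \<eta>) curve = \<bar>\<eta>\<bar>"
  "\<And>p. p \<in> curve ==> (\<forall>y\<in>curve. dist (offset t \<eta>) p <= dist (offset t \<eta>) y) ==> p = \<Gamma> 0 t"
proof -
 have far: "\<bar>\<eta>\<bar> < dist (offset t \<eta>) y" if "y \<in> curve" "y \<noteq> \<Gamma> 0 t" for y
  using r \<eta> that unfolding reach_def by (auto simp: dist_norm)
 have here: "dist (offset t \<eta>) (\<Gamma> 0 t) = \<bar>\<eta>\<bar>" by (simp add: dist_norm norm_offset)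
 show uniq: "p = \<Gamma> 0 t" if "p \<in> curve" "\<forall>y\<in>curve. dist (offset t \<eta>) p <= dist (offset t \<eta>) y" for p
 proof (rule ccontr)
  assume "p \<noteq> \<Gamma> 0 t"
  then show False using far[OF that(1)] bspec[OF that(2), of "\<Gamma> 0 t"] here by simp
 qed
 have cl: "closed curve" using compact_range by (rule compact_imp_closed)
 show cp: "closest_point curve (offset t \<eta>) = \<Gamma> 0 t"
  using closest_point_exists[OF cl, of "offset t \<eta>"] by (intro uniq) auto
 have "infdist (offset t \<eta>) curve = dist (offset t \<eta>) (closest_point curve (offset t \<eta>))"
  using infdist_attains_inf[OF cl, of "offset t \<eta>"] closest_point_exists[OF cl, of "offset t \<eta>"] infdist_le[of _ "curve" "offset t \<eta>"]
  by (metis UNIV_not_empty antisym image_is_empty)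
 then show "infdist (offset t \<eta>) curve = \<bar>\<eta>\<bar>" using cp here by simp
qed

lemma offset_inj:
 assumes r: "reach r" and "\<bar>\<eta>\<bar> <= r" "\<bar>\<eta>'\<bar> <= r" and eq: "offset t \<eta> = offset t' \<eta>'"
 shows "\<Gamma> 0 t = \<Gamma> 0 t'" "nrml t = nrml t'" "\<eta> = \<eta>'"
proof -
 show 1: "\<Gamma> 0 t = \<Gamma> 0 t'" using offset_closest(1)[OF r] assms by metis
 then obtain n :: int where "t = t' + of_int n" using eq_imp_int by blast
 then show 2: "nrml t = nrml t'" using periodic_int[of nrml t' n] per_frame by simp
 have "\<eta> *\<^sub>R nrml t = \<eta>' *\<^sub>R nrml t" using eq 1 2 by (simp add: offset_def)
 then have "(\<eta> *\<^sub>R nrml t) \<bullet> nrml t = (\<eta>' *\<^sub>R nrml t) \<bullet> nrml t" by (rule arg_cong)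
 then show "\<eta> = \<eta>'" by (simp only: inner_scaleR_left inner_self mult_1_right)
qed

text \<open>The first-order condition at a closest point makes the connecting segment normal to the
  curve. This holds at any distance; beyond the reach only uniqueness is lost.\<close>

lemma offset_surj:
 obtains t \<eta> where "t \<in> {0..<1}" "x = offset t \<eta>" "\<bar>\<eta>\<bar> = infdist x curve"
proof -
 have cl: "closed curve" using compact_range by (rule compact_imp_closed)
 obtain p where p: "p \<in> curve" "infdist x curve = dist x p"
  using infdist_attains_inf[OF cl, of x] by auto
 then obtain t where t: "t \<in> {0..<1}" "p = \<Gamma> 0 t" unfolding range_\<Gamma>(2) by blast
 have le: "dist x p <= dist x (\<Gamma> 0 u)" for u using infdist_le[of "\<Gamma> 0 u" "curve" x] p by simp
 define f where "f u = (x - \<Gamma> 0 u) \<bullet> (x - \<Gamma> 0 u)" for u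
 have "((\<lambda>u. x - \<Gamma> 0 u) has_vector_derivative - \<Gamma> 1 t) (at t)"
  using d\<Gamma>[of 0 t] by (auto intro!: derivative_eq_intros)
 then have "(f has_derivative (\<lambda>h. (x - \<Gamma> 0 t) \<bullet> (h *\<^sub>R - \<Gamma> 1 t) + (h *\<^sub>R - \<Gamma> 1 t) \<bullet> (x - \<Gamma> 0 t))) (at t)"
  unfolding f_def has_vector_derivative_def by (intro has_derivative_inner)
 then have "DERIV f t :> - 2 * ((x - \<Gamma> 0 t) \<bullet> \<Gamma> 1 t)"
  unfolding has_field_derivative_def by (rule has_derivative_eq_rhs) (auto simp: inner_commute algebra_simps)
 moreover have "f t <= f u" for u
  using le[of u] by (simp add: f_def t dist_norm norm_le)
 ultimately have "- 2 * ((x - \<Gamma> 0 t) \<bullet> \<Gamma> 1 t) = 0"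
  by (intro DERIV_local_min[of f _ t 1]) auto
 then have "(x - \<Gamma> 0 t) \<bullet> tang t = 0" by (simp add: tang_def)
 then have "x - \<Gamma> 0 t = ((x - \<Gamma> 0 t) \<bullet> nrml t) *\<^sub>R nrml t" using frame_decomp[of "x - \<Gamma> 0 t" t] by simp
 then have x: "x = offset t ((x - \<Gamma> 0 t) \<bullet> nrml t)" unfolding offset_def by (metis add.commute diff_add_cancel)
 then have "\<bar>(x - \<Gamma> 0 t) \<bullet> nrml t\<bar> = infdist x curve"
  using p t norm_offset[of t "(x - \<Gamma> 0 t) \<bullet> nrml t"] by (simp add: dist_norm)
 then show ?thesis using that t(1) x by blast
qed

end

section \<open>Oscillatory integrals along a curve\<close>

locale curve_data = plane_curve +
 fixes Fd :: "nat => real => real" and r :: real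
 assumes dF: "\<And>j t. (Fd j has_real_derivative Fd (Suc j) t) (at t)"
  and perF0: "\<And>t. Fd 0 (t + 1) = Fd 0 t"
  and reach: "reach r"
begin

lemma r_pos: "0 < r" using reach by (simp add: reach_def)

lemma perF: "Fd j (t + 1) = Fd j t"
proof (induction j arbitrary: t)
 case (Suc j)
 have "((\<lambda>t. Fd j (t + 1)) has_real_derivative Fd (Suc j) (t + 1)) (at t)"
  using dF[of j "t + 1"] by (simp add: DERIV_shift)
 then show ?case using Suc DERIV_unique[OF _ dF[of j t]] by simp
qed (rule perF0)

lemma contF: "continuous_on S (Fd j)"
 by (intro DERIV_continuous_on[OF DERIV_subset[OF dF]]) auto

text \<open>Within the reach this is \<open>speed t / stretch t \<eta>\<close>, the Jacobian of the
  closest point map on a level curve; \<open>level_jacobian_offset\<close> identifies it with the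
  factor in the quadrature.\<close>

definition shrink :: "real => real => real" where
 "shrink t \<eta> = inverse (1 + \<eta> * (turn t * ispeed t))"

lemma shrink_denom:
 assumes "\<bar>\<eta>\<bar> <= r"
 shows "1/2 <= 1 + \<eta> * (turn t * ispeed t)"
 using stretch_pos(3)[OF reach assms, of t] by (simp add: abs_le_iff)

lemma stretch_shrink:
 assumes "\<bar>\<eta>\<bar> <= r"
 shows "ispeed t * shrink t \<eta> * stretch t \<eta> = 1"
proof -
 have "ispeed t * stretch t \<eta> = 1 + \<eta> * (turn t * ispeed t)"
  by (simp add: stretch_def distrib_left speed_ispeed mult_ac)
 then have "ispeed t * shrink t \<eta> * stretch t \<eta> = shrink t \<eta> * (1 + \<eta> * (turn t * ispeed t))"
  by (simp add: mult_ac)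
 then show ?thesis using shrink_denom[OF assms, of t] by (simp add: shrink_def)
qed

text \<open>An algebra of amplitudes that is closed under both partial derivatives; \<open>om\<close> is the direction of the frequency.\<close>

inductive_set amp :: "(real => real => real^2 => real) set" where
 const: "(\<lambda>t \<eta> om. c) \<in> amp"
| curve: "(\<lambda>t \<eta> om. \<Gamma> (Suc j) t $ i) \<in> amp"
| data: "(\<lambda>t \<eta> om. Fd j t) \<in> amp"
| ispeed: "(\<lambda>t \<eta> om. ispeed t) \<in> amp"
| eta: "(\<lambda>t \<eta> om. \<eta>) \<in> amp"
| dir: "(\<lambda>t \<eta> om. om $ i) \<in> amp"
| shrink: "(\<lambda>t \<eta> om. shrink t \<eta>) \<in> amp"
| add: "b \<in> amp ==> c \<in> amp ==> (\<lambda>t \<eta> om. b t \<eta> om + c t \<eta> om) \<in> amp"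
| mult: "b \<in> amp ==> c \<in> amp ==> (\<lambda>t \<eta> om. b t \<eta> om * c t \<eta> om) \<in> amp"

lemma amp_curve1: "(\<lambda>t \<eta> om. \<Gamma> 1 t $ i) \<in> amp" "(\<lambda>t \<eta> om. \<Gamma> 2 t $ i) \<in> amp"
 using amp.curve[of 0 i] amp.curve[of 1 i] by (simp_all add: numeral_2_eq_2)

lemma amp_minus: "b \<in> amp ==> (\<lambda>t \<eta> om. - b t \<eta> om) \<in> amp"
 using amp.mult[OF amp.const[of "-1"]] by simp

lemma amp_diff: "b \<in> amp ==> c \<in> amp ==> (\<lambda>t \<eta> om. b t \<eta> om - c t \<eta> om) \<in> amp"
 using amp.add[OF _ amp_minus] by simp

lemmas amp_intros = amp.add amp.mult amp_minus amp_diff amp_curve1 amp.ispeed amp.eta amp.dir amp.shrink amp.data amp.const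

lemma amp_turn: "(\<lambda>t \<eta> om. turn t) \<in> amp"
 unfolding turn_def power2_eq_square by (intro amp_intros)

lemma amp_speed: "(\<lambda>t \<eta> om. speed t) \<in> amp"
proof -
 have "speed t = ispeed t * (\<Gamma> 1 t $ 1 * \<Gamma> 1 t $ 1 + \<Gamma> 1 t $ 2 * \<Gamma> 1 t $ 2)" for t
  using speed2[of t] speed_ispeed[of t] by (simp add: power2_eq_square)
 then show ?thesis by (simp only:) (intro amp_intros)
qed

lemma amp_frame: "(\<lambda>t \<eta> om. om \<bullet> tang t) \<in> amp" "(\<lambda>t \<eta> om. om \<bullet> nrml t) \<in> amp"
 unfolding inner_2 nrml_nth tang_nth by (intro amp_intros)+

lemma amp_stretch: "(\<lambda>t \<eta> om. stretch t \<eta>) \<in> amp"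
 unfolding stretch_def by (intro amp_intros amp_speed amp_turn)

text \<open>Membership in \<open>amp\<close> is part of the invariant because the product rule
  reproduces the factors themselves next to their derivatives.\<close>

definition dt_closed :: "(real => real => real^2 => real) => bool" where
 "dt_closed b \<longleftrightarrow> b \<in> amp \<and> (\<exists>b'\<in>amp. \<forall>t \<eta> om. \<bar>\<eta>\<bar> <= r --> ((\<lambda>t. b t \<eta> om) has_real_derivative b' t \<eta> om) (at t))"

lemma dt_closedI:
 assumes "b \<in> amp" "b' \<in> amp" "\<And>t \<eta> om. \<bar>\<eta>\<bar> <= r ==> ((\<lambda>t. b t \<eta> om) has_real_derivative b' t \<eta> om) (at t)"
 shows "dt_closed b"
 using assms unfolding dt_closed_def by blast

lemma dt_closed_simple:
 "dt_closed (\<lambda>t \<eta> om. c)" "dt_closed (\<lambda>t \<eta> om. \<Gamma> (Suc j) t $ i)" "dt_closed (\<lambda>t \<eta> om. Fd j t)"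
 "dt_closed (\<lambda>t \<eta> om. ispeed t)" "dt_closed (\<lambda>t \<eta> om. \<eta>)" "dt_closed (\<lambda>t \<eta> om. om $ i)"
proof -
 show "dt_closed (\<lambda>t \<eta> om. c)" by (rule dt_closedI[OF amp.const amp.const[of 0]]) simp
 show "dt_closed (\<lambda>t \<eta> om. \<Gamma> (Suc j) t $ i)" by (rule dt_closedI[OF amp.curve amp.curve[of "Suc j"] dcomp])
 show "dt_closed (\<lambda>t \<eta> om. Fd j t)" by (rule dt_closedI[OF amp.data amp.data[of "Suc j"] dF])
 show "dt_closed (\<lambda>t \<eta> om. \<eta>)" by (rule dt_closedI[OF amp.eta amp.const[of 0]]) simp
 show "dt_closed (\<lambda>t \<eta> om. om $ i)" by (rule dt_closedI[OF amp.dir amp.const[of 0]]) simp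
 have "(\<lambda>t \<eta> om. - ((\<Gamma> 1 t $ 1 * \<Gamma> 2 t $ 1 + \<Gamma> 1 t $ 2 * \<Gamma> 2 t $ 2) * ispeed t ^ 3)) \<in> amp"
  unfolding power3_eq_cube by (intro amp_intros)
 then show "dt_closed (\<lambda>t \<eta> om. ispeed t)" by (rule dt_closedI[OF amp.ispeed _ dispeed])
qed

lemma dt_closed_add: "dt_closed b ==> dt_closed c ==> dt_closed (\<lambda>t \<eta> om. b t \<eta> om + c t \<eta> om)"
proof -
 assume "dt_closed b" "dt_closed c"
 then obtain b' c' where *: "b \<in> amp" "b' \<in> amp" "\<And>t \<eta> om. \<bar>\<eta>\<bar> <= r ==> ((\<lambda>t. b t \<eta> om) has_real_derivative b' t \<eta> om) (at t)"
  "c \<in> amp" "c' \<in> amp" "\<And>t \<eta> om. \<bar>\<eta>\<bar> <= r ==> ((\<lambda>t. c t \<eta> om) has_real_derivative c' t \<eta> om) (at t)"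
  unfolding dt_closed_def by auto
 show ?thesis
  by (rule dt_closedI[of _ "\<lambda>t \<eta> om. b' t \<eta> om + c' t \<eta> om"]) (intro amp_intros DERIV_add * | assumption)+
qed

lemma dt_closed_mult: "dt_closed b ==> dt_closed c ==> dt_closed (\<lambda>t \<eta> om. b t \<eta> om * c t \<eta> om)"
proof -
 assume "dt_closed b" "dt_closed c"
 then obtain b' c' where *: "b \<in> amp" "b' \<in> amp" "\<And>t \<eta> om. \<bar>\<eta>\<bar> <= r ==> ((\<lambda>t. b t \<eta> om) has_real_derivative b' t \<eta> om) (at t)"
  "c \<in> amp" "c' \<in> amp" "\<And>t \<eta> om. \<bar>\<eta>\<bar> <= r ==> ((\<lambda>t. c t \<eta> om) has_real_derivative c' t \<eta> om) (at t)"
  unfolding dt_closed_def by auto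
 show ?thesis
  by (rule dt_closedI[of _ "\<lambda>t \<eta> om. b' t \<eta> om * c t \<eta> om + c' t \<eta> om * b t \<eta> om"]) (intro amp_intros DERIV_mult * | assumption)+
qed

lemma dt_closed_turn: "dt_closed (\<lambda>t \<eta> om. turn t)"
proof -
 have "dt_closed (\<lambda>t \<eta> om. \<Gamma> 1 t $ i)" "dt_closed (\<lambda>t \<eta> om. \<Gamma> 2 t $ i)" for i
  using dt_closed_simple(2)[of 0 i] dt_closed_simple(2)[of 1 i] by (simp_all add: numeral_2_eq_2)
 moreover have "turn t = sg * (ispeed t * ispeed t) * (\<Gamma> 1 t $ 1 * \<Gamma> 2 t $ 2 + (-1) * (\<Gamma> 1 t $ 2 * \<Gamma> 2 t $ 1))" for t
  by (simp add: turn_def power2_eq_square)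
 ultimately show ?thesis by (simp only:) (intro dt_closed_add dt_closed_mult dt_closed_simple)
qed

text \<open>Only \<open>shrink\<close> needs work: the derivative of the reciprocal contains
  \<open>shrink\<close> twice and the derivative of \<open>turn * ispeed\<close>, which stays in the
  algebra because \<open>turn\<close> is a polynomial in the generators.\<close>

lemma amp_dt: "b \<in> amp ==> dt_closed b"
proof (induction rule: amp.induct)
 case shrink
 obtain q' where q': "q' \<in> amp" "\<And>t \<eta> om. \<bar>\<eta>\<bar> <= r ==> ((\<lambda>t. turn t * ispeed t) has_real_derivative q' t \<eta> om) (at t)"
  using dt_closed_mult[OF dt_closed_turn dt_closed_simple(4)] unfolding dt_closed_def by auto
 show ?case
 proof (rule dt_closedI[of _ "\<lambda>t \<eta> om. - (\<eta> * q' t \<eta> om * (shrink t \<eta> * shrink t \<eta>))"])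
  fix t \<eta> :: real and om :: "real^2" assume \<eta>: "\<bar>\<eta>\<bar> <= r"
  have "((\<lambda>t. 1 + \<eta> * (turn t * ispeed t)) has_real_derivative \<eta> * q' t \<eta> om) (at t)"
   using DERIV_add[OF DERIV_const[of 1] DERIV_cmult[OF q'(2)[OF \<eta>, of t om], of \<eta>]] by simp
  from DERIV_inverse'[OF this] show "((\<lambda>t. shrink t \<eta>) has_real_derivative - (\<eta> * q' t \<eta> om * (shrink t \<eta> * shrink t \<eta>))) (at t)"
   using shrink_denom[OF \<eta>, of t] by (simp add: shrink_def mult_ac)
 qed (intro amp_intros q')+
qed (auto intro: dt_closed_simple dt_closed_add dt_closed_mult)

lemma amp_dtE:
 assumes "b \<in> amp"
 obtains b' where "b' \<in> amp" "\<And>t \<eta> om S. \<bar>\<eta>\<bar> <= r ==> ((\<lambda>t. b t \<eta> om) has_real_derivative b' t \<eta> om) (at t within S)"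
proof -
 obtain b' where "b' \<in> amp" "\<And>t \<eta> om. \<bar>\<eta>\<bar> <= r ==> ((\<lambda>t. b t \<eta> om) has_real_derivative b' t \<eta> om) (at t)"
  using amp_dt[OF assms] unfolding dt_closed_def by auto
 then show ?thesis using that[of b'] has_field_derivative_at_within by blast
qed

lemma amp_d\<eta>: "b \<in> amp ==> \<exists>b'\<in>amp. \<forall>t \<eta> om. \<bar>\<eta>\<bar> <= r --> ((\<lambda>\<eta>. b t \<eta> om) has_real_derivative b' t \<eta> om) (at \<eta>)"
proof (induction rule: amp.induct)
 case shrink
 show ?case
 proof (intro bexI[of _ "\<lambda>t \<eta> om. - (turn t * ispeed t * (shrink t \<eta> * shrink t \<eta>))"] allI impI)
  fix t \<eta> :: real and om :: "real^2" assume \<eta>: "\<bar>\<eta>\<bar> <= r"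
  have "((\<lambda>\<eta>. 1 + \<eta> * (turn t * ispeed t)) has_real_derivative turn t * ispeed t) (at \<eta>)"
   by (auto intro!: derivative_eq_intros)
  from DERIV_inverse'[OF this] show "((\<lambda>\<eta>. shrink t \<eta>) has_real_derivative - (turn t * ispeed t * (shrink t \<eta> * shrink t \<eta>))) (at \<eta>)"
   using shrink_denom[OF \<eta>, of t] by (simp add: shrink_def mult_ac)
 qed (intro amp_intros amp_turn)
next
 case (add b c)
 then obtain b' c' where *: "b' \<in> amp" "c' \<in> amp" "\<And>t \<eta> om. \<bar>\<eta>\<bar> <= r ==> ((\<lambda>\<eta>. b t \<eta> om) has_real_derivative b' t \<eta> om) (at \<eta>)"
  "\<And>t \<eta> om. \<bar>\<eta>\<bar> <= r ==> ((\<lambda>\<eta>. c t \<eta> om) has_real_derivative c' t \<eta> om) (at \<eta>)"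
  by auto
 then show ?case
  by (intro bexI[of _ "\<lambda>t \<eta> om. b' t \<eta> om + c' t \<eta> om"] allI impI DERIV_add amp_intros) auto
next
 case (mult b c)
 then obtain b' c' where *: "b' \<in> amp" "c' \<in> amp" "\<And>t \<eta> om. \<bar>\<eta>\<bar> <= r ==> ((\<lambda>\<eta>. b t \<eta> om) has_real_derivative b' t \<eta> om) (at \<eta>)"
  "\<And>t \<eta> om. \<bar>\<eta>\<bar> <= r ==> ((\<lambda>\<eta>. c t \<eta> om) has_real_derivative c' t \<eta> om) (at \<eta>)"
  by auto
 then show ?case using mult.hyps
  by (intro bexI[of _ "\<lambda>t \<eta> om. b' t \<eta> om * c t \<eta> om + c' t \<eta> om * b t \<eta> om"] allI impI DERIV_mult amp_intros) auto
next
 case eta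
 show ?case by (intro bexI[of _ "\<lambda>t \<eta> om. 1"] amp_intros) auto
qed (intro bexI[of _ "\<lambda>t \<eta> om. 0"] amp_intros; simp)+

lemma amp_d\<eta>E:
 assumes "b \<in> amp"
 obtains b' where "b' \<in> amp" "\<And>t \<eta> om S. \<bar>\<eta>\<bar> <= r ==> ((\<lambda>\<eta>. b t \<eta> om) has_real_derivative b' t \<eta> om) (at \<eta> within S)"
proof -
 obtain b' where "b' \<in> amp" "\<And>t \<eta> om. \<bar>\<eta>\<bar> <= r ==> ((\<lambda>\<eta>. b t \<eta> om) has_real_derivative b' t \<eta> om) (at \<eta>)"
  using amp_d\<eta>[OF assms] by auto
 then show ?thesis using that[of b'] has_field_derivative_at_within by blast
qed

lemma amp_periodic: "b \<in> amp ==> b (t + 1) \<eta> om = b t \<eta> om"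
 by (induction rule: amp.induct) (auto simp: per\<Gamma> perF per_frame shrink_def)

lemma amp_bounded:
 assumes "b \<in> amp"
 shows "\<exists>C\<ge>0. \<forall>t \<eta> om. \<bar>\<eta>\<bar> <= r --> norm om = 1 --> \<bar>b t \<eta> om\<bar> <= C"
 using assms
proof (induction rule: amp.induct)
 case (const c)
 show ?case by (intro exI[of _ "\<bar>c\<bar>"]) auto
next
 case (curve j i)
 obtain B where "0 < B" "\<And>t. norm (\<Gamma> (Suc j) t) <= B" using periodic_bounded[of "\<Gamma> (Suc j)"] per\<Gamma> cont\<Gamma> by metis
 then show ?case
  by (intro exI[of _ B] conjI allI impI) (auto intro: order_trans[OF component_le_norm_cart])
next
 case (data j)
 obtain B where "0 < B" "\<And>t. norm (Fd j t) <= B" using periodic_bounded[of "Fd j"] perF contF by metis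
 then show ?case by (intro exI[of _ B]) auto
next
 case ispeed
 obtain B where "0 < B" "\<And>t. norm (ispeed t) <= B" using periodic_bounded[of ispeed] per_frame cont_frame by metis
 then show ?case by (intro exI[of _ B]) auto
next
 case eta
 show ?case using r_pos by (intro exI[of _ r]) auto
next
 case (dir i)
 show ?case by (intro exI[of _ 1]) (auto intro: order_trans[OF component_le_norm_cart])
next
 case shrink
 have "\<bar>shrink t \<eta>\<bar> <= 2" if "\<bar>\<eta>\<bar> <= r" for t \<eta>
  using le_imp_inverse_le[OF shrink_denom[OF that, of t]] shrink_denom[OF that, of t] by (simp add: shrink_def)
 then show ?case by (intro exI[of _ 2]) auto
next
 case (add b c)
 then obtain B C where "0 <= B" "0 <= C" "\<And>t \<eta> om. \<bar>\<eta>\<bar> <= r ==> norm om = 1 ==> \<bar>b t \<eta> om\<bar> <= B"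
  "\<And>t \<eta> om. \<bar>\<eta>\<bar> <= r ==> norm om = 1 ==> \<bar>c t \<eta> om\<bar> <= C" by auto
 then show ?case by (intro exI[of _ "B + C"]) (auto intro!: order_trans[OF abs_triangle_ineq] add_mono)
next
 case (mult b c)
 then obtain B C where "0 <= B" "0 <= C" "\<And>t \<eta> om. \<bar>\<eta>\<bar> <= r ==> norm om = 1 ==> \<bar>b t \<eta> om\<bar> <= B"
  "\<And>t \<eta> om. \<bar>\<eta>\<bar> <= r ==> norm om = 1 ==> \<bar>c t \<eta> om\<bar> <= C" by auto
 then show ?case by (intro exI[of _ "B * C"]) (auto simp: abs_mult intro!: mult_mono)
qed

lemma amp_continuous:
 assumes "b \<in> amp"
 shows "continuous_on ({-r..r} \<times> S) (\<lambda>(\<eta>, t). b t \<eta> om)"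
 using assms
proof (induction rule: amp.induct)
 case (curve j i)
 have "continuous_on ({-r..r} \<times> S) (\<lambda>p. \<Gamma> (Suc j) (snd p) $ i)"
  by (intro continuous_intros continuous_on_compose2[OF cont\<Gamma>[of UNIV]]) auto
 then show ?case by (simp add: split_def)
next
 case (data j)
 have "continuous_on ({-r..r} \<times> S) (\<lambda>p. Fd j (snd p))"
  by (intro continuous_intros continuous_on_compose2[OF contF[of UNIV]]) auto
 then show ?case by (simp add: split_def)
next
 case ispeed
 have "continuous_on ({-r..r} \<times> S) (\<lambda>p. ispeed (snd p))"
  by (intro continuous_intros continuous_on_compose2[OF cont_frame(3)[of UNIV]]) auto
 then show ?case by (simp add: split_def)
next
 case shrink
 have "1 + fst p * (turn (snd p) * ispeed (snd p)) \<noteq> 0" if "p \<in> {-r..r} \<times> S" for p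
  using shrink_denom[of "fst p" "snd p"] that by (auto simp: abs_le_iff)
 then have "continuous_on ({-r..r} \<times> S) (\<lambda>p. shrink (snd p) (fst p))"
  unfolding shrink_def
  by (intro continuous_intros continuous_on_compose2[OF cont_frame(3)[of UNIV]] continuous_on_compose2[OF cont_frame(5)[of UNIV]]) auto
 then show ?case by (simp add: split_def)
qed (auto simp: split_def intro!: continuous_intros)

lemma amp_continuous_t:
 assumes "b \<in> amp" "\<bar>\<eta>\<bar> <= r"
 shows "continuous_on S (\<lambda>t. b t \<eta> om)"
proof -
 obtain b' where "\<And>t. ((\<lambda>t. b t \<eta> om) has_real_derivative b' t \<eta> om) (at t within S)"
  using amp_dtE[OF assms(1)] assms(2) by metis
 then show ?thesis by (rule DERIV_continuous_on)
qed

text \<open>A plane wave restricted to the offset curve. The frequency \<open>w\<close> is given as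
  modulus and unit direction. Integration is with respect to the parameter, so the arc length
  element has to be part of the amplitude.\<close>

definition osc :: "(real => real => real^2 => real) => real \<times> (real^2) => real => real => complex" where
 "osc b w \<eta> t = of_real (b t \<eta> (snd w)) * cis (fst w * (snd w \<bullet> offset t \<eta>))"

definition osc_int :: "(real => real => real^2 => real) => real \<times> (real^2) => real => complex" where
 "osc_int b w \<eta> = integral {0..1} (osc b w \<eta>)"

lemma dphase_t: "((\<lambda>t. l * (om \<bullet> offset t \<eta>)) has_real_derivative l * (om \<bullet> tang t) * stretch t \<eta>) (at t within S)"
proof -
 have "((\<lambda>t. om \<bullet> offset t \<eta>) has_vector_derivative om \<bullet> (stretch t \<eta> *\<^sub>R tang t)) (at t within S)"
  by (rule bounded_linear.has_vector_derivative[OF bounded_linear_inner_right doffset_t])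
 from DERIV_cmult[OF this[folded has_real_derivative_iff_has_vector_derivative], of l]
 show ?thesis by (simp add: mult_ac)
qed

lemma dphase_\<eta>: "((\<lambda>\<eta>. l * (om \<bullet> offset t \<eta>)) has_real_derivative l * (om \<bullet> nrml t)) (at \<eta> within S)"
proof -
 have "((\<lambda>\<eta>. om \<bullet> offset t \<eta>) has_vector_derivative om \<bullet> nrml t) (at \<eta> within S)"
  by (rule bounded_linear.has_vector_derivative[OF bounded_linear_inner_right doffset_\<eta>])
 from DERIV_cmult[OF this[folded has_real_derivative_iff_has_vector_derivative], of l]
 show ?thesis by simp
qed

lemma continuous_offset: "continuous_on S (\<lambda>p. offset (snd p) (fst p))"
 unfolding offset_def
 by (intro continuous_intros continuous_on_compose2[OF cont\<Gamma>[of UNIV]] continuous_on_compose2[OF cont_frame(2)[of UNIV]]) auto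

lemma continuous_cis_phase: "continuous_on S (\<lambda>p. cis (l * (om \<bullet> offset (snd p) (fst p))))"
 by (intro continuous_on_cis continuous_intros continuous_offset)

lemma continuous_osc:
 assumes "b \<in> amp"
 shows "continuous_on ({-r..r} \<times> S) (\<lambda>(\<eta>, t). osc b w \<eta> t)"
 using amp_continuous[OF assms, of S "snd w"]
 unfolding osc_def split_def by (intro continuous_on_mult continuous_on_of_real continuous_cis_phase)

lemma continuous_osc_t:
 assumes "b \<in> amp" "\<bar>\<eta>\<bar> <= r"
 shows "continuous_on S (osc b w \<eta>)"
proof -
 have "continuous_on S (\<lambda>t. cis (fst w * (snd w \<bullet> offset t \<eta>)))"
  by (intro continuous_on_cis DERIV_continuous_on[OF dphase_t])
 then show ?thesis unfolding osc_def by (intro continuous_on_mult continuous_on_of_real amp_continuous_t assms)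
qed

lemma continuous_osc_int:
 assumes "b \<in> amp"
 shows "continuous_on {-r..r} (osc_int b w)"
proof -
 have "continuous_on ({-r..r} \<times> cbox 0 1) (\<lambda>(\<eta>, t). osc b w \<eta> t)" by (rule continuous_osc[OF assms])
 from integral_continuous_on_param[OF this] show ?thesis by (simp add: osc_int_def[abs_def])
qed

text \<open>Since \<open>(om \<bullet> nrml t)\<^sup>2 + (om \<bullet> tang t)\<^sup>2 = 1\<close>, the amplitude splits into a part with a factor
 \<open>om \<bullet> nrml t\<close>, which is integrated by parts in \<open>\<eta>\<close>, and a part with a factor \<open>om \<bullet> tang t\<close>,
 which is integrated by parts in \<open>t\<close>; no cut-off is needed.\<close>

lemma osc_int_reduce:
 assumes b: "b \<in> amp"
 shows "\<exists>b1\<in>amp. \<exists>b2\<in>amp. \<exists>D. \<forall>w\<in>{w. 0 < fst w \<and> norm (snd w) = 1}.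
  splits r (fst w) (osc_int b w) (osc_int b1 w) (osc_int b2 w) (D w)"
proof -
 define b2 where "b2 = (\<lambda>t \<eta> om. b t \<eta> om * (om \<bullet> nrml t))"
 \<comment> \<open>\<open>ispeed t * shrink t \<eta>\<close> is the reciprocal of
   \<open>stretch t \<eta>\<close>. It cancels the stretch in the \<open>t\<close>-derivative of the
   phase and leaves \<open>b\<close> times the square of \<open>om \<bullet> tang t\<close>.\<close>
 define c where "c = (\<lambda>t \<eta> om. b t \<eta> om * (om \<bullet> tang t) * (ispeed t * shrink t \<eta>))"
 have b2: "b2 \<in> amp" and c: "c \<in> amp"
  unfolding b2_def c_def by (intro amp_intros b amp_frame)+
 obtain b2' where b2': "b2' \<in> amp" "\<And>t \<eta> om S. \<bar>\<eta>\<bar> <= r ==> ((\<lambda>\<eta>. b2 t \<eta> om) has_real_derivative b2' t \<eta> om) (at \<eta> within S)"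
  using amp_d\<eta>E[OF b2] by metis
 obtain c' where c': "c' \<in> amp" "\<And>t \<eta> om S. \<bar>\<eta>\<bar> <= r ==> ((\<lambda>t. c t \<eta> om) has_real_derivative c' t \<eta> om) (at t within S)"
  using amp_dtE[OF c] by metis
 define b1 where "b1 = (\<lambda>t \<eta> om. - (b2' t \<eta> om + c' t \<eta> om))"
 have b1: "b1 \<in> amp" unfolding b1_def by (intro amp_intros b2' c')
 define b3 where "b3 = (\<lambda>t \<eta> om. b2 t \<eta> om * (om \<bullet> nrml t))"
 have b3: "b3 \<in> amp" unfolding b3_def by (intro amp_intros b2 amp_frame)
 \<comment> \<open>The \<open>\<eta>\<close>-derivative of \<open>osc b2\<close>: one term from the
   amplitude and one from the phase, which brings down the second factor
   \<open>om \<bullet> nrml t\<close>.\<close>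
 define E where "E w \<eta> t = osc b2' w \<eta> t + \<i> * of_real (fst w) * osc b3 w \<eta> t" for w \<eta> t
 define D where "D w \<eta> = integral {0..1} (E w \<eta>)" for w \<eta>
 show ?thesis
  unfolding splits_def
 proof (rule bexI[OF _ b1], rule bexI[OF _ b2], intro exI[of _ D] ballI conjI)
  fix w :: "real \<times> (real^2)" assume "w \<in> {w. 0 < fst w \<and> norm (snd w) = 1}"
  then have w: "0 < fst w" "norm (snd w) = 1" by auto
  have cE: "continuous_on ({-r..r} \<times> cbox 0 1) (\<lambda>(\<eta>, t). E w \<eta> t)"
   using continuous_osc[OF b2'(1), of "cbox 0 1" w] continuous_osc[OF b3, of "cbox 0 1" w]
   unfolding E_def split_def by (intro continuous_intros)
  from integral_continuous_on_param[OF this] show "continuous_on {-r..r} (D w)"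
   by (simp add: D_def[abs_def])
  fix \<eta> assume \<eta>: "\<eta> \<in> {-r..r}"
  then have \<eta>': "\<bar>\<eta>\<bar> <= r" by auto
  have "((\<lambda>\<eta>. integral (cbox 0 1) (osc b2 w \<eta>)) has_vector_derivative integral (cbox 0 1) (E w \<eta>)) (at \<eta> within {-r..r})"
  proof (rule leibniz_rule_vector_derivative[OF _ _ cE \<eta>])
   fix x t :: real assume x: "x \<in> {-r..r}"
   then have x': "\<bar>x\<bar> <= r" by auto
   have 1: "((\<lambda>x. complex_of_real (b2 t x (snd w))) has_vector_derivative of_real (b2' t x (snd w))) (at x within {-r..r})"
    using b2'(2)[OF x'] by (intro has_vector_derivative_of_real) (simp add: has_real_derivative_iff_has_vector_derivative)
   show "((\<lambda>x. osc b2 w x t) has_vector_derivative E w x t) (at x within {-r..r})"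
    using has_vector_derivative_mult[OF 1 cis_has_vector_derivative[OF dphase_\<eta>[of "fst w" "snd w" t x "{-r..r}"]]]
    unfolding osc_def[abs_def] E_def b3_def by (simp add: algebra_simps)
   show "osc b2 w x integrable_on cbox 0 1"
    by (intro integrable_continuous continuous_osc_t b2 x')
  qed auto
  then show "(osc_int b2 w has_vector_derivative D w \<eta>) (at \<eta> within {-r..r})"
   by (simp add: osc_int_def[abs_def] D_def)
  have uv: "(snd w \<bullet> tang t)\<^sup>2 + (snd w \<bullet> nrml t)\<^sup>2 = 1" for t
   using frame_pythagoras[of "snd w" t] w by simp
  have "((\<lambda>t. osc c' w \<eta> t + \<i> * of_real (fst w) * (of_real ((snd w \<bullet> tang t)\<^sup>2) * osc b w \<eta> t)) has_integral (osc c w \<eta> 1 - osc c w \<eta> 0)) {0..1}"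
  proof (rule fundamental_theorem_of_calculus)
   fix t :: real
   have 1: "((\<lambda>t. complex_of_real (c t \<eta> (snd w))) has_vector_derivative of_real (c' t \<eta> (snd w))) (at t within {0..1})"
    using c'(2)[OF \<eta>'] by (intro has_vector_derivative_of_real) (simp add: has_real_derivative_iff_has_vector_derivative)
   have eq: "c t \<eta> (snd w) * (fst w * (snd w \<bullet> tang t) * stretch t \<eta>) = fst w * ((snd w \<bullet> tang t)\<^sup>2 * b t \<eta> (snd w))"
   proof -
    have "c t \<eta> (snd w) * (fst w * (snd w \<bullet> tang t) * stretch t \<eta>) =
     (ispeed t * shrink t \<eta> * stretch t \<eta>) * (fst w * ((snd w \<bullet> tang t)\<^sup>2 * b t \<eta> (snd w)))"
     by (simp add: c_def power2_eq_square mult_ac)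
    then show ?thesis by (simp add: stretch_shrink[OF \<eta>'])
   qed
   have eq': "of_real (c t \<eta> (snd w)) * (\<i> * of_real (fst w * (snd w \<bullet> tang t) * stretch t \<eta>) * z) =
     \<i> * of_real (fst w) * (of_real ((snd w \<bullet> tang t)\<^sup>2) * (of_real (b t \<eta> (snd w)) * z))" for z
    using arg_cong[OF eq, of "\<lambda>x. \<i> * (complex_of_real x * z)"] by (simp add: mult_ac)
   show "(osc c w \<eta> has_vector_derivative osc c' w \<eta> t + \<i> * of_real (fst w) * (of_real ((snd w \<bullet> tang t)\<^sup>2) * osc b w \<eta> t)) (at t within {0..1})"
    using has_vector_derivative_mult[OF 1 cis_has_vector_derivative[OF dphase_t[of "fst w" "snd w" \<eta> t "{0..1}"]]]
    unfolding osc_def[abs_def] eq' by (simp add: add.commute)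
  qed simp
  \<comment> \<open>The curve is closed, so a total \<open>t\<close>-derivative integrates to
    zero.\<close>
  moreover have "osc c w \<eta> 1 = osc c w \<eta> 0"
   using amp_periodic[OF c, of 0 \<eta> "snd w"] per0[of 0] per_frame(4)[of 0] by (simp add: osc_def offset_def)
  ultimately have z: "((\<lambda>t. osc c' w \<eta> t + \<i> * of_real (fst w) * (of_real ((snd w \<bullet> tang t)\<^sup>2) * osc b w \<eta> t)) has_integral 0) {0..1}"
   by simp
  have iE: "(E w \<eta> has_integral D w \<eta>) {0..1}"
   unfolding D_def E_def[abs_def]
   by (intro integrable_integral integrable_continuous_real continuous_intros continuous_osc_t b2' b3 \<eta>')
  have i1: "(osc b1 w \<eta> has_integral osc_int b1 w \<eta>) {0..1}"
   unfolding osc_int_def by (intro integrable_integral integrable_continuous_real continuous_osc_t b1 \<eta>')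
  \<comment> \<open>The two phase terms add up to \<open>(om \<bullet> nrml t)\<^sup>2 + (om
    \<bullet> tang t)\<^sup>2 = 1\<close> times the integrand, and \<open>b1\<close> was chosen to
    cancel the two derivatives of the amplitudes.\<close>
  have pt: "E w \<eta> t + osc b1 w \<eta> t + (osc c' w \<eta> t + \<i> * of_real (fst w) * (of_real ((snd w \<bullet> tang t)\<^sup>2) * osc b w \<eta> t)) =
    osc b w \<eta> t * (\<i> * of_real (fst w))" for t
  proof -
   have "osc b3 w \<eta> t = of_real ((snd w \<bullet> nrml t)\<^sup>2) * osc b w \<eta> t"
    by (simp add: osc_def b3_def b2_def power2_eq_square mult_ac)
   then have "E w \<eta> t + osc b1 w \<eta> t + (osc c' w \<eta> t + \<i> * of_real (fst w) * (of_real ((snd w \<bullet> tang t)\<^sup>2) * osc b w \<eta> t)) =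
    \<i> * of_real (fst w) * (of_real ((snd w \<bullet> tang t)\<^sup>2 + (snd w \<bullet> nrml t)\<^sup>2) * osc b w \<eta> t)
     + (osc b2' w \<eta> t + osc c' w \<eta> t + osc b1 w \<eta> t)"
    by (simp add: E_def algebra_simps)
   moreover have "osc b2' w \<eta> t + osc c' w \<eta> t + osc b1 w \<eta> t = 0"
    by (simp add: osc_def b1_def algebra_simps)
   ultimately show ?thesis by (simp add: uv)
  qed
  have "((\<lambda>t. osc b w \<eta> t * (\<i> * of_real (fst w))) has_integral (D w \<eta> + osc_int b1 w \<eta> + 0)) {0..1}"
   using has_integral_add[OF has_integral_add[OF iE i1] z] by (simp only: pt)
  from integral_unique[OF this]
  have "integral {0..1} (\<lambda>t. osc b w \<eta> t * (\<i> * of_real (fst w))) = D w \<eta> + osc_int b1 w \<eta>"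
   by (simp only: add_0_right)
  then show "osc_int b w \<eta> = (D w \<eta> + osc_int b1 w \<eta>) / (\<i> * of_real (fst w))"
   using w by (simp add: osc_int_def integral_mult_left field_simps)
 qed
qed

end

section \<open>Decay of the oscillatory integrals\<close>

text \<open>Each \<open>x\<close> is of one of two types: \<open>turn\<close> is nonzero there, with
  \<open>\<beta> = 0\<close>, or it vanishes exactly like the power \<open>\<kappa> - 2\<close> and
  \<open>x\<close> belongs to \<open>Zp\<close>. The upper bound with \<open>M\<close> controls how
  far the tangent turns near a flat point.\<close>

locale decay = curve_data +
 fixes \<kappa> :: real and Zp :: "real set"
 assumes \<kappa>: "2 <= \<kappa>" and Zp: "Zp \<noteq> {}"
  and flat: "\<And>x. \<exists>\<beta> e m M d. \<bar>e\<bar> = 1 \<and> 0 < m \<and> 0 < M \<and> 0 < d \<and>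
   (\<forall>t. \<bar>t - x\<bar> < d --> 0 <= e * turn t \<and> m * \<bar>t - x\<bar> powr \<beta> <= e * turn t) \<and>
   (\<beta> = 0 \<or> \<beta> = \<kappa> - 2 \<and> x \<in> Zp \<and> (\<forall>t. \<bar>t - x\<bar> < d --> e * turn t <= M * \<bar>t - x\<bar> powr \<beta>))"
begin

definition admissible :: "real => real => real^2 => bool" where
 "admissible l \<eta> om \<longleftrightarrow> 1 <= l \<and> \<bar>\<eta>\<bar> <= r \<and> norm om = 1"

text \<open>The second bound, with \<open>\<phi>\<close> up to the distance of \<open>om\<close> from the normal directions at the flat points, is the
 better one away from these directions.\<close>

definition decay_bound :: "real => real => real^2 => complex => bool" where
 "decay_bound C l om I \<longleftrightarrow> norm I <= C * l powr - (1 / \<kappa>) \<and>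
   (\<forall>\<phi>. 0 <= \<phi> --> (\<forall>z\<in>Zp. \<phi> <= \<bar>om \<bullet> tang z\<bar>) --> norm I * sqrt (l * \<phi>) <= C)"

lemma inner_tang_le: "norm om = 1 ==> \<bar>om \<bullet> tang t\<bar> <= 1" "norm om = 1 ==> \<bar>om \<bullet> nrml t\<bar> <= 1"
 using Cauchy_Schwarz_ineq2[of om "tang t"] Cauchy_Schwarz_ineq2[of om "nrml t"] by (auto simp: norm_tang norm_nrml)

text \<open>Square root decay implies both parts: the first because \<open>\<kappa> >= 2\<close>,
  the second because \<open>\<phi>\<close> cannot exceed one as long as \<open>Zp\<close> is
  nonempty.\<close>

lemma decay_bound_sqrt:
 assumes C: "0 <= C" and l: "1 <= l" and om: "norm om = 1" and I: "norm I <= C * l powr - (1/2)"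
 shows "decay_bound C l om I"
 unfolding decay_bound_def
proof (intro conjI allI impI)
 have "l powr - (1/2) <= l powr - (1 / \<kappa>)" using l \<kappa> by (intro powr_mono) (auto simp: field_simps)
 then show "norm I <= C * l powr - (1 / \<kappa>)" using I C by (meson mult_left_mono order_trans)
 fix \<phi> assume \<phi>: "0 <= \<phi>" "\<forall>z\<in>Zp. \<phi> <= \<bar>om \<bullet> tang z\<bar>"
 obtain z where "z \<in> Zp" using Zp by blast
 then have "\<phi> <= 1" using \<phi> inner_tang_le(1)[OF om, of z] by force
 then have "sqrt (l * \<phi>) <= sqrt l" using l \<phi> by (simp add: mult_left_le)
 then have "norm I * sqrt (l * \<phi>) <= (C * l powr - (1/2)) * sqrt l"
  using I C l \<phi> by (intro mult_mono) auto
 also have "l powr - (1/2) * sqrt l = l powr - (1/2) * l powr (1/2)" using l by (simp add: powr_half_sqrt)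
 then have "(C * l powr - (1/2)) * sqrt l = C" using l by (simp flip: powr_add)
 finally show "norm I * sqrt (l * \<phi>) <= C" .
qed

lemma decay_bound_mono: "decay_bound C l om I ==> C <= C' ==> decay_bound C' l om I"
 unfolding decay_bound_def by (meson mult_right_mono order_trans powr_ge_zero)

lemma decay_bound_add:
 assumes 1: "decay_bound C l om I" and 2: "decay_bound C' l om I'"
 shows "decay_bound (C + C') l om (I + I')"
 unfolding decay_bound_def
proof (intro conjI allI impI)
 show "norm (I + I') <= (C + C') * l powr - (1 / \<kappa>)"
  using 1 2 unfolding decay_bound_def distrib_right by (intro norm_triangle_le add_mono) auto
 fix \<phi> assume \<phi>: "0 <= \<phi>" "\<forall>z\<in>Zp. \<phi> <= \<bar>om \<bullet> tang z\<bar>"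
 have "norm (I + I') * sqrt (l * \<phi>) <= (norm I + norm I') * \<bar>sqrt (l * \<phi>)\<bar>"
  by (rule order_trans[OF mult_left_mono[OF abs_ge_self] mult_right_mono[OF norm_triangle_ineq]]) auto
 \<comment> \<open>\<open>l\<close> may be negative here, and then so may be the square root; that
   case follows from \<open>C + C' >= 0\<close>, which is the instance \<open>\<phi> = 0\<close> of
   the two bounds.\<close>
 show "norm (I + I') * sqrt (l * \<phi>) <= C + C'"
 proof (cases "0 <= sqrt (l * \<phi>)")
  case True
  then have "norm (I + I') * sqrt (l * \<phi>) <= norm I * sqrt (l * \<phi>) + norm I' * sqrt (l * \<phi>)"
   unfolding distrib_right[symmetric] by (intro mult_right_mono norm_triangle_ineq)
  then show ?thesis using 1 2 \<phi> unfolding decay_bound_def by fastforce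
 next
  case False
  have "decay_bound C l om I ==> norm I * sqrt (l * 0) <= C" "decay_bound C' l om I' ==> norm I' * sqrt (l * 0) <= C'"
   unfolding decay_bound_def by auto
  then have "0 <= C + C'" using 1 2 by simp
  moreover have "norm (I + I') * sqrt (l * \<phi>) <= 0" using False by (intro mult_nonneg_nonpos) auto
  ultimately show ?thesis by linarith
 qed
qed

lemma dinner_tang: "((\<lambda>t. om \<bullet> tang t) has_real_derivative - (turn t * (om \<bullet> nrml t))) (at t within S)"
proof -
 have "((\<lambda>t. om \<bullet> tang t) has_vector_derivative om \<bullet> ((- turn t) *\<^sub>R nrml t)) (at t within S)"
  by (rule bounded_linear.has_vector_derivative[OF bounded_linear_inner_right dtang])
 then show ?thesis by (simp add: has_real_derivative_iff_has_vector_derivative)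
qed

text \<open>If the normal component of \<open>om\<close> at \<open>x\<close> is at most
  \<open>1 / 2\<close>, the phase is not stationary near \<open>x\<close> and the integral decays
  like \<open>1 / l\<close>. Otherwise \<open>om \<bullet> nrml t\<close> keeps its sign and is
  bounded away from zero, so the derivative of \<open>om \<bullet> tang t\<close> has the size of
  \<open>turn t\<close> and a fixed sign, and the estimates for monotone phases apply.\<close>

lemma local_decay:
 assumes c: "c \<in> amp"
 shows "\<exists>d>0. \<exists>C\<ge>0. \<forall>a b. a <= x --> x <= b --> b - a < d -->
  (\<forall>l \<eta> om. admissible l \<eta> om --> decay_bound C l om (integral {a..b} (osc c (l, om) \<eta>)))"
proof -
 obtain \<beta> e m M d1 where e: "\<bar>e\<bar> = 1" and m: "0 < m" and M: "0 < M" and d1: "0 < d1"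
  and pos: "\<And>t. \<bar>t - x\<bar> < d1 ==> 0 <= e * turn t"
  and low: "\<And>t. \<bar>t - x\<bar> < d1 ==> m * \<bar>t - x\<bar> powr \<beta> <= e * turn t"
  and type: "\<beta> = 0 \<or> \<beta> = \<kappa> - 2 \<and> x \<in> Zp \<and> (\<forall>t. \<bar>t - x\<bar> < d1 --> e * turn t <= M * \<bar>t - x\<bar> powr \<beta>)"
  using flat[of x] by blast
 have \<beta>: "0 <= \<beta>" using type \<kappa> by auto
 obtain d2 where d2: "0 < d2" "\<And>t. \<bar>t - x\<bar> < d2 ==> norm (tang t - tang x) < 1/4"
 proof -
  have "isCont tang x" using cont_frame(1)[of UNIV] by (simp add: continuous_on_eq_continuous_at)
  then show ?thesis using that unfolding continuous_at_eps_delta dist_norm real_norm_def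
   by (metis divide_pos_pos zero_less_numeral zero_less_one)
 qed
 obtain d3 where d3: "0 < d3" "\<And>t. \<bar>t - x\<bar> < d3 ==> norm (nrml t - nrml x) < 1/4"
 proof -
  have "isCont nrml x" using cont_frame(2)[of UNIV] by (simp add: continuous_on_eq_continuous_at)
  then show ?thesis using that unfolding continuous_at_eps_delta dist_norm real_norm_def
   by (metis divide_pos_pos zero_less_numeral zero_less_one)
 qed
 define d where "d = min 1 (min d1 (min d2 d3))"
 have d: "0 < d" "d <= 1" "d <= d1" "d <= d2" "d <= d3" using d1 d2 d3 by (auto simp: d_def)
 \<comment> \<open>Division by the stretch brings the integrand into the form \<open>B * G\<close>,
   where \<open>G = stretch\<close> is the factor that the phase derivative contains as
   well.\<close>
 define B where "B = (\<lambda>t \<eta> om. c t \<eta> om * (ispeed t * shrink t \<eta>))"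
 have Ba: "B \<in> amp" unfolding B_def by (intro amp_intros c)
 obtain B' where B': "B' \<in> amp" "\<And>t \<eta> om S. \<bar>\<eta>\<bar> <= r ==> ((\<lambda>t. B t \<eta> om) has_real_derivative B' t \<eta> om) (at t within S)"
  using amp_dtE[OF Ba] by metis
 obtain K1 where K1: "0 <= K1" "\<And>t \<eta> om. \<bar>\<eta>\<bar> <= r ==> norm om = 1 ==> \<bar>B t \<eta> om\<bar> <= K1" using amp_bounded[OF Ba] by blast
 obtain K2 where K2: "0 <= K2" "\<And>t \<eta> om. \<bar>\<eta>\<bar> <= r ==> norm om = 1 ==> \<bar>B' t \<eta> om\<bar> <= K2" using amp_bounded[OF B'(1)] by blast
 obtain K' where K': "0 <= K'" "\<And>t \<eta> om. \<bar>\<eta>\<bar> <= r ==> norm om = 1 ==> \<bar>c t \<eta> om\<bar> <= K'" using amp_bounded[OF c] by blast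
 obtain W where W: "0 < W" "\<And>t. norm (turn t) <= W" using periodic_bounded[of turn] per_frame cont_frame by metis
 define K where "K = K1 + K2"
 have K0: "0 <= K" using K1 K2 by (simp add: K_def)
 define C1 where "C1 = 6 * K + 4 * K * W"
 define C2 where "C2 = 4 * K' * (2 / (m / 4)) powr (1 / (\<beta> + 1)) + 10 * K"
 define C3 where "C3 = 4 * K' * M / (m / 4) + 10 * K + 2 * K'"
 have C0: "0 <= C1" "0 <= C2" "0 <= C3" using K0 K' W m M by (auto simp: C1_def C2_def C3_def)
 show ?thesis
 proof (rule exI[of _ d], rule conjI[OF d(1)], rule exI[of _ "C1 + C2 + C3"], rule conjI, goal_cases)
  case 1 then show ?case using C0 by simp
 next
  case 2
  show ?case
  proof (intro allI impI)
   fix a b l \<eta> and om :: "real^2" assume ab: "a <= x" "x <= b" "b - a < d" and adm: "admissible l \<eta> om"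
   have l: "1 <= l" and \<eta>: "\<bar>\<eta>\<bar> <= r" and om: "norm om = 1" using adm by (auto simp: admissible_def)
   have near: "\<bar>t - x\<bar> < d" if "t \<in> {a..b}" for t using that ab by auto
   have ptw: "osc c (l, om) \<eta> t = of_real (B t \<eta> om * stretch t \<eta>) * cis (l * (om \<bullet> offset t \<eta>))" for t
   proof -
    have "B t \<eta> om * stretch t \<eta> = c t \<eta> om * (ispeed t * shrink t \<eta> * stretch t \<eta>)" by (simp add: B_def mult_ac)
    then show ?thesis by (simp add: osc_def stretch_shrink[OF \<eta>])
   qed
   have pyth: "(om \<bullet> tang x)\<^sup>2 + (om \<bullet> nrml x)\<^sup>2 = 1" using frame_pythagoras[of om x] om by simp
   have close: "\<bar>om \<bullet> tang t - om \<bullet> tang x\<bar> <= 1/4" "\<bar>om \<bullet> nrml t - om \<bullet> nrml x\<bar> <= 1/4" if t: "t \<in> {a..b}" for t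
    using Cauchy_Schwarz_ineq2[of om "tang t - tang x"] Cauchy_Schwarz_ineq2[of om "nrml t - nrml x"]
     d2(2)[of t] d3(2)[of t] near[OF t] d om by (auto simp: inner_diff_right)
   have cstr: "continuous_on {a..b} (\<lambda>t. stretch t \<eta>)" by (rule amp_continuous_t[OF amp_stretch \<eta>])
   have cB': "continuous_on {a..b} (\<lambda>t. B' t \<eta> om)" by (rule amp_continuous_t[OF B'(1) \<eta>])
   have cp': "continuous_on {a..b} (\<lambda>t. - (turn t * (om \<bullet> nrml t)))" by (intro continuous_intros cont_frame)
   have KB: "\<bar>B t \<eta> om\<bar> <= K" "\<bar>B' t \<eta> om\<bar> <= K" for t
    using K1(1) K2(1) K1(2)[OF \<eta> om, of t] K2(2)[OF \<eta> om, of t] by (auto simp: K_def)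
   show "decay_bound (C1 + C2 + C3) l om (integral {a..b} (osc c (l, om) \<eta>))"
   proof (cases "\<bar>om \<bullet> nrml x\<bar> <= 1/2")
    case True
    have "(3/4)\<^sup>2 <= (om \<bullet> tang x)\<^sup>2"
    proof -
     have "(om \<bullet> nrml x)\<^sup>2 <= (1/2)\<^sup>2" using True by (metis abs_ge_zero power2_abs power_mono)
     then show ?thesis using pyth by (simp add: power2_eq_square)
    qed
    then have "3/4 <= \<bar>om \<bullet> tang x\<bar>" using abs_le_square_iff[of "3/4" "om \<bullet> tang x"] by simp
    then have pd: "1/2 <= \<bar>om \<bullet> tang t\<bar>" if "t \<in> {a..b}" for t using close(1)[OF that] by linarith
    have p0: "om \<bullet> tang t \<noteq> 0" if "t \<in> {a..b}" for t using pd[OF that] by auto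
    have V: "integral {a..b} (\<lambda>t. \<bar>- (turn t * (om \<bullet> nrml t))\<bar> / (om \<bullet> tang t)\<^sup>2) <= 4 * W"
    proof -
     have "integral {a..b} (\<lambda>t. \<bar>- (turn t * (om \<bullet> nrml t))\<bar> / (om \<bullet> tang t)\<^sup>2) <= integral {a..b} (\<lambda>t. 4 * W)"
     proof (rule integral_le)
      show "(\<lambda>t. \<bar>- (turn t * (om \<bullet> nrml t))\<bar> / (om \<bullet> tang t)\<^sup>2) integrable_on {a..b}"
       using p0 by (intro integrable_continuous_real continuous_intros cont_frame) auto
      fix t assume t: "t \<in> {a..b}"
      have "(1/2)\<^sup>2 <= (om \<bullet> tang t)\<^sup>2" using pd[OF t] abs_le_square_iff[of "1/2" "om \<bullet> tang t"] by simp
      moreover have "\<bar>turn t * (om \<bullet> nrml t)\<bar> <= W * 1"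
       unfolding abs_mult using W(2)[of t] W(1) inner_tang_le(2)[OF om, of t] by (intro mult_mono) auto
      ultimately have "\<bar>turn t * (om \<bullet> nrml t)\<bar> / (om \<bullet> tang t)\<^sup>2 <= W * 1 / (1/2)\<^sup>2"
       using W(1) by (intro frac_le) auto
      then show "\<bar>- (turn t * (om \<bullet> nrml t))\<bar> / (om \<bullet> tang t)\<^sup>2 <= 4 * W" by (simp add: power2_eq_square)
     qed (rule integrable_const_ivl)
     also have "\<dots> = (b - a) * (4 * W)" using ab by simp
     also have "\<dots> <= 1 * (4 * W)" using ab d W by (intro mult_right_mono) auto
     finally show ?thesis by simp
    qed
    have "norm (integral {a..b} (\<lambda>t. of_real (B t \<eta> om * stretch t \<eta>) * cis (l * (om \<bullet> offset t \<eta>))))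
      <= (2 * K / (1/2) + K * (b - a) / (1/2) + K * (4 * W)) / l"
     by (rule oscillatory_integral_by_parts[where p = "\<lambda>t. om \<bullet> tang t" and p' = "\<lambda>t. - (turn t * (om \<bullet> nrml t))" and B' = "\<lambda>t. B' t \<eta> om"])
      (use l ab pd V KB in \<open>auto intro!: dphase_t dinner_tang B'(2) \<eta> cstr cB' cp'\<close>)
    also have "\<dots> <= C1 / l"
    proof -
     have "K * (b - a) <= K * 1" using K0 ab d by (intro mult_left_mono) auto
     then show ?thesis using l by (intro divide_right_mono) (auto simp: C1_def)
    qed
    also have "\<dots> = C1 * l powr - 1" using l by (simp add: powr_minus divide_inverse)
    also have "\<dots> <= C1 * l powr - (1/2)" using C0 l by (intro mult_left_mono powr_mono) auto
    finally have "norm (integral {a..b} (osc c (l, om) \<eta>)) <= C1 * l powr - (1/2)" by (simp only: ptw[abs_def])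
    then show ?thesis by (intro decay_bound_mono[OF decay_bound_sqrt[OF C0(1) l om]]) (use C0 in auto)
   next
    case False
    define s0 where "s0 = sgn (om \<bullet> nrml x)"
    have s0: "\<bar>s0\<bar> = 1" using False by (auto simp: s0_def abs_sgn_eq)
    have s0n: "1/4 <= s0 * (om \<bullet> nrml t)" if "t \<in> {a..b}" for t
     using close(2)[OF that] False by (auto simp: s0_def sgn_if abs_if split: if_splits)
    \<comment> \<open>\<open>e\<close> is the sign of \<open>turn\<close> and \<open>s0\<close> that
      of \<open>om \<bullet> nrml\<close>; hence \<open>- e * s0\<close> is the sign of the
      derivative of \<open>om \<bullet> tang\<close>.\<close>
    interpret mp: monotone_phase a b l K K' "- e * s0" "\<lambda>t. B t \<eta> om" "\<lambda>t. B' t \<eta> om" "\<lambda>t. stretch t \<eta>"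
     "\<lambda>t. om \<bullet> tang t" "\<lambda>t. - (turn t * (om \<bullet> nrml t))" "\<lambda>t. l * (om \<bullet> offset t \<eta>)"
    proof
     fix t assume t: "t \<in> {a..b}"
     show "\<bar>B t \<eta> om * stretch t \<eta>\<bar> <= K'"
     proof -
      have "B t \<eta> om * stretch t \<eta> = c t \<eta> om * (ispeed t * shrink t \<eta> * stretch t \<eta>)" by (simp add: B_def mult_ac)
      then show ?thesis using K'(2)[OF \<eta> om] by (simp add: stretch_shrink[OF \<eta>])
     qed
     have "0 <= (e * turn t) * (s0 * (om \<bullet> nrml t))"
     proof (rule mult_nonneg_nonneg)
      show "0 <= e * turn t" using pos[of t] near[OF t] d by simp
      show "0 <= s0 * (om \<bullet> nrml t)" using s0n[OF t] by linarith
     qed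
     then show "0 <= - e * s0 * - (turn t * (om \<bullet> nrml t))" by (simp add: mult_ac)
    qed (use l ab d s0 e KB in \<open>auto intro!: dphase_t dinner_tang B'(2) \<eta> cstr cB' cp' simp: abs_mult\<close>)
    have low': "m / 4 * \<bar>t - x\<bar> powr \<beta> <= \<bar>- (turn t * (om \<bullet> nrml t))\<bar>" if t: "t \<in> {a..b}" for t
    proof -
     have "(m * \<bar>t - x\<bar> powr \<beta>) * (1/4) <= (e * turn t) * (s0 * (om \<bullet> nrml t))"
     proof (rule mult_mono)
      show "m * \<bar>t - x\<bar> powr \<beta> <= e * turn t" using low[of t] near[OF t] d by simp
      show "0 <= e * turn t" using pos[of t] near[OF t] d by simp
     qed (use s0n[OF t] in auto)
     also have "\<dots> <= \<bar>(e * turn t) * (s0 * (om \<bullet> nrml t))\<bar>" by simp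
     also have "\<dots> = \<bar>- (turn t * (om \<bullet> nrml t))\<bar>" using e s0 by (simp add: abs_mult)
     finally show ?thesis by simp
    qed
    have A: "norm (integral {a..b} (osc c (l, om) \<eta>)) <= C2 * l powr - (1 / (\<beta> + 2))"
     using mp.power_type_bound[of "m / 4" \<beta> x, OF _ \<beta> low'] m by (simp only: ptw[abs_def] C2_def)
    show ?thesis
    proof (cases "\<beta> = 0")
     case True
     then have "norm (integral {a..b} (osc c (l, om) \<eta>)) <= C2 * l powr - (1/2)" using A by simp
     then show ?thesis by (intro decay_bound_mono[OF decay_bound_sqrt[OF C0(2) l om]]) (use C0 in auto)
    next
     case False
     then have b: "\<beta> = \<kappa> - 2" "x \<in> Zp" and up: "\<And>t. \<bar>t - x\<bar> < d1 ==> e * turn t <= M * \<bar>t - x\<bar> powr \<beta>"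
      using type by auto
     \<comment> \<open>The value at \<open>x\<close> plays the part of \<open>q\<close> in
       \<open>directional_bound\<close>. The integrated bound for \<open>turn\<close> has an
       additional factor \<open>\<bar>t - x\<bar>\<close>, which is below one and is
       dropped.\<close>
     have up': "\<bar>om \<bullet> tang t - om \<bullet> tang x\<bar> <= M * \<bar>t - x\<bar> powr \<beta>" if t: "t \<in> {a..b}" for t
     proof -
      have "norm (om \<bullet> tang t - om \<bullet> tang x) <= (M * \<bar>t - x\<bar> powr \<beta>) * \<bar>t - x\<bar>"
      proof (rule vector_derivative_bound[of "min t x" "max t x" _ "\<lambda>t. - (turn t * (om \<bullet> nrml t))" "M * \<bar>t - x\<bar> powr \<beta>"])
       fix u assume u: "u \<in> {min t x..max t x}"
       show "((\<lambda>t. om \<bullet> tang t) has_vector_derivative - (turn u * (om \<bullet> nrml u))) (at u within {min t x..max t x})"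
        using dinner_tang by (simp add: has_real_derivative_iff_has_vector_derivative)
       have ux: "\<bar>u - x\<bar> <= \<bar>t - x\<bar>" using u by (auto simp: abs_if min_def max_def split: if_splits)
       have "norm (- (turn u * (om \<bullet> nrml u))) <= \<bar>turn u\<bar> * 1"
        using inner_tang_le(2)[OF om, of u] by (simp add: abs_mult mult_left_le)
       also have "\<dots> = e * turn u" using pos[of u] ux near[OF t] d e by (simp add: abs_if split: if_splits)
       also have "\<dots> <= M * \<bar>u - x\<bar> powr \<beta>" using up[of u] ux near[OF t] d by simp
       also have "\<dots> <= M * \<bar>t - x\<bar> powr \<beta>" using ux M \<beta> by (intro mult_left_mono powr_mono2) auto
       finally show "norm (- (turn u * (om \<bullet> nrml u))) <= M * \<bar>t - x\<bar> powr \<beta>" .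
      qed auto
      also have "\<dots> <= (M * \<bar>t - x\<bar> powr \<beta>) * 1" using near[OF t] d M by (intro mult_left_mono) auto
      finally show ?thesis by simp
     qed
     show ?thesis
      unfolding decay_bound_def
     proof (intro conjI allI impI)
      have "norm (integral {a..b} (osc c (l, om) \<eta>)) <= C2 * l powr - (1 / \<kappa>)" using A b(1) by simp
      also have "\<dots> <= (C1 + C2 + C3) * l powr - (1 / \<kappa>)" using C0 by (intro mult_right_mono) auto
      finally show "norm (integral {a..b} (osc c (l, om) \<eta>)) <= (C1 + C2 + C3) * l powr - (1 / \<kappa>)" .
      fix \<phi> assume \<phi>: "0 <= \<phi>" "\<forall>z\<in>Zp. \<phi> <= \<bar>om \<bullet> tang z\<bar>"
      have "norm (integral {a..b} (osc c (l, om) \<eta>)) * sqrt (l * \<phi>) <= C3"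
       using mp.directional_bound[of "m / 4" M \<beta> x "om \<bullet> tang x" \<phi>, OF _ M \<beta> low' up' \<phi>(1)] m \<phi>(2) b(2)
       by (simp only: ptw[abs_def] C3_def)
      then show "norm (integral {a..b} (osc c (l, om) \<eta>)) * sqrt (l * \<phi>) <= C1 + C2 + C3" using C0 by simp
     qed
    qed
   qed
  qed
 qed
qed

text \<open>Bisection glues the local estimates: the constants add up over finitely many intervals,
  uniformly in the frequency, the offset and the direction.\<close>

theorem osc_int_decay:
 assumes c: "c \<in> amp"
 shows "\<exists>C\<ge>0. \<forall>l \<eta> om. admissible l \<eta> om --> decay_bound C l om (osc_int c (l, om) \<eta>)"
proof -
 define P where "P a b \<longleftrightarrow> (\<exists>C\<ge>0. \<forall>l \<eta> om. admissible l \<eta> om --> decay_bound C l om (integral {a..b} (osc c (l, om) \<eta>)))" for a b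
 have "P 0 1"
  using zero_le_one[where 'a = real]
 proof (induction rule: Bolzano)
  case (trans a b b')
  obtain C where C: "0 <= C" "\<And>l \<eta> om. admissible l \<eta> om ==> decay_bound C l om (integral {a..b} (osc c (l, om) \<eta>))"
   using trans(1) unfolding P_def by blast
  obtain C' where C': "0 <= C'" "\<And>l \<eta> om. admissible l \<eta> om ==> decay_bound C' l om (integral {b..b'} (osc c (l, om) \<eta>))"
   using trans(2) unfolding P_def by blast
  show ?case
   unfolding P_def
  proof (intro exI[of _ "C + C'"] conjI allI impI)
   fix l \<eta> om assume adm: "admissible l \<eta> om"
   have "integral {a..b} (osc c (l, om) \<eta>) + integral {b..b'} (osc c (l, om) \<eta>) = integral {a..b'} (osc c (l, om) \<eta>)"
    using trans(3,4) adm
    by (intro Henstock_Kurzweil_Integration.integral_combine integrable_continuous_real continuous_osc_t c) (auto simp: admissible_def)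
   then show "decay_bound (C + C') l om (integral {a..b'} (osc c (l, om) \<eta>))"
    using decay_bound_add[OF C(2)[OF adm] C'(2)[OF adm]] by simp
  qed (use C C' in auto)
 next
  case (local x)
  obtain d C where "0 < d" "0 <= C" "\<forall>a b. a <= x --> x <= b --> b - a < d -->
    (\<forall>l \<eta> om. admissible l \<eta> om --> decay_bound C l om (integral {a..b} (osc c (l, om) \<eta>)))"
   using local_decay[OF c, of x] by blast
  then show ?case unfolding P_def by (intro exI[of _ d] conjI allI impI exI[of _ C]) auto
 qed
 then show ?thesis by (simp add: P_def osc_int_def)
qed

end

section \<open>The domain inside the curve\<close>

context plane_curve
begin

lemma reach_mono: "reach r ==> 0 < r' ==> r' <= r ==> reach r'"
proof -
 assume r: "reach r" and r': "0 < r'" "r' <= r"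
 have "r' * (\<bar>turn t\<bar> * ispeed t) <= r * (\<bar>turn t\<bar> * ispeed t)" for t
  using r' ispeed_pos[of t] by (intro mult_right_mono) auto
 then show ?thesis using r r' unfolding reach_def by (meson order_trans)
qed

lemma continuous_offset0: "continuous_on S (\<lambda>p. offset (snd p) (fst p))"
 unfolding offset_def
 by (intro continuous_intros continuous_on_compose2[OF cont\<Gamma>[of UNIV]] continuous_on_compose2[OF cont_frame(2)[of UNIV]]) auto

text \<open>The curve is a simple closed path, hence homeomorphic to a circle, and both facts are
  instances of the Jordan-Brouwer theorems.\<close>

lemma not_connected_complement: "\<not> connected (- curve)"
 and frontier_component: "C \<in> components (- curve) ==> frontier C = curve"
proof -
 have im: "path_image (\<Gamma> 0) = curve" unfolding path_image_def range_\<Gamma>(1) ..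
 have "simple_path (\<Gamma> 0)"
  unfolding simple_path_def loop_free_def
 proof (intro conjI ballI impI)
  show "path (\<Gamma> 0)" unfolding path_def by (rule cont\<Gamma>)
  fix x y :: real assume xy: "x \<in> {0..1}" "y \<in> {0..1}" "\<Gamma> 0 x = \<Gamma> 0 y"
  obtain n :: int where n: "x = y + of_int n" using eq_imp_int[OF xy(3)] by blast
  then have "-1 <= real_of_int n" "real_of_int n <= 1" using xy by auto
  then have "n = -1 \<or> n = 0 \<or> n = 1" by linarith
  then show "x = y \<or> x = 0 \<and> y = 1 \<or> x = 1 \<and> y = 0" using n xy by auto
 qed
 moreover have "pathfinish (\<Gamma> 0) = pathstart (\<Gamma> 0)"
  using per0[of 0] by (simp add: pathfinish_def pathstart_def)
 ultimately have "curve homeomorphic sphere (0::complex) 1"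
  using homeomorphic_simple_path_image_circle[of "\<Gamma> 0" 1 0] by (simp add: im)
 moreover have "sphere (0::complex) 1 homeomorphic sphere (0::real^2) 1"
  by (rule homeomorphic_spheres') simp_all
 ultimately have h: "curve homeomorphic sphere (0::real^2) 1" by (rule homeomorphic_trans)
 then show "\<not> connected (- curve)" by (rule Jordan_Brouwer_separation) simp
 show "C \<in> components (- curve) ==> frontier C = curve"
  by (rule Jordan_Brouwer_frontier[OF h]) simp_all
qed

lemma offset_not_range: "reach r ==> \<bar>\<eta>\<bar> <= r ==> \<eta> \<noteq> 0 ==> offset t \<eta> \<notin> curve"
 using offset_closest(2)[of r \<eta> t] by (metis abs_eq_0 infdist_zero)

text \<open>One side of the tube is a continuous image of a connected set and avoids the curve, so
  that a single component of the complement contains it.\<close>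

lemma side_connected:
 assumes r: "reach r" and I: "connected I" "\<And>\<eta>. \<eta> \<in> I ==> \<bar>\<eta>\<bar> <= r \<and> \<eta> \<noteq> 0"
  and C: "C \<in> components (- curve)" and \<eta>: "\<eta> \<in> I" "offset t \<eta> \<in> C" and \<eta>': "\<eta>' \<in> I"
 shows "offset t' \<eta>' \<in> C"
proof -
 let ?S = "(\<lambda>p. offset (snd p) (fst p)) ` (I \<times> UNIV)"
 have "connected ?S" by (intro connected_continuous_image continuous_offset0 connected_Times I connected_UNIV)
 moreover have "?S \<subseteq> - curve"
 proof clarify
  fix \<eta> t y assume "\<eta> \<in> I" "offset (snd (\<eta>, t)) (fst (\<eta>, t)) = \<Gamma> 0 y"
  then show False using offset_not_range[OF r, of \<eta> t] I(2)[of \<eta>] rangeI[of "\<Gamma> 0" y] by simp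
 qed
 moreover have "C \<inter> ?S \<noteq> {}" using \<eta> by force
 ultimately have "?S \<subseteq> C" by (rule components_maximal[OF C])
 then show ?thesis using \<eta>' by force
qed

text \<open>\<open>\<Omega>\<close> is a component of the complement of the curve, and there is
  another one. Both have the whole curve as frontier and therefore meet the tube; as each side of
  the tube lies in one component, they occupy opposite sides.\<close>

lemma sides:
 assumes r: "reach r" and \<Omega>: "open \<Omega>" "\<Omega> \<noteq> {}" "connected \<Omega>" "frontier \<Omega> = curve"
 shows "(\<forall>t \<eta>. 0 < \<eta> --> \<eta> <= r --> offset t \<eta> \<notin> closure \<Omega> \<and> offset t (- \<eta>) \<in> \<Omega>) \<or>
  (\<forall>t \<eta>. 0 < \<eta> --> \<eta> <= r --> offset t (- \<eta>) \<notin> closure \<Omega> \<and> offset t \<eta> \<in> \<Omega>)"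
proof -
 have disj: "\<Omega> \<inter> curve = {}" using \<Omega> by (simp add: frontier_def interior_open flip: \<Omega>(4))
 obtain C where C: "C \<in> components (- curve)" "\<Omega> \<subseteq> C"
  using exists_component_superset[of \<Omega> "- curve"] \<Omega> disj by blast
 have "C \<subseteq> \<Omega>"
 proof (rule ccontr)
  assume "\<not> C \<subseteq> \<Omega>"
  then have "C \<inter> frontier \<Omega> \<noteq> {}"
   using C \<Omega> in_components_connected[OF C(1)] by (intro connected_Int_frontier) auto
  then show False using in_components_subset[OF C(1)] \<Omega>(4) by auto
 qed
 then have \<Omega>c: "\<Omega> \<in> components (- curve)" using C by auto
 obtain C' where C': "C' \<in> components (- curve)" "C' \<noteq> \<Omega>"
 proof -
  have "\<not> (\<forall>C\<in>components (- curve). C = \<Omega>)"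
  proof
   assume "\<forall>C\<in>components (- curve). C = \<Omega>"
   then have eq: "components (- curve) = {\<Omega>}" using \<Omega>c by blast
   have "- curve = \<Omega>" using Union_components[of "- curve"] unfolding eq by simp
   then have "connected (- curve)" using \<Omega>(3) by simp
   then show False using not_connected_complement by simp
  qed
  then show ?thesis using that by blast
 qed
 have dis: "\<Omega> \<inter> C' = {}" using components_nonoverlap[OF \<Omega>c C'(1)] C'(2) by auto
 have oC': "open C'"
  by (rule open_components[OF _ C'(1)]) (use compact_imp_closed[OF compact_range] in auto)
 have out: "x \<notin> closure \<Omega>" if "x \<in> C'" for x
 proof
  assume "x \<in> closure \<Omega>"
  then have "C' \<inter> \<Omega> \<noteq> {}" using oC' that closure_iff_nhds_not_empty[of x \<Omega>] by (metis open_Int_closure_eq_empty disjoint_iff)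
  then show False using dis by auto
 qed
 have touch: "\<exists>t \<eta>. \<bar>\<eta>\<bar> < r \<and> \<eta> \<noteq> 0 \<and> offset t \<eta> \<in> D" if D: "D \<in> components (- curve)" for D
 proof -
  have "\<Gamma> 0 0 \<in> closure D" using frontier_component[OF D] by (auto simp: frontier_def)
  then obtain x where x: "x \<in> D" "dist x (\<Gamma> 0 0) < r"
   using r unfolding reach_def closure_approachable by blast
  obtain t \<eta> where t: "x = offset t \<eta>" "\<bar>\<eta>\<bar> = infdist x curve" using offset_surj[of x] by blast
  have "\<bar>\<eta>\<bar> < r" using infdist_le[of "\<Gamma> 0 0" "curve" x] x t by simp
  moreover have "\<eta> \<noteq> 0" using x(1) t(1) in_components_subset[OF D] by (auto simp: offset_def)
  ultimately show ?thesis using t(1) x(1) by blast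
 qed
 have pos: "connected {0<..r}" "\<And>\<eta>. \<eta> \<in> {0<..r} ==> \<bar>\<eta>\<bar> <= r \<and> \<eta> \<noteq> 0" by auto
 have neg: "connected {-r..<0}" "\<And>\<eta>. \<eta> \<in> {-r..<0} ==> \<bar>\<eta>\<bar> <= r \<and> \<eta> \<noteq> 0" by auto
 obtain t1 \<eta>1 where 1: "\<bar>\<eta>1\<bar> < r" "\<eta>1 \<noteq> 0" "offset t1 \<eta>1 \<in> \<Omega>" using touch[OF \<Omega>c] by blast
 obtain t2 \<eta>2 where 2: "\<bar>\<eta>2\<bar> < r" "\<eta>2 \<noteq> 0" "offset t2 \<eta>2 \<in> C'" using touch[OF C'(1)] by blast
 have no: "offset t \<eta> \<notin> C' \<or> offset t \<eta> \<notin> \<Omega>" for t \<eta> using dis by auto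
 show ?thesis
 proof (cases "0 < \<eta>1")
  case True
  then have P: "offset t \<eta> \<in> \<Omega>" if "0 < \<eta>" "\<eta> <= r" for t \<eta>
   using side_connected[OF r pos \<Omega>c _ 1(3)] 1 that by auto
  have "\<not> 0 < \<eta>2" using P[of \<eta>2 t2] 2 no by auto
  then have N: "offset t \<eta> \<in> C'" if "\<eta> < 0" "-r <= \<eta>" for t \<eta>
   using side_connected[OF r neg C'(1) _ 2(3)] 2 that by auto
  show ?thesis using P N[THEN out] by auto
 next
  case False
  then have P: "offset t \<eta> \<in> \<Omega>" if "\<eta> < 0" "-r <= \<eta>" for t \<eta>
   using side_connected[OF r neg \<Omega>c _ 1(3)] 1 that by auto
  have "\<not> \<eta>2 < 0" using P[of \<eta>2 t2] 2 no by auto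
  then have N: "offset t \<eta> \<in> C'" if "0 < \<eta>" "\<eta> <= r" for t \<eta>
   using side_connected[OF r pos C'(1) _ 2(3)] 2 that by auto
  show ?thesis using P N[THEN out] by auto
 qed
qed

text \<open>By \<open>normal_deviation\<close>, \<open>K * (norm (c s - c 0))\<^sup>2 - nrml t
  \<bullet> (c s - c 0)\<close> is nonnegative and zero at \<open>s = 0\<close>, so its derivative
  \<open>- (nrml t \<bullet> v)\<close> there must vanish. The argument suits a \<open>c\<close>
  that is differentiable at a single point.\<close>

lemma curve_perp:
 assumes c: "range c \<subseteq> curve" "c 0 = \<Gamma> 0 t" "(c has_vector_derivative v) (at (0::real))"
 shows "nrml t \<bullet> v = 0"
proof -
 obtain K where K: "0 < K" "\<And>s t. \<bar>nrml t \<bullet> (\<Gamma> 0 s - \<Gamma> 0 t)\<bar> <= K * (norm (\<Gamma> 0 s - \<Gamma> 0 t))\<^sup>2"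
  using normal_deviation by blast
 have d: "((\<lambda>s. c s - c 0) has_vector_derivative v) (at 0)" using c(3) by (auto intro!: derivative_eq_intros)
 define h where "h s = K * ((c s - c 0) \<bullet> (c s - c 0)) - nrml t \<bullet> (c s - c 0)" for s
 have "((\<lambda>s. (c s - c 0) \<bullet> (c s - c 0)) has_derivative (\<lambda>k. (c 0 - c 0) \<bullet> (k *\<^sub>R v) + (k *\<^sub>R v) \<bullet> (c 0 - c 0))) (at 0)"
  using d unfolding has_vector_derivative_def by (intro has_derivative_inner)
 then have 1: "((\<lambda>s. (c s - c 0) \<bullet> (c s - c 0)) has_real_derivative 0) (at 0)"
  by (simp add: has_field_derivative_def lambda_zero)
 have 2: "((\<lambda>s. nrml t \<bullet> (c s - c 0)) has_real_derivative nrml t \<bullet> v) (at 0)"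
  using bounded_linear.has_vector_derivative[OF bounded_linear_inner_right d]
  by (simp add: has_real_derivative_iff_has_vector_derivative)
 have "(h has_real_derivative K * 0 - nrml t \<bullet> v) (at 0)"
  unfolding h_def by (intro DERIV_diff DERIV_cmult 1 2)
 moreover have "h 0 <= h s" for s
 proof -
  obtain s' where "c s = \<Gamma> 0 s'" using c(1) by blast
  then show ?thesis using K(2)[of t s'] by (simp add: h_def c(2) power2_norm_eq_inner abs_le_iff)
 qed
 ultimately have "K * 0 - nrml t \<bullet> v = 0" by (intro DERIV_local_min[of h _ 0 1]) auto
 then show ?thesis by simp
qed

text \<open>Within half a period, but off a neighbourhood of \<open>t0\<close>, the offset curve
  keeps a positive distance from \<open>offset t0 \<eta>\<close>, by compactness and injectivity.
  Any choice of parameters along a curve is thus continuous where it passes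
  \<open>t0\<close>.\<close>

lemma offset_local_lift:
 assumes r: "reach r" and \<eta>: "\<bar>\<eta>\<bar> <= r" and e: "0 < e"
 obtains d where "0 < d" "\<And>t. \<bar>t - t0\<bar> <= 1/2 ==> norm (offset t \<eta> - offset t0 \<eta>) < d ==> \<bar>t - t0\<bar> < e"
proof -
 define K where "K = {t0 - 1/2..t0 + 1/2} - {t0 - e<..<t0 + e}"
 define f where "f t = norm (offset t \<eta> - offset t0 \<eta>)" for t
 have K: "compact K" unfolding K_def by (intro compact_diff) auto
 have cf: "continuous_on K f"
  unfolding f_def by (intro continuous_intros continuous_at_imp_continuous_on ballI has_vector_derivative_continuous[OF doffset_t])
 have pos: "0 < f t" if t: "t \<in> K" for t
 proof (rule ccontr)
  assume "\<not> 0 < f t"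
  then have "offset t \<eta> = offset t0 \<eta>" by (simp add: f_def)
  then have "\<Gamma> 0 t = \<Gamma> 0 t0" by (rule offset_inj(1)[OF r \<eta> \<eta>])
  then obtain n :: int where n: "t = t0 + of_int n" using eq_imp_int by blast
  have "t0 - 1/2 <= t" "t <= t0 + 1/2" using t by (auto simp: K_def)
  moreover have "t \<noteq> t0" using t e by (auto simp: K_def)
  then have "n \<noteq> 0" using n by auto
  ultimately have "- (1/2) <= real_of_int n" "real_of_int n <= 1/2" "n \<noteq> 0" using n by linarith+
  then show False by linarith
 qed
 obtain d where d: "0 < d" "\<And>t. t \<in> K ==> d <= f t"
 proof (cases "K = {}")
  case False
  obtain t1 where "t1 \<in> K" "\<forall>t\<in>K. f t1 <= f t" using continuous_attains_inf[OF K False cf] by blast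
  then show ?thesis using that[of "f t1"] pos by blast
 qed (use that[of 1] in auto)
 show ?thesis
 proof (rule that[OF d(1)])
  fix t assume t: "\<bar>t - t0\<bar> <= 1/2" "norm (offset t \<eta> - offset t0 \<eta>) < d"
  then have "t \<notin> K" using d(2)[of t] by (auto simp: f_def)
  then show "\<bar>t - t0\<bar> < e" using t(1) by (auto simp: K_def abs_if split: if_splits)
 qed
qed

lemma offset_periodic: "offset (t + of_int n) \<eta> = offset t \<eta>"
 using periodic_int[of "\<lambda>t. offset t \<eta>" t n] by (simp add: offset_def per0 per_frame)

text \<open>The parametrisation \<open>c\<close> is lifted to \<open>c s = offset (\<tau> s) \<eta>\<close>; differentiating \<open>c' s \<bullet> nrml (\<tau> s) = 0\<close>
 at \<open>0\<close> only uses that \<open>\<tau>\<close> is differentiable at this point.\<close>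

lemma level_curve_curvature:
 assumes r: "reach r" and \<eta>: "\<bar>\<eta>\<bar> < r" and on: "\<And>t. offset t \<eta> \<in> C"
  and U: "open U" "offset t0 \<eta> \<in> U" "\<And>y. y \<in> C \<inter> U ==> \<exists>t. y = offset t \<eta>"
 shows "signed_curvature C (nrml t0) (offset t0 \<eta>) = turn t0 / stretch t0 \<eta>"
proof -
 have \<eta>': "\<bar>\<eta>\<bar> <= r" using \<eta> by simp
 note st = stretch_pos(2)[OF r \<eta>']
 have dstr: "\<exists>s'. ((\<lambda>t. stretch t \<eta>) has_real_derivative s') (at t)" for t
 proof -
  have d1: "((\<lambda>t. \<Gamma> 1 t $ i) has_real_derivative \<Gamma> 2 t $ i) (at t)" "((\<lambda>t. \<Gamma> 2 t $ i) has_real_derivative \<Gamma> 3 t $ i) (at t)" for i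
   using dcomp[of 1 i t UNIV] dcomp[of 2 i t UNIV] by (simp_all add: numeral_2_eq_2 numeral_3_eq_3)
  show ?thesis unfolding stretch_def turn_def
   by (rule exI) (rule derivative_eq_intros refl dspeed dispeed d1)+
 qed
 show ?thesis
  unfolding signed_curvature_def
 proof (rule the_equality)
  obtain s' where s': "((\<lambda>t. stretch t \<eta>) has_real_derivative s') (at t0)" using dstr by blast
  \<comment> \<open>The derivative of \<open>stretch * tang\<close> at \<open>t0\<close>; the
    tangential part with \<open>s'\<close> disappears in the product with
    \<open>nrml t0\<close>.\<close>
  define w where "w = stretch t0 \<eta> *\<^sub>R ((- turn t0) *\<^sub>R nrml t0) + s' *\<^sub>R tang t0"
  have shift: "((\<lambda>s. g (t0 + s)) has_vector_derivative D) (at s)"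
   if "(g has_vector_derivative D) (at (t0 + s))" for g :: "real => real^2" and D s
  proof -
   have "(g \<circ> (\<lambda>s. t0 + s) has_vector_derivative (1 *\<^sub>R D)) (at s)"
    using that by (intro vector_diff_chain_at[where f = "\<lambda>s. t0 + s" and g = g]) (auto intro!: derivative_eq_intros)
   then show ?thesis by (simp add: o_def)
  qed
  have c1: "((\<lambda>s. offset (t0 + s) \<eta>) has_vector_derivative stretch (t0 + s) \<eta> *\<^sub>R tang (t0 + s)) (at s)" for s
   by (rule shift[OF doffset_t])
  have c2: "((\<lambda>s. stretch (t0 + s) \<eta> *\<^sub>R tang (t0 + s)) has_vector_derivative w) (at 0)"
   unfolding w_def by (rule shift) (use has_vector_derivative_scaleR[OF s' dtang[of t0 UNIV]] in simp)
  have "- (w \<bullet> nrml t0) / (norm (stretch t0 \<eta> *\<^sub>R tang t0))\<^sup>2 = turn t0 / stretch t0 \<eta>"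
   using st[of t0] by (simp add: w_def inner_add_left inner_diff_left inner_self inner_tang_nrml norm_tang power2_eq_square)
  then show "\<exists>c c' w r. 0 < r \<and> c 0 = offset t0 \<eta> \<and> (\<forall>t. \<bar>t\<bar> < r --> c t \<in> C \<and> (c has_vector_derivative c' t) (at t)) \<and>
    (c' has_vector_derivative w) (at (0::real)) \<and> c' 0 \<noteq> 0 \<and> turn t0 / stretch t0 \<eta> = - (w \<bullet> nrml t0) / (norm (c' 0))\<^sup>2"
   using on c1 c2 st[of t0] norm_tang[of t0]
   by (intro exI[of _ "\<lambda>s. offset (t0 + s) \<eta>"] exI[of _ "\<lambda>s. stretch (t0 + s) \<eta> *\<^sub>R tang (t0 + s)"] exI[of _ w] exI[of _ 1]) auto
 next
  fix k assume "\<exists>c c' w r. 0 < r \<and> c 0 = offset t0 \<eta> \<and> (\<forall>t. \<bar>t\<bar> < r --> c t \<in> C \<and> (c has_vector_derivative c' t) (at t)) \<and>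
    (c' has_vector_derivative w) (at (0::real)) \<and> c' 0 \<noteq> 0 \<and> k = - (w \<bullet> nrml t0) / (norm (c' 0))\<^sup>2"
  then obtain c c' w q where q: "0 < q" and c0: "c 0 = offset t0 \<eta>"
   and c: "\<And>t. \<bar>t\<bar> < q ==> c t \<in> C" "\<And>t. \<bar>t\<bar> < q ==> (c has_vector_derivative c' t) (at t)"
   and w: "(c' has_vector_derivative w) (at (0::real))" and c'0: "c' 0 \<noteq> 0" and k: "k = - (w \<bullet> nrml t0) / (norm (c' 0))\<^sup>2"
   by blast
  have cont0: "isCont c 0" using has_vector_derivative_continuous[OF c(2)[of 0]] q by simp
  obtain q1 where q1: "0 < q1" "\<And>s. \<bar>s\<bar> < q1 ==> c s \<in> U"
  proof -
   have "\<forall>\<^sub>F s in nhds 0. c s \<in> U"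
    using cont0[unfolded isCont_def tendsto_at_iff_tendsto_nhds] U(1,2) c0 by (intro topological_tendstoD) auto
   then show ?thesis using that unfolding eventually_nhds_metric dist_real_def by auto
  qed
  define q2 where "q2 = min q q1"
  have q2: "0 < q2" using q q1 by (simp add: q2_def)
  have ex: "\<exists>t. \<bar>t - t0\<bar> <= 1/2 \<and> c s = offset t \<eta>" if s: "\<bar>s\<bar> < q2" for s
  proof -
   have "c s \<in> C \<inter> U" using c(1) q1(2) s by (auto simp: q2_def)
   then obtain t where t: "c s = offset t \<eta>" using U(3) by blast
   define t' where "t' = t + of_int (- round (t - t0))"
   have "\<bar>of_int (round (t - t0)) - (t - t0)\<bar> <= 1/2" by (rule of_int_round_abs_le)
   moreover have "t' - t0 = - (of_int (round (t - t0)) - (t - t0))" by (simp add: t'_def)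
   ultimately have "\<bar>t' - t0\<bar> <= 1/2" by (simp only: abs_minus_cancel)
   moreover have "c s = offset t' \<eta>" unfolding t'_def offset_periodic by (rule t)
   ultimately show ?thesis by blast
  qed
  \<comment> \<open>A choice without any regularity in \<open>s\<close>; continuity at
    \<open>0\<close> is supplied by \<open>offset_local_lift\<close>.\<close>
  define \<tau> where "\<tau> s = (SOME t. \<bar>t - t0\<bar> <= 1/2 \<and> c s = offset t \<eta>)" for s
  have \<tau>: "\<bar>\<tau> s - t0\<bar> <= 1/2" "c s = offset (\<tau> s) \<eta>" if "\<bar>s\<bar> < q2" for s
   using someI_ex[OF ex[OF that]] by (auto simp: \<tau>_def)
  have \<tau>small: "\<exists>d>0. \<forall>s. \<bar>s\<bar> < d --> \<bar>\<tau> s - t0\<bar> < e" if e: "0 < e" for e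
  proof -
   obtain d where d: "0 < d" "\<And>t. \<bar>t - t0\<bar> <= 1/2 ==> norm (offset t \<eta> - offset t0 \<eta>) < d ==> \<bar>t - t0\<bar> < e"
    using offset_local_lift[OF r \<eta>' e] by blast
   obtain d' where d': "0 < d'" "\<And>s. \<bar>s\<bar> < d' ==> norm (c s - c 0) < d"
    using cont0 d(1) unfolding continuous_at_eps_delta dist_norm by force
   show ?thesis
   proof (rule exI[of _ "min d' q2"], intro conjI allI impI)
    fix s assume "\<bar>s\<bar> < min d' q2"
    then show "\<bar>\<tau> s - t0\<bar> < e" using d(2)[of "\<tau> s"] \<tau>[of s] d'(2)[of s] c0 by auto
   qed (use d' q2 in auto)
  qed
  have \<tau>0: "\<tau> 0 = t0"
  proof (rule ccontr)
   assume "\<tau> 0 \<noteq> t0"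
   then obtain d where "0 < d" "\<forall>s. \<bar>s\<bar> < d --> \<bar>\<tau> s - t0\<bar> < \<bar>\<tau> 0 - t0\<bar>" using \<tau>small[of "\<bar>\<tau> 0 - t0\<bar>"] by auto
   then show False by force
  qed
  have cont\<tau>: "isCont \<tau> 0"
   unfolding continuous_at_eps_delta using \<tau>small by (simp add: \<tau>0 dist_real_def)
  have perp: "c' s \<bullet> nrml (\<tau> s) = 0" if s: "\<bar>s\<bar> < q2" for s
  proof (cases "\<eta> = 0")
   case True
   \<comment> \<open>\<open>curve_perp\<close> asks for a map of the whole line into the curve, so
     \<open>c\<close> is continued by a constant point outside the small interval.\<close>
   define c3 where "c3 u = (if \<bar>s + u\<bar> < q2 then c (s + u) else \<Gamma> 0 0)" for u
   have "range c3 \<subseteq> curve" using \<tau>(2) True by (auto simp: c3_def offset_def)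
   moreover have "c3 0 = \<Gamma> 0 (\<tau> s)" using \<tau>(2)[OF s] True s by (simp add: c3_def offset_def)
   moreover have "(c3 has_vector_derivative c' s) (at 0)"
   proof (rule has_vector_derivative_transform_within_open)
    have "(c \<circ> (\<lambda>u. s + u) has_vector_derivative (1 *\<^sub>R c' s)) (at 0)"
     by (rule vector_diff_chain_at[where f = "\<lambda>u. s + u" and g = c]) (use c(2)[of s] s in \<open>auto intro!: derivative_eq_intros simp: q2_def\<close>)
    then show "((\<lambda>u. c (s + u)) has_vector_derivative c' s) (at 0)" by (simp add: o_def)
    show "open {u. \<bar>s + u\<bar> < q2}" by (intro open_Collect_less continuous_intros)
   qed (use s in \<open>auto simp: c3_def\<close>)
   ultimately have "nrml (\<tau> s) \<bullet> c' s = 0" by (rule curve_perp)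
   then show ?thesis by (simp add: inner_commute)
  next
   case False
   \<comment> \<open>The foot point of \<open>c s\<close> is at distance
     \<open>\<bar>\<eta>\<bar>\<close>, and no nearby \<open>c u\<close> is closer to it, since
     \<open>c u\<close> has the distance \<open>\<bar>\<eta>\<bar>\<close> from the whole curve. So
     \<open>c' s\<close> is orthogonal to \<open>c s - p\<close>, a nonzero multiple of
     \<open>nrml (\<tau> s)\<close>.\<close>
   define p where "p = \<Gamma> 0 (\<tau> s)"
   define h where "h u = (c u - p) \<bullet> (c u - p)" for u
   have dc: "((\<lambda>u. c u - p) has_vector_derivative c' s) (at s)"
    using c(2)[of s] s by (auto intro!: derivative_eq_intros simp: q2_def)
   then have "(h has_derivative (\<lambda>k. (c s - p) \<bullet> (k *\<^sub>R c' s) + (k *\<^sub>R c' s) \<bullet> (c s - p))) (at s)"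
    unfolding h_def has_vector_derivative_def by (intro has_derivative_inner)
   then have "DERIV h s :> 2 * ((c s - p) \<bullet> c' s)"
    unfolding has_field_derivative_def by (rule has_derivative_eq_rhs) (auto simp: inner_commute algebra_simps)
   moreover have "h s <= h u" if u: "\<bar>s - u\<bar> < q2 - \<bar>s\<bar>" for u
   proof -
    have u2: "\<bar>u\<bar> < q2" using u by linarith
    have "norm (c s - p) = \<bar>\<eta>\<bar>" using \<tau>(2)[OF s] norm_offset by (simp add: p_def)
    also have "\<bar>\<eta>\<bar> = infdist (c u) curve" using \<tau>(2)[OF u2] offset_closest(2)[OF r \<eta>'] by simp
    also have "\<dots> <= norm (c u - p)" using infdist_le[of p "curve" "c u"] by (simp add: p_def dist_norm)
    finally show ?thesis by (simp add: h_def norm_le)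
   qed
   ultimately have "2 * ((c s - p) \<bullet> c' s) = 0" using s by (intro DERIV_local_min[of h _ s "q2 - \<bar>s\<bar>"]) auto
   moreover have "c s - p = \<eta> *\<^sub>R nrml (\<tau> s)" using \<tau>(2)[OF s] by (simp add: p_def offset_def)
   ultimately show ?thesis using False by (simp add: inner_commute)
  qed
  define v where "v = c' 0 \<bullet> tang t0"
  have c'0eq: "c' 0 = v *\<^sub>R tang t0"
   using frame_decomp[of "c' 0" t0] perp[of 0] q2 by (simp add: \<tau>0 v_def)
  have v: "v \<noteq> 0" using c'0 c'0eq by auto
  have dA: "((\<lambda>t. tang t0 \<bullet> offset t \<eta>) has_real_derivative stretch t0 \<eta>) (at t0)"
   using bounded_linear.has_vector_derivative[OF bounded_linear_inner_right doffset_t[of \<eta> t0 UNIV], of "tang t0"]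
   by (simp add: has_real_derivative_iff_has_vector_derivative inner_self)
  have dB: "((\<lambda>s. tang t0 \<bullet> c s) has_real_derivative v) (at 0)"
   using bounded_linear.has_vector_derivative[OF bounded_linear_inner_right c(2)[of 0], of "tang t0"] q
   by (simp add: has_real_derivative_iff_has_vector_derivative v_def inner_commute)
  \<comment> \<open>Both derivatives are used in Caratheodory's form. The quotient of the two slope
    functions represents \<open>\<tau>\<close> near \<open>0\<close>, which upgrades its continuity
    at \<open>0\<close> to differentiability.\<close>
  obtain g where g: "\<And>z. tang t0 \<bullet> offset z \<eta> - tang t0 \<bullet> offset t0 \<eta> = g z * (z - t0)" "isCont g t0" "g t0 = stretch t0 \<eta>"
   using dA unfolding CARAT_DERIV by blast
  obtain h where h: "\<And>z. tang t0 \<bullet> c z - tang t0 \<bullet> c 0 = h z * (z - 0)" "isCont h 0" "h 0 = v"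
   using dB unfolding CARAT_DERIV by blast
  have cg: "isCont (\<lambda>s. g (\<tau> s)) 0" using isCont_o2[OF cont\<tau>, of g] g(2) by (simp add: \<tau>0)
  have "\<forall>\<^sub>F s in nhds 0. g (\<tau> s) \<noteq> 0"
  proof (rule tendsto_imp_eventually_ne)
   show "((\<lambda>s. g (\<tau> s)) \<longlongrightarrow> stretch t0 \<eta>) (nhds 0)"
    using cg[unfolded isCont_def] tendsto_at_iff_tendsto_nhds[of "\<lambda>s. g (\<tau> s)" 0] by (simp only: \<tau>0 g(3))
   show "stretch t0 \<eta> \<noteq> 0" using st[of t0] by simp
  qed
  moreover have "\<forall>\<^sub>F s in nhds 0. \<bar>s\<bar> < q2" using q2 unfolding eventually_nhds_metric dist_real_def by auto
  ultimately have ev: "\<forall>\<^sub>F s in nhds 0. \<tau> s = t0 + h s / g (\<tau> s) * s"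
  proof eventually_elim
   case (elim s)
   have "g (\<tau> s) * (\<tau> s - t0) = h s * s" using g(1)[of "\<tau> s"] h(1)[of s] \<tau>(2)[OF elim(2)] c0 by simp
   then show ?case using elim(1) by (simp add: field_simps)
  qed
  have "((\<lambda>s. t0 + h s / g (\<tau> s) * s) has_real_derivative v / stretch t0 \<eta>) (at 0)"
   unfolding CARAT_DERIV using cg h(2,3) g(3) st[of t0] \<tau>0
   by (intro exI[of _ "\<lambda>s. h s / g (\<tau> s)"]) (auto intro!: continuous_intros)
  then have d\<tau>: "(\<tau> has_real_derivative v / stretch t0 \<eta>) (at 0)"
   using DERIV_cong_ev[OF refl ev refl] by blast
  have dn: "((\<lambda>s. nrml (\<tau> s)) has_vector_derivative (v / stretch t0 \<eta>) *\<^sub>R (turn t0 *\<^sub>R tang t0)) (at 0)"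
   using vector_diff_chain_at[OF d\<tau>[unfolded has_real_derivative_iff_has_vector_derivative], of nrml "turn t0 *\<^sub>R tang t0"] dnrml[of t0 UNIV]
   by (simp add: \<tau>0 o_def)
  have "((\<lambda>s. c' s \<bullet> nrml (\<tau> s)) has_derivative (\<lambda>k. c' 0 \<bullet> (k *\<^sub>R ((v / stretch t0 \<eta>) *\<^sub>R (turn t0 *\<^sub>R tang t0))) + (k *\<^sub>R w) \<bullet> nrml (\<tau> 0))) (at 0)"
   using w dn unfolding has_vector_derivative_def by (intro has_derivative_inner)
  then have "((\<lambda>s. c' s \<bullet> nrml (\<tau> s)) has_real_derivative (v * v * turn t0 / stretch t0 \<eta> + w \<bullet> nrml t0)) (at 0)"
   unfolding has_field_derivative_def
   by (rule has_derivative_eq_rhs) (auto simp: c'0eq \<tau>0 inner_self algebra_simps)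
  moreover have "((\<lambda>s. c' s \<bullet> nrml (\<tau> s)) has_real_derivative 0) (at 0)"
  proof -
   have "\<forall>\<^sub>F s in nhds 0. c' s \<bullet> nrml (\<tau> s) = 0"
    using q2 perp unfolding eventually_nhds_metric dist_real_def by (intro exI[of _ q2]) auto
   then show ?thesis using DERIV_cong_ev[OF refl _ refl, of _ "\<lambda>_. 0" 0 0] by simp
  qed
  ultimately have "v * v * turn t0 / stretch t0 \<eta> + w \<bullet> nrml t0 = 0" by (rule DERIV_unique)
  then have "- (w \<bullet> nrml t0) = (v * v) * (turn t0 / stretch t0 \<eta>)" by simp
  then show "k = turn t0 / stretch t0 \<eta>"
   using v by (simp add: k c'0eq norm_tang power2_eq_square)
 qed
qed

end

locale curve_domain = curve_data +
 fixes \<Omega> :: "(real^2) set"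
 assumes frontier: "frontier \<Omega> = curve"
  and outside: "\<And>t \<eta>. 0 < \<eta> ==> \<eta> <= r ==> offset t \<eta> \<notin> closure \<Omega>"
  and inside: "\<And>t \<eta>. 0 < \<eta> ==> \<eta> <= r ==> offset t (- \<eta>) \<in> \<Omega>"
begin

text \<open>Orthogonality to the velocity of the curve itself leaves the two unit normals, and the
  inner one is excluded because short steps along \<open>nrml t\<close> leave the closure of
  \<open>\<Omega>\<close>.\<close>

lemma outward_normal_eq: "outward_normal \<Omega> (\<Gamma> 0 t) = nrml t"
 unfolding outward_normal_def
proof (rule the_equality)
 show "norm (nrml t) = 1 \<and>
  (\<forall>c v. range c \<subseteq> frontier \<Omega> \<and> c 0 = \<Gamma> 0 t \<and> (c has_vector_derivative v) (at (0::real)) --> nrml t \<bullet> v = 0) \<and>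
  (\<exists>\<delta>>0. \<forall>u. 0 < u \<and> u < \<delta> --> \<Gamma> 0 t - u *\<^sub>R nrml t \<in> \<Omega> \<and> \<Gamma> 0 t + u *\<^sub>R nrml t \<notin> closure \<Omega>)"
  using norm_nrml curve_perp frontier r_pos inside outside[unfolded offset_def]
  by (intro conjI allI impI exI[of _ r]) (auto simp: offset_def)
next
 fix \<nu> assume \<nu>: "norm \<nu> = 1 \<and>
  (\<forall>c v. range c \<subseteq> frontier \<Omega> \<and> c 0 = \<Gamma> 0 t \<and> (c has_vector_derivative v) (at (0::real)) --> \<nu> \<bullet> v = 0) \<and>
  (\<exists>\<delta>>0. \<forall>u. 0 < u \<and> u < \<delta> --> \<Gamma> 0 t - u *\<^sub>R \<nu> \<in> \<Omega> \<and> \<Gamma> 0 t + u *\<^sub>R \<nu> \<notin> closure \<Omega>)"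
 have "(\<Gamma> 0 \<circ> (\<lambda>s. t + s) has_vector_derivative (1 *\<^sub>R \<Gamma> 1 t)) (at 0)"
  by (rule vector_diff_chain_at[where f = "\<lambda>s. t + s" and g = "\<Gamma> 0"]) (use d\<Gamma>[of 0 t] in \<open>auto intro!: derivative_eq_intros\<close>)
 then have "((\<lambda>s. \<Gamma> 0 (t + s)) has_vector_derivative \<Gamma> 1 t) (at 0)" by (simp add: o_def)
 then have "\<nu> \<bullet> \<Gamma> 1 t = 0"
  using \<nu> frontier by (auto dest!: spec[of _ "\<lambda>s. \<Gamma> 0 (t + s)"])
 then have "\<nu> \<bullet> tang t = 0" by (simp add: tang_def)
 then have eq: "\<nu> = (\<nu> \<bullet> nrml t) *\<^sub>R nrml t" using frame_decomp[of \<nu> t] by simp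
 then have "\<bar>\<nu> \<bullet> nrml t\<bar> = 1" using \<nu> norm_nrml[of t] by (metis mult.right_neutral norm_scaleR)
 then consider "\<nu> \<bullet> nrml t = 1" | "\<nu> \<bullet> nrml t = -1" by linarith
 then show "\<nu> = nrml t"
 proof cases
  case 1
  then show ?thesis using eq by simp
 next
  case neg: 2
  then have 2: "\<nu> = - nrml t" using eq by simp
  obtain \<delta> where \<delta>: "0 < \<delta>" "\<And>u. 0 < u ==> u < \<delta> ==> \<Gamma> 0 t - u *\<^sub>R \<nu> \<in> \<Omega>" using \<nu> by blast
  define u where "u = min r (\<delta> / 2)"
  have u: "0 < u" "u < \<delta>" "u <= r" using \<delta>(1) r_pos by (auto simp: u_def)
  have "offset t u \<in> \<Omega>" using \<delta>(2)[OF u(1,2)] 2 by (simp add: offset_def)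
  then show ?thesis using outside[OF u(1,3)] closure_subset by blast
 qed
qed

lemma signed_distance_offset:
 assumes "\<bar>\<eta>\<bar> <= r"
 shows "signed_distance \<Omega> (offset t \<eta>) = \<eta>"
 using offset_closest(1)[OF reach assms, of t]
 by (simp add: signed_distance_def frontier outward_normal_eq offset_def inner_self)

text \<open>\<open>1 - \<eta> * turn / stretch\<close> equals \<open>speed / stretch\<close>. The
  strict inequality provides the open tube of radius \<open>r\<close> around the point, in which the
  level set is exactly the offset curve.\<close>

lemma level_jacobian_offset:
 assumes \<eta>: "\<bar>\<eta>\<bar> < r"
 shows "level_jacobian \<Omega> (offset t \<eta>) \<eta> = shrink t \<eta>"
proof -
 have \<eta>': "\<bar>\<eta>\<bar> <= r" using \<eta> by simp
 have "signed_curvature {y. signed_distance \<Omega> y = \<eta>} (nrml t) (offset t \<eta>) = turn t / stretch t \<eta>"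
 proof (rule level_curve_curvature[OF reach \<eta>])
  show "offset u \<eta> \<in> {y. signed_distance \<Omega> y = \<eta>}" for u using signed_distance_offset[OF \<eta>'] by simp
  show "open {y. infdist y curve < r}" by (intro open_Collect_less continuous_intros)
  show "offset t \<eta> \<in> {y. infdist y curve < r}" using offset_closest(2)[OF reach \<eta>'] \<eta> by simp
  fix y assume y: "y \<in> {y. signed_distance \<Omega> y = \<eta>} \<inter> {y. infdist y curve < r}"
  obtain u \<eta>1 where u: "y = offset u \<eta>1" "\<bar>\<eta>1\<bar> = infdist y curve" using offset_surj[of y] by blast
  then have "\<eta>1 = \<eta>" using y signed_distance_offset[of \<eta>1 u] by auto
  then show "\<exists>t. y = offset t \<eta>" using u(1) by blast
 qed
 then have "level_jacobian \<Omega> (offset t \<eta>) \<eta> = 1 - \<eta> * (turn t / stretch t \<eta>)"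
  using offset_closest(1)[OF reach \<eta>', of t] by (simp add: level_jacobian_def level_curvature_def frontier outward_normal_eq)
 also have "\<dots> = speed t / stretch t \<eta>"
  using stretch_pos(2)[OF reach \<eta>', of t] by (simp add: field_simps stretch_def)
 also have "\<dots> = shrink t \<eta>"
 proof -
  have "speed t = speed t * (ispeed t * shrink t \<eta> * stretch t \<eta>)" by (simp add: stretch_shrink[OF \<eta>'])
  also have "\<dots> = (speed t * ispeed t) * (shrink t \<eta> * stretch t \<eta>)" by (simp add: mult_ac)
  finally show ?thesis using stretch_pos(2)[OF reach \<eta>', of t] by (simp add: speed_ispeed field_simps)
 qed
 finally show ?thesis .
qed

lemma curvature_zero_iff:
 "signed_curvature (frontier \<Omega>) (outward_normal \<Omega> (\<Gamma> 0 t)) (\<Gamma> 0 t) = 0 \<longleftrightarrow> turn t = 0"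
proof -
 have "signed_curvature curve (nrml t) (offset t 0) = turn t / stretch t 0"
  using r_pos by (intro level_curve_curvature[OF reach, of 0 _ UNIV]) (auto simp: offset_def)
 then show ?thesis using speed_pos[of t] by (simp add: frontier outward_normal_eq offset_def stretch_def)
qed

end

section \<open>The quadrature as a trapezoidal sum\<close>

lemma cbox_2: "x \<in> cbox a b \<longleftrightarrow> a $ 1 <= x $ 1 \<and> x $ 1 <= b $ 1 \<and> a $ 2 <= x $ 2 \<and> x $ 2 <= b $ 2" for x :: "real^2"
 by (auto simp: mem_box_cart forall_2)

lemma continuous_vector_2: "continuous_on T (\<lambda>p. vector [fst p, snd p] :: real^2)"
proof (rule continuous_on_eq)
 show "continuous_on T (\<lambda>p. \<chi> i::2. if i = 1 then fst p else snd p)"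
 proof (rule continuous_on_vec_lambda)
  show "continuous_on T (\<lambda>p. if i = 1 then fst p else snd p)" for i :: 2
   by (cases "i = 1") (auto intro!: continuous_intros)
 qed
qed (simp add: vec_eq_iff forall_2)

text \<open>The coordinate map between \<open>real^2\<close> and pairs preserves boxes and their
  measure, which carries Fubini's theorem over.\<close>

lemma integral_cbox_2:
 fixes f :: "real => real => real"
 assumes f: "continuous_on ({a..b} \<times> {c..d}) (\<lambda>(x, y). f x y)"
 shows "integral (cbox (vector [a, c]) (vector [b, d] :: real^2)) (\<lambda>v. f (v $ 1) (v $ 2)) = integral {a..b} (\<lambda>x. integral {c..d} (f x))"
proof -
 define g where "g v = (v $ 1, v $ 2)" for v :: "real^2"
 define h where "h p = (vector [fst p, snd p] :: real^2)" for p :: "real \<times> real"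
 have hg: "h (g v) = v" for v by (simp add: h_def g_def vec_eq_iff forall_2)
 have gh: "g (h p) = p" for p by (simp add: h_def g_def)
 have box: "cbox (a, c) (b, d) = {a..b} \<times> {c..d}" by (simp add: cbox_Pair_eq)
 have gi: "g ` cbox u v = cbox (g u) (g v)" for u v
 proof
  show "g ` cbox u v \<subseteq> cbox (g u) (g v)" by (auto simp: g_def cbox_Pair_eq cbox_2)
  show "cbox (g u) (g v) \<subseteq> g ` cbox u v"
  proof
   fix p assume "p \<in> cbox (g u) (g v)"
   then have "h p \<in> cbox u v" by (cases p) (simp add: g_def h_def cbox_Pair_eq cbox_2)
   then show "p \<in> g ` cbox u v" using gh[of p] by (metis imageI)
  qed
 qed
 have hi: "h ` cbox u v = cbox (h u) (h v)" for u v
 proof -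
  have "cbox u v = g ` cbox (h u) (h v)" by (simp add: gi gh)
  then show ?thesis by (simp add: image_image hg)
 qed
 have cont: "measure lborel (g ` cbox u v) = 1 * measure lborel (cbox u v)" for u v
 proof -
  have "measure lborel (cbox u v) = (if u $ 1 <= v $ 1 \<and> u $ 2 <= v $ 2 then (v $ 1 - u $ 1) * (v $ 2 - u $ 2) else 0)"
  proof (cases "cbox u v = {}")
   case True
   then have "\<not> (u $ 1 <= v $ 1 \<and> u $ 2 <= v $ 2)" using cbox_2[of u u v] by auto
   then show ?thesis using True by auto
  next
   case False
   then have "u $ 1 <= v $ 1 \<and> u $ 2 <= v $ 2" by (auto simp: cbox_2 ex_in_conv[symmetric])
   then show ?thesis using False by (simp add: content_cbox_cart UNIV_2)
  qed
  then show ?thesis by (simp add: gi) (auto simp: g_def content_Pair content_real_if)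
 qed
 have fi: "((\<lambda>(x, y). f x y) has_integral integral (cbox (a, c) (b, d)) (\<lambda>(x, y). f x y)) (cbox (a, c) (b, d))"
  by (intro integrable_integral integrable_continuous) (use f box in simp)
 have "((\<lambda>v. (\<lambda>(x, y). f x y) (g v)) has_integral (1 / 1) *\<^sub>R integral (cbox (a, c) (b, d)) (\<lambda>(x, y). f x y)) (h ` cbox (a, c) (b, d))"
 proof (rule has_integral_twiddle[OF _ hg gh _ _ _ cont fi])
  show "isCont g v" for v unfolding g_def by (intro continuous_intros)
  show "\<exists>w z. g ` cbox u v = cbox w z" for u v using gi by blast
  show "\<exists>w z. h ` cbox u v = cbox w z" for u v using hi by blast
 qed auto
 then have "integral (cbox (vector [a, c]) (vector [b, d] :: real^2)) (\<lambda>v. f (v $ 1) (v $ 2)) = integral (cbox (a, c) (b, d)) (\<lambda>(x, y). f x y)"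
  by (simp only: hi) (simp add: g_def h_def integral_unique)
 also have "\<dots> = integral {a..b} (\<lambda>x. integral {c..d} (f x))"
  using integral_prod_continuous[of a c b d "\<lambda>(x, y). f x y"] f box by simp
 finally show ?thesis .
qed

context curve_domain
begin

text \<open>The summand of the quadrature, extended by zero to the plane. The cut is made at the
  fixed radius \<open>r\<close> and not at the tube width; for \<open>\<psi>\<close> supported in a
  smaller interval it causes no discontinuity.\<close>

definition plane_weight :: "(real^2 => real) => (real => real) => real^2 => real" where
 "plane_weight u \<psi> x = (if infdist x curve < r
   then u (closest_point curve x) * \<psi> (signed_distance \<Omega> x) * level_jacobian \<Omega> x (signed_distance \<Omega> x) else 0)"

lemma plane_weight_offset:
 assumes z: "\<And>\<eta>. r <= \<bar>\<eta>\<bar> ==> \<psi> \<eta> = 0" and \<eta>: "\<bar>\<eta>\<bar> <= r"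
 shows "plane_weight u \<psi> (offset t \<eta>) = u (\<Gamma> 0 t) * \<psi> \<eta> * shrink t \<eta>"
 using offset_closest[OF reach \<eta>, where t = t] signed_distance_offset[OF \<eta>, where t = t] level_jacobian_offset[where \<eta> = \<eta> and t = t] z[of \<eta>] \<eta>
 by (cases "\<bar>\<eta>\<bar> < r") (simp_all add: plane_weight_def)

lemma plane_weight_zero:
 assumes z: "\<And>\<eta>. \<rho> <= \<bar>\<eta>\<bar> ==> \<psi> \<eta> = 0" and \<rho>: "\<rho> <= r" and x: "\<rho> <= infdist x curve"
 shows "plane_weight u \<psi> x = 0"
proof -
 obtain t \<eta> where "x = offset t \<eta>" "\<bar>\<eta>\<bar> = infdist x curve" using offset_surj by blast
 then show ?thesis
  using plane_weight_offset[where \<psi> = \<psi> and \<eta> = \<eta> and u = u and t = t] z[of \<eta>] x z \<rho> by (cases "\<bar>\<eta>\<bar> <= r") (auto simp: plane_weight_def)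
qed

text \<open>On the closed tube the composition with the offset map is continuous, and continuity
  descends because that map takes compact sets to compact, hence closed, sets. The closed region
  where the function is zero overlaps the tube, as \<open>\<rho> < r\<close>, and the two pieces are
  glued.\<close>

lemma continuous_plane_weight:
 assumes u: "continuous_on UNIV (\<lambda>t. u (\<Gamma> 0 t))" and \<psi>: "continuous_on {-r..r} \<psi>"
  and \<rho>: "0 < \<rho>" "\<rho> < r" "\<And>\<eta>. \<rho> <= \<bar>\<eta>\<bar> ==> \<psi> \<eta> = 0"
 shows "continuous_on UNIV (plane_weight u \<psi>)"
proof -
 let ?F = "plane_weight u \<psi>" and ?K = "{-r..r} \<times> {0..1 :: real}" and ?p = "\<lambda>p. offset (snd p) (fst p)"
 have z: "\<psi> \<eta> = 0" if "r <= \<bar>\<eta>\<bar>" for \<eta> using \<rho>(2) \<rho>(3)[of \<eta>] that by simp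
 have K: "compact ?K" by (intro compact_Times) auto
 have im: "?p ` ?K = {x. infdist x curve <= r}"
 proof (intro equalityI subsetI)
  fix x assume "x \<in> {x. infdist x curve <= r}"
  moreover obtain t \<eta> where "t \<in> {0..<1}" "x = offset t \<eta>" "\<bar>\<eta>\<bar> = infdist x curve" using offset_surj by blast
  ultimately have "(\<eta>, t) \<in> ?K" "x = ?p (\<eta>, t)" by auto
  then show "x \<in> ?p ` ?K" by blast
 qed (use offset_closest(2)[OF reach] in auto)
 have cl: "closed {x. infdist x curve <= r}" "closed {x. \<rho> <= infdist x curve}"
  by (intro closed_Collect_le continuous_intros)+
 have cs: "continuous_on ?K (\<lambda>p. shrink (snd p) (fst p))"
  using amp_continuous[OF amp.shrink, of "{0..1}"] by (simp add: split_def)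
 have cG: "continuous_on ?K (\<lambda>p. u (\<Gamma> 0 (snd p)) * \<psi> (fst p) * shrink (snd p) (fst p))"
  by (intro continuous_on_mult cs continuous_on_compose2[OF u] continuous_on_compose2[OF \<psi>] continuous_intros) auto
 have cFp: "continuous_on ?K (\<lambda>p. ?F (?p p))"
  by (rule continuous_on_eq[OF cG]) (use plane_weight_offset[where \<psi> = \<psi> and u = u, OF z] in auto)
 have 1: "continuous_on {x. infdist x curve <= r} ?F"
  unfolding continuous_on_closed_vimage[OF cl(1)]
 proof (intro allI impI)
  fix B :: "real set" assume B: "closed B"
  have "?F -` B \<inter> {x. infdist x curve <= r} = ?p ` ((\<lambda>p. ?F (?p p)) -` B \<inter> ?K)"
   unfolding im[symmetric] by auto
  moreover have "compact ((\<lambda>p. ?F (?p p)) -` B \<inter> ?K)"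
   using continuous_on_closed_vimage[OF compact_imp_closed[OF K], THEN iffD1, OF cFp] B
    compact_Int_closed[OF K, of "(\<lambda>p. ?F (?p p)) -` B \<inter> ?K"] by (simp add: Int_ac)
  then have "compact (?p ` ((\<lambda>p. ?F (?p p)) -` B \<inter> ?K))"
   by (intro compact_continuous_image continuous_offset)
  ultimately show "closed (?F -` B \<inter> {x. infdist x curve <= r})" by (simp add: compact_imp_closed)
 qed
 have 2: "continuous_on {x. \<rho> <= infdist x curve} ?F"
  by (rule continuous_on_eq[of _ "\<lambda>_. 0"]) (use plane_weight_zero[where \<psi> = \<psi> and u = u, OF \<rho>(3)] \<rho>(2) in auto)
 have "continuous_on ({x. infdist x curve <= r} \<union> {x. \<rho> <= infdist x curve}) ?F"
  by (rule continuous_on_closed_Un[OF cl 1 2])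
 moreover have "{x. infdist x curve <= r} \<union> {x. \<rho> <= infdist x curve} = UNIV" using \<rho>(2) by auto
 ultimately show ?thesis by simp
qed

section \<open>Substitution of the tube coordinates and Fourier integrals\<close>

lemma offset_derivative:
 "((\<lambda>v. offset (v $ 1) (v $ 2)) has_derivative (\<lambda>k. (k $ 1 * stretch (v $ 1) (v $ 2)) *\<^sub>R tang (v $ 1) + k $ 2 *\<^sub>R nrml (v $ 1))) (at v within S)"
 for v :: "real^2"
proof -
 have c: "((\<lambda>v::real^2. v $ i) has_derivative (\<lambda>k. k $ i)) (at v within S)" for i :: 2
  by (rule bounded_linear_imp_has_derivative[OF bounded_linear_vec_nth])
 have g: "((\<lambda>v. \<Gamma> 0 (v $ 1)) has_derivative (\<lambda>k. k $ 1 *\<^sub>R \<Gamma> 1 (v $ 1))) (at v within S)"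
  using has_derivative_compose[OF c[of 1] d\<Gamma>[of 0 "v $ 1", unfolded has_vector_derivative_def]] by simp
 have n: "((\<lambda>v. nrml (v $ 1)) has_derivative (\<lambda>k. k $ 1 *\<^sub>R (turn (v $ 1) *\<^sub>R tang (v $ 1)))) (at v within S)"
  using has_derivative_compose[OF c[of 1] dnrml[of "v $ 1" UNIV, unfolded has_vector_derivative_def]] by simp
 show ?thesis
  unfolding offset_def stretch_def
  by (rule has_derivative_eq_rhs[OF has_derivative_add[OF g has_derivative_scaleR[OF c[of 2] n]]])
   (subst \<Gamma>1_eq, simp add: algebra_simps)
qed

lemma offset_jacobian:
 assumes "\<bar>\<eta>\<bar> <= r"
 shows "\<bar>det (matrix (\<lambda>k::real^2. a *\<^sub>R ((k $ 1 * stretch t \<eta>) *\<^sub>R tang t + k $ 2 *\<^sub>R nrml t)))\<bar> = a\<^sup>2 * stretch t \<eta>"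
proof -
 have "det (matrix (\<lambda>k::real^2. a *\<^sub>R ((k $ 1 * stretch t \<eta>) *\<^sub>R tang t + k $ 2 *\<^sub>R nrml t))) =
   - (a\<^sup>2 * stretch t \<eta> * sg * ((tang t $ 1)\<^sup>2 + (tang t $ 2)\<^sup>2))"
  by (simp add: det_2 matrix_def axis_def nrml_nth power2_eq_square algebra_simps)
 also have "\<bar>\<dots>\<bar> = a\<^sup>2 * stretch t \<eta>"
  using sg stretch_pos(2)[OF reach assms, of t] by (auto simp: tang_sq abs_mult)
 finally show ?thesis .
qed

lemma change_of_variables_2:
 fixes f :: "real^2 => real" and g :: "real^2 => real^2"
 assumes S: "S \<in> sets lebesgue" and d: "\<And>x. x \<in> S ==> (g has_derivative g' x) (at x within S)" and inj: "inj_on g S"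
  and int: "(\<lambda>x. \<bar>det (matrix (g' x))\<bar> * f (g x)) absolutely_integrable_on S"
 shows "integral (g ` S) f = integral S (\<lambda>x. \<bar>det (matrix (g' x))\<bar> * f (g x))"
proof -
 have "(\<lambda>x. \<bar>det (matrix (g' x))\<bar> *\<^sub>R vec (f (g x)) :: real^1) absolutely_integrable_on S \<and>
   integral S (\<lambda>x. \<bar>det (matrix (g' x))\<bar> *\<^sub>R vec (f (g x)) :: real^1) = vec (integral S (\<lambda>x. \<bar>det (matrix (g' x))\<bar> * f (g x)))
  \<longleftrightarrow> (\<lambda>x. vec (f x) :: real^1) absolutely_integrable_on g ` S \<and>
   integral (g ` S) (\<lambda>x. vec (f x) :: real^1) = vec (integral S (\<lambda>x. \<bar>det (matrix (g' x))\<bar> * f (g x)))"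
  by (rule has_absolute_integral_change_of_variables[OF S d inj])
 then show ?thesis using int by (simp add: absolutely_integrable_on_1_iff integral_on_1_eq vec_eq_iff)
qed

lemma continuous_stretch_mult:
 assumes "continuous_on T \<tau>" "continuous_on T \<sigma>" "continuous_on UNIV \<Phi>"
 shows "continuous_on T (\<lambda>p. stretch (\<tau> p) (\<sigma> p) * \<Phi> (a *\<^sub>R offset (\<tau> p) (\<sigma> p)))"
 unfolding stretch_def
 by (intro continuous_on_mult continuous_on_add continuous_on_const assms(1,2) continuous_on_scaleR continuous_on_compose2[OF cont_frame(4)[of UNIV]]
   continuous_on_compose2[OF cont_frame(5)[of UNIV]] continuous_on_compose2[OF assms(3)]
   continuous_on_compose2[OF continuous_offset[of UNIV], where f = "\<lambda>p. (\<sigma> p, \<tau> p)", simplified] continuous_on_Pair) auto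

text \<open>The coarea formula in integrated form: \<open>\<Phi>\<close> lives on the tube, whose
  coordinates \<open>(t, \<eta>)\<close> have area element \<open>stretch t \<eta>\<close>. The
  variable \<open>x\<close> stands for the point \<open>h *\<^sub>R x\<close>, whence the factor
  \<open>(1 / h)\<^sup>2\<close>.\<close>

lemma integral_plane:
 assumes h: "0 < h" and \<Phi>: "continuous_on UNIV \<Phi>" and z: "\<And>x. r <= infdist (h *\<^sub>R x) curve ==> \<Phi> x = 0"
  and box: "\<And>x i. infdist x curve <= r ==> \<bar>x $ i\<bar> <= h * (real L + 1/2)"
 shows "integral (cell_box L) (\<lambda>x. integral (cell_box L) (\<lambda>y. \<Phi> (vector [x, y]))) =
  (1 / h)\<^sup>2 * integral {-r..r} (\<lambda>\<eta>. integral {0..1} (\<lambda>t. stretch t \<eta> * \<Phi> ((1 / h) *\<^sub>R offset t \<eta>)))"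
proof -
 let ?a = "- real L - 1/2" and ?b = "real L + 1/2"
 let ?B = "cbox (vector [?a, ?a]) (vector [?b, ?b]) :: (real^2) set"
 let ?C = "cbox (vector [0, -r]) (vector [1, r]) :: (real^2) set"
 \<comment> \<open>The edge \<open>t = 1\<close> repeats \<open>t = 0\<close> and is removed to make
   \<open>g\<close> injective; being a null set, it is put back after the substitution.\<close>
 define S where "S = ?C - {v. v $ 1 = 1}"
 define g where "g v = (1 / h) *\<^sub>R offset (v $ 1) (v $ 2)" for v :: "real^2"
 define g' where "g' v k = (1 / h) *\<^sub>R ((k $ 1 * stretch (v $ 1) (v $ 2)) *\<^sub>R tang (v $ 1) + k $ 2 *\<^sub>R nrml (v $ 1))" for v k :: "real^2"
 have gd: "\<bar>det (matrix (g' v))\<bar> = (1 / h)\<^sup>2 * stretch (v $ 1) (v $ 2)" if "v \<in> S" for v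
  unfolding g'_def[abs_def] by (rule offset_jacobian) (use that in \<open>simp add: S_def cbox_2 abs_le_iff\<close>)
 have vec: "(vector [v $ 1, v $ 2] :: real^2) = v" for v :: "real^2" by (simp add: vec_eq_iff forall_2)
 have "integral (cell_box L) (\<lambda>x. integral (cell_box L) (\<lambda>y. \<Phi> (vector [x, y]))) = integral ?B (\<lambda>v. \<Phi> (vector [v $ 1, v $ 2]))"
  unfolding cell_box_def
  by (rule integral_cbox_2[symmetric]) (auto simp: split_def intro: continuous_on_compose2[OF \<Phi> continuous_vector_2])
 also have "\<dots> = integral ?B \<Phi>" by (simp only: vec)
 also have "\<dots> = integral (g ` S) \<Phi>"
 proof -
  have gS: "g ` S \<subseteq> ?B"
  proof
   fix x assume "x \<in> g ` S"
   then obtain v where v: "v \<in> S" "x = g v" by blast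
   then have "\<bar>v $ 2\<bar> <= r" by (simp add: S_def cbox_2 abs_le_iff)
   then have "\<bar>offset (v $ 1) (v $ 2) $ i\<bar> <= h * ?b" for i using box[of "offset (v $ 1) (v $ 2)" i] offset_closest(2)[OF reach] by simp
   then have "\<bar>x $ i\<bar> <= ?b" for i using h by (simp add: v(2) g_def abs_mult field_simps)
   from this[of 1] this[of 2] show "x \<in> ?B" by (auto simp: cbox_2 abs_le_iff)
  qed
  have "integral ?B \<Phi> = integral UNIV (\<lambda>x. if x \<in> ?B then \<Phi> x else 0)" by (rule integral_restrict_UNIV[symmetric])
  also have "(\<lambda>x. if x \<in> ?B then \<Phi> x else 0) = (\<lambda>x. if x \<in> g ` S then \<Phi> x else 0)"
  proof
   fix x
   show "(if x \<in> ?B then \<Phi> x else 0) = (if x \<in> g ` S then \<Phi> x else 0)"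
   proof (cases "x \<in> g ` S")
    case False
    obtain t \<eta> where t: "t \<in> {0..<1}" "h *\<^sub>R x = offset t \<eta>" "\<bar>\<eta>\<bar> = infdist (h *\<^sub>R x) curve" using offset_surj by blast
    have "\<not> \<bar>\<eta>\<bar> < r"
    proof
     assume "\<bar>\<eta>\<bar> < r"
     then have "vector [t, \<eta>] \<in> S" using t(1) by (auto simp: S_def cbox_2 abs_less_iff)
     moreover have "x = g (vector [t, \<eta>])" using t(2)[symmetric] h by (simp add: g_def)
     ultimately show False using False by blast
    qed
    then show ?thesis using z[of x] t(3) False by simp
   qed (use gS in auto)
  qed
  also have "integral UNIV \<dots> = integral (g ` S) \<Phi>" by (rule integral_restrict_UNIV)
  finally show ?thesis .
 qed
 also have "\<dots> = integral S (\<lambda>v. \<bar>det (matrix (g' v))\<bar> * \<Phi> (g v))"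
 proof (rule change_of_variables_2)
  have "closed {v :: real^2. v $ 1 = 1}" by (intro closed_Collect_eq continuous_intros)
  then have "S \<in> sets borel" unfolding S_def by (intro sets.Diff borel_closed) auto
  then show Sl: "S \<in> sets lebesgue" by simp
  show "(g has_derivative g' v) (at v within S)" for v
   unfolding g_def[abs_def] g'_def by (intro has_derivative_scaleR_right offset_derivative)
  show "inj_on g S"
  proof (rule inj_onI)
   fix v w assume vw: "v \<in> S" "w \<in> S" "g v = g w"
   have le: "\<bar>v $ 2\<bar> <= r" "\<bar>w $ 2\<bar> <= r" using vw(1,2) by (auto simp: S_def cbox_2 abs_le_iff)
   have eq: "offset (v $ 1) (v $ 2) = offset (w $ 1) (w $ 2)" using vw(3) h by (simp add: g_def)
   have "v $ 1 \<in> {0..<1}" "w $ 1 \<in> {0..<1}" using vw(1,2) by (auto simp: S_def cbox_2 less_le)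
   then have "v $ 1 = w $ 1" using inj_onD[OF inj offset_inj(1)[OF reach le eq]] by simp
   moreover have "v $ 2 = w $ 2" by (rule offset_inj(3)[OF reach le eq])
   ultimately show "v = w" by (simp add: vec_eq_iff forall_2)
  qed
  have c2: "continuous_on ?C (\<lambda>v. (1 / h)\<^sup>2 * stretch (v $ 1) (v $ 2) * \<Phi> (g v))"
   unfolding g_def mult.assoc by (rule continuous_on_mult[OF continuous_on_const continuous_stretch_mult[OF _ _ \<Phi>]]) (intro continuous_intros)+
  have "(\<lambda>v. (1 / h)\<^sup>2 * stretch (v $ 1) (v $ 2) * \<Phi> (g v)) absolutely_integrable_on S"
   by (rule set_integrable_subset[OF absolutely_integrable_continuous[OF c2] Sl]) (auto simp: S_def)
  then show "(\<lambda>v. \<bar>det (matrix (g' v))\<bar> * \<Phi> (g v)) absolutely_integrable_on S"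
   by (subst absolutely_integrable_spike_eq[where S = "{}" and g = "\<lambda>v. (1 / h)\<^sup>2 * stretch (v $ 1) (v $ 2) * \<Phi> (g v)"])
    (auto simp: gd)
 qed
 also have "\<dots> = integral S (\<lambda>v. (1 / h)\<^sup>2 * (stretch (v $ 1) (v $ 2) * \<Phi> (g v)))"
  by (rule integral_cong) (simp add: gd)
 also have "\<dots> = integral ?C (\<lambda>v. (1 / h)\<^sup>2 * (stretch (v $ 1) (v $ 2) * \<Phi> (g v)))"
 proof (rule integral_subset_negligible)
  have "negligible {v :: real^2. v \<bullet> axis 1 1 = 1}" by (intro negligible_standard_hyperplane) (auto simp: Basis_vec_def)
  then show "negligible (?C - S)"
   by (rule negligible_subset) (auto simp: S_def cart_eq_inner_axis)
 qed (auto simp: S_def)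
 also have "\<dots> = (1 / h)\<^sup>2 * integral ?C (\<lambda>v. stretch (v $ 1) (v $ 2) * \<Phi> ((1 / h) *\<^sub>R offset (v $ 1) (v $ 2)))"
  by (simp add: g_def)
 also have "integral ?C (\<lambda>v. stretch (v $ 1) (v $ 2) * \<Phi> ((1 / h) *\<^sub>R offset (v $ 1) (v $ 2))) =
   integral {0..1} (\<lambda>t. integral {-r..r} (\<lambda>\<eta>. stretch t \<eta> * \<Phi> ((1 / h) *\<^sub>R offset t \<eta>)))"
 proof (rule integral_cbox_2)
  show "continuous_on ({0..1} \<times> {-r..r}) (\<lambda>(t, \<eta>). stretch t \<eta> * \<Phi> ((1 / h) *\<^sub>R offset t \<eta>))"
   unfolding split_def by (rule continuous_stretch_mult[OF _ _ \<Phi>]) (intro continuous_intros)+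
 qed
 also have "\<dots> = integral {-r..r} (\<lambda>\<eta>. integral {0..1} (\<lambda>t. stretch t \<eta> * \<Phi> ((1 / h) *\<^sub>R offset t \<eta>)))"
 proof -
  have "continuous_on (cbox (0, -r) (1, r)) (\<lambda>(t, \<eta>). stretch t \<eta> * \<Phi> ((1 / h) *\<^sub>R offset t \<eta>))"
   unfolding split_def by (rule continuous_stretch_mult[OF _ _ \<Phi>]) (intro continuous_intros)+
  from integral_swap_continuous[OF this] show ?thesis by simp
 qed
 finally show ?thesis .
qed

text \<open>Polar form of the wave vector \<open>2 * pi * k / h\<close>, meaningful for
  \<open>k \<noteq> (0, 0)\<close>.\<close>

definition freq :: "real => int \<times> int => real \<times> (real^2)" where
 "freq h k = (let v = vector [of_int (fst k), of_int (snd k)] in (2 * pi * norm v / h, (1 / norm v) *\<^sub>R v))"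

lemma norm_freq:
 assumes "k \<noteq> (0, 0)"
 shows "norm (snd (freq h k)) = 1" "0 < h ==> 0 < fst (freq h k)"
  "fst (freq h k) * (snd (freq h k) \<bullet> x) = 2 * pi / h * (of_int (fst k) * x $ 1 + of_int (snd k) * x $ 2)"
proof -
 define v :: "real^2" where "v = vector [of_int (fst k), of_int (snd k)]"
 have "v $ 1 \<noteq> 0 \<or> v $ 2 \<noteq> 0" using assms by (cases k) (auto simp: v_def)
 then have v: "v \<noteq> 0" by auto
 have f: "freq h k = (2 * pi * norm v / h, (1 / norm v) *\<^sub>R v)" by (simp add: freq_def v_def Let_def)
 show "norm (snd (freq h k)) = 1" "0 < h ==> 0 < fst (freq h k)" using v by (simp_all add: f)
 have "fst (freq h k) * (snd (freq h k) \<bullet> x) = 2 * pi / h * (v \<bullet> x)" using v by (simp add: f)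
 then show "fst (freq h k) * (snd (freq h k) \<bullet> x) = 2 * pi / h * (of_int (fst k) * x $ 1 + of_int (snd k) * x $ 2)"
  by (simp only: inner_2 v_def vector_2)
qed

abbreviation wave :: "real => int \<times> int => real => real => real" where
 "wave h k t \<eta> \<equiv> cos (2 * pi / h * (of_int (fst k) * offset t \<eta> $ 1 + of_int (snd k) * offset t \<eta> $ 2))"

text \<open>The area element \<open>stretch\<close> times the factor \<open>shrink\<close> is
  \<open>speed\<close>, which is free of \<open>\<eta>\<close>. The weight therefore separates from
  a curve integral in which \<open>\<eta>\<close> occurs only in the wave, and at frequency zero the
  integral is a product.\<close>

lemma plane_weight_fourier:
 assumes h: "0 < h" and u: "continuous_on UNIV (\<lambda>t. u (\<Gamma> 0 t))" and \<psi>: "continuous_on {-r..r} \<psi>"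
  and \<rho>: "0 < \<rho>" "\<rho> < r" "\<And>\<eta>. \<rho> <= \<bar>\<eta>\<bar> ==> \<psi> \<eta> = 0"
  and box: "\<And>x i. infdist x curve <= r ==> \<bar>x $ i\<bar> <= h * (real L + 1/2)"
 shows "integral (cell_box L) (\<lambda>x. integral (cell_box L) (\<lambda>y. plane_weight u \<psi> (h *\<^sub>R vector [x, y]) *
    cos (2 * pi * (of_int k * x + of_int l * y)))) =
  (1 / h)\<^sup>2 * integral {-r..r} (\<lambda>\<eta>. \<psi> \<eta> * integral {0..1} (\<lambda>t. u (\<Gamma> 0 t) * speed t *
    wave h (k, l) t \<eta>))"
proof -
 define \<Phi> where "\<Phi> x = plane_weight u \<psi> (h *\<^sub>R x) * cos (2 * pi * (of_int k * x $ 1 + of_int l * x $ 2))" for x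
 have z: "\<psi> \<eta> = 0" if "r <= \<bar>\<eta>\<bar>" for \<eta> using \<rho>(2) \<rho>(3)[of \<eta>] that by simp
 have c\<Phi>: "continuous_on UNIV \<Phi>"
  unfolding \<Phi>_def
  by (intro continuous_intros continuous_on_compose2[OF continuous_plane_weight[OF u \<psi> \<rho>]]) auto
 have z\<Phi>: "\<Phi> x = 0" if "r <= infdist (h *\<^sub>R x) curve" for x
  using that by (simp add: \<Phi>_def plane_weight_def)
 have "integral (cell_box L) (\<lambda>x. integral (cell_box L) (\<lambda>y. \<Phi> (vector [x, y]))) =
  (1 / h)\<^sup>2 * integral {-r..r} (\<lambda>\<eta>. integral {0..1} (\<lambda>t. stretch t \<eta> * \<Phi> ((1 / h) *\<^sub>R offset t \<eta>)))"
  by (rule integral_plane[OF h c\<Phi> z\<Phi> box])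
 also have "integral {-r..r} (\<lambda>\<eta>. integral {0..1} (\<lambda>t. stretch t \<eta> * \<Phi> ((1 / h) *\<^sub>R offset t \<eta>))) =
   integral {-r..r} (\<lambda>\<eta>. \<psi> \<eta> * integral {0..1} (\<lambda>t. u (\<Gamma> 0 t) * speed t *
    wave h (k, l) t \<eta>))"
 proof (rule integral_cong)
  fix \<eta> assume "\<eta> \<in> {-r..r}"
  then have \<eta>: "\<bar>\<eta>\<bar> <= r" by (simp add: abs_le_iff)
  have "stretch t \<eta> * \<Phi> ((1 / h) *\<^sub>R offset t \<eta>) = \<psi> \<eta> * (u (\<Gamma> 0 t) * speed t *
    wave h (k, l) t \<eta>)" for t
  proof -
   have "speed t = speed t * (ispeed t * shrink t \<eta> * stretch t \<eta>)" using stretch_shrink[OF \<eta>, of t] by simp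
   also have "\<dots> = shrink t \<eta> * stretch t \<eta>" using speed_ispeed(1)[of t] by simp
   finally have s: "stretch t \<eta> * shrink t \<eta> = speed t" by simp
   have "2 * pi * (of_int k * ((1 / h) *\<^sub>R offset t \<eta>) $ 1 + of_int l * ((1 / h) *\<^sub>R offset t \<eta>) $ 2) =
     2 * pi / h * (of_int k * offset t \<eta> $ 1 + of_int l * offset t \<eta> $ 2)" by (simp add: algebra_simps add_divide_distrib)
   moreover have "plane_weight u \<psi> (h *\<^sub>R ((1 / h) *\<^sub>R offset t \<eta>)) = u (\<Gamma> 0 t) * \<psi> \<eta> * shrink t \<eta>"
    using plane_weight_offset[where \<psi> = \<psi> and u = u and t = t, OF z \<eta>] h by simp
   ultimately have "stretch t \<eta> * \<Phi> ((1 / h) *\<^sub>R offset t \<eta>) = (stretch t \<eta> * shrink t \<eta>) * (u (\<Gamma> 0 t) * \<psi> \<eta> *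
     wave h (k, l) t \<eta>)"
    unfolding \<Phi>_def by simp
   then show ?thesis unfolding s by simp
  qed
  then show "integral {0..1} (\<lambda>t. stretch t \<eta> * \<Phi> ((1 / h) *\<^sub>R offset t \<eta>)) = \<psi> \<eta> * integral {0..1} (\<lambda>t. u (\<Gamma> 0 t) * speed t *
    wave h (k, l) t \<eta>)" by simp
 qed
 finally show ?thesis by (simp add: \<Phi>_def)
qed

lemma integral_osc_Re:
 assumes b: "b \<in> amp" "\<And>t \<eta> om. b t \<eta> om = u (\<Gamma> 0 t) * speed t" and \<psi>: "continuous_on {-r..r} \<psi>" and k: "k \<noteq> (0, 0)"
 shows "integral {-r..r} (\<lambda>\<eta>. \<psi> \<eta> * integral {0..1} (\<lambda>t. u (\<Gamma> 0 t) * speed t *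
    wave h k t \<eta>)) =
  Re (pairing r \<psi> (osc_int b (freq h k)))"
proof -
 let ?w = "freq h k"
 have "integral {0..1} (\<lambda>t. u (\<Gamma> 0 t) * speed t *
    wave h k t \<eta>) = Re (osc_int b ?w \<eta>)"
  if "\<eta> \<in> {-r..r}" for \<eta>
 proof -
  have "osc b ?w \<eta> integrable_on {0..1}"
   by (intro integrable_continuous_real continuous_osc_t b) (use that in \<open>simp add: abs_le_iff\<close>)
  then have "integral {0..1} (\<lambda>t. Re (osc b ?w \<eta> t)) = Re (osc_int b ?w \<eta>)"
   unfolding osc_int_def by (rule integral_linear[OF _ bounded_linear_Re, unfolded o_def])
  then show ?thesis by (simp add: osc_def b(2) norm_freq(3)[OF k])
 qed
 then have "integral {-r..r} (\<lambda>\<eta>. \<psi> \<eta> * integral {0..1} (\<lambda>t. u (\<Gamma> 0 t) * speed t *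
    wave h k t \<eta>)) =
   integral {-r..r} (\<lambda>\<eta>. Re (\<psi> \<eta> *\<^sub>R osc_int b ?w \<eta>))"
  by (intro integral_cong) simp
 also have "\<dots> = Re (pairing r \<psi> (osc_int b ?w))"
 proof (rule integral_linear[OF _ bounded_linear_Re, unfolded o_def])
  show "(\<lambda>\<eta>. \<psi> \<eta> *\<^sub>R osc_int b ?w \<eta>) integrable_on {-r..r}"
   by (intro integrable_continuous_real continuous_on_scaleR \<psi> continuous_osc_int b)
 qed
 finally show ?thesis .
qed

section \<open>The lattice sum and its error in terms of the frequencies\<close>

definition grid_sum :: "real => nat => (real^2 => real) => real" where
 "grid_sum h L g = h\<^sup>2 * (\<Sum>m\<in>{-int L..int L}. \<Sum>n\<in>{-int L..int L}. g (h *\<^sub>R vector [of_int m, of_int n]))"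

text \<open>The powers of \<open>h\<close> cancel, \<open>h\<^sup>2\<close> from the sum against
  \<open>(1 / h)\<^sup>2\<close> from every Fourier integral, so that \<open>D\<close> bounds the
  error without a further factor.\<close>

lemma trapezoid_error:
 assumes h: "0 < h" and b: "b \<in> amp" "\<And>t \<eta> om. b t \<eta> om = u (\<Gamma> 0 t) * speed t"
  and u: "continuous_on UNIV (\<lambda>t. u (\<Gamma> 0 t))" and \<psi>: "continuous_on {-r..r} \<psi>"
  and \<rho>: "0 < \<rho>" "\<rho> < r" "\<And>\<eta>. \<rho> <= \<bar>\<eta>\<bar> ==> \<psi> \<eta> = 0"
  and box: "\<And>x i. infdist x curve <= r ==> \<bar>x $ i\<bar> <= h * (real L + 1/2)"
  and D: "\<And>S. finite S ==> (0, 0) \<notin> S ==>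
    (\<Sum>k\<in>S. norm (pairing r \<psi> (osc_int b (freq h k)))) <= D"
 shows "\<bar>grid_sum h L (plane_weight u \<psi>) -
   integral {-r..r} \<psi> * integral {0..1} (\<lambda>t. u (\<Gamma> 0 t) * speed t)\<bar> <= D"
proof -
 let ?Q = "cell_box L" and ?E = "\<lambda>x y. plane_weight u \<psi> (h *\<^sub>R vector [x, y])"
 let ?s = "\<Sum>m\<in>{-int L..int L}. \<Sum>n\<in>{-int L..int L}. ?E (of_int m) (of_int n)" and ?I = "integral ?Q (\<lambda>x. integral ?Q (?E x))"
 have F: "integral ?Q (\<lambda>x. integral ?Q (\<lambda>y. ?E x y * cos (2 * pi * (of_int k * x + of_int l * y)))) =
  (1 / h)\<^sup>2 * integral {-r..r} (\<lambda>\<eta>. \<psi> \<eta> * integral {0..1} (\<lambda>t. u (\<Gamma> 0 t) * speed t *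
    wave h (k, l) t \<eta>))" for k l
  by (rule plane_weight_fourier[OF h u \<psi> \<rho> box])
 have cE: "continuous_on (?Q \<times> ?Q) (\<lambda>(x, y). ?E x y)"
  unfolding split_def
  by (rule continuous_on_compose2[OF continuous_plane_weight[OF u \<psi> \<rho>]]) (auto intro!: continuous_intros continuous_vector_2)
 have "\<bar>?s - ?I\<bar> <= (1 / h)\<^sup>2 * D"
 proof (rule poisson_inequality[OF cE])
  fix S :: "(int \<times> int) set" assume S: "finite S" "(0, 0) \<notin> S"
  have "(\<Sum>(k, l)\<in>S. \<bar>integral ?Q (\<lambda>x. integral ?Q (\<lambda>y. ?E x y * cos (2 * pi * (of_int k * x + of_int l * y))))\<bar>)
    <= (\<Sum>k\<in>S. (1 / h)\<^sup>2 * norm (pairing r \<psi> (osc_int b (freq h k))))"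
  proof (rule sum_mono)
   fix k assume "k \<in> S"
   then have "k \<noteq> (0, 0)" using S(2) by auto
   then have "\<bar>integral ?Q (\<lambda>x. integral ?Q (\<lambda>y. ?E x y * cos (2 * pi * (of_int (fst k) * x + of_int (snd k) * y))))\<bar>
     = (1 / h)\<^sup>2 * \<bar>Re (pairing r \<psi> (osc_int b (freq h k)))\<bar>"
    unfolding F by (subst integral_osc_Re[OF b \<psi>]) (simp_all add: abs_mult)
   also have "\<dots> <= (1 / h)\<^sup>2 * norm (pairing r \<psi> (osc_int b (freq h k)))"
    by (intro mult_left_mono abs_Re_le_cmod) simp
   finally show "(case k of (k, l) => \<bar>integral ?Q (\<lambda>x. integral ?Q (\<lambda>y. ?E x y * cos (2 * pi * (of_int k * x + of_int l * y))))\<bar>)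
    <= (1 / h)\<^sup>2 * norm (pairing r \<psi> (osc_int b (freq h k)))" by (simp add: split_def)
  qed
  also have "\<dots> <= (1 / h)\<^sup>2 * D" unfolding sum_distrib_left[symmetric] by (intro mult_left_mono D S) simp
  finally show "(\<Sum>(k, l)\<in>S. \<bar>integral ?Q (\<lambda>x. integral ?Q (\<lambda>y. ?E x y * cos (2 * pi * (of_int k * x + of_int l * y))))\<bar>) <= (1 / h)\<^sup>2 * D" .
 qed
 then have "h\<^sup>2 * \<bar>?s - ?I\<bar> <= h\<^sup>2 * ((1 / h)\<^sup>2 * D)" by (intro mult_left_mono) auto
 also have "\<dots> = D" using h by (simp add: power_divide)
 finally have "\<bar>h\<^sup>2 * ?s - h\<^sup>2 * ?I\<bar> <= D" by (simp add: abs_mult flip: right_diff_distrib)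
 moreover have "h\<^sup>2 * ?I = integral {-r..r} \<psi> * integral {0..1} (\<lambda>t. u (\<Gamma> 0 t) * speed t)"
  using F[of 0 0] h by (simp add: power_divide)
 ultimately show ?thesis by (simp add: grid_sum_def)
qed

lemma lattice_quadrature_eq:
 assumes h: "0 < h" and eps: "0 < eps" "eps < r" and \<theta>: "\<And>s. 1 < \<bar>s\<bar> ==> \<theta> s = 0"
  and box: "\<And>x i. infdist x curve <= r ==> \<bar>x $ i\<bar> <= h * (real L + 1/2)"
 shows "lattice_quadrature \<Omega> \<theta> f eps h =
  grid_sum h L (plane_weight f (scaled_weight \<theta> eps))"
proof -
 let ?J = "{-int L..int L}" and ?T = "tube curve eps" and ?p = "\<lambda>p. h *\<^sub>R (vector [of_int (fst p), of_int (snd p)] :: real^2)"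
 let ?F = "plane_weight f (scaled_weight \<theta> eps)"
 let ?A = "{p \<in> ?J \<times> ?J. ?p p \<in> ?T}"
 have inj: "inj_on ?p ?A"
  using h by (auto simp: inj_on_def vec_eq_iff forall_2)
 have im: "?p ` ?A = square_grid h \<inter> ?T"
 proof (intro equalityI subsetI)
  fix x assume "x \<in> ?p ` ?A"
  then show "x \<in> square_grid h \<inter> ?T" by (auto simp: square_grid_def forall_2)
 next
  fix x assume x: "x \<in> square_grid h \<inter> ?T"
  obtain m n :: int where mn: "x $ 1 = h * of_int m" "x $ 2 = h * of_int n" using x by (auto simp: square_grid_def forall_2)
  have "infdist x curve <= r" using x eps by (simp add: tube_def)
  then have "\<bar>x $ 1\<bar> <= h * (real L + 1/2)" "\<bar>x $ 2\<bar> <= h * (real L + 1/2)" using box by blast+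
  then have "\<bar>real_of_int m\<bar> <= real L + 1/2" "\<bar>real_of_int n\<bar> <= real L + 1/2" using h by (simp_all add: mn abs_mult)
  then have "(m, n) \<in> ?J \<times> ?J" by (auto simp: abs_le_iff)
  moreover have "x = ?p (m, n)" using mn by (simp add: vec_eq_iff forall_2)
  ultimately show "x \<in> ?p ` ?A" using x by blast
 qed
 have z: "scaled_weight \<theta> eps \<eta> = 0" if "eps < \<bar>\<eta>\<bar>" for \<eta>
  using \<theta>[of "\<eta> / eps"] eps that by (simp add: scaled_weight_def abs_divide)
 have out: "?F x = 0" if "x \<notin> ?T" for x
 \<comment> \<open>The radius is adapted to the point: \<open>x\<close> lies at least this far from
   the curve, and the weight vanishes from there on because both \<open>r\<close> and the distance
   of \<open>x\<close> exceed \<open>eps\<close>.\<close>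
 proof (rule plane_weight_zero[where \<rho> = "min r (infdist x curve)"])
  show "scaled_weight \<theta> eps \<eta> = 0" if "min r (infdist x curve) <= \<bar>\<eta>\<bar>" for \<eta>
   using z[of \<eta>] eps that \<open>x \<notin> ?T\<close> by (auto simp: tube_def)
 qed auto
 have "lattice_quadrature \<Omega> \<theta> f eps h = h\<^sup>2 * (\<Sum>x\<in>?p ` ?A. ?F x)"
  unfolding lattice_quadrature_def im frontier
  by (intro arg_cong[where f = "\<lambda>x. h\<^sup>2 * x"] sum.cong) (use eps in \<open>auto simp: tube_def plane_weight_def\<close>)
 also have "(\<Sum>x\<in>?p ` ?A. ?F x) = (\<Sum>p\<in>?A. ?F (?p p))" by (simp add: sum.reindex[OF inj])
 also have "\<dots> = (\<Sum>p\<in>?J \<times> ?J. ?F (?p p))" by (rule sum.mono_neutral_left) (auto intro: out)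
 also have "\<dots> = (\<Sum>m\<in>?J. \<Sum>n\<in>?J. ?F (h *\<^sub>R vector [of_int m, of_int n]))" by (simp add: sum.cartesian_product split_def)
 finally show ?thesis by (simp add: grid_sum_def)
qed

end

section \<open>Flat points\<close>

lemma isCont_nonzero_bounds:
 fixes w :: "real => real"
 assumes "isCont w x" "w x \<noteq> 0"
 obtains d where "0 < d" "\<And>t. \<bar>t - x\<bar> < d ==> \<bar>w x\<bar> / 2 <= sgn (w x) * w t \<and> sgn (w x) * w t <= 2 * \<bar>w x\<bar>"
proof -
 obtain d where d: "0 < d" "\<And>t. \<bar>t - x\<bar> < d ==> \<bar>w t - w x\<bar> < \<bar>w x\<bar> / 2"
  using assms unfolding continuous_at_eps_delta dist_real_def by (metis half_gt_zero zero_less_abs_iff)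
 have "\<bar>w x\<bar> / 2 <= sgn (w x) * w t \<and> sgn (w x) * w t <= 2 * \<bar>w x\<bar>" if "\<bar>t - x\<bar> < d" for t
  using d(2)[OF that] assms(2) by (cases "0 < w x") (auto simp: abs_if split: if_splits)
 then show ?thesis using that d(1) by blast
qed

text \<open>With \<open>g x = \<bar>x\<bar>\<^sup>\<kappa> a x\<close>, the determinant of the first two derivatives of the curve \<open>(X, g \<circ> X)\<close> is
 \<open>g'' (X) X'\<^sup>3\<close>, and \<open>g'' x = \<bar>x\<bar> powr (\<kappa> - 2) * (\<kappa> (\<kappa> - 1) a x + 2 \<kappa> x a' x + x\<^sup>2 a'' x)\<close>.\<close>

lemma graph_wronskian:
 fixes X X1 X2 Y Y1 Y2 :: "real => real" and D :: "nat => real => real"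
 assumes \<kappa>: "2 < \<kappa>" and X: "\<And>t. (X has_real_derivative X1 t) (at t)" "\<And>t. (X1 has_real_derivative X2 t) (at t)"
  and Y: "\<And>t. (Y has_real_derivative Y1 t) (at t)" "\<And>t. (Y1 has_real_derivative Y2 t) (at t)"
  and D: "\<And>j x. j < 2 ==> \<bar>x\<bar> < \<rho> ==> (D j has_real_derivative D (Suc j) x) (at x)"
  and graph: "0 < d" "\<And>t. \<bar>t - t0\<bar> < d ==> \<bar>X t\<bar> < \<rho> \<and> Y t = \<bar>X t\<bar> powr \<kappa> * D 0 (X t)"
  and t: "\<bar>t - t0\<bar> < d" and nz: "X t \<noteq> 0"
 shows "X1 t * Y2 t - Y1 t * X2 t = (X1 t) ^ 3 * (\<kappa> * (\<kappa> - 1) * D 0 (X t) + 2 * \<kappa> * X t * D 1 (X t) + (X t)\<^sup>2 * D 2 (X t)) * \<bar>X t\<bar> powr (\<kappa> - 2)"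
proof -
 \<comment> \<open>Near \<open>t\<close> the sign of \<open>X\<close> is constant, so
   \<open>\<bar>X\<bar> = s * X\<close> is differentiable and the power rule applies.\<close>
 define s where "s = sgn (X t)"
 have s: "s * s = 1" "s * X t = \<bar>X t\<bar>" using nz by (auto simp: s_def sgn_if)
 define U where "U = {u. 0 < s * X u \<and> \<bar>u - t0\<bar> < d}"
 have cX: "continuous_on UNIV X" by (intro continuous_at_imp_continuous_on ballI DERIV_isCont[OF X(1)])
 have oU: "open U" unfolding U_def Collect_conj_eq
  by (intro open_Int open_Collect_less continuous_intros cX)
 have tU: "t \<in> U" using t nz s by (simp add: U_def)
 have absX: "\<bar>X u\<bar> = s * X u" if "u \<in> U" for u
  using that nz by (auto simp: U_def s_def sgn_if abs_if zero_less_mult_iff split: if_splits)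
 define P where "P u = \<kappa> * s * (s * X u) powr (\<kappa> - 1) * D 0 (X u) + (s * X u) powr \<kappa> * D 1 (X u)" for u
 define Q where "Q u = \<kappa> * (\<kappa> - 1) * (s * X u) powr (\<kappa> - 2) * D 0 (X u) + 2 * \<kappa> * s * (s * X u) powr (\<kappa> - 1) * D 1 (X u) + (s * X u) powr \<kappa> * D 2 (X u)" for u
 have pw: "((\<lambda>u. (s * X u) powr p) has_real_derivative p * s * (s * X u) powr (p - 1) * X1 u) (at u)" if "u \<in> U" for u p
 proof -
  have "0 < s * X u" using that by (simp add: U_def)
  from has_real_derivative_powr[OF this, of p] have "((\<lambda>y. y powr p) has_real_derivative p * (s * X u) powr (p - 1)) (at (s * X u))" .
  from DERIV_chain2[OF this DERIV_cmult[OF X(1)[of u], of s]] show ?thesis by (simp add: mult_ac)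
 qed
 have Dc: "((\<lambda>u. D j (X u)) has_real_derivative D (Suc j) (X u) * X1 u) (at u)" if "j < 2" "u \<in> U" for j u
  using that graph(2)[of u] by (intro DERIV_chain2[OF D X(1)]) (auto simp: U_def)
 have Y1: "Y1 u = P u * X1 u" if u: "u \<in> U" for u
 proof -
  have "((\<lambda>u. (s * X u) powr \<kappa> * D 0 (X u)) has_real_derivative P u * X1 u) (at u)"
   by (rule DERIV_cong[OF DERIV_mult[OF pw[OF u] Dc[OF _ u]]]) (simp_all add: P_def algebra_simps)
  moreover have "((\<lambda>u. (s * X u) powr \<kappa> * D 0 (X u)) has_real_derivative Y1 u) (at u)"
   by (rule has_field_derivative_transform_within_open[OF Y(1)[of u] oU u])
    (use graph(2) absX in \<open>auto simp: U_def\<close>)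
  ultimately show ?thesis using DERIV_unique by blast
 qed
 have dP: "(P has_real_derivative Q t * X1 t) (at t)"
 proof -
  have 1: "((\<lambda>u. \<kappa> * s * (s * X u) powr (\<kappa> - 1)) has_real_derivative \<kappa> * s * ((\<kappa> - 1) * s * (s * X t) powr (\<kappa> - 1 - 1) * X1 t)) (at t)"
   by (rule DERIV_cmult[OF pw[OF tU]])
  have "(P has_real_derivative \<kappa> * s * ((\<kappa> - 1) * s * (s * X t) powr (\<kappa> - 1 - 1) * X1 t) * D 0 (X t) + D (Suc 0) (X t) * X1 t * (\<kappa> * s * (s * X t) powr (\<kappa> - 1))
    + (\<kappa> * s * (s * X t) powr (\<kappa> - 1) * X1 t * D 1 (X t) + D (Suc 1) (X t) * X1 t * (s * X t) powr \<kappa>)) (at t)"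
   unfolding P_def[abs_def] by (intro DERIV_add DERIV_mult 1 pw[OF tU] Dc[OF _ tU]) auto
  then show ?thesis
  proof (rule DERIV_cong)
   have eqs: "\<kappa> - 1 - 1 = \<kappa> - 2" "D (Suc 0) = D 1" "D (Suc 1) = D 2" by (simp_all add: numeral_2_eq_2)
   show "\<kappa> * s * ((\<kappa> - 1) * s * (s * X t) powr (\<kappa> - 1 - 1) * X1 t) * D 0 (X t) + D (Suc 0) (X t) * X1 t * (\<kappa> * s * (s * X t) powr (\<kappa> - 1))
    + (\<kappa> * s * (s * X t) powr (\<kappa> - 1) * X1 t * D 1 (X t) + D (Suc 1) (X t) * X1 t * (s * X t) powr \<kappa>) = Q t * X1 t"
    unfolding Q_def eqs using s(1) by algebra
  qed
 qed
 have "(Y1 has_real_derivative Q t * X1 t * X1 t + X2 t * P t) (at t)"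
  by (rule has_field_derivative_transform_within_open[OF DERIV_mult[OF dP X(2)] oU tU]) (simp add: Y1)
 then have Y2: "Y2 t = Q t * X1 t * X1 t + X2 t * P t" using DERIV_unique Y(2) by blast
 have p1: "s * \<bar>X t\<bar> powr (\<kappa> - 1) = X t * \<bar>X t\<bar> powr (\<kappa> - 2)"
 proof -
  have "\<bar>X t\<bar> powr (\<kappa> - 1) = \<bar>X t\<bar> powr 1 * \<bar>X t\<bar> powr (\<kappa> - 2)" by (simp only: flip: powr_add) simp
  then have "s * \<bar>X t\<bar> powr (\<kappa> - 1) = (s * \<bar>X t\<bar>) * \<bar>X t\<bar> powr (\<kappa> - 2)" using nz by simp
  moreover have "s * \<bar>X t\<bar> = X t" using nz by (simp add: s_def sgn_if)
  ultimately show ?thesis by simp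
 qed
 have p2: "\<bar>X t\<bar> powr \<kappa> = (X t)\<^sup>2 * \<bar>X t\<bar> powr (\<kappa> - 2)"
 proof -
  have "\<bar>X t\<bar> powr \<kappa> = \<bar>X t\<bar> powr 2 * \<bar>X t\<bar> powr (\<kappa> - 2)" by (simp only: flip: powr_add) simp
  then show ?thesis using nz by simp
 qed
 have Q: "Q t = (\<kappa> * (\<kappa> - 1) * D 0 (X t) + 2 * \<kappa> * X t * D 1 (X t) + (X t)\<^sup>2 * D 2 (X t)) * \<bar>X t\<bar> powr (\<kappa> - 2)"
 proof -
  have "Q t = \<kappa> * (\<kappa> - 1) * \<bar>X t\<bar> powr (\<kappa> - 2) * D 0 (X t) + 2 * \<kappa> * (s * \<bar>X t\<bar> powr (\<kappa> - 1)) * D 1 (X t) + \<bar>X t\<bar> powr \<kappa> * D 2 (X t)"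
   by (simp add: Q_def s)
  then show ?thesis unfolding p1 p2 by (simp add: algebra_simps)
 qed
 have "X1 t * Y2 t - Y1 t * X2 t = (X1 t) ^ 3 * Q t"
  by (simp add: Y2 Y1[OF tU] power3_eq_cube algebra_simps)
 then show ?thesis by (simp add: Q)
qed

context curve_data
begin

text \<open>A rotation preserves the determinant of the first two derivatives, so
  \<open>turn\<close> can be computed in the graph coordinates: near \<open>t0\<close> it is a
  continuous nonzero function times \<open>\<bar>X t\<bar> powr (\<kappa> - 2)\<close>, and
  \<open>X t\<close> is comparable to \<open>t - t0\<close>.\<close>

lemma flat_point:
 assumes \<kappa>: "2 < \<kappa>" and turn0: "turn t0 = 0" and van: "curvature_vanishes_to_order curve (\<Gamma> 0 t0) (\<kappa> - 2)"
 shows "\<exists>e m M d. \<bar>e\<bar> = 1 \<and> 0 < m \<and> 0 < M \<and> 0 < d \<and>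
  (\<forall>t. \<bar>t - t0\<bar> < d --> m * \<bar>t - t0\<bar> powr (\<kappa> - 2) <= e * turn t \<and> e * turn t <= M * \<bar>t - t0\<bar> powr (\<kappa> - 2))"
proof -
 obtain Q \<rho> a where Q: "rotation_matrix (Q :: real^2^2)" and \<rho>: "0 < \<rho>" and a: "smooth_on {-\<rho>..\<rho>} a" "\<forall>x\<in>{-\<rho>..\<rho>}. a x \<noteq> (0::real)"
  and gr: "\<exists>U. open U \<and> 0 \<in> U \<and> (\<lambda>y. Q *v (y - \<Gamma> 0 t0)) ` curve \<inter> U \<subseteq> {vector [x, \<bar>x\<bar> powr (\<kappa> - 2 + 2) * a x] | x. \<bar>x\<bar> <= \<rho>}"
  using van unfolding curvature_vanishes_to_order_def Let_def by blast
 obtain U where U: "open U" "0 \<in> U"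
  "(\<lambda>y. Q *v (y - \<Gamma> 0 t0)) ` curve \<inter> U \<subseteq> {vector [x, \<bar>x\<bar> powr \<kappa> * a x] | x. \<bar>x\<bar> <= \<rho>}"
  using gr by auto
 obtain D where D0: "\<forall>x\<in>{-\<rho>..\<rho>}. D 0 x = a x" and D1: "\<forall>j<3. \<forall>x\<in>{-\<rho>..\<rho>}. (D j has_vector_derivative D (Suc j) x) (at x within {-\<rho>..\<rho>})"
  using a(1) unfolding smooth_on_def Ck_on_def by blast
 have D: "(D j has_real_derivative D (Suc j) x) (at x)" if "j < 3" "\<bar>x\<bar> < \<rho>" for j x
 proof -
  have "(D j has_vector_derivative D (Suc j) x) (at x within {-\<rho>..\<rho>})" using D1 that by (auto simp: abs_less_iff)
  moreover have "at x within {-\<rho>..\<rho>} = at x" by (rule at_within_Icc_at) (use that in auto)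
  ultimately show ?thesis by (simp add: has_real_derivative_iff_has_vector_derivative)
 qed
 define R where "R v i = Q $ i $ 1 * v $ 1 + Q $ i $ 2 * v $ 2" for v :: "real^2" and i :: 2
 have Rmv: "(Q *v v) $ i = R v i" for v i by (simp add: matrix_vector_mult_def sum_2 R_def)
 have dR: "((\<lambda>t. R (\<Gamma> j t) i) has_real_derivative R (\<Gamma> (Suc j) t) i) (at t)" for j i t
  unfolding R_def by (intro DERIV_add DERIV_cmult dcomp)
 define X Y where "X t = R (\<Gamma> 0 t) 1 - R (\<Gamma> 0 t0) 1" and "Y t = R (\<Gamma> 0 t) 2 - R (\<Gamma> 0 t0) 2" for t
 define X1 X2 Y1 Y2 where "X1 t = R (\<Gamma> 1 t) 1" and "X2 t = R (\<Gamma> 2 t) 1" and "Y1 t = R (\<Gamma> 1 t) 2" and "Y2 t = R (\<Gamma> 2 t) 2" for t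
 have dX: "(X has_real_derivative X1 t) (at t)" "(X1 has_real_derivative X2 t) (at t)" for t
  unfolding X_def[abs_def] X1_def[abs_def] X2_def using dR[of 0 1 t] dR[of 1 1 t]
  by (auto intro!: derivative_eq_intros simp: numeral_2_eq_2)
 have dY: "(Y has_real_derivative Y1 t) (at t)" "(Y1 has_real_derivative Y2 t) (at t)" for t
  unfolding Y_def[abs_def] Y1_def[abs_def] Y2_def using dR[of 0 2 t] dR[of 1 2 t]
  by (auto intro!: derivative_eq_intros simp: numeral_2_eq_2)
 have QXY: "Q *v (\<Gamma> 0 t - \<Gamma> 0 t0) = vector [X t, Y t]" for t
  by (simp add: vec_eq_iff forall_2 Rmv X_def Y_def) (simp add: R_def algebra_simps)
 have det: "Q $ 1 $ 1 * Q $ 2 $ 2 - Q $ 1 $ 2 * Q $ 2 $ 1 = 1"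
  using Q by (simp add: rotation_matrix_def det_2)
 have wr: "X1 t * Y2 t - Y1 t * X2 t = \<Gamma> 1 t $ 1 * \<Gamma> 2 t $ 2 - \<Gamma> 1 t $ 2 * \<Gamma> 2 t $ 1" for t
 proof -
  have "X1 t * Y2 t - Y1 t * X2 t = (Q $ 1 $ 1 * Q $ 2 $ 2 - Q $ 1 $ 2 * Q $ 2 $ 1) * (\<Gamma> 1 t $ 1 * \<Gamma> 2 t $ 2 - \<Gamma> 1 t $ 2 * \<Gamma> 2 t $ 1)"
   unfolding X1_def X2_def Y1_def Y2_def R_def by algebra
  then show ?thesis by (simp add: det)
 qed
 have XY0: "X t0 = 0" "Y t0 = 0" by (simp_all add: X_def Y_def)
 have cX: "isCont X t" "isCont Y t" "isCont X1 t" for t using DERIV_isCont dX dY by blast+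
 have "\<forall>\<^sub>F t in nhds t0. Q *v (\<Gamma> 0 t - \<Gamma> 0 t0) \<in> U"
 proof -
  have "isCont (\<lambda>t. Q *v (\<Gamma> 0 t - \<Gamma> 0 t0)) t0"
   by (intro continuous_intros has_vector_derivative_continuous[OF d\<Gamma>] bounded_linear.continuous[OF matrix_vector_mul_bounded_linear])
  from this[unfolded isCont_def] tendsto_at_iff_tendsto_nhds[of "\<lambda>t. Q *v (\<Gamma> 0 t - \<Gamma> 0 t0)" t0]
  have "((\<lambda>t. Q *v (\<Gamma> 0 t - \<Gamma> 0 t0)) \<longlongrightarrow> 0) (nhds t0)" by simp
  then show ?thesis using U(1,2) by (rule topological_tendstoD)
 qed
 moreover have "\<forall>\<^sub>F t in nhds t0. \<bar>X t\<bar> < \<rho>"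
 proof -
  have "open {t. \<bar>X t\<bar> < \<rho>}" by (intro open_Collect_less continuous_intros continuous_at_imp_continuous_on ballI cX)
  then show ?thesis using \<rho> XY0 by (auto simp: eventually_nhds intro!: exI[of _ "{t. \<bar>X t\<bar> < \<rho>}"])
 qed
 ultimately have "\<forall>\<^sub>F t in nhds t0. \<bar>X t\<bar> < \<rho> \<and> Y t = \<bar>X t\<bar> powr \<kappa> * D 0 (X t)"
 proof eventually_elim
  case (elim t)
  have "Q *v (\<Gamma> 0 t - \<Gamma> 0 t0) \<in> {vector [x, \<bar>x\<bar> powr \<kappa> * a x] | x. \<bar>x\<bar> <= \<rho>}" using elim(1) U(3) by blast
  then obtain x where x: "vector [X t, Y t] = (vector [x, \<bar>x\<bar> powr \<kappa> * a x] :: real^2)" unfolding QXY by blast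
  have "X t = x" "Y t = \<bar>x\<bar> powr \<kappa> * a x" using arg_cong[OF x, of "\<lambda>v. v $ 1"] arg_cong[OF x, of "\<lambda>v. v $ 2"] by simp_all
  then show ?case using elim(2) D0 by (auto simp: abs_less_iff)
 qed
 then obtain d1 where d1: "0 < d1" "\<And>t. \<bar>t - t0\<bar> < d1 ==> \<bar>X t\<bar> < \<rho> \<and> Y t = \<bar>X t\<bar> powr \<kappa> * D 0 (X t)"
  unfolding eventually_nhds_metric dist_real_def by auto
 have cD: "isCont (\<lambda>t. D j (X t)) t0" if "j < 3" for j
  using isCont_o2[OF cX(1)[of t0], of "D j"] DERIV_isCont[OF D[OF that, of 0]] XY0 \<rho> by simp
 \<comment> \<open>As \<open>\<kappa> > 2\<close>, one has \<open>\<bar>Y\<bar> <= X\<^sup>2\<close>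
   near \<open>t0\<close>, hence \<open>Y\<close> has derivative zero there. If \<open>X\<close> had
   too, the curve would not be regular.\<close>
 have X1nz: "X1 t0 \<noteq> 0"
 proof
  assume X10: "X1 t0 = 0"
  have "((\<lambda>t. \<bar>X t\<bar> powr (\<kappa> - 2)) \<longlongrightarrow> \<bar>X t0\<bar> powr (\<kappa> - 2)) (at t0)"
   using \<kappa> cX(1)[of t0] by (intro tendsto_powr' tendsto_intros) (auto simp: isCont_def)
  then have "isCont (\<lambda>t. \<bar>X t\<bar> powr (\<kappa> - 2)) t0" by (simp add: isCont_def)
  have "isCont (\<lambda>t. \<bar>X t\<bar> powr (\<kappa> - 2) * \<bar>D 0 (X t)\<bar>) t0"
   by (intro continuous_intros \<open>isCont (\<lambda>t. \<bar>X t\<bar> powr (\<kappa> - 2)) t0\<close> cD) simp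
  then obtain d2 where d2: "0 < d2" "\<And>t. \<bar>t - t0\<bar> < d2 ==> \<bar>\<bar>X t\<bar> powr (\<kappa> - 2) * \<bar>D 0 (X t)\<bar>\<bar> < 1"
   unfolding continuous_at_eps_delta dist_real_def using XY0 \<kappa> by (metis abs_zero diff_zero mult_zero_left powr_zero_eq_one powr_0 zero_less_one)
  define h where "h t = (X t)\<^sup>2 - Y t" for t
  have "(h has_real_derivative 2 * X t0 * X1 t0 - Y1 t0) (at t0)"
   unfolding h_def power2_eq_square by (auto intro!: derivative_eq_intros dX dY)
  moreover have "h t0 <= h t" if t: "\<bar>t0 - t\<bar> < min d1 d2" for t
  proof -
   have "\<bar>Y t\<bar> = (X t)\<^sup>2 * (\<bar>X t\<bar> powr (\<kappa> - 2) * \<bar>D 0 (X t)\<bar>)"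
   proof -
    have "\<bar>X t\<bar> powr \<kappa> = (X t)\<^sup>2 * \<bar>X t\<bar> powr (\<kappa> - 2)"
    proof (cases "X t = 0")
     case False
     have "\<bar>X t\<bar> powr \<kappa> = \<bar>X t\<bar> powr 2 * \<bar>X t\<bar> powr (\<kappa> - 2)" by (simp only: flip: powr_add) simp
     then show ?thesis using False by simp
    qed simp
    then show ?thesis using d1(2)[of t] t by (auto simp: abs_mult abs_minus_commute)
   qed
   also have "\<dots> <= (X t)\<^sup>2 * 1" using d2(2)[of t] t by (intro mult_left_mono) (auto simp: abs_minus_commute)
   finally show ?thesis by (simp add: h_def XY0)
  qed
  ultimately have "2 * X t0 * X1 t0 - Y1 t0 = 0" using d1 d2 by (intro DERIV_local_min[of h _ t0 "min d1 d2"]) auto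
  then have "Y1 t0 = 0" by (simp add: XY0)
  then have "R (\<Gamma> 1 t0) 1 = 0" "R (\<Gamma> 1 t0) 2 = 0" using X10 by (simp_all add: X1_def Y1_def)
  moreover have "\<Gamma> 1 t0 $ 1 = Q $ 2 $ 2 * R (\<Gamma> 1 t0) 1 - Q $ 1 $ 2 * R (\<Gamma> 1 t0) 2" "\<Gamma> 1 t0 $ 2 = Q $ 1 $ 1 * R (\<Gamma> 1 t0) 2 - Q $ 2 $ 1 * R (\<Gamma> 1 t0) 1"
   using det unfolding R_def by algebra+
  ultimately have "\<Gamma> 1 t0 = 0" by (simp add: vec_eq_iff forall_2)
  then show False using reg by simp
 qed
 \<comment> \<open>At \<open>t0\<close>, where \<open>X\<close> vanishes, the last bracket is
   \<open>\<kappa> * (\<kappa> - 1) * a 0\<close>, which is not zero.\<close>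
 define w where "w t = sg * (ispeed t)\<^sup>2 * ((X1 t) ^ 3 * (\<kappa> * (\<kappa> - 1) * D 0 (X t) + 2 * \<kappa> * X t * D 1 (X t) + (X t)\<^sup>2 * D 2 (X t)))" for t
 have w0: "w t0 \<noteq> 0"
  using X1nz sg ispeed_pos[of t0] a(2) D0 \<kappa> \<rho> by (auto simp: w_def XY0)
 have ci: "isCont ispeed t0" using cont_frame(3)[of UNIV] by (simp add: continuous_on_eq_continuous_at)
 have cw: "isCont w t0" unfolding w_def by (intro continuous_intros cX ci cD) simp_all
 obtain d2 where d2: "0 < d2" "\<And>t. \<bar>t - t0\<bar> < d2 ==> \<bar>w t0\<bar> / 2 <= sgn (w t0) * w t \<and> sgn (w t0) * w t <= 2 * \<bar>w t0\<bar>"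
  using isCont_nonzero_bounds[OF cw w0] by blast
 obtain g where g: "\<And>t. X t - X t0 = g t * (t - t0)" "isCont g t0" "g t0 = X1 t0"
  using dX(1)[of t0] unfolding CARAT_DERIV by blast
 obtain d3 where d3: "0 < d3" "\<And>t. \<bar>t - t0\<bar> < d3 ==> \<bar>g t0\<bar> / 2 <= sgn (g t0) * g t \<and> sgn (g t0) * g t <= 2 * \<bar>g t0\<bar>"
  using isCont_nonzero_bounds[OF g(2)] X1nz g(3) by auto
 define c where "c = \<bar>X1 t0\<bar>"
 have c: "0 < c" using X1nz by (simp add: c_def)
 have Xb: "c / 2 * \<bar>t - t0\<bar> <= \<bar>X t\<bar>" "\<bar>X t\<bar> <= 2 * c * \<bar>t - t0\<bar>" if "\<bar>t - t0\<bar> < d3" for t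
 proof -
  have "\<bar>X t\<bar> = \<bar>sgn (g t0) * g t\<bar> * \<bar>t - t0\<bar>" using g(1)[of t] XY0 g(3) X1nz by (simp add: abs_mult abs_sgn_eq)
  moreover have "c / 2 <= \<bar>sgn (g t0) * g t\<bar>" "\<bar>sgn (g t0) * g t\<bar> <= 2 * c" using d3(2)[OF that] by (auto simp: g(3) c_def)
  ultimately show "c / 2 * \<bar>t - t0\<bar> <= \<bar>X t\<bar>" "\<bar>X t\<bar> <= 2 * c * \<bar>t - t0\<bar>" by (metis abs_ge_zero mult_right_mono)+
 qed
 define e where "e = sgn (w t0)"
 have "(\<bar>w t0\<bar> / 2 * (c / 2) powr (\<kappa> - 2)) * \<bar>t - t0\<bar> powr (\<kappa> - 2) <= e * turn t \<and>
   e * turn t <= (2 * \<bar>w t0\<bar> * (2 * c) powr (\<kappa> - 2)) * \<bar>t - t0\<bar> powr (\<kappa> - 2)"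
  if t: "\<bar>t - t0\<bar> < min d1 (min d2 d3)" for t
 proof (cases "t = t0")
  case False
  note b = Xb[of t] d2(2)[of t]
  have nz: "X t \<noteq> 0"
  proof
   assume "X t = 0"
   then have "c / 2 * \<bar>t - t0\<bar> <= 0" using b t by simp
   then show False using c False by (simp add: mult_le_0_iff)
  qed
  have "X1 t * Y2 t - Y1 t * X2 t = (X1 t) ^ 3 * (\<kappa> * (\<kappa> - 1) * D 0 (X t) + 2 * \<kappa> * X t * D 1 (X t) + (X t)\<^sup>2 * D 2 (X t)) * \<bar>X t\<bar> powr (\<kappa> - 2)"
   by (rule graph_wronskian[OF \<kappa> dX dY D d1]) (use t nz in auto)
  then have "turn t = w t * \<bar>X t\<bar> powr (\<kappa> - 2)" unfolding wr turn_def w_def by simp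
  then have et: "e * turn t = (sgn (w t0) * w t) * \<bar>X t\<bar> powr (\<kappa> - 2)" by (simp add: e_def)
  have "\<bar>t - t0\<bar> < d2" "\<bar>t - t0\<bar> < d3" using t by auto
  note b = Xb[OF this(2)] d2(2)[OF this(1)]
  have p: "(c / 2 * \<bar>t - t0\<bar>) powr (\<kappa> - 2) <= \<bar>X t\<bar> powr (\<kappa> - 2)" "\<bar>X t\<bar> powr (\<kappa> - 2) <= (2 * c * \<bar>t - t0\<bar>) powr (\<kappa> - 2)"
   using b(1,2) c \<kappa> by (auto intro!: powr_mono2)
  have "0 <= sgn (w t0) * w t" using b(3) by linarith
  then have "(\<bar>w t0\<bar> / 2) * (c / 2 * \<bar>t - t0\<bar>) powr (\<kappa> - 2) <= e * turn t"
   unfolding et using b(3) by (intro mult_mono[OF _ p(1)]) simp_all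
  moreover have "e * turn t <= (2 * \<bar>w t0\<bar>) * (2 * c * \<bar>t - t0\<bar>) powr (\<kappa> - 2)"
   unfolding et using b(3) by (intro mult_mono[OF _ p(2)]) simp_all
  moreover have "(c / 2 * \<bar>t - t0\<bar>) powr (\<kappa> - 2) = (c / 2) powr (\<kappa> - 2) * \<bar>t - t0\<bar> powr (\<kappa> - 2)"
   "(2 * c * \<bar>t - t0\<bar>) powr (\<kappa> - 2) = (2 * c) powr (\<kappa> - 2) * \<bar>t - t0\<bar> powr (\<kappa> - 2)"
   using c by (intro powr_mult; simp)+
  ultimately show ?thesis by (simp only: mult.assoc)
 qed (simp add: turn0)
 then show ?thesis
  using w0 c d1(1) d2(1) d3(1)
  by (intro exI[of _ e] exI[of _ "\<bar>w t0\<bar> / 2 * (c / 2) powr (\<kappa> - 2)"] exI[of _ "2 * \<bar>w t0\<bar> * (2 * c) powr (\<kappa> - 2)"] exI[of _ "min d1 (min d2 d3)"])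
   (auto simp: e_def abs_sgn_eq)
qed

text \<open>The curvature is smooth and keeps its sign near the flat point, so that it vanishes to an order of at least two.\<close>

lemma flat_order:
 assumes flat: "\<bar>e\<bar> = 1" "0 < m" "0 < d" "\<And>t. \<bar>t - t0\<bar> < d ==> m * \<bar>t - t0\<bar> powr \<beta> <= e * turn t"
  and turn0: "turn t0 = 0"
 shows "2 <= \<beta>"
proof (rule ccontr)
 assume "\<not> 2 <= \<beta>"
 obtain b1 where b1: "b1 \<in> amp" "\<And>t \<eta> om S. \<bar>\<eta>\<bar> <= r ==> ((\<lambda>t. turn t) has_real_derivative b1 t \<eta> om) (at t within S)"
  using amp_dtE[OF amp_turn] by blast
 obtain b2 where b2: "b2 \<in> amp" "\<And>t \<eta> om S. \<bar>\<eta>\<bar> <= r ==> ((\<lambda>t. b1 t \<eta> om) has_real_derivative b2 t \<eta> om) (at t within S)"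
  using amp_dtE[OF b1(1)] by blast
 define T1 T2 where "T1 t = b1 t 0 (axis 1 1)" and "T2 t = b2 t 0 (axis 1 1)" for t
 have d1: "(turn has_real_derivative T1 t) (at t within S)" and d2: "(T1 has_real_derivative T2 t) (at t within S)" for t S
  using b1(2)[of 0] b2(2)[of 0] r_pos by (simp_all add: T1_def[abs_def] T2_def)
 obtain K where K: "0 <= K" "\<And>t. \<bar>T2 t\<bar> <= K"
  using amp_bounded[OF b2(1)] r_pos by (auto simp: T2_def norm_axis_1)
 have "((\<lambda>t. e * turn t) has_real_derivative e * T1 t0) (at t0)" by (rule DERIV_cmult[OF d1])
 moreover have "e * turn t0 <= e * turn t" if "\<bar>t0 - t\<bar> < d" for t
 proof -
  have "0 <= m * \<bar>t - t0\<bar> powr \<beta>" using flat(2) by simp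
  then show ?thesis using flat(4)[of t] that turn0 by (simp add: abs_minus_commute)
 qed
 ultimately have "e * T1 t0 = 0" using flat(3) by (intro DERIV_local_min[of "\<lambda>t. e * turn t" _ t0 d]) auto
 then have T10: "T1 t0 = 0" using flat(1) by auto
 have B1: "\<bar>T1 t\<bar> <= K * \<bar>t - t0\<bar>" for t
  using vector_derivative_bound[of "min t t0" "max t t0" T1 T2 K t t0] d2 K(2) T10
  by (simp add: has_real_derivative_iff_has_vector_derivative)
 have B0: "\<bar>turn t\<bar> <= K * \<bar>t - t0\<bar> * \<bar>t - t0\<bar>" for t
 proof -
  have "norm (T1 u) <= K * \<bar>t - t0\<bar>" if u: "u \<in> {min t t0..max t t0}" for u
  proof -
   have "K * \<bar>u - t0\<bar> <= K * \<bar>t - t0\<bar>" using u K(1) by (intro mult_left_mono) (auto simp: abs_if min_def max_def split: if_splits)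
   then show ?thesis using B1[of u] by simp
  qed
  then show ?thesis
   using vector_derivative_bound[of "min t t0" "max t t0" turn T1 "K * \<bar>t - t0\<bar>" t t0] d1 turn0
   by (simp add: has_real_derivative_iff_has_vector_derivative)
 qed
 \<comment> \<open>\<open>e * turn\<close> has a minimum at \<open>t0\<close>, so
   \<open>turn\<close> is quadratically small there. A lower bound with \<open>\<beta> < 2\<close>
   would yield \<open>m <= K * s powr p\<close> with \<open>p > 0\<close> for all small
   \<open>s\<close>.\<close>
 define p where "p = 2 - \<beta>"
 have p: "0 < p" using \<open>\<not> 2 <= \<beta>\<close> by (simp add: p_def)
 have bd: "m <= K * s powr p" if s: "0 < s" "s < d" for s
 proof -
  have "m * s powr \<beta> <= e * turn (t0 + s)" using flat(4)[of "t0 + s"] s by simp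
  also have "\<dots> <= \<bar>e * turn (t0 + s)\<bar>" by simp
  also have "\<dots> <= K * s * s" using B0[of "t0 + s"] flat(1) s by (simp add: abs_mult)
  also have "\<dots> = K * s powr p * s powr \<beta>" using s by (simp add: p_def power2_eq_square flip: powr_add)
  finally show ?thesis using s by simp
 qed
 have "((\<lambda>s. K * s powr p) \<longlongrightarrow> K * 0 powr p) (at_right 0)"
  using p by (intro tendsto_intros tendsto_powr' tendsto_ident_at) (auto simp: eventually_at_right_field intro: exI[of _ 1])
 then have "((\<lambda>s. K * s powr p) \<longlongrightarrow> 0) (at_right 0)" using p by simp
 moreover have "\<forall>\<^sub>F s in at_right 0. m <= K * s powr p"
  using bd flat(3) by (auto simp: eventually_at_right_field intro: exI[of _ d])
 ultimately have "m <= 0" by (intro tendsto_lowerbound[of "\<lambda>s. K * s powr p" 0 "at_right 0"]) auto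
 then show False using flat(2) by simp
qed

end

section \<open>The error for continuous weights\<close>

context curve_domain
begin

text \<open>\<open>shrink\<close> is nonnegative within the reach, so a pointwise comparison of
  weights carries over to the functions on the plane.\<close>

lemma plane_weight_nonneg_bound:
 assumes "\<And>\<eta>. \<bar>\<psi>1 \<eta> - \<psi>2 \<eta>\<bar> <= \<xi> \<eta>" and u: "\<And>t. \<bar>u (\<Gamma> 0 t)\<bar> <= B"
 shows "\<bar>plane_weight u \<psi>1 x - plane_weight u \<psi>2 x\<bar> <= B * plane_weight (\<lambda>_. 1) \<xi> x"
proof (cases "infdist x curve < r")
 case True
 obtain t \<eta> where x: "x = offset t \<eta>" "\<bar>\<eta>\<bar> = infdist x curve" using offset_surj by blast
 then have \<eta>: "\<bar>\<eta>\<bar> < r" "\<bar>\<eta>\<bar> <= r" using True by auto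
 have pw: "plane_weight v \<psi> x = v (\<Gamma> 0 t) * \<psi> \<eta> * shrink t \<eta>" for v \<psi>
  using offset_closest[OF reach \<eta>(2), where t = t] signed_distance_offset[OF \<eta>(2), where t = t] level_jacobian_offset[OF \<eta>(1), where t = t] \<eta>(1)
  by (simp add: plane_weight_def x(1))
 have s: "0 <= shrink t \<eta>" using shrink_denom[OF \<eta>(2), of t] by (simp add: shrink_def)
 have "\<bar>plane_weight u \<psi>1 x - plane_weight u \<psi>2 x\<bar> = \<bar>u (\<Gamma> 0 t)\<bar> * \<bar>\<psi>1 \<eta> - \<psi>2 \<eta>\<bar> * shrink t \<eta>"
  using s by (simp add: pw abs_mult flip: left_diff_distrib right_diff_distrib)
 also have "\<dots> <= B * \<xi> \<eta> * shrink t \<eta>"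
  using assms(1)[of \<eta>] u[of t] s by (intro mult_right_mono mult_mono) auto
 finally show ?thesis by (simp add: pw)
qed (simp add: plane_weight_def)

lemma plane_weight_linear:
 "plane_weight u (\<lambda>\<eta>. c * ((\<Sum>i\<in>I. \<psi> i \<eta>) + a * \<xi> \<eta>)) x = c * ((\<Sum>i\<in>I. plane_weight u (\<psi> i) x) + a * plane_weight u \<xi> x)"
proof (cases "infdist x curve < r")
 case True
 show ?thesis unfolding plane_weight_def using True
  by (simp add: sum_distrib_left sum_distrib_right algebra_simps)
qed (simp add: plane_weight_def)

lemma grid_box:
 assumes "0 < h"
 obtains L :: nat where "\<And>x i. infdist x curve <= r ==> \<bar>x $ i\<bar> <= h * (real L + 1/2)"
proof -
 obtain B where B: "\<And>t. norm (\<Gamma> 0 t) <= B"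
  using compact_imp_bounded[OF compact_range] unfolding bounded_iff by blast
 obtain L :: nat where L: "(B + r) / h <= real L" using real_arch_simple by blast
 have "\<bar>x $ i\<bar> <= h * (real L + 1/2)" if x: "infdist x curve <= r" for x i
 proof -
  obtain t \<eta> where t: "x = offset t \<eta>" "\<bar>\<eta>\<bar> = infdist x curve" using offset_surj by blast
  have "\<bar>x $ i\<bar> <= norm x" by (rule component_le_norm_cart)
  also have "\<dots> <= norm (\<Gamma> 0 t) + norm (\<eta> *\<^sub>R nrml t)" unfolding t(1) offset_def by (rule norm_triangle_ineq)
  also have "\<dots> <= B + r" using B[of t] t(2) x by (simp add: norm_nrml)
  also have "\<dots> <= h * real L" using L assms by (simp add: field_simps)
  also have "\<dots> <= h * (real L + 1/2)" using assms by simp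
  finally show ?thesis .
 qed
 then show ?thesis using that by blast
qed

end

text \<open>Pairing with the constant one, whose backward mean is again one.\<close>

lemma integral_steklov:
 assumes "steklov_profile \<theta> \<rho> \<delta> r V E"
 shows "integral {-r..r} (steklov \<delta> \<theta>) = integral {-\<rho>..\<rho>} \<theta>"
proof -
 interpret steklov_profile \<theta> \<rho> \<delta> r V E by (rule assms)
 have "integral {-r..r} (\<lambda>\<eta>. complex_of_real (steklov \<delta> \<theta> \<eta>)) = pairing r (steklov \<delta> \<theta>) (\<lambda>_. 1 :: complex)"
  by (simp add: scaleR_conv_of_real)
 also have "\<dots> = pairing \<rho> \<theta> (\<lambda>\<eta>. (integral {-r..\<eta>} (\<lambda>_. 1) - integral {-r..\<eta> - \<delta>} (\<lambda>_. 1)) /\<^sub>R \<delta>)"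
  by (rule steklov_pairing) simp
 also have "\<dots> = integral {-\<rho>..\<rho>} (\<lambda>\<eta>. complex_of_real (\<theta> \<eta>))"
 proof (rule integral_cong)
  fix \<eta> assume "\<eta> \<in> {-\<rho>..\<rho>}"
  then have "-r <= \<eta> - \<delta>" "-r <= \<eta>" using \<rho> \<delta> by auto
  then have "integral {-r..\<eta>} (\<lambda>_. 1 :: complex) - integral {-r..\<eta> - \<delta>} (\<lambda>_. 1) = \<delta> *\<^sub>R 1"
   by (simp add: scaleR_conv_of_real)
  then show "\<theta> \<eta> *\<^sub>R ((integral {-r..\<eta>} (\<lambda>_. 1 :: complex) - integral {-r..\<eta> - \<delta>} (\<lambda>_. 1)) /\<^sub>R \<delta>) = complex_of_real (\<theta> \<eta>)"
   using \<delta> by (simp add: scaleR_conv_of_real)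
 qed
 finally have eq: "integral {-r..r} (\<lambda>\<eta>. complex_of_real (steklov \<delta> \<theta> \<eta>)) = integral {-\<rho>..\<rho>} (\<lambda>\<eta>. complex_of_real (\<theta> \<eta>))" .
 have "steklov \<delta> \<theta> integrable_on {-r..r}" by (intro integrable_continuous_real continuous_steklov)
 moreover have "bounded_linear complex_of_real" by (rule bounded_linear_of_real)
 note integral_linear[OF _ this]
 from this[of "steklov \<delta> \<theta>" "{-r..r}"] this[OF int[of "-\<rho>" \<rho>]] calculation
 have "complex_of_real (integral {-r..r} (steklov \<delta> \<theta>)) = complex_of_real (integral {-\<rho>..\<rho>} \<theta>)"
  using eq by (simp add: o_def)
 then show ?thesis by (simp only: of_real_eq_iff)
qed

lemma sup_norm_ge_1: "k \<noteq> (0, 0) ==> 1 <= sup_norm k"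
 by (cases k) (auto simp: sup_norm_def)

text \<open>In the application \<open>Zp\<close> contains all parameters of flat points and is
  invariant under integer shifts; finiteness is therefore asked of the tangents there.\<close>

locale flat_domain = decay \<Gamma> sg Fd r \<kappa> Zp + curve_domain \<Gamma> sg Fd r \<Omega>
 for \<Gamma> sg Fd r \<kappa> Zp \<Omega> +
 assumes \<kappa>4: "4 <= \<kappa>" and fin: "finite (tang ` Zp)"
begin

definition freqs :: "(real \<times> (real^2)) set" where "freqs = {w. 1 <= fst w \<and> norm (snd w) = 1}"

text \<open>The orthogonal case is separated because \<open>1 / sqrt 0\<close> is \<open>0\<close>
  and would make the minimum vanish.\<close>

definition gain :: "real^2 => real \<times> (real^2) => real" where
 "gain \<tau> w = (if snd w \<bullet> \<tau> = 0 then fst w powr - (1 / \<kappa>)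
   else min (fst w powr - (1 / \<kappa>)) (1 / sqrt (fst w * \<bar>snd w \<bullet> \<tau>\<bar>)))"

text \<open>A sum over the flat directions stands in for the gain of the decisive one, which depends
  on \<open>w\<close>; the lattice sums are estimated for one \<open>\<tau>\<close> at a
  time.\<close>

definition total_gain :: "real \<times> (real^2) => real" where "total_gain w = (\<Sum>\<tau>\<in>tang ` Zp. gain \<tau> w)"

lemma gain_nonneg: "w \<in> freqs ==> 0 <= gain \<tau> w"
 by (auto simp: gain_def freqs_def)

lemma gain_le: "gain \<tau> w <= fst w powr - (1 / \<kappa>)"
 by (simp add: gain_def)

text \<open>The \<open>\<tau>\<close> with the smallest
  \<open>\<bar>om \<bullet> \<tau>\<bar>\<close> provides the largest \<open>\<phi>\<close> that
  \<open>decay_bound\<close> admits, and its gain is one of the summands.\<close>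

lemma total_gain_bound:
 assumes b: "b \<in> amp"
 shows "\<exists>C\<ge>0. \<forall>w\<in>freqs. \<forall>\<eta>\<in>{-r..r}. norm (osc_int b w \<eta>) <= C * total_gain w"
proof -
 obtain C where C: "0 <= C" "\<And>l \<eta> om. admissible l \<eta> om ==> decay_bound C l om (osc_int b (l, om) \<eta>)"
  using osc_int_decay[OF b] by blast
 show ?thesis
 proof (intro exI[of _ C] conjI ballI C(1))
  fix w \<eta> assume w: "w \<in> freqs" and \<eta>: "\<eta> \<in> {-r..r}"
  define l om where "l = fst w" and "om = snd w"
  have lw: "1 <= l" "norm om = 1" "w = (l, om)" using w by (auto simp: l_def om_def freqs_def)
  have "admissible l \<eta> om" using lw \<eta> by (auto simp: admissible_def)
  then have D: "norm (osc_int b w \<eta>) <= C * l powr - (1 / \<kappa>)"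
   "\<And>\<phi>. 0 <= \<phi> ==> (\<forall>z\<in>Zp. \<phi> <= \<bar>om \<bullet> tang z\<bar>) ==> norm (osc_int b w \<eta>) * sqrt (l * \<phi>) <= C"
   using C(2) unfolding decay_bound_def lw(3) by blast+
  obtain \<tau> where \<tau>: "\<tau> \<in> tang ` Zp" "\<And>\<tau>'. \<tau>' \<in> tang ` Zp ==> \<bar>om \<bullet> \<tau>\<bar> <= \<bar>om \<bullet> \<tau>'\<bar>"
   using ex_min_if_finite[of "(\<lambda>\<tau>. \<bar>om \<bullet> \<tau>\<bar>) ` tang ` Zp"] fin Zp by (auto simp: not_less)
  have "norm (osc_int b w \<eta>) <= C * gain \<tau> w"
  proof (cases "om \<bullet> \<tau> = 0")
   case False
   have "norm (osc_int b w \<eta>) * sqrt (l * \<bar>om \<bullet> \<tau>\<bar>) <= C" using \<tau>(2) by (intro D(2)) auto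
   moreover have "0 < sqrt (l * \<bar>om \<bullet> \<tau>\<bar>)" using False lw(1) by simp
   ultimately have "norm (osc_int b w \<eta>) <= C * (1 / sqrt (l * \<bar>om \<bullet> \<tau>\<bar>))" by (simp add: field_simps)
   then show ?thesis using D(1) False by (simp add: gain_def l_def om_def min_def)
  qed (use D(1) in \<open>simp add: gain_def l_def om_def\<close>)
  also have "\<dots> <= C * total_gain w"
   unfolding total_gain_def by (intro mult_left_mono member_le_sum \<tau>(1) gain_nonneg w fin C(1))
  finally show "norm (osc_int b w \<eta>) <= C * total_gain w" .
 qed
qed

sublocale osc: osc_family osc_int amp fst total_gain freqs r
proof
 fix w assume "w \<in> freqs"
 then show "0 < fst w" "0 <= total_gain w" by (auto simp: freqs_def total_gain_def intro!: sum_nonneg gain_nonneg)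
next
 fix b assume b: "b \<in> amp"
 show "\<exists>C\<ge>0. \<forall>w\<in>freqs. \<forall>\<eta>\<in>{-r..r}. norm (osc_int b w \<eta>) <= C * total_gain w" by (rule total_gain_bound[OF b])
 have sub: "freqs \<subseteq> {w. 0 < fst w \<and> norm (snd w) = 1}" by (auto simp: freqs_def)
 show "\<exists>b1\<in>amp. \<exists>b2\<in>amp. \<exists>D. \<forall>w\<in>freqs. splits r (fst w) (osc_int b w) (osc_int b1 w) (osc_int b2 w) (D w)"
  using osc_int_reduce[OF b] sub by blast
 show "continuous_on {-r..r} (osc_int b w)" for w by (rule continuous_osc_int[OF b])
qed

lemma freq_bounds:
 assumes k: "k \<noteq> (0, 0)" and h: "0 < h" "h <= 1"
 shows "sup_norm k / h <= fst (freq h k)" "freq h k \<in> freqs"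
  "fst (freq h k) powr - (1 / \<kappa>) <= (h / sup_norm k) powr (1 / \<kappa>)"
proof -
 define v :: "real^2" where "v = vector [of_int (fst k), of_int (snd k)]"
 have "sup_norm k <= norm v"
  using component_le_norm_cart[of v 1] component_le_norm_cart[of v 2] by (simp add: sup_norm_def v_def)
 also have "norm v <= 2 * pi * norm v" using pi_gt3 by (simp add: mult_le_cancel_right1)
 finally have "sup_norm k / h <= 2 * pi * norm v / h" using h by (intro divide_right_mono) auto
 then show 1: "sup_norm k / h <= fst (freq h k)" by (simp add: freq_def v_def Let_def)
 have s: "1 <= sup_norm k" by (rule sup_norm_ge_1[OF k])
 have "1 <= sup_norm k / h" using s h by (simp add: field_simps)
 then show "freq h k \<in> freqs" using 1 norm_freq(1)[OF k] by (simp add: freqs_def)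
 have "fst (freq h k) powr - (1 / \<kappa>) <= (sup_norm k / h) powr - (1 / \<kappa>)"
  using 1 s h \<kappa>4 by (intro powr_mono2') auto
 also have "\<dots> = (h / sup_norm k) powr (1 / \<kappa>)" using s h by (simp add: powr_minus powr_divide)
 finally show "fst (freq h k) powr - (1 / \<kappa>) <= (h / sup_norm k) powr (1 / \<kappa>)" .
qed

text \<open>For \<open>q >= 1\<close> the exponent of \<open>sup_norm k\<close> is at least
  \<open>2 + 1 / \<kappa>\<close>. In the case \<open>q = 1\<close> it is the contribution
  \<open>1 / \<kappa>\<close> of the curve that makes the sum over the plane lattice
  converge.\<close>

lemma smooth_profile_error:
 assumes wp: "weight_profile q \<theta>" and q: "1 <= q" and f: "\<And>t. f (\<Gamma> 0 t) = Fd 0 t"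
 shows "\<exists>C\<ge>0. \<forall>eps h. 0 < h --> h <= 1 --> 0 < eps --> eps <= min 1 (r / 8) -->
  \<bar>integral {0..1} (\<lambda>t. Fd 0 t * speed t) - lattice_quadrature \<Omega> \<theta> f eps h\<bar> <= C * ((h / eps) ^ (q + 1) * h powr (1 / \<kappa>))"
proof -
 obtain T V where T0: "T 0 = \<theta>" and bv: "\<And>i. i <= q ==> dual_bv (T i) (-2) 2 V"
  and parts: "\<And>i (X :: real => complex) X'. i < q ==>
    (\<And>t. t \<in> {-2..2} ==> (X has_vector_derivative X' t) (at t within {-2..2})) ==> continuous_on {-2..2} X' ==>
    pairing 2 (T i) X' = - pairing 2 (T (Suc i)) X"
  and cont: "1 <= q ==> continuous_on UNIV \<theta>"
  using weight_profile_chain[OF wp] by blast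
 define b where "b t \<eta> om = Fd 0 t * speed t" for t \<eta> :: real and om :: "real^2"
 have b: "b \<in> amp" unfolding b_def[abs_def] by (intro amp.mult amp.data amp_speed)
 obtain C1 where C1: "0 <= C1" and C1b: "\<forall>w\<in>freqs. \<forall>eps. 0 < eps --> eps <= 1 --> 2 * eps <= r -->
   norm (pairing 2 (T 0) (\<lambda>s. osc_int b w (eps * s))) <= C1 * total_gain w / (eps * fst w) ^ (q + 1)"
  using osc.profile_bound[where \<theta> = T and c = 2 and q = q and V = V and n = "q + 1" and i = 0, OF parts bv _ b] by auto
 obtain C2 where C2: "0 <= C2" "\<And>S. finite S ==> (0, 0) \<notin> S ==> (\<Sum>k\<in>S. sup_norm k powr - (2 + 1 / \<kappa>)) <= C2"
  using lattice_sum_radial[of "1 / \<kappa>"] \<kappa>4 by auto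
 define N where "N = real (card (tang ` Zp))"
 \<comment> \<open>The directional part of the gain is given up here; what remains is the number of
   flat directions.\<close>
 have tg: "total_gain w <= N * fst w powr - (1 / \<kappa>)" for w
  unfolding total_gain_def N_def by (rule sum_bounded_above) (rule gain_le)
 show ?thesis
 proof (intro exI[of _ "C1 * N * C2"] conjI allI impI)
  show "0 <= C1 * N * C2" using C1 C2 by (simp add: N_def)
  fix eps h :: real assume h: "0 < h" "h <= 1" and eps: "0 < eps" "eps <= min 1 (r / 8)"
  have er: "eps <= 1" "2 * eps < r" "eps < r" using eps r_pos by auto
  obtain L where box: "\<And>x i. infdist x curve <= r ==> \<bar>x $ i\<bar> <= h * (real L + 1/2)"
   using grid_box[OF h(1)] by blast
  let ?\<psi> = "scaled_weight \<theta> eps"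
  have c\<psi>: "continuous_on {-r..r} ?\<psi>"
   unfolding scaled_weight_def using eps by (intro continuous_intros continuous_on_compose2[OF cont[OF q]]) auto
  have z: "?\<psi> \<eta> = 0" if "2 * eps <= \<bar>\<eta>\<bar>" for \<eta>
   using weight_profile_support[OF wp, of "\<eta> / eps"] eps that by (simp add: scaled_weight_def abs_divide less_divide_eq)
  have scale: "pairing r ?\<psi> X = pairing 2 \<theta> (\<lambda>s. X (eps * s))"
   if X: "continuous_on {-r..r} X" for X :: "real => complex"
  proof -
   have in_r: "eps * s \<in> {-r..r}" if "s \<in> {-2..2}" for s
   proof -
    have "\<bar>s\<bar> <= 2" using that by (simp add: abs_le_iff)
    then have "eps * \<bar>s\<bar> <= eps * 2" using eps by (intro mult_left_mono) auto
    then have "eps * \<bar>s\<bar> <= r" using er by linarith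
    then have "\<bar>eps * s\<bar> <= r" using eps by (simp add: abs_mult)
    then show ?thesis by (simp add: abs_le_iff)
   qed
   have "(\<lambda>s. \<theta> s *\<^sub>R X (eps * s)) integrable_on {-2..2}"
    by (intro integrable_continuous_real continuous_intros continuous_on_subset[OF cont[OF q]] continuous_on_compose2[OF X])
     (use in_r in auto)
   from scaled_weight_integral[OF eps(1) this]
   have "((\<lambda>\<eta>. ?\<psi> \<eta> *\<^sub>R X \<eta>) has_integral pairing 2 \<theta> (\<lambda>s. X (eps * s))) {- 2 * eps..2 * eps}" by simp
   then have "((\<lambda>\<eta>. ?\<psi> \<eta> *\<^sub>R X \<eta>) has_integral pairing 2 \<theta> (\<lambda>s. X (eps * s))) {-r..r}"
    by (rule has_integral_on_superset) (use z er in auto)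
   then show ?thesis by (rule integral_unique)
  qed
  have one: "integral {-r..r} ?\<psi> = 1" using integral_scaled_weight[OF wp eps(1)] er by simp
  have "\<bar>grid_sum h L (plane_weight f ?\<psi>) -
    integral {-r..r} ?\<psi> * integral {0..1} (\<lambda>t. f (\<Gamma> 0 t) * speed t)\<bar> <= C1 * N * C2 * ((h / eps) ^ (q + 1) * h powr (1 / \<kappa>))"
  proof (rule trapezoid_error[OF h(1) b _ _ c\<psi> _ er(2) z box])
   show "b t \<eta> om = f (\<Gamma> 0 t) * speed t" for t \<eta> om by (simp add: b_def f)
   show "continuous_on UNIV (\<lambda>t. f (\<Gamma> 0 t))" unfolding f by (rule contF)
   show "0 < 2 * eps" using eps by simp
   fix S :: "(int \<times> int) set" assume S: "finite S" "(0, 0) \<notin> S"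
   define R where "R = C1 * N * ((h / eps) ^ (q + 1) * h powr (1 / \<kappa>))"
   have R: "0 <= R" using C1 h eps by (simp add: R_def N_def)
   have "norm (pairing r ?\<psi> (osc_int b (freq h k))) <= R * sup_norm k powr - (2 + 1 / \<kappa>)" if "k \<in> S" for k
   proof -
    have k: "k \<noteq> (0, 0)" using that S by auto
    note fb = freq_bounds[OF k h]
    have s: "1 <= sup_norm k" by (rule sup_norm_ge_1[OF k])
    let ?l = "fst (freq h k)"
    have "norm (pairing r ?\<psi> (osc_int b (freq h k))) =
      norm (pairing 2 (T 0) (\<lambda>s. osc_int b (freq h k) (eps * s)))"
     unfolding scale[OF continuous_osc_int[OF b]] T0 ..
    also have "\<dots> <= C1 * total_gain (freq h k) / (eps * ?l) ^ (q + 1)"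
     using C1b fb(2) eps(1) er by simp
    also have "\<dots> <= C1 * (N * (h / sup_norm k) powr (1 / \<kappa>)) / (eps * (sup_norm k / h)) ^ (q + 1)"
    proof (rule frac_le)
     have "total_gain (freq h k) <= N * ?l powr - (1 / \<kappa>)" by (rule tg)
     also have "\<dots> <= N * (h / sup_norm k) powr (1 / \<kappa>)" using fb(3) by (intro mult_left_mono) (simp_all add: N_def)
     finally show "C1 * total_gain (freq h k) <= C1 * (N * (h / sup_norm k) powr (1 / \<kappa>))" using C1 by (rule mult_left_mono)
     show "(eps * (sup_norm k / h)) ^ (q + 1) <= (eps * ?l) ^ (q + 1)" using fb(1) eps h s by (intro power_mono mult_left_mono) auto
     show "0 < (eps * (sup_norm k / h)) ^ (q + 1)" using eps h s by simp
     show "0 <= C1 * (N * (h / sup_norm k) powr (1 / \<kappa>))" using C1 by (simp add: N_def)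
    qed
    also have "\<dots> = R * (sup_norm k powr - (1 / \<kappa>) * sup_norm k powr - real (q + 1))"
    proof -
     have "(h / sup_norm k) powr (1 / \<kappa>) = h powr (1 / \<kappa>) * sup_norm k powr - (1 / \<kappa>)"
      using h s by (simp add: powr_divide powr_minus_divide)
     moreover have "sup_norm k powr - real (q + 1) = inverse (sup_norm k ^ (q + 1))"
      using s by (simp only: powr_minus powr_realpow)
     moreover have "(eps * (sup_norm k / h)) ^ (q + 1) = sup_norm k ^ (q + 1) / (h / eps) ^ (q + 1)"
      using h eps by (simp only: power_divide power_mult_distrib) (simp add: field_simps)
     ultimately show ?thesis unfolding R_def by (simp only: divide_inverse inverse_mult_distrib inverse_inverse_eq mult_ac)
    qed
    also have "\<dots> <= R * sup_norm k powr - (2 + 1 / \<kappa>)"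
     using R s q by (intro mult_left_mono) (auto simp: simp flip: powr_add intro!: powr_mono)
    finally show ?thesis .
   qed
   then have "(\<Sum>k\<in>S. norm (pairing r ?\<psi> (osc_int b (freq h k)))) <= (\<Sum>k\<in>S. R * sup_norm k powr - (2 + 1 / \<kappa>))"
    by (rule sum_mono)
   also have "\<dots> <= R * C2" unfolding sum_distrib_left[symmetric] by (intro mult_left_mono C2 S R)
   finally show "(\<Sum>k\<in>S. norm (pairing r ?\<psi> (osc_int b (freq h k)))) <= C1 * N * C2 * ((h / eps) ^ (q + 1) * h powr (1 / \<kappa>))"
    by (simp add: R_def mult_ac)
  qed
  moreover have "lattice_quadrature \<Omega> \<theta> f eps h =
   grid_sum h L (plane_weight f ?\<psi>)"
   by (rule lattice_quadrature_eq[OF h(1) eps(1) er(3) weight_profile_support[OF wp] box])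
  ultimately show "\<bar>integral {0..1} (\<lambda>t. Fd 0 t * speed t) - lattice_quadrature \<Omega> \<theta> f eps h\<bar> <= C1 * N * C2 * ((h / eps) ^ (q + 1) * h powr (1 / \<kappa>))"
   by (simp add: one f abs_minus_commute)
 qed
qed

end

section \<open>The error for discontinuous weights\<close>

context flat_domain
begin

text \<open>The modulus of the frequency times its inner product with \<open>\<tau>\<close> is
  \<open>2 * pi / h\<close> times the linear form, so the square roots cancel up to
  \<open>1 / sqrt (2 * pi)\<close>, which is below one. If the form vanishes, the left side is
  zero.\<close>

lemma gain_directional:
 assumes k: "k \<noteq> (0, 0)" and h: "0 < h" "h <= 1"
 shows "gain \<tau> (freq h k) * sqrt \<bar>\<tau> $ 1 * of_int (fst k) + \<tau> $ 2 * of_int (snd k)\<bar> <= sqrt h"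
proof -
 let ?l = "fst (freq h k)" and ?om = "snd (freq h k)"
 define P where "P = \<bar>\<tau> $ 1 * of_int (fst k) + \<tau> $ 2 * of_int (snd k)\<bar>"
 have l: "0 < ?l" using norm_freq(2)[OF k h(1)] .
 have "?l * \<bar>?om \<bullet> \<tau>\<bar> = \<bar>2 * pi / h * (of_int (fst k) * \<tau> $ 1 + of_int (snd k) * \<tau> $ 2)\<bar>"
  unfolding norm_freq(3)[OF k, symmetric] using l by (simp add: abs_mult)
 also have "\<dots> = 2 * pi / h * P" using h by (simp add: P_def abs_mult mult.commute)
 finally have eq: "?l * \<bar>?om \<bullet> \<tau>\<bar> = 2 * pi / h * P" .
 show ?thesis
 proof (cases "?om \<bullet> \<tau> = 0")
  case True
  then have "P = 0" using eq h by simp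
  then show ?thesis using h by (simp add: P_def)
 next
  case False
  then have "0 < 2 * pi / h * P" unfolding eq[symmetric] using l by simp
  then have "P \<noteq> 0" by auto
  then have P: "0 < P" by (simp add: P_def)
  have "gain \<tau> (freq h k) * sqrt P <= 1 / sqrt (2 * pi / h * P) * sqrt P"
   using False P by (intro mult_right_mono) (simp_all add: gain_def eq)
  also have "\<dots> = sqrt (h / (2 * pi))"
   using P h by (simp add: real_sqrt_mult real_sqrt_divide field_simps)
  also have "\<dots> <= sqrt h" using h pi_gt3 by (simp add: divide_le_eq mult_le_cancel_left1)
  finally show ?thesis by (simp add: P_def)
 qed
qed

lemma grid_sum_abs_diff:
 assumes "\<And>x. \<bar>g x - g' x\<bar> <= B * G x"
 shows "\<bar>grid_sum h L g - grid_sum h L g'\<bar> <= B * grid_sum h L G"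
proof -
 have "grid_sum h L g - grid_sum h L g' = h\<^sup>2 * (\<Sum>m\<in>{-int L..int L}. \<Sum>n\<in>{-int L..int L}.
   g (h *\<^sub>R vector [of_int m, of_int n]) - g' (h *\<^sub>R vector [of_int m, of_int n]))"
  by (simp add: grid_sum_def sum_subtractf right_diff_distrib)
 also have "\<bar>\<dots>\<bar> <= h\<^sup>2 * (\<Sum>m\<in>{-int L..int L}. \<Sum>n\<in>{-int L..int L}. B * G (h *\<^sub>R vector [of_int m, of_int n]))"
  unfolding abs_mult by (intro mult_mono order_trans[OF sum_abs] sum_mono assms) auto
 also have "\<dots> = B * grid_sum h L G" by (simp add: grid_sum_def sum_distrib_left mult_ac)
 finally show ?thesis .
qed

lemma grid_sum_linear:
 "grid_sum h L (\<lambda>x. c * ((\<Sum>i\<in>I. p i x) + a * g x)) = c * ((\<Sum>i\<in>I. grid_sum h L (p i)) + a * grid_sum h L g)"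
proof -
 let ?J = "{-int L..int L} \<times> {-int L..int L}"
 have gs: "grid_sum h L f = h\<^sup>2 * (\<Sum>k\<in>?J. f (h *\<^sub>R vector [of_int (fst k), of_int (snd k)]))" for f
  by (simp add: grid_sum_def sum.cartesian_product split_def)
 have "(\<Sum>k\<in>?J. \<Sum>i\<in>I. p i (h *\<^sub>R vector [of_int (fst k), of_int (snd k)])) =
   (\<Sum>i\<in>I. \<Sum>k\<in>?J. p i (h *\<^sub>R vector [of_int (fst k), of_int (snd k)]))"
  by (rule sum.swap)
 then have "(\<Sum>k\<in>?J. c * ((\<Sum>i\<in>I. p i (h *\<^sub>R vector [of_int (fst k), of_int (snd k)])) + a * g (h *\<^sub>R vector [of_int (fst k), of_int (snd k)]))) =
   c * ((\<Sum>i\<in>I. \<Sum>k\<in>?J. p i (h *\<^sub>R vector [of_int (fst k), of_int (snd k)])) + a * (\<Sum>k\<in>?J. g (h *\<^sub>R vector [of_int (fst k), of_int (snd k)])))"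
  by (simp only: sum.distrib flip: sum_distrib_left)
 then show ?thesis unfolding gs by (simp only: sum_distrib_left distrib_left mult_ac)
qed

text \<open>The profile enters only through \<open>V\<close>. This uniformity allows the same
  constant for the averaged weight, where \<open>V\<close> is of order \<open>1 / eps\<close>, and
  for averaged indicators, where \<open>V\<close> is bounded.\<close>

definition trapezoid_bound :: "(real^2 => real) => real => bool" where
 "trapezoid_bound u C \<longleftrightarrow> (\<forall>h \<delta> \<theta> \<rho> V E L. 0 < h --> h <= 1 --> \<delta> = h powr (1 + 1 / \<kappa>) --> 0 < \<rho> --> \<rho> + \<delta> < r --> steklov_profile \<theta> \<rho> \<delta> r V E -->
  (\<forall>x i. infdist x curve <= r --> \<bar>x $ i\<bar> <= h * (real L + 1/2)) -->
  \<bar>grid_sum h L (plane_weight u (steklov \<delta> \<theta>)) - integral {-\<rho>..\<rho>} \<theta> * integral {0..1} (\<lambda>t. u (\<Gamma> 0 t) * speed t)\<bar> <= C * V * \<delta>)"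

text \<open>The two Steklov bounds supply the weights \<open>1 / sup_norm k\<close> and
  \<open>K / (sup_norm k)\<^sup>2\<close> with \<open>K = h / \<delta>\<close>, and
  \<open>directional_lattice_sum\<close> is applied once for every flat direction. The result
  \<open>V * h * h powr (1 / \<kappa>)\<close> is \<open>V * \<delta>\<close>.\<close>

lemma steklov_trapezoid:
 assumes b: "b \<in> amp" "\<And>t \<eta> om. b t \<eta> om = u (\<Gamma> 0 t) * speed t" and cu: "continuous_on UNIV (\<lambda>t. u (\<Gamma> 0 t))"
 shows "\<exists>C\<ge>0. trapezoid_bound u C"
proof -
 obtain C1 where C1: "0 <= C1" and C1b: "\<forall>w\<in>freqs. \<forall>\<theta> \<rho> \<delta> V E. steklov_profile \<theta> \<rho> \<delta> r V E -->
   norm (pairing r (steklov \<delta> \<theta>) (osc_int b w)) <= C1 * V * total_gain w / fst w"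
  using osc.steklov_bound(1)[OF b(1)] by blast
 obtain C2 where C2: "0 <= C2" and C2b: "\<forall>w\<in>freqs. \<forall>\<theta> \<rho> \<delta> V E. steklov_profile \<theta> \<rho> \<delta> r V E -->
   norm (pairing r (steklov \<delta> \<theta>) (osc_int b w)) <= C2 * V * total_gain w / (\<delta> * (fst w)\<^sup>2)"
  using osc.steklov_bound(2)[OF b(1)] by blast
 have "0 < 1 / \<kappa>" using \<kappa>4 by simp
 from directional_lattice_sum[OF this] obtain C3 where C3: "0 <= C3" and
  C3b: "\<forall>a b h K m w S. a\<^sup>2 + b\<^sup>2 = 1 --> 0 < h --> 0 <= K --> finite S --> (0, 0) \<notin> S -->
  (\<forall>k\<in>S. 0 <= m k \<and> m k <= (h / sup_norm k) powr (1 / \<kappa>) \<and> m k * sqrt \<bar>a * of_int (fst k) + b * of_int (snd k)\<bar> <= sqrt h) -->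
  (\<forall>k\<in>S. 0 <= w k \<and> w k <= 1 / sup_norm k \<and> w k <= K / (sup_norm k)\<^sup>2) -->
  (\<Sum>k\<in>S. m k * w k) <= C3 * (h powr (1 / \<kappa>) + K * sqrt h)"
  by blast
 define C0 where "C0 = max C1 C2"
 have C0: "0 <= C0" "C1 <= C0" "C2 <= C0" using C1 by (auto simp: C0_def)
 define N where "N = real (card (tang ` Zp))"
 show ?thesis
  unfolding trapezoid_bound_def
 proof (intro exI[of _ "C0 * (N * (C3 * 2))"] conjI allI impI)
  show "0 <= C0 * (N * (C3 * 2))" using C0 C3 by (simp add: N_def)
  fix h \<delta> :: real and \<theta> \<rho> V E L
  assume h: "0 < h" "h <= 1" and \<delta>: "\<delta> = h powr (1 + 1 / \<kappa>)" and \<rho>: "0 < \<rho>" "\<rho> + \<delta> < r" and sp: "steklov_profile \<theta> \<rho> \<delta> r V E"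
   and box: "\<forall>x i. infdist x curve <= r --> \<bar>x $ i\<bar> <= h * (real L + 1/2)"
  interpret sp: steklov_profile \<theta> \<rho> \<delta> r V E by (rule sp)
  have V: "0 <= V" using sp.bv by (rule dual_bv_nonneg)
  have dh: "\<delta> = h * h powr (1 / \<kappa>)" using h by (simp add: \<delta> powr_add)
  define K where "K = h powr - (1 / \<kappa>)"
  have hK: "h\<^sup>2 / \<delta> = h * K" using h by (simp add: K_def dh powr_minus power2_eq_square field_simps)
  \<comment> \<open>Here \<open>\<kappa> >= 4\<close> enters, as
    \<open>1 / 2 - 1 / \<kappa> >= 1 / \<kappa>\<close>; the base \<open>h\<close> is at most
    one.\<close>
  have Kh: "K * sqrt h <= h powr (1 / \<kappa>)"
  proof -
   have "K * sqrt h = h powr (1 / 2 - 1 / \<kappa>)" using h by (simp add: K_def flip: powr_half_sqrt powr_add)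
   also have "\<dots> <= h powr (1 / \<kappa>)" using h \<kappa>4 by (intro powr_mono') (auto simp: field_simps)
   finally show ?thesis .
  qed
  define w where "w k = min (1 / sup_norm k) (K / (sup_norm k)\<^sup>2)" for k
  have "\<bar>grid_sum h L (plane_weight u (steklov \<delta> \<theta>)) - integral {-r..r} (steklov \<delta> \<theta>) * integral {0..1} (\<lambda>t. u (\<Gamma> 0 t) * speed t)\<bar> <= C0 * (N * (C3 * 2)) * V * \<delta>"
  proof (rule trapezoid_error[OF h(1) b cu sp.continuous_steklov])
   \<comment> \<open>The averaged profile is zero beyond \<open>\<rho> + \<delta>\<close>; the
     midpoint to \<open>r\<close> leaves room on both sides.\<close>
   show "0 < (\<rho> + \<delta> + r) / 2" "(\<rho> + \<delta> + r) / 2 < r" using \<rho> sp.\<delta> r_pos by auto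
   show "steklov \<delta> \<theta> \<eta> = 0" if "(\<rho> + \<delta> + r) / 2 <= \<bar>\<eta>\<bar>" for \<eta>
    using that \<rho> sp.\<delta> by (intro sp.steklov_support) (auto simp: abs_if split: if_splits)
   show "\<bar>x $ i\<bar> <= h * (real L + 1/2)" if "infdist x curve <= r" for x i using box that by blast
   fix S :: "(int \<times> int) set" assume S: "finite S" "(0, 0) \<notin> S"
   have "norm (pairing r (steklov \<delta> \<theta>) (osc_int b (freq h k))) <= (C0 * V * h) * (total_gain (freq h k) * w k)"
    if "k \<in> S" for k
   proof -
    have k: "k \<noteq> (0, 0)" using that S by auto
    note fb = freq_bounds[OF k h]
    have s: "1 <= sup_norm k" by (rule sup_norm_ge_1[OF k])
    let ?l = "fst (freq h k)" and ?I = "norm (pairing r (steklov \<delta> \<theta>) (osc_int b (freq h k)))"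
    have g: "0 <= total_gain (freq h k)" unfolding total_gain_def by (intro sum_nonneg gain_nonneg fb)
    have "?I <= C1 * V * total_gain (freq h k) / ?l" using C1b fb(2) sp by blast
    also have "\<dots> <= (C0 * V * total_gain (freq h k)) / (sup_norm k / h)"
     using C0 V g fb(1) h s by (intro frac_le mult_right_mono) auto
    finally have 1: "?I <= (C0 * V * h) * (total_gain (freq h k) * (1 / sup_norm k))" by (simp add: mult_ac)
    have "?I <= C2 * V * total_gain (freq h k) / (\<delta> * ?l\<^sup>2)" using C2b fb(2) sp by blast
    also have "\<dots> <= (C0 * V * total_gain (freq h k)) / (\<delta> * (sup_norm k / h)\<^sup>2)"
     using C0 V g fb(1) h s sp.\<delta> by (intro frac_le mult_right_mono mult_left_mono power_mono) auto
    also have "\<dots> = C0 * V * total_gain (freq h k) * (h\<^sup>2 / \<delta>) / (sup_norm k)\<^sup>2"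
     by (simp add: power_divide mult_ac)
    finally have 2: "?I <= (C0 * V * h) * (total_gain (freq h k) * (K / (sup_norm k)\<^sup>2))" unfolding hK by (simp add: mult_ac)
    show ?thesis using 1 2 by (simp add: w_def min_def)
   qed
   then have "(\<Sum>k\<in>S. norm (pairing r (steklov \<delta> \<theta>) (osc_int b (freq h k))))
    <= (\<Sum>k\<in>S. (C0 * V * h) * (total_gain (freq h k) * w k))" by (rule sum_mono)
   also have "\<dots> = (C0 * V * h) * (\<Sum>\<tau>\<in>tang ` Zp. \<Sum>k\<in>S. gain \<tau> (freq h k) * w k)"
    unfolding total_gain_def by (simp only: sum_distrib_right sum.swap[of _ S] flip: sum_distrib_left)
   also have "\<dots> <= (C0 * V * h) * (N * (C3 * (2 * h powr (1 / \<kappa>))))"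
   proof (intro mult_left_mono)
    show "(\<Sum>\<tau>\<in>tang ` Zp. \<Sum>k\<in>S. gain \<tau> (freq h k) * w k) <= N * (C3 * (2 * h powr (1 / \<kappa>)))"
     unfolding N_def
    proof (rule sum_bounded_above)
     fix \<tau> assume "\<tau> \<in> tang ` Zp"
     then have \<tau>: "(\<tau> $ 1)\<^sup>2 + (\<tau> $ 2)\<^sup>2 = 1" using tang_sq by auto
     have m: "\<forall>k\<in>S. 0 <= gain \<tau> (freq h k) \<and> gain \<tau> (freq h k) <= (h / sup_norm k) powr (1 / \<kappa>) \<and>
       gain \<tau> (freq h k) * sqrt \<bar>\<tau> $ 1 * of_int (fst k) + \<tau> $ 2 * of_int (snd k)\<bar> <= sqrt h"
     proof
      fix k assume "k \<in> S"
      then have k: "k \<noteq> (0, 0)" using S by auto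
      show "0 <= gain \<tau> (freq h k) \<and> gain \<tau> (freq h k) <= (h / sup_norm k) powr (1 / \<kappa>) \<and>
       gain \<tau> (freq h k) * sqrt \<bar>\<tau> $ 1 * of_int (fst k) + \<tau> $ 2 * of_int (snd k)\<bar> <= sqrt h"
       using gain_nonneg[OF freq_bounds(2)[OF k h]] order_trans[OF gain_le freq_bounds(3)[OF k h]] gain_directional[OF k h]
       by blast
     qed
     have ww: "\<forall>k\<in>S. 0 <= w k \<and> w k <= 1 / sup_norm k \<and> w k <= K / (sup_norm k)\<^sup>2"
      by (auto simp: w_def K_def sup_norm_def)
     have K0: "0 <= K" by (simp add: K_def)
     have "(\<Sum>k\<in>S. gain \<tau> (freq h k) * w k) <= C3 * (h powr (1 / \<kappa>) + K * sqrt h)"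
      using C3b[rule_format, of "\<tau> $ 1" "\<tau> $ 2" h K S "\<lambda>k. gain \<tau> (freq h k)" w] \<tau> h(1) K0 S m ww by blast
     also have "\<dots> <= C3 * (2 * h powr (1 / \<kappa>))" using Kh C3 by (intro mult_left_mono) auto
     finally show "(\<Sum>k\<in>S. gain \<tau> (freq h k) * w k) <= C3 * (2 * h powr (1 / \<kappa>))" .
    qed
    show "0 <= C0 * V * h" using C0 V h by simp
   qed
   also have "\<dots> = C0 * (N * (C3 * 2)) * V * \<delta>" by (simp add: dh mult_ac)
   finally show "(\<Sum>k\<in>S. norm (pairing r (steklov \<delta> \<theta>) (osc_int b (freq h k)))) <= C0 * (N * (C3 * 2)) * V * \<delta>" .
  qed
  then show "\<bar>grid_sum h L (plane_weight u (steklov \<delta> \<theta>)) - integral {-\<rho>..\<rho>} \<theta> * integral {0..1} (\<lambda>t. u (\<Gamma> 0 t) * speed t)\<bar> <= C0 * (N * (C3 * 2)) * V * \<delta>"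
   by (simp only: integral_steklov[OF sp])
 qed
qed

text \<open>The averaged weight has an error of order \<open>\<delta> / eps\<close>. Its difference
  to the weight is dominated by averaged indicators, and the quadrature of such an indicator is at
  most the length of its interval times the length of the curve, up to order
  \<open>\<delta>\<close>. So the jumps cost \<open>\<delta> / eps\<close> once more.\<close>

lemma rough_profile_error:
 assumes wp: "weight_profile 0 \<theta>" and f: "\<And>t. f (\<Gamma> 0 t) = Fd 0 t"
 shows "\<exists>C\<ge>0. \<forall>eps h. 0 < h --> h <= 1 --> 0 < eps --> eps <= min 1 (r / 8) --> h powr (1 + 1 / \<kappa>) <= eps -->
  \<bar>integral {0..1} (\<lambda>t. Fd 0 t * speed t) - lattice_quadrature \<Omega> \<theta> f eps h\<bar> <= C * ((h / eps) * h powr (1 / \<kappa>))"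
proof -
 obtain V where V: "0 <= V" and prof: "\<And>eps \<delta> r. 0 < eps ==> eps <= 1 ==> 0 < \<delta> ==> \<delta> <= 1 ==> 2 * eps + \<delta> <= r ==>
  \<exists>E. steklov_profile (scaled_weight \<theta> eps) (2 * eps) \<delta> r (V / eps) E"
  using steklov_profile_scaled_weight[OF wp] by blast
 obtain F A where F: "finite F" "F \<subseteq> {-2..2}" "0 <= A" and err: "\<And>eps \<delta> \<eta>. 0 < eps ==> 0 < \<delta> ==> \<delta> <= eps ==>
  \<bar>scaled_weight \<theta> eps \<eta> - steklov \<delta> (scaled_weight \<theta> eps) \<eta>\<bar> <=
   A / eps * ((\<Sum>f\<in>F. steklov \<delta> (indicator {f * eps - \<delta>..f * eps + \<delta>}) \<eta>) + \<delta> / eps * steklov \<delta> (indicator {- 2 * eps..2 * eps}) \<eta>)"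
  using steklov_error_scaled[OF wp] by blast
 have bf: "(\<lambda>t \<eta> om. Fd 0 t * speed t) \<in> amp" by (intro amp.mult amp.data amp_speed)
 obtain Cf where Cf: "0 <= Cf" and Cfb: "trapezoid_bound f Cf"
  using steklov_trapezoid[OF bf, of f] contF[of UNIV 0] f by auto
 obtain Cu where Cu: "0 <= Cu" and Cub: "trapezoid_bound (\<lambda>_. 1) Cu"
  using steklov_trapezoid[OF amp_speed, of "\<lambda>_. 1"] by auto
 obtain B where B: "0 < B" "\<And>t. norm (Fd 0 t) <= B"
  using periodic_bounded[of "Fd 0"] perF0 contF by blast
 define len where "len = integral {0..1} speed"
 have len: "0 <= len"
  unfolding len_def by (intro integral_nonneg integrable_continuous_real cont_frame) (use speed_pos in \<open>auto intro: less_imp_le\<close>)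
 define M where "M = real (card F) * (2 * len + 8 * Cu) + (4 * len + 8 * Cu)"
 have M: "0 <= M" using len Cu by (simp add: M_def)
 show ?thesis
 proof (intro exI[of _ "Cf * V + B * (A * M)"] conjI allI impI)
  show "0 <= Cf * V + B * (A * M)" using Cf V B F M by simp
  fix eps h :: real assume h: "0 < h" "h <= 1" and eps: "0 < eps" "eps <= min 1 (r / 8)" and heps: "h powr (1 + 1 / \<kappa>) <= eps"
  define \<delta> where "\<delta> = h powr (1 + 1 / \<kappa>)"
  have \<delta>: "0 < \<delta>" "\<delta> <= 1" "\<delta> <= eps" using h heps eps by (auto simp: \<delta>_def)
  \<comment> \<open>Break points are as far out as \<open>2 * eps\<close>, and their indicators
    extend by \<open>\<delta> <= eps\<close>. This explains the radius \<open>3 * eps\<close>, with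
    a further \<open>\<delta>\<close> for the averaging.\<close>
  have er: "eps <= 1" "eps < r" "3 * eps + \<delta> < r" "2 * eps + \<delta> < r" using eps r_pos \<delta> by auto
  obtain L where box: "\<And>x i. infdist x curve <= r ==> \<bar>x $ i\<bar> <= h * (real L + 1/2)"
   using grid_box[OF h(1)] by blast
  let ?\<psi> = "scaled_weight \<theta> eps" and ?I = "integral {0..1} (\<lambda>t. Fd 0 t * speed t)"
  have one: "integral {- (2 * eps)..2 * eps} ?\<psi> = 1" by (rule integral_scaled_weight[OF wp eps(1)]) simp
  obtain E where sp: "steklov_profile ?\<psi> (2 * eps) \<delta> r (V / eps) E"
   using prof[OF eps(1) er(1) \<delta>(1,2) less_imp_le[OF er(4)]] by blast
  have 1: "\<bar>grid_sum h L (plane_weight f (steklov \<delta> ?\<psi>)) - ?I\<bar> <= Cf * (V / eps) * \<delta>"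
   using Cfb[unfolded trapezoid_bound_def, rule_format, OF h \<delta>_def _ er(4) sp box] eps(1) by (simp add: one f)
  have ind: "grid_sum h L (plane_weight (\<lambda>_. 1) (steklov \<delta> (indicator {a..b}))) <= (b - a) * len + 8 * Cu * \<delta>"
   if ab: "- (3 * eps) <= a" "a <= b" "b <= 3 * eps" for a b
  proof -
   have "steklov_profile (indicator {a..b}) (3 * eps) \<delta> r (2 + 2 * (3 * eps)) {a, b}"
    using steklov_profile_indicator[OF \<delta>(1,2) ab less_imp_le[OF er(3)]] .
   from Cub[unfolded trapezoid_bound_def, rule_format, OF h \<delta>_def _ er(3) this box]
   have "grid_sum h L (plane_weight (\<lambda>_. 1) (steklov \<delta> (indicator {a..b}))) <= (b - a) * len + Cu * (2 + 2 * (3 * eps)) * \<delta>"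
    using eps(1) integral_indicator_Icc[OF ab] by (simp add: len_def)
   \<comment> \<open>\<open>2 + 2 * (3 * eps)\<close> is the constant of
     \<open>dual_bv_indicator\<close> at \<open>\<rho> = 3 * eps\<close>, and
     \<open>eps \<le> 1\<close> makes it at most eight.\<close>
   also have "Cu * (2 + 2 * (3 * eps)) * \<delta> <= Cu * 8 * \<delta>" using Cu \<delta> er by (intro mult_right_mono mult_left_mono) auto
   finally show ?thesis by (simp add: mult_ac)
  qed
  define G where "G \<eta> = A / eps * ((\<Sum>f\<in>F. steklov \<delta> (indicator {f * eps - \<delta>..f * eps + \<delta>}) \<eta>) + \<delta> / eps * steklov \<delta> (indicator {- 2 * eps..2 * eps}) \<eta>)" for \<eta>
  have "\<bar>grid_sum h L (plane_weight f ?\<psi>) - grid_sum h L (plane_weight f (steklov \<delta> ?\<psi>))\<bar> <= B * grid_sum h L (plane_weight (\<lambda>_. 1) G)"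
  proof (rule grid_sum_abs_diff, rule plane_weight_nonneg_bound)
   show "\<bar>?\<psi> \<eta> - steklov \<delta> ?\<psi> \<eta>\<bar> <= G \<eta>" for \<eta> unfolding G_def by (rule err[OF eps(1) \<delta>(1,3)])
   show "\<bar>f (\<Gamma> 0 t)\<bar> <= B" for t using B(2)[of t] by (simp add: f)
  qed
  also have "grid_sum h L (plane_weight (\<lambda>_. 1) G) <= A * M * \<delta> / eps"
  proof -
   have "grid_sum h L (plane_weight (\<lambda>_. 1) G) =
    A / eps * ((\<Sum>f\<in>F. grid_sum h L (plane_weight (\<lambda>_. 1) (steklov \<delta> (indicator {f * eps - \<delta>..f * eps + \<delta>})))) +
     \<delta> / eps * grid_sum h L (plane_weight (\<lambda>_. 1) (steklov \<delta> (indicator {- 2 * eps..2 * eps}))))"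
    unfolding G_def[abs_def] plane_weight_linear[abs_def] grid_sum_linear ..
   \<comment> \<open>The short indicators have length \<open>2 * \<delta>\<close> each. The long one
     has length \<open>4 * eps\<close>, which its prefactor \<open>\<delta> / eps\<close> reduces to
     order \<open>\<delta>\<close>.\<close>
   also have "\<dots> <= A / eps * (real (card F) * ((2 * len + 8 * Cu) * \<delta>) + \<delta> / eps * ((4 * len + 8 * Cu) * eps))"
   proof (intro mult_left_mono add_mono)
    show "(\<Sum>f\<in>F. grid_sum h L (plane_weight (\<lambda>_. 1) (steklov \<delta> (indicator {f * eps - \<delta>..f * eps + \<delta>})))) <= real (card F) * ((2 * len + 8 * Cu) * \<delta>)"
    proof (rule sum_bounded_above)
     fix f assume "f \<in> F"
     then have "-2 <= f" "f <= 2" using F(2) by auto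
     then have "(-2) * eps <= f * eps" "f * eps <= 2 * eps" using eps(1) by (intro mult_right_mono; simp)+
     then have "- (3 * eps) <= f * eps - \<delta>" "f * eps - \<delta> <= f * eps + \<delta>" "f * eps + \<delta> <= 3 * eps" using \<delta> by linarith+
     from ind[OF this]
     show "grid_sum h L (plane_weight (\<lambda>_. 1) (steklov \<delta> (indicator {f * eps - \<delta>..f * eps + \<delta>}))) <= (2 * len + 8 * Cu) * \<delta>"
      by (simp add: algebra_simps)
    qed
    have "8 * Cu * \<delta> <= 8 * Cu * eps" using Cu \<delta> by (intro mult_left_mono) auto
    then show "grid_sum h L (plane_weight (\<lambda>_. 1) (steklov \<delta> (indicator {- 2 * eps..2 * eps}))) <= (4 * len + 8 * Cu) * eps"
     using ind[of "- 2 * eps" "2 * eps"] eps(1) by (simp add: algebra_simps)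
   qed (use F eps \<delta> in auto)
   also have "\<dots> = A * M * \<delta> / eps" using eps(1) by (simp add: M_def field_simps)
   finally show ?thesis .
  qed
  finally have 2: "\<bar>grid_sum h L (plane_weight f ?\<psi>) - grid_sum h L (plane_weight f (steklov \<delta> ?\<psi>))\<bar> <= B * (A * M * \<delta> / eps)"
   using B(1) by simp
  have "lattice_quadrature \<Omega> \<theta> f eps h = grid_sum h L (plane_weight f ?\<psi>)"
   by (rule lattice_quadrature_eq[OF h(1) eps(1) er(2) weight_profile_support[OF wp] box])
  then have "\<bar>?I - lattice_quadrature \<Omega> \<theta> f eps h\<bar> <= Cf * (V / eps) * \<delta> + B * (A * M * \<delta> / eps)" using 1 2 by linarith
  also have "\<dots> = (Cf * V + B * (A * M)) * (\<delta> / eps)" by (simp add: distrib_right add_divide_distrib)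
  also have "\<delta> / eps = (h / eps) * h powr (1 / \<kappa>)" using h by (simp add: \<delta>_def powr_add)
  finally show "\<bar>?I - lattice_quadrature \<Omega> \<theta> f eps h\<bar> <= (Cf * V + B * (A * M)) * ((h / eps) * h powr (1 / \<kappa>))" .
 qed
qed

end

section \<open>The order of the error\<close>

text \<open>\<open>smooth_on\<close> provides a chain of derivatives for every order separately.
  Iterating \<open>vector_derivative\<close> yields one sequence for all orders, which agrees with
  each chain by uniqueness of derivatives.\<close>

lemma smooth_derivative_sequence:
  fixes g :: "real \<Rightarrow> 'a::real_normed_vector"
  assumes "smooth_on UNIV g"
  obtains G where "G 0 = g" "\<And>j t. (G j has_vector_derivative G (Suc j) t) (at t)"
proof -
  define G where "G j = ((\<lambda>g t. vector_derivative g (at t)) ^^ j) g" for j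
  have "(G j has_vector_derivative G (Suc j) t) (at t)" for j t
  proof -
    obtain D where D: "\<forall>x. D 0 x = g x" "\<forall>i<Suc j. \<forall>x. (D i has_vector_derivative D (Suc i) x) (at x)"
      using assms[unfolded smooth_on_def Ck_on_def, rule_format, of "Suc j"] by auto
    have "i \<le> Suc j \<Longrightarrow> G i = D i" for i
    proof (induction i)
      case 0
      then show ?case using D(1) by (auto simp: G_def)
    next
      case (Suc i)
      then have "G (Suc i) = (\<lambda>t. vector_derivative (D i) (at t))" by (simp add: G_def)
      also have "\<dots> = D (Suc i)" using D(2) Suc.prems by (auto intro!: vector_derivative_at)
      finally show ?case .
    qed
    then show ?thesis using D(2) by simp
  qed
  then show ?thesis using that[of G] by (simp add: G_def)
qed

theorem corollary3p1:
  fixes \<Omega> :: "(real^2) set" and \<gamma> :: "real \<Rightarrow> real^2" and f :: "real^2 \<Rightarrow> real"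
    and \<theta> :: "real \<Rightarrow> real" and \<kappa> \<alpha> :: real and q :: nat and Z :: "(real^2) set"
  assumes "open \<Omega>" and "\<Omega> \<noteq> {}" and "connected \<Omega>" and "bounded \<Omega>" and "simply_connected \<Omega>"
    and "smooth_closed_curve \<gamma>" and "frontier \<Omega> = range \<gamma>"
    and "\<kappa> > 2"
    and "Z = {z \<in> frontier \<Omega>. signed_curvature (frontier \<Omega>) (outward_normal \<Omega> z) z = 0}"
    and "finite Z" and "Z \<noteq> {}"
    and "\<And>z. z \<in> Z \<Longrightarrow> curvature_vanishes_to_order (frontier \<Omega>) z (\<kappa> - 2)"
    and "smooth_on UNIV (f \<circ> \<gamma>)"
    and "weight_profile q \<theta>"
    and "0 \<le> \<alpha>" and "\<alpha> \<le> 1"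
  shows "\<exists>\<epsilon>0>0. unique_closest_points (frontier \<Omega>) \<epsilon>0 \<and>
    (\<forall>\<epsilon> :: real \<Rightarrow> real.
       (\<forall>\<^sub>F h in at_right 0. 0 < \<epsilon> h \<and> \<epsilon> h \<le> \<epsilon>0) \<and> \<epsilon> \<in> \<Theta>[at_right 0](\<lambda>h. h powr \<alpha>) \<longrightarrow>
       (\<lambda>h. \<bar>arc_length_integral \<gamma> f - lattice_quadrature \<Omega> \<theta> f (\<epsilon> h) h\<bar>)
         \<in> O[at_right 0](\<lambda>h. h powr (1 / \<kappa> + (real q + 1) * (1 - \<alpha>))))"
proof -
  obtain \<Gamma> where \<Gamma>0: "\<Gamma> 0 = \<gamma>" and d\<Gamma>: "\<And>j t. (\<Gamma> j has_vector_derivative \<Gamma> (Suc j) t) (at t)"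
    using smooth_derivative_sequence[of \<gamma>] assms(6) unfolding smooth_closed_curve_def by blast
  obtain Fd where Fd0: "Fd 0 = f \<circ> \<gamma>" and dF: "\<And>j t. (Fd j has_real_derivative Fd (Suc j) t) (at t)"
    using smooth_derivative_sequence[OF assms(13)] unfolding has_real_derivative_iff_has_vector_derivative by blast
  have \<Gamma>1: "\<Gamma> 1 t = vector_derivative \<gamma> (at t)" for t
    using vector_derivative_at[OF d\<Gamma>[of 0 t]] by (simp add: \<Gamma>0)
  have fr: "frontier \<Omega> = range (\<Gamma> 0)" using assms(7) by (simp add: \<Gamma>0)
  have pc: "plane_curve \<Gamma> sg" if "sg = 1 \<or> sg = -1" for sg
    by unfold_locales (use that d\<Gamma> assms(6) in \<open>auto simp: smooth_closed_curve_def \<Gamma>0 \<Gamma>1 simp del: One_nat_def\<close>)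
  \<comment> \<open>Both orientations are prepared with a common reach. Reversing the normal
    exchanges the two sides of the tube, so one of the signs makes \<open>nrml\<close> point out of
    \<open>\<Omega>\<close>.\<close>
  obtain sg r where sg: "sg = 1 \<or> sg = -1" and r: "plane_curve.reach \<Gamma> sg r"
    and sides: "\<And>t \<eta>. 0 < \<eta> \<Longrightarrow> \<eta> \<le> r \<Longrightarrow> plane_curve.offset \<Gamma> sg t \<eta> \<notin> closure \<Omega>"
      "\<And>t \<eta>. 0 < \<eta> \<Longrightarrow> \<eta> \<le> r \<Longrightarrow> plane_curve.offset \<Gamma> sg t (- \<eta>) \<in> \<Omega>"
  proof -
    interpret P: plane_curve \<Gamma> 1 by (rule pc) simp
    interpret M: plane_curve \<Gamma> "-1" by (rule pc) simp
    obtain r1 r2 where r12: "P.reach r1" "M.reach r2" using P.reach_exists M.reach_exists by blast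
    then have "0 < r1" "0 < r2" by (auto simp: P.reach_def M.reach_def)
    then have r: "P.reach (min r1 r2)" "M.reach (min r1 r2)"
      using P.reach_mono[OF r12(1)] M.reach_mono[OF r12(2)] by auto
    have flip: "M.offset t \<eta> = P.offset t (- \<eta>)" for t \<eta>
      by (simp add: M.offset_def P.offset_def M.nrml_def P.nrml_def vec_eq_iff forall_2)
    from P.sides[OF r(1) assms(1-3) fr] show ?thesis
    proof
      assume "\<forall>t \<eta>. 0 < \<eta> \<longrightarrow> \<eta> \<le> min r1 r2 \<longrightarrow> P.offset t \<eta> \<notin> closure \<Omega> \<and> P.offset t (- \<eta>) \<in> \<Omega>"
      then show ?thesis using that[of 1 "min r1 r2"] r(1) by blast
    next
      assume "\<forall>t \<eta>. 0 < \<eta> \<longrightarrow> \<eta> \<le> min r1 r2 \<longrightarrow> P.offset t (- \<eta>) \<notin> closure \<Omega> \<and> P.offset t \<eta> \<in> \<Omega>"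
      then show ?thesis using that[of "-1" "min r1 r2"] r(2) by (simp add: flip)
    qed
  qed
  have cd: "curve_domain \<Gamma> sg Fd r \<Omega>"
    unfolding curve_domain_def curve_data_def curve_data_axioms_def curve_domain_axioms_def
    using pc[OF sg] dF r sides fr assms(6) by (auto simp: Fd0 smooth_closed_curve_def)
  interpret curve_domain \<Gamma> sg Fd r \<Omega> by (rule cd)
  \<comment> \<open>All real parameters are included, not only those of one period, so that every
    \<open>x\<close> is of one of the two types in \<open>flat\<close>.\<close>
  define Zp where "Zp = {t. turn t = 0}"
  have ZZ: "Z = \<Gamma> 0 ` Zp"
    unfolding assms(9) Zp_def using curvature_zero_iff by (auto simp: fr)
  have Zp: "Zp \<noteq> {}" using assms(11) by (auto simp: ZZ)
  have flat0: "\<exists>e m M d. \<bar>e\<bar> = 1 \<and> 0 < m \<and> 0 < M \<and> 0 < d \<and>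
    (\<forall>t. \<bar>t - x\<bar> < d \<longrightarrow> m * \<bar>t - x\<bar> powr (\<kappa> - 2) \<le> e * turn t \<and> e * turn t \<le> M * \<bar>t - x\<bar> powr (\<kappa> - 2))"
    if "x \<in> Zp" for x
    using flat_point[OF assms(8), of x] assms(12)[of "\<Gamma> 0 x"] that by (auto simp: Zp_def ZZ fr)
  have \<kappa>4: "4 \<le> \<kappa>"
  proof -
    obtain x where x: "x \<in> Zp" using Zp by blast
    obtain e m M d where *: "\<bar>e\<bar> = 1" "0 < m" "0 < M" "0 < d"
      "\<forall>t. \<bar>t - x\<bar> < d \<longrightarrow> m * \<bar>t - x\<bar> powr (\<kappa> - 2) \<le> e * turn t \<and> e * turn t \<le> M * \<bar>t - x\<bar> powr (\<kappa> - 2)"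
      using flat0[OF x] by blast
    have "2 \<le> \<kappa> - 2" by (rule flat_order[OF *(1,2,4)]) (use *(5) x in \<open>auto simp: Zp_def\<close>)
    then show ?thesis by simp
  qed
  have fin: "finite (tang ` Zp)"
  proof -
    have "finite (\<Gamma> 0 ` (Zp \<inter> {0..<1}))" by (rule finite_subset[OF _ assms(10)]) (auto simp: ZZ)
    then have "finite (Zp \<inter> {0..<1})" by (rule finite_imageD) (rule inj_on_subset[OF inj], auto)
    moreover have "tang ` Zp \<subseteq> tang ` (Zp \<inter> {0..<1})"
    proof (rule image_subsetI)
      fix t assume t: "t \<in> Zp"
      have "tang (frac t) = tang t" "turn (frac t) = turn t" by (intro periodic_frac per_frame)+
      then show "tang t \<in> tang ` (Zp \<inter> {0..<1})"
        using t frac_ge_0[of t] frac_lt_1[of t] by (intro image_eqI[of _ _ "frac t"]) (auto simp: Zp_def)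
    qed
    ultimately show ?thesis by (meson finite_imageI finite_subset)
  qed
  have flat: "\<exists>\<beta> e m M d. \<bar>e\<bar> = 1 \<and> 0 < m \<and> 0 < M \<and> 0 < d \<and>
      (\<forall>t. \<bar>t - x\<bar> < d \<longrightarrow> 0 \<le> e * turn t \<and> m * \<bar>t - x\<bar> powr \<beta> \<le> e * turn t) \<and>
      (\<beta> = 0 \<or> \<beta> = \<kappa> - 2 \<and> x \<in> Zp \<and> (\<forall>t. \<bar>t - x\<bar> < d \<longrightarrow> e * turn t \<le> M * \<bar>t - x\<bar> powr \<beta>))" for x
  proof (cases "x \<in> Zp")
    case True
    obtain e m M d where *: "\<bar>e\<bar> = 1" "0 < m" "0 < M" "0 < d"
      "\<forall>t. \<bar>t - x\<bar> < d \<longrightarrow> m * \<bar>t - x\<bar> powr (\<kappa> - 2) \<le> e * turn t \<and> e * turn t \<le> M * \<bar>t - x\<bar> powr (\<kappa> - 2)"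
      using flat0[OF True] by blast
    show ?thesis
    proof (rule exI[of _ "\<kappa> - 2"], rule exI[of _ e], rule exI[of _ m], rule exI[of _ M], rule exI[of _ d], intro conjI allI impI disjI2)
      fix t assume t: "\<bar>t - x\<bar> < d"
      show "m * \<bar>t - x\<bar> powr (\<kappa> - 2) \<le> e * turn t" "e * turn t \<le> M * \<bar>t - x\<bar> powr (\<kappa> - 2)" using *(5) t by auto
      moreover have "0 \<le> m * \<bar>t - x\<bar> powr (\<kappa> - 2)" using *(2) by simp
      ultimately show "0 \<le> e * turn t" by linarith
    qed (use * True in auto)
  next
    case False
    then have nz: "turn x \<noteq> 0" by (simp add: Zp_def)
    have "isCont turn x" using cont_frame(5)[of UNIV] by (simp add: continuous_on_eq_continuous_at)
    then obtain d where d: "0 < d" "\<And>t. \<bar>t - x\<bar> < d \<Longrightarrow> \<bar>turn x\<bar> / 2 \<le> sgn (turn x) * turn t \<and> sgn (turn x) * turn t \<le> 2 * \<bar>turn x\<bar>"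
      using isCont_nonzero_bounds[where w = turn and x = x] nz by blast
    have "0 \<le> sgn (turn x) * turn t \<and> \<bar>turn x\<bar> / 2 * \<bar>t - x\<bar> powr 0 \<le> sgn (turn x) * turn t" if "\<bar>t - x\<bar> < d" for t
    proof -
      \<comment> \<open>At \<open>t = x\<close> the power is \<open>0 powr 0 = 0\<close>; elsewhere
        it is one.\<close>
      have "\<bar>t - x\<bar> powr 0 \<le> 1" by simp
      then have "\<bar>turn x\<bar> / 2 * \<bar>t - x\<bar> powr 0 \<le> \<bar>turn x\<bar> / 2" by (simp add: mult_left_le)
      then show ?thesis using d(2)[OF that] by linarith
    qed
    then show ?thesis using d(1) nz
      by - (rule exI[of _ 0], rule exI[of _ "sgn (turn x)"], rule exI[of _ "\<bar>turn x\<bar> / 2"], rule exI[of _ 1], rule exI[of _ d],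
        intro conjI disjI1 allI impI, simp_all add: abs_sgn_eq)
  qed
  interpret flat_domain \<Gamma> sg Fd r \<kappa> Zp \<Omega>
    by unfold_locales (use \<kappa>4 Zp flat fin in auto)
  have f\<Gamma>: "f (\<Gamma> 0 t) = Fd 0 t" for t by (simp add: \<Gamma>0 Fd0)
  have arc: "arc_length_integral \<gamma> f = integral {0..1} (\<lambda>t. Fd 0 t * speed t)"
    by (simp add: arc_length_integral_def speed_def Fd0 flip: \<Gamma>1)
  have "\<exists>C\<ge>0. \<forall>\<epsilon> h. 0 < h \<longrightarrow> h \<le> 1 \<longrightarrow> 0 < \<epsilon> \<longrightarrow> \<epsilon> \<le> min 1 (r / 8) \<longrightarrow> h powr (1 + 1 / \<kappa>) \<le> \<epsilon> \<longrightarrow>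
    \<bar>arc_length_integral \<gamma> f - lattice_quadrature \<Omega> \<theta> f \<epsilon> h\<bar> \<le> C * ((h / \<epsilon>) ^ (q + 1) * h powr (1 / \<kappa>))"
  proof (cases "q = 0")
    case True
    then show ?thesis using rough_profile_error[of \<theta> f] assms(14) f\<Gamma> unfolding arc by simp
  next
    case False
    then have "1 \<le> q" by simp
    from smooth_profile_error[OF assms(14) this, of f] f\<Gamma> show ?thesis unfolding arc by blast
  qed
  then obtain C where C: "0 \<le> C" "\<And>\<epsilon> h. 0 < h \<Longrightarrow> h \<le> 1 \<Longrightarrow> 0 < \<epsilon> \<Longrightarrow> \<epsilon> \<le> min 1 (r / 8) \<Longrightarrow> h powr (1 + 1 / \<kappa>) \<le> \<epsilon> \<Longrightarrow>
    \<bar>arc_length_integral \<gamma> f - lattice_quadrature \<Omega> \<theta> f \<epsilon> h\<bar> \<le> C * ((h / \<epsilon>) ^ (q + 1) * h powr (1 / \<kappa>))"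
    by blast
  show ?thesis
  \<comment> \<open>An eighth of the reach leaves room beyond the tube for the averaging and the
    widened indicators; the bound by one serves the scaling estimates.\<close>
  proof (intro exI[of _ "min 1 (r / 8)"] conjI allI impI)
    show "0 < min 1 (r / 8)" using r_pos by simp
    show "unique_closest_points (frontier \<Omega>) (min 1 (r / 8))"
      unfolding unique_closest_points_def fr
    proof
      fix x assume "x \<in> tube (range (\<Gamma> 0)) (min 1 (r / 8))"
      then have "infdist x (range (\<Gamma> 0)) \<le> r" using r_pos by (simp add: tube_def)
      moreover obtain t \<eta> where x: "x = offset t \<eta>" "\<bar>\<eta>\<bar> = infdist x (range (\<Gamma> 0))" using offset_surj by blast
      ultimately have \<eta>: "\<bar>\<eta>\<bar> \<le> r" by simp
      show "\<exists>!p. p \<in> range (\<Gamma> 0) \<and> (\<forall>y\<in>range (\<Gamma> 0). dist x p \<le> dist x y)"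
      proof (rule ex1I[of _ "\<Gamma> 0 t"])
        have "dist x (\<Gamma> 0 t) = infdist x (range (\<Gamma> 0))" using norm_offset[of t \<eta>] x by (simp add: dist_norm)
        then show "\<Gamma> 0 t \<in> range (\<Gamma> 0) \<and> (\<forall>y\<in>range (\<Gamma> 0). dist x (\<Gamma> 0 t) \<le> dist x y)" by (auto intro: infdist_le)
        fix p assume "p \<in> range (\<Gamma> 0) \<and> (\<forall>y\<in>range (\<Gamma> 0). dist x p \<le> dist x y)"
        then show "p = \<Gamma> 0 t" unfolding x(1) by (intro offset_closest(3)[OF reach \<eta>]) auto
      qed
    qed
    fix \<epsilon> :: "real \<Rightarrow> real"
    assume \<epsilon>: "(\<forall>\<^sub>F h in at_right 0. 0 < \<epsilon> h \<and> \<epsilon> h \<le> min 1 (r / 8)) \<and> \<epsilon> \<in> \<Theta>[at_right 0](\<lambda>h. h powr \<alpha>)"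
    then have "\<epsilon> \<in> \<Omega>[at_right 0](\<lambda>h. h powr \<alpha>)" by (auto intro: bigthetaD2)
    then obtain c where c: "0 < c" and ec: "\<forall>\<^sub>F h in at_right 0. c * norm (h powr \<alpha>) \<le> norm (\<epsilon> h)"
      by (rule landau_omega.bigE)
    have "\<forall>\<^sub>F h :: real in at_right 0. 0 < h" by (rule eventually_at_right_less)
    \<comment> \<open>For \<open>h < c powr \<kappa>\<close> one has
      \<open>h powr (1 / \<kappa>) \<le> c\<close>. Together with \<open>\<alpha> \<le> 1\<close>
      this keeps the averaging length \<open>h powr (1 + 1 / \<kappa>)\<close> below
      \<open>c * h powr \<alpha>\<close> and hence below the tube width.\<close>
    moreover have "\<forall>\<^sub>F h in at_right 0. h < min 1 (c powr \<kappa>)" 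
      using eventually_at_right_real[of 0 "min 1 (c powr \<kappa>)"] c by (auto elim: eventually_mono)
    ultimately have "\<forall>\<^sub>F h in at_right 0. norm \<bar>arc_length_integral \<gamma> f - lattice_quadrature \<Omega> \<theta> f (\<epsilon> h) h\<bar>
        \<le> (C * (1 / c) ^ (q + 1)) * norm (h powr (1 / \<kappa> + (real q + 1) * (1 - \<alpha>)))"
      using ec conjunct1[OF \<epsilon>]
    proof eventually_elim
      case (elim h)
      have h: "0 < h" "h \<le> 1" and e: "0 < \<epsilon> h" "\<epsilon> h \<le> min 1 (r / 8)" "c * h powr \<alpha> \<le> \<epsilon> h" using elim by auto
      have "h powr (1 + 1 / \<kappa>) \<le> \<epsilon> h"
      proof -
        have "h powr (1 / \<kappa>) \<le> (c powr \<kappa>) powr (1 / \<kappa>)" using elim(2) h \<kappa>4 by (intro powr_mono2) auto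
        also have "\<dots> = c" using c \<kappa>4 by (simp add: powr_powr)
        finally have "h powr 1 * h powr (1 / \<kappa>) \<le> h powr \<alpha> * c"
          using h c assms(16) by (intro mult_mono powr_mono') auto
        then show ?thesis using e(3) h by (simp add: powr_add mult.commute)
      qed
      from C(2)[OF h e(1,2) this]
      have "\<bar>arc_length_integral \<gamma> f - lattice_quadrature \<Omega> \<theta> f (\<epsilon> h) h\<bar> \<le> C * ((h / \<epsilon> h) ^ (q + 1) * h powr (1 / \<kappa>))" .
      also have "\<dots> \<le> C * ((h powr (1 - \<alpha>) / c) ^ (q + 1) * h powr (1 / \<kappa>))"
      proof (intro mult_left_mono mult_right_mono power_mono)
        have "h / \<epsilon> h \<le> h / (c * h powr \<alpha>)" using h c e by (intro divide_left_mono) auto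
        also have "\<dots> = h powr (1 - \<alpha>) / c" using h by (simp add: powr_diff field_simps)
        finally show "h / \<epsilon> h \<le> h powr (1 - \<alpha>) / c" .
      qed (use h e C in auto)
      also have "(h powr (1 - \<alpha>) / c) ^ (q + 1) = (1 / c) ^ (q + 1) * h powr ((real q + 1) * (1 - \<alpha>))"
      proof -
        have "(h powr (1 - \<alpha>)) ^ (q + 1) = h powr ((real q + 1) * (1 - \<alpha>))"
          using h by (simp add: powr_powr algebra_simps flip: powr_realpow powr_add)
        then show ?thesis by (simp only: power_divide power_one) simp
      qed
      finally show ?case using h by (simp add: powr_add mult_ac)
    qed
    then show "(\<lambda>h. \<bar>arc_length_integral \<gamma> f - lattice_quadrature \<Omega> \<theta> f (\<epsilon> h) h\<bar>)
         \<in> O[at_right 0](\<lambda>h. h powr (1 / \<kappa> + (real q + 1) * (1 - \<alpha>)))"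
      by (rule bigoI)
  qed
qed

end
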